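(* Let $X$ be a $\sigma$-compact, locally compact, $k$-dimensional metric space. Let $\mathcal{A}$ be a maximal full algebra of operator fields over $X$ with fibre algebras $\{\mathcal{A}_t\}_{t\in X}$ such that $\mathcal{A}_t$ is unital for all $t\in X$. Then the stable rank of $\mathcal{A}$ satisfies $$\mathrm{sr}(\mathcal{A}) \leq \sup_{t\in X} \mathrm{sr}\big(C([0,1]^k)\otimes\mathcal{A}_t\big).$$
   Context: Stable rank: for a unital $C^*$-algebra $\mathcal{B}$ and a positive integer $M$, $Lg_M(\mathcal{B})$ is the set of all $(b_1,\dots,b_M)\in\mathcal{B}^M$ such that $\sum_{j=1}^M b_j^*b_j$ is invertible in $\mathcal{B}$. The stable rank $\mathrm{sr}(\mathcal{B})$ is the least positive integer $M$ such that $Lg_M(\mathcal{B})$ is norm-dense in $\mathcal{B}^M$, and $\mathrm{sr}(\mathcal{B})=\infty$ if there is no such $M$. For a non-unital $C^*$-algebra, the stable rank is defined to be that of its unitization. Full algebra of operator fields (in the sense of Fell): let $X$ be a locally compact Hausdorff space and, for each $t\in X$, let $\mathcal{A}_t$ be a $C^*$-algebra (the fibre algebra at $t$). An operator field is a function $a$ on $X$ with $a(t)\in\mathcal{A}_t$ for every $t\in X$. A full algebra of operator fields over (with base space) $X$ with fibre algebras $\{\mathcal{A}_t\}_{t\in X}$ is a family $\mathcal{A}$ of operator fields such that: (i) $\mathcal{A}$ is a $*$-algebra under the pointwise operations; (ii) for each $a\in\mathcal{A}$, the function $t\mapsto\|a(t)\|$ is continuous on $X$ and vanishes at infinity; (iii)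 for each $t\in X$, the set $\{a(t):a\in\mathcal{A}\}$ is dense in $\mathcal{A}_t$; (iv) $\mathcal{A}$ is complete in the norm $\|a\|=\sup_{t\in X}\|a(t)\|$. Thus $\mathcal{A}$ is a $C^*$-algebra. It is called maximal if it is not properly contained in any other full algebra of operator fields with the same base space $X$ and the same fibre algebras $\{\mathcal{A}_t\}_{t\in X}$. The dimension of $X$ is its topological (covering) dimension, $k$ is a nonnegative integer, and $[0,1]^0$ is a one-point space. *)

theory Defs
  imports "HOL-Analysis.Analysis"
begin

section \<open>C*-algebras, not necessarily unital, with explicit carriers\<close>

text \<open>The fibres of an operator field vary from point to point, so a C*-algebra is a record with
  a carrier set and its own operations.\<close>

record 'a cstar =
  carrier :: "'a set"
  zero :: 'a  ("\<zero>\<index>")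
  add :: "'a \<Rightarrow> 'a \<Rightarrow> 'a"  (infixl "\<oplus>\<index>" 65)
  smult :: "complex \<Rightarrow> 'a \<Rightarrow> 'a"  (infixr "\<odot>\<index>" 75)
  mult :: "'a \<Rightarrow> 'a \<Rightarrow> 'a"  (infixl "\<otimes>\<index>" 70)
  adj :: "'a \<Rightarrow> 'a"
  cnorm :: "'a \<Rightarrow> real"

definition diff :: "'a cstar \<Rightarrow> 'a \<Rightarrow> 'a \<Rightarrow> 'a"  (infixl "\<ominus>\<index>" 65)
  where "x \<ominus>\<^bsub>A\<^esub> y = x \<oplus>\<^bsub>A\<^esub> ((-1) \<odot>\<^bsub>A\<^esub> y)"

primrec fin_sum :: "'a cstar \<Rightarrow> (nat \<Rightarrow> 'a) \<Rightarrow> nat \<Rightarrow> 'a"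
  where
    "fin_sum A f 0 = \<zero>\<^bsub>A\<^esub>"
  | "fin_sum A f (Suc n) = fin_sum A f n \<oplus>\<^bsub>A\<^esub> f n"

locale star_algebra =
  fixes A :: "'a cstar" (structure)
  assumes zero_closed: "\<zero> \<in> carrier A"
    and add_closed: "\<lbrakk>x \<in> carrier A; y \<in> carrier A\<rbrakk> \<Longrightarrow> x \<oplus> y \<in> carrier A"
    and smult_closed: "x \<in> carrier A \<Longrightarrow> c \<odot> x \<in> carrier A"
    and mult_closed: "\<lbrakk>x \<in> carrier A; y \<in> carrier A\<rbrakk> \<Longrightarrow> x \<otimes> y \<in> carrier A"
    and adj_closed: "x \<in> carrier A \<Longrightarrow> adj A x \<in> carrier A"
    and add_assoc: "\<lbrakk>x \<in> carrier A; y \<in> carrier A; z \<in> carrier A\<rbrakk>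
          \<Longrightarrow> (x \<oplus> y) \<oplus> z = x \<oplus> (y \<oplus> z)"
    and add_commute: "\<lbrakk>x \<in> carrier A; y \<in> carrier A\<rbrakk> \<Longrightarrow> x \<oplus> y = y \<oplus> x"
    and add_zero: "x \<in> carrier A \<Longrightarrow> x \<oplus> \<zero> = x"
    and add_inverse: "x \<in> carrier A \<Longrightarrow> \<exists>y\<in>carrier A. x \<oplus> y = \<zero>"
    and smult_add: "\<lbrakk>x \<in> carrier A; y \<in> carrier A\<rbrakk> \<Longrightarrow> c \<odot> (x \<oplus> y) = c \<odot> x \<oplus> c \<odot> y"
    and add_smult: "x \<in> carrier A \<Longrightarrow> (c + c') \<odot> x = c \<odot> x \<oplus> c' \<odot> x"
    and smult_smult: "x \<in> carrier A \<Longrightarrow> c \<odot> (c' \<odot> x) = (c * c') \<odot> x"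
    and smult_one: "x \<in> carrier A \<Longrightarrow> 1 \<odot> x = x"
    and mult_assoc: "\<lbrakk>x \<in> carrier A; y \<in> carrier A; z \<in> carrier A\<rbrakk>
          \<Longrightarrow> (x \<otimes> y) \<otimes> z = x \<otimes> (y \<otimes> z)"
    and mult_add: "\<lbrakk>x \<in> carrier A; y \<in> carrier A; z \<in> carrier A\<rbrakk>
          \<Longrightarrow> x \<otimes> (y \<oplus> z) = x \<otimes> y \<oplus> x \<otimes> z"
    and add_mult: "\<lbrakk>x \<in> carrier A; y \<in> carrier A; z \<in> carrier A\<rbrakk>
          \<Longrightarrow> (x \<oplus> y) \<otimes> z = x \<otimes> z \<oplus> y \<otimes> z"
    and smult_mult: "\<lbrakk>x \<in> carrier A; y \<in> carrier A\<rbrakk> \<Longrightarrow> (c \<odot> x) \<otimes> y = c \<odot> (x \<otimes> y)"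
    and mult_smult: "\<lbrakk>x \<in> carrier A; y \<in> carrier A\<rbrakk> \<Longrightarrow> x \<otimes> (c \<odot> y) = c \<odot> (x \<otimes> y)"
    and adj_adj: "x \<in> carrier A \<Longrightarrow> adj A (adj A x) = x"
    and adj_add: "\<lbrakk>x \<in> carrier A; y \<in> carrier A\<rbrakk> \<Longrightarrow> adj A (x \<oplus> y) = adj A x \<oplus> adj A y"
    and adj_smult: "x \<in> carrier A \<Longrightarrow> adj A (c \<odot> x) = cnj c \<odot> adj A x"
    and adj_mult: "\<lbrakk>x \<in> carrier A; y \<in> carrier A\<rbrakk> \<Longrightarrow> adj A (x \<otimes> y) = adj A y \<otimes> adj A x"

definition norm_complete :: "'a cstar \<Rightarrow> bool"
  where "norm_complete A \<longleftrightarrow>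
    (\<forall>f :: nat \<Rightarrow> 'a.
      (\<forall>n. f n \<in> carrier A) \<and>
      (\<forall>\<epsilon>>0. \<exists>N. \<forall>m\<ge>N. \<forall>n\<ge>N. cnorm A (f m \<ominus>\<^bsub>A\<^esub> f n) < \<epsilon>)
      \<longrightarrow> (\<exists>x\<in>carrier A. (\<lambda>n. cnorm A (f n \<ominus>\<^bsub>A\<^esub> x)) \<longlonglongrightarrow> 0))"

locale cstar_algebra = star_algebra +
  assumes norm_nonneg: "x \<in> carrier A \<Longrightarrow> 0 \<le> cnorm A x"
    and norm_eq_zero: "x \<in> carrier A \<Longrightarrow> cnorm A x = 0 \<longleftrightarrow> x = \<zero>"
    and norm_triangle: "\<lbrakk>x \<in> carrier A; y \<in> carrier A\<rbrakk>
          \<Longrightarrow> cnorm A (x \<oplus> y) \<le> cnorm A x + cnorm A y"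
    and norm_smult: "x \<in> carrier A \<Longrightarrow> cnorm A (c \<odot> x) = cmod c * cnorm A x"
    and norm_mult: "\<lbrakk>x \<in> carrier A; y \<in> carrier A\<rbrakk>
          \<Longrightarrow> cnorm A (x \<otimes> y) \<le> cnorm A x * cnorm A y"
    and cstar_identity: "x \<in> carrier A \<Longrightarrow> cnorm A (adj A x \<otimes> x) = (cnorm A x)\<^sup>2"
    and complete: "norm_complete A"

definition is_unit_of :: "'a cstar \<Rightarrow> 'a \<Rightarrow> bool"
  where "is_unit_of A e \<longleftrightarrow>
    e \<in> carrier A \<and> (\<forall>x\<in>carrier A. e \<otimes>\<^bsub>A\<^esub> x = x \<and> x \<otimes>\<^bsub>A\<^esub> e = x)"

text \<open>The zero algebra counts as unital. Its stable rank below is 1, which is also the stable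
  rank of its unitization, the complex numbers.\<close>

definition unital :: "'a cstar \<Rightarrow> bool"
  where "unital A \<longleftrightarrow> (\<exists>e. is_unit_of A e)"

definition invertible_in :: "'a cstar \<Rightarrow> 'a \<Rightarrow> bool"
  where "invertible_in A x \<longleftrightarrow>
    x \<in> carrier A \<and> (\<exists>y\<in>carrier A. is_unit_of A (x \<otimes>\<^bsub>A\<^esub> y) \<and> is_unit_of A (y \<otimes>\<^bsub>A\<^esub> x))"

definition unitization :: "'a cstar \<Rightarrow> ('a \<times> complex) cstar"
  where \<comment> \<open>The norm is that of left multiplication operators on \<open>A\<close>; it is the C*-norm exactly
    when \<open>A\<close> is not unital.\<close>
  "unitization A = \<lparr>
    carrier = carrier A \<times> UNIV,
    zero = (\<zero>\<^bsub>A\<^esub>, 0),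
    add = (\<lambda>(a, p) (b, q). (a \<oplus>\<^bsub>A\<^esub> b, p + q)),
    smult = (\<lambda>c (a, p). (c \<odot>\<^bsub>A\<^esub> a, c * p)),
    mult = (\<lambda>(a, p) (b, q). (a \<otimes>\<^bsub>A\<^esub> b \<oplus>\<^bsub>A\<^esub> p \<odot>\<^bsub>A\<^esub> b \<oplus>\<^bsub>A\<^esub> q \<odot>\<^bsub>A\<^esub> a, p * q)),
    adj = (\<lambda>(a, p). (adj A a, cnj p)),
    cnorm = (\<lambda>(a, p). SUP b\<in>{b \<in> carrier A. cnorm A b \<le> 1}. cnorm A (a \<otimes>\<^bsub>A\<^esub> b \<oplus>\<^bsub>A\<^esub> p \<odot>\<^bsub>A\<^esub> b)) \<rparr>"


section \<open>Stable rank\<close>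

definition tuples :: "'a cstar \<Rightarrow> nat \<Rightarrow> (nat \<Rightarrow> 'a) set"
  where "tuples A M = {..<M} \<rightarrow>\<^sub>E carrier A"

definition Lg :: "'a cstar \<Rightarrow> nat \<Rightarrow> (nat \<Rightarrow> 'a) set"
  where "Lg A M =
    {b \<in> tuples A M. invertible_in A (fin_sum A (\<lambda>j. adj A (b j) \<otimes>\<^bsub>A\<^esub> b j) M)}"

text \<open>Norm density in the \<open>M\<close>-fold product, with the maximum norm on tuples.\<close>

definition Lg_dense :: "'a cstar \<Rightarrow> nat \<Rightarrow> bool"
  where "Lg_dense A M \<longleftrightarrow>
    (\<forall>a\<in>tuples A M. \<forall>\<epsilon>>0. \<exists>b\<in>Lg A M. \<forall>j<M. cnorm A (a j \<ominus>\<^bsub>A\<^esub> b j) < \<epsilon>)"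

definition unital_stable_rank :: "'a cstar \<Rightarrow> enat"
  where "unital_stable_rank A =
    (if \<exists>M\<ge>1. Lg_dense A M then enat (LEAST M. 1 \<le> M \<and> Lg_dense A M) else \<infinity>)"

definition stable_rank :: "'a cstar \<Rightarrow> enat"
  where "stable_rank A =
    (if unital A then unital_stable_rank A else unital_stable_rank (unitization A))"


section \<open>Full algebras of operator fields\<close>

text \<open>The set \<open>S\<close> of fields \<open>t \<mapsto> a t \<in> F t\<close> over \<open>T\<close> with the pointwise operations and the
  supremum norm. Fields are \<^const>\<open>undefined\<close> outside \<open>T\<close>. The base set \<open>T\<close> is meant to be
  nonempty, since the real supremum over the empty set is unspecified.\<close>

definition field_algebra :: "'x set \<Rightarrow> ('x \<Rightarrow> 'b cstar) \<Rightarrow> ('x \<Rightarrow> 'b) set \<Rightarrow> ('x \<Rightarrow> 'b) cstar"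
  where "field_algebra T F S = \<lparr>
    carrier = S,
    zero = (\<lambda>t\<in>T. \<zero>\<^bsub>F t\<^esub>),
    add = (\<lambda>a b. \<lambda>t\<in>T. a t \<oplus>\<^bsub>F t\<^esub> b t),
    smult = (\<lambda>c a. \<lambda>t\<in>T. c \<odot>\<^bsub>F t\<^esub> a t),
    mult = (\<lambda>a b. \<lambda>t\<in>T. a t \<otimes>\<^bsub>F t\<^esub> b t),
    adj = (\<lambda>a. \<lambda>t\<in>T. adj (F t) (a t)),
    cnorm = (\<lambda>a. SUP t\<in>T. cnorm (F t) (a t)) \<rparr>"

definition operator_fields :: "'x topology \<Rightarrow> ('x \<Rightarrow> 'b cstar) \<Rightarrow> ('x \<Rightarrow> 'b) set"
  where "operator_fields X F = (\<Pi>\<^sub>E t\<in>topspace X. carrier (F t))"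

definition vanishes_at_infinity :: "'x topology \<Rightarrow> ('x \<Rightarrow> real) \<Rightarrow> bool"
  where "vanishes_at_infinity X h \<longleftrightarrow>
    (\<forall>\<epsilon>>0. \<exists>K. compactin X K \<and> (\<forall>t\<in>topspace X - K. \<bar>h t\<bar> < \<epsilon>))"

locale full_algebra =
  fixes X :: "'x topology" and F :: "'x \<Rightarrow> 'b cstar" and \<A> :: "('x \<Rightarrow> 'b) set"
  assumes base_locally_compact: "locally_compact_space X"
    and base_Hausdorff: "Hausdorff_space X"
    and fibre_cstar: "t \<in> topspace X \<Longrightarrow> cstar_algebra (F t)"
    and fields: "\<A> \<subseteq> operator_fields X F"
    and star_alg: "star_algebra (field_algebra (topspace X) F \<A>)"
    and norm_continuous: "a \<in> \<A> \<Longrightarrow> continuous_map X euclideanreal (\<lambda>t. cnorm (F t) (a t))"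
    and norm_vanishes: "a \<in> \<A> \<Longrightarrow> vanishes_at_infinity X (\<lambda>t. cnorm (F t) (a t))"
    and fibre_dense: "\<lbrakk>t \<in> topspace X; x \<in> carrier (F t); 0 < \<epsilon>\<rbrakk>
          \<Longrightarrow> \<exists>a\<in>\<A>. cnorm (F t) (x \<ominus>\<^bsub>F t\<^esub> a t) < \<epsilon>"
    and sup_complete: "norm_complete (field_algebra (topspace X) F \<A>)"

definition maximal_full_algebra :: "'x topology \<Rightarrow> ('x \<Rightarrow> 'b cstar) \<Rightarrow> ('x \<Rightarrow> 'b) set \<Rightarrow> bool"
  where "maximal_full_algebra X F \<A> \<longleftrightarrow>
    full_algebra X F \<A> \<and> (\<forall>\<B>. full_algebra X F \<B> \<longrightarrow> \<not> \<A> \<subset> \<B>)"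


section \<open>Tensor products with commutative C*-algebras\<close>

definition complex_cstar :: "complex cstar"
  where "complex_cstar =
    \<lparr> carrier = UNIV, zero = 0, add = (+), smult = (*), mult = (*), adj = cnj, cnorm = cmod \<rparr>"

definition C_algebra :: "'y topology \<Rightarrow> ('y \<Rightarrow> complex) cstar"
  where "C_algebra Y = field_algebra (topspace Y) (\<lambda>_. complex_cstar)
    {f \<in> extensional (topspace Y). continuous_map Y euclidean f}"

definition elem_tensor :: "'y topology \<Rightarrow> 'a cstar \<Rightarrow> ('y \<Rightarrow> complex) \<Rightarrow> 'a \<Rightarrow> ('y \<Rightarrow> 'a)"
  where "elem_tensor Y A f a = (\<lambda>s\<in>topspace Y. f s \<odot>\<^bsub>A\<^esub> a)"

text \<open>For a nonempty compact Hausdorff space \<open>Y\<close>, the map \<open>f \<otimes> a \<mapsto> (s \<mapsto> f s \<odot> a)\<close> is injective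
  on the algebraic tensor product of \<open>C(Y)\<close> and \<open>A\<close>. The supremum norm is the spatial
  tensor norm (let \<open>C(Y)\<close> act faithfully by multiplication on square summable functions on \<open>Y\<close>),
  and it is the only C*-norm on the algebraic tensor product because \<open>C(Y)\<close> is nuclear. The
  C*-tensor product is the completion, that is, the closure in the functions from \<open>Y\<close> to \<open>A\<close>.\<close>

definition alg_tensor :: "'y topology \<Rightarrow> 'a cstar \<Rightarrow> ('y \<Rightarrow> 'a) set"
  where "alg_tensor Y A =
    {fin_sum (field_algebra (topspace Y) (\<lambda>_. A) (topspace Y \<rightarrow>\<^sub>E carrier A))
        (\<lambda>i. elem_tensor Y A (f i) (a i)) n | f a n.
      (\<forall>i<n. f i \<in> carrier (C_algebra Y)) \<and> (\<forall>i<n. a i \<in> carrier A)}"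

definition C_tensor :: "'y topology \<Rightarrow> 'a cstar \<Rightarrow> ('y \<Rightarrow> 'a) cstar"
  where "C_tensor Y A = field_algebra (topspace Y) (\<lambda>_. A)
    {g \<in> topspace Y \<rightarrow>\<^sub>E carrier A.
      \<forall>\<epsilon>>0. \<exists>h\<in>alg_tensor Y A. \<forall>s\<in>topspace Y. cnorm A (g s \<ominus>\<^bsub>A\<^esub> h s) < \<epsilon>}"

definition cube :: "nat \<Rightarrow> (nat \<Rightarrow> real) topology"
  where "cube k = product_topology (\<lambda>_. top_of_set {0..1}) {..<k}"


section \<open>Topological notions\<close>

definition sigma_compact_space :: "'x topology \<Rightarrow> bool"
  where "sigma_compact_space X \<longleftrightarrow>
    (\<exists>K :: nat \<Rightarrow> 'x set. (\<forall>n. compactin X (K n)) \<and> topspace X = (\<Union>n. K n))"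

text \<open>The library's \<open>dim_le\<close> is small inductive dimension; the following is covering dimension.
  The empty space is exactly the space of dimension \<open>-1\<close>.\<close>

definition finite_open_cover :: "'x topology \<Rightarrow> 'x set set \<Rightarrow> bool"
  where "finite_open_cover X \<U> \<longleftrightarrow> finite \<U> \<and> (\<forall>U\<in>\<U>. openin X U) \<and> \<Union>\<U> = topspace X"

definition covering_dim_le :: "'x topology \<Rightarrow> int \<Rightarrow> bool"
  where "covering_dim_le X n \<longleftrightarrow>
    (\<forall>\<U>. finite_open_cover X \<U> \<longrightarrow>
      (\<exists>\<V>. finite_open_cover X \<V> \<and> (\<forall>V\<in>\<V>. \<exists>U\<in>\<U>. V \<subseteq> U) \<and>
        (\<forall>x\<in>topspace X. int (card {V \<in> \<V>. x \<in> V}) \<le> n + 1)))"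

definition has_covering_dim :: "'x topology \<Rightarrow> int \<Rightarrow> bool"
  where "has_covering_dim X n \<longleftrightarrow> covering_dim_le X n \<and> \<not> covering_dim_le X (n - 1)"

end

theory Submission
  imports Defs
begin

text \<open>Suppose that the supremum is a natural number \<open>M\<close>. An \<open>M\<close>-tuple over \<open>\<A>\<close>, or over its unitization,
  has entries \<open>a\<^sub>j + p\<^sub>j 1\<close> with \<open>a\<^sub>j\<close> in \<open>\<A>\<close> and scalars \<open>p\<^sub>j\<close>, and after a small change
  \<open>P = \<Sum>\<^sub>j \<bar>p\<^sub>j\<bar>\<^sup>2\<close> is positive; if \<open>\<A>\<close> has a unit, every entry can be written with \<open>p\<^sub>j = 1\<close>. Fix the
  \<open>p\<^sub>j\<close> and call the tuple left invertible at \<open>t\<close> if \<open>\<Sum>\<^sub>j c\<^sub>j (a\<^sub>j(t) + p\<^sub>j 1\<^sub>t) = 1\<^sub>t\<close> for some \<open>c\<^sub>j\<close>. It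
  is enough to move the \<open>a\<^sub>j\<close> a little inside \<open>\<A>\<close> so that this holds at every \<open>t\<close>. For then
  \<open>\<Sum>\<^sub>j b\<^sub>j\<^sup>* b\<^sub>j\<close>, with \<open>b\<^sub>j = a\<^sub>j + p\<^sub>j 1\<close>, is invertible in each fibre because elements \<open>y\<^sup>* y\<close> are
  positive (\<open>sum_star_mult_invertible\<close>, \<open>pos_star_mult\<close>), and the pointwise inverses form \<open>1/P\<close>
  plus a field that is locally approximated by members of \<open>\<A>\<close> and vanishes at infinity
  (\<open>inverse_field\<close>). The fields of the latter kind form a full algebra of operator fields, so by
  maximality they all belong to \<open>\<A>\<close> (\<open>completion_full\<close>, \<open>completion_eq\<close>).

  Left invertibility is an open condition, jointly in the point and the tuple (\<open>LI_open\<close>), and it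
  is automatic where all \<open>a\<^sub>j(t)\<close> are small, because \<open>P > 0\<close> (\<open>LI_small\<close>). As fields vanish at
  infinity, only the points of a compact set \<open>K\<close> matter.

  The hypothesis on \<open>C([0,1]\<^sup>k) \<otimes> \<A>\<^sub>t\<close> says that continuous maps from the cube to \<open>M\<close>-tuples over
  \<open>\<A>\<^sub>t\<close> can be moved to left invertible ones. A simplex of dimension at most \<open>k\<close> is a retract of
  the cube, so the same holds for such simplices (\<open>C_tensor_simplex_dense\<close>). With openness it
  follows that a norm continuous family of tuples of fields, indexed by the points of a finite
  complex of dimension at most \<open>k\<close>, can be perturbed by a small family so that all its members
  become left invertible at one given point \<open>t\<close> (\<open>perturbable_simplex\<close>, \<open>perturbable_Union\<close>).

  To reach all points at once, vertices \<open>n\<close> on levels \<open>0, \<dots>, k\<close> are produced, each with an open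
  set \<open>W n\<close> inside a closed set \<open>C n\<close>, such that the sets \<open>W n\<close> of each level cover \<open>K\<close>; along
  with them comes a family \<open>F\<close> close to \<open>a\<close> on the complex whose simplices have at most one vertex
  on each level. The requirement is that \<open>F s\<close> is left invertible at \<open>t\<close> whenever \<open>t \<in> C n\<close> for
  all vertices \<open>n\<close> of the simplex that contains \<open>s\<close> in its interior. A new level is added as
  follows (\<open>extend_family\<close>, \<open>stage_step\<close>). For \<open>x \<in> K\<close> take the cone with a new vertex over the
  part of the complex spanned by the \<open>n\<close> with \<open>x \<in> C n\<close>. The family is good at \<open>x\<close> on the base of
  the cone, and a perturbation that dies out towards the base makes it good at \<open>x\<close> on the whole
  cone. Then it is good on the cone at all points near \<open>x\<close>, and finitely many such neighbourhoods
  cover \<open>K\<close>. New vertices on the same level are never joined, so their perturbations do not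
  interfere.

  Finally, since \<open>X\<close> has covering dimension at most \<open>k\<close>, there is a continuous map \<open>w\<close> on \<open>X\<close>
  which sends each \<open>t \<in> K\<close> into such a simplex all of whose vertices \<open>n\<close> satisfy \<open>t \<in> W n\<close>: it
  comes from the barycentric subdivision of the nerve of a suitable cover. The vertices of a
  simplex of that subdivision are simplices of the nerve, and no two of them have the same
  dimension, which then serves as the level (\<open>covering_map\<close>). The tuple \<open>b t = F (w t) t\<close> is the
  one wanted (\<open>perturb_everywhere\<close>).

  The fibres are algebras with explicit carriers and in general all different. They are realized
  as ideals in one C*-algebra with unit, which is a type (\<open>'b universal_cstar\<close>); the unit of the
  fibre at \<open>t\<close> is then a central projection \<open>e t\<close>, and the fields become functions into this type.\<close>

section \<open>Positivity in C*-algebras\<close>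

text \<open>C*-algebras with unit, over the reals as far as the type classes go: the complex structure
  is carried by a central element \<open>im\<close> with square \<open>-1\<close>, so that the real Banach algebra library
  applies. The number \<open>1\<close> has norm 1 here, so the zero algebra is not an instance.\<close>

class star_banach_algebra = real_normed_algebra_1 + banach +
  fixes star :: "'a \<Rightarrow> 'a" and im :: 'a
  assumes star_add: "star (x + y) = star x + star y"
    and star_mult: "star (x * y) = star y * star x"
    and star_star [simp]: "star (star x) = x"
    and star_scaleR: "star (r *\<^sub>R x) = r *\<^sub>R star x"
    and im_central: "im * x = x * im"
    and im_im: "im * im = - 1"
    and star_im: "star im = - im"
    and cstar_norm: "norm (star x * x) = (norm x)\<^sup>2"

lemma star_zero [simp]: "star (0 :: 'a :: star_banach_algebra) = 0"
  using star_scaleR[of 0 0] by simp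

lemma star_minus: "star (- x) = - star (x :: 'a :: star_banach_algebra)"
  using star_scaleR[of "-1" x] by simp

lemma star_diff: "star (x - y) = star x - star (y :: 'a :: star_banach_algebra)"
  using star_add[of x "- y"] by (simp add: star_minus)

lemma star_one [simp]: "star (1 :: 'a :: star_banach_algebra) = 1"
  using star_mult[of "star 1" "1 :: 'a"] by simp

lemma star_of_real [simp]: "star (of_real r :: 'a :: star_banach_algebra) = of_real r"
  by (simp add: of_real_def star_scaleR)

lemma star_sum: "star (sum f A :: 'a :: star_banach_algebra) = (\<Sum>i\<in>A. star (f i))"
  by (induction A rule: infinite_finite_induct) (auto simp: star_add)

lemma norm_star [simp]: "norm (star x) = norm (x :: 'a :: star_banach_algebra)"
proof -
  have le: "norm y \<le> norm (star y)" for y :: 'a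
  proof (cases "norm y = 0")
    case False
    have "(norm y)\<^sup>2 \<le> norm (star y) * norm y"
      using norm_mult_ineq[of "star y" y] by (simp add: cstar_norm)
    then show ?thesis using False by (simp add: power2_eq_square mult_le_cancel_right)
  qed simp
  show ?thesis using le[of x] le[of "star x"] by simp
qed

lemma tendsto_star [tendsto_intros]:
  fixes f :: "_ \<Rightarrow> 'a :: star_banach_algebra"
  assumes "(f \<longlongrightarrow> l) F"
  shows "((\<lambda>x. star (f x)) \<longlongrightarrow> star l) F"
proof -
  have "((\<lambda>x. norm (f x - l)) \<longlongrightarrow> 0) F"
    using assms by (simp add: tendsto_norm_zero_iff LIM_zero_iff)
  then have "((\<lambda>x. norm (star (f x) - star l)) \<longlongrightarrow> 0) F"
    by (simp flip: star_diff)
  then show ?thesis by (simp add: tendsto_norm_zero_iff LIM_zero_iff)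
qed

lemma continuous_on_star [continuous_intros]:
  fixes f :: "_ \<Rightarrow> 'a :: star_banach_algebra"
  shows "continuous_on S f \<Longrightarrow> continuous_on S (\<lambda>x. star (f x))"
  by (auto simp: continuous_on_def intro: tendsto_star)

subsection \<open>Invertible elements\<close>

definition invertible_elt :: "'a :: monoid_mult \<Rightarrow> bool"
  where "invertible_elt x \<longleftrightarrow> (\<exists>y. x * y = 1 \<and> y * x = 1)"

lemma neumann:
  fixes w :: "'a :: {real_normed_algebra_1, banach}"
  assumes "norm w < 1"
  obtains y where "(1 - w) * y = 1" "y * (1 - w) = 1"
proof -
  have sm: "summable (\<lambda>n. w ^ n)"
  proof (rule summable_comparison_test)
    show "\<exists>N. \<forall>n\<ge>N. norm (w ^ n) \<le> norm w ^ n" using norm_power_ineq by blast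
    show "summable (\<lambda>n. norm w ^ n)" using assms by (simp add: summable_geometric)
  qed
  define y where "y = (\<Sum>n. w ^ n)"
  have "y = 1 + (\<Sum>n. w ^ Suc n)"
    unfolding y_def using suminf_split_head[OF sm] by (simp add: algebra_simps)
  moreover have "(\<Sum>n. w ^ Suc n) = w * y"
    unfolding y_def using suminf_mult[OF sm, of w] by simp
  moreover have "(\<Sum>n. w ^ Suc n) = y * w"
    unfolding y_def using suminf_mult2[OF sm, of w] by (simp add: power_commutes)
  ultimately have "y = 1 + w * y" "y = 1 + y * w" by simp_all
  then have "(1 - w) * y = 1" "y * (1 - w) = 1" by (simp_all add: algebra_simps)
  then show ?thesis by (rule that)
qed

lemma invertible_eltI: "x * y = 1 \<Longrightarrow> y * x = 1 \<Longrightarrow> invertible_elt x"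
  unfolding invertible_elt_def by blast

lemma invertible_near_of_real:
  fixes x :: "'a :: {real_normed_algebra_1, banach}"
  assumes "norm (of_real r - x) < r"
  shows "invertible_elt x"
proof -
  have r: "r > 0" using assms norm_ge_zero le_less_trans by blast
  let ?w = "(1 / r) *\<^sub>R (of_real r - x)"
  have "norm ?w < 1" using r assms by simp
  then obtain y where y: "(1 - ?w) * y = 1" "y * (1 - ?w) = 1" by (rule neumann)
  have x: "x = r *\<^sub>R (1 - ?w)" using r by (simp add: of_real_def algebra_simps)
  show ?thesis
    by (rule invertible_eltI[where y = "(1 / r) *\<^sub>R y"]; subst x) (use y r in auto)
qed

text \<open>The assumption on commuting makes \<open>y\<close> commute with the inverse of \<open>x y\<close>, which turns the two
  one-sided inverses of \<open>x\<close> into one.\<close>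

lemma invertible_commuting_factor:
  fixes x y :: "'a :: monoid_mult"
  assumes "invertible_elt (x * y)" "x * y = y * x"
  shows "invertible_elt x"
proof -
  obtain z where z: "x * y * z = 1" "z * (x * y) = 1"
    using assms(1) unfolding invertible_elt_def by blast
  have l: "(z * y) * x = 1" using z(2) assms(2) by (simp add: mult.assoc)
  have r: "x * (y * z) = 1" using z(1) by (simp add: mult.assoc)
  have "z * y = (z * y) * (x * (y * z))" by (simp add: r)
  also have "\<dots> = (z * y) * x * (y * z)" by (simp only: mult.assoc)
  finally have "z * y = y * z" by (simp add: l)
  then show ?thesis using l r by (auto intro!: invertible_eltI)
qed

lemma commutes_inverse:
  fixes x y z :: "'a :: monoid_mult"
  assumes "x * y = 1" "y * x = 1" "x * z = z * x"
  shows "y * z = z * y"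
proof -
  have "y * (x * z) * y = y * (z * x) * y" using assms(3) by simp
  then have "(y * x) * (z * y) = (y * z) * (x * y)" by (simp only: mult.assoc)
  then show ?thesis using assms(1,2) by simp
qed

subsection \<open>Square roots and positive elements\<close>

text \<open>The square root is \<open>1 - z\<close> where \<open>z\<close> is the fixed point of \<open>z \<mapsto> (g + z\<^sup>2)/2\<close>, a contraction
  of the ball of radius \<open>norm g\<close>. Restricting it to selfadjoint elements that commute with
  everything that commutes with \<open>g\<close> gives these properties of the root for free, without any
  functional calculus.\<close>

lemma sqrt_near_one:
  fixes g :: "'a :: star_banach_algebra"
  assumes sa: "star g = g" and n: "norm g < 1"
  obtains v where "star v = v" "v * v = 1 - g" "norm (1 - v) < 1"
    "\<And>x. g * x = x * g \<Longrightarrow> v * x = x * v"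
proof -
  define Z where "Z = {z :: 'a. norm z \<le> norm g \<and> star z = z \<and> (\<forall>x. g * x = x * g \<longrightarrow> z * x = x * z)}"
  define f where "f = (\<lambda>z. (1/2) *\<^sub>R (g + z * z))"
  have "closed Z"
    unfolding Z_def
    by (intro closed_Collect_conj closed_Collect_le closed_Collect_eq closed_Collect_all
        closed_Collect_imp continuous_intros) auto
  then have cp: "complete Z" by (simp add: complete_eq_closed)
  have "0 \<in> Z" unfolding Z_def by simp
  then have ne: "Z \<noteq> {}" by blast
  have maps: "f ` Z \<subseteq> Z"
  proof (clarify)
    fix z assume z: "z \<in> Z"
    then have zg: "norm z \<le> norm g" and sz: "star z = z" unfolding Z_def by blast+
    have "norm (z * z) \<le> norm g * norm g"
      by (rule order_trans[OF norm_mult_ineq]) (intro mult_mono zg norm_ge_zero)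
    also have "\<dots> \<le> norm g" using n mult_left_le[of "norm g" "norm g"] by simp
    finally have "norm (z * z) \<le> norm g" .
    then have "norm (g + z * z) \<le> 2 * norm g" using norm_triangle_ineq[of g "z * z"] by linarith
    then have "norm (f z) \<le> norm g" unfolding f_def by simp
    moreover have "star (f z) = f z"
      unfolding f_def by (simp add: star_scaleR star_add star_mult sa sz)
    moreover have "f z * x = x * f z" if "g * x = x * g" for x
    proof -
      have zx: "z * x = x * z" using z that unfolding Z_def by blast
      have "z * z * x = z * (z * x)" by (rule mult.assoc)
      also have "\<dots> = (z * x) * z" by (simp only: zx[symmetric] mult.assoc)
      also have "\<dots> = x * z * z" by (simp only: zx)
      finally have "z * z * x = x * z * z" .
      then have "(g + z * z) * x = x * (g + z * z)"
        by (simp only: distrib_left distrib_right that mult.assoc)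
      then show ?thesis unfolding f_def by simp
    qed
    ultimately show "f z \<in> Z" unfolding Z_def by blast
  qed
  have lip: "dist (f x) (f y) \<le> norm g * dist x y" if "x \<in> Z \<and> y \<in> Z" for x y
  proof -
    have "f x - f y = (1/2) *\<^sub>R (x * (x - y) + (x - y) * y)"
      unfolding f_def by (simp add: algebra_simps)
    then have "norm (f x - f y) = norm (x * (x - y) + (x - y) * y) / 2" by simp
    also have "norm (x * (x - y) + (x - y) * y) \<le> norm x * norm (x - y) + norm (x - y) * norm y"
      by (meson add_mono norm_mult_ineq norm_triangle_le)
    also have "\<dots> \<le> norm g * norm (x - y) + norm (x - y) * norm g"
    proof -
      have "norm x \<le> norm g" "norm y \<le> norm g" using that unfolding Z_def by blast+
      then show ?thesis by (intro add_mono mult_right_mono mult_left_mono) auto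
    qed
    finally show ?thesis by (simp add: dist_norm)
  qed
  have "\<exists>!z\<in>Z. f z = z"
    by (rule Banach_fix[OF cp ne _ n maps]) (use lip in auto)
  then obtain z where z: "z \<in> Z" "f z = z" by blast
  have "2 *\<^sub>R z = 2 *\<^sub>R f z" using z(2) by simp
  then have "z * z = 2 *\<^sub>R z - g" unfolding f_def by simp
  then have "(1 - z) * (1 - z) = 1 - g"
    by (simp add: left_diff_distrib right_diff_distrib scaleR_2)
  moreover have "norm z \<le> norm g" and sz: "star z = z" using z(1) unfolding Z_def by blast+
  then have "star (1 - z) = 1 - z" and "norm (1 - (1 - z)) < 1" using n by (simp_all add: star_diff)
  moreover have "(1 - z) * x = x * (1 - z)" if "g * x = x * g" for x
  proof -
    have "z * x = x * z" using z(1) that unfolding Z_def by blast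
    then show ?thesis by (simp add: left_diff_distrib right_diff_distrib)
  qed
  ultimately show ?thesis using that by blast
qed

text \<open>For selfadjoint \<open>h\<close> the second condition says that the spectrum lies in \<open>[0, 2r]\<close>. This form
  makes sums of positive elements positive by the triangle inequality.\<close>

definition pos :: "'a :: star_banach_algebra \<Rightarrow> bool"
  where "pos h \<longleftrightarrow> star h = h \<and> (\<exists>r\<ge>0. norm (of_real r - h) \<le> r)"

lemma pos_star: "pos h \<Longrightarrow> star h = h" unfolding pos_def by blast

lemma pos_add: assumes "pos h" "pos g" shows "pos (h + g)"
proof -
  obtain r s where rs: "r \<ge> 0" "s \<ge> 0" "norm (of_real r - h) \<le> r" "norm (of_real s - g) \<le> s"
    using assms unfolding pos_def by blast
  have "of_real (r + s) - (h + g) = (of_real r - h) + (of_real s - g)" by simp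
  then have "norm (of_real (r + s) - (h + g)) \<le> r + s"
    using rs norm_triangle_le by (metis add_mono)
  then show ?thesis using assms rs unfolding pos_def
    by (auto simp: star_add intro!: exI[of _ "r + s"])
qed

lemma pos_of_real: "r \<ge> 0 \<Longrightarrow> pos (of_real r)"
  unfolding pos_def by (auto intro: exI[of _ r])

lemma pos_zero: "pos 0" using pos_of_real[of 0] by simp

lemma pos_sum: "(\<And>i. i \<in> A \<Longrightarrow> pos (f i)) \<Longrightarrow> pos (sum f A)"
  by (induction A rule: infinite_finite_induct) (auto simp: pos_zero pos_add)

lemma pos_scaleR: assumes "pos h" "c \<ge> 0" shows "pos (c *\<^sub>R h)"
proof -
  obtain r where r: "r \<ge> 0" "norm (of_real r - h) \<le> r" using assms unfolding pos_def by blast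
  have "of_real (c * r) - c *\<^sub>R h = c *\<^sub>R (of_real r - h)"
    by (simp add: of_real_def algebra_simps)
  then have "norm (of_real (c * r) - c *\<^sub>R h) \<le> c * r"
    using r assms by (simp add: mult_left_mono)
  then show ?thesis using assms r unfolding pos_def
    by (auto simp: star_scaleR intro!: exI[of _ "c * r"])
qed

lemma pos_norm_minus: "star h = h \<Longrightarrow> pos (of_real (norm h) - h)"
  unfolding pos_def by (auto simp: star_diff intro!: exI[of _ "norm h"])

lemma pos_norm_plus: "star h = h \<Longrightarrow> pos (of_real (norm h) + h)"
  using pos_norm_minus[of "- h"] by (simp add: star_minus)

lemma pos_shift_sqrt:
  fixes h :: "'a :: star_banach_algebra"
  assumes "pos h" "l > 0"
  obtains v where "star v = v" "v * v = h + of_real l" "pos v" "invertible_elt v"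
    "\<And>x. h * x = x * h \<Longrightarrow> v * x = x * v"
proof -
  obtain r where r: "r \<ge> 0" "norm (of_real r - h) \<le> r" and sa: "star h = h"
    using assms unfolding pos_def by blast
  define g where "g = (1 / (r + l)) *\<^sub>R (of_real r - h)"
  have rl: "r + l > 0" using r assms by simp
  have "norm g \<le> r / (r + l)" using r rl unfolding g_def by (simp add: divide_simps)
  also have "\<dots> < 1" using assms r by simp
  finally have "norm g < 1" .
  moreover have "star g = g" unfolding g_def by (simp add: star_scaleR star_diff sa)
  ultimately obtain v where v: "star v = v" "v * v = 1 - g" "norm (1 - v) < 1"
    "\<And>x. g * x = x * g \<Longrightarrow> v * x = x * v" by - (rule sqrt_near_one[of g], assumption, assumption, rule that)
  define c where "c = sqrt (r + l)"
  have c: "c > 0" "c * c = r + l" using rl unfolding c_def by simp_all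
  show ?thesis
  proof
    show "star (c *\<^sub>R v) = c *\<^sub>R v" by (simp add: star_scaleR v)
    have "(r + l) *\<^sub>R g = of_real r - h" unfolding g_def using rl by simp
    moreover have "(c *\<^sub>R v) * (c *\<^sub>R v) = (r + l) *\<^sub>R 1 - (r + l) *\<^sub>R g"
      by (simp add: c v(2) scaleR_diff_right)
    ultimately show "(c *\<^sub>R v) * (c *\<^sub>R v) = h + of_real l"
      by (simp add: of_real_def scaleR_add_left)
    have "pos v" unfolding pos_def using v(1,3) by (intro conjI exI[of _ 1]) auto
    then show "pos (c *\<^sub>R v)" using c by (intro pos_scaleR) auto
    have "c *\<^sub>R (1 - v) = of_real c - c *\<^sub>R v" by (simp add: of_real_def algebra_simps)
    then have "norm (of_real c - c *\<^sub>R v) = c * norm (1 - v)" using c by (metis abs_of_pos norm_scaleR)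
    then have "norm (of_real c - c *\<^sub>R v) < c" using v(3) c by simp
    then show "invertible_elt (c *\<^sub>R v)" by (rule invertible_near_of_real)
    show "(c *\<^sub>R v) * x = x * (c *\<^sub>R v)" if hx: "h * x = x * h" for x
    proof -
      have "g * x = x * g"
        unfolding g_def by (simp add: left_diff_distrib right_diff_distrib of_real_def hx)
      then have "v * x = x * v" by (rule v(4))
      then show ?thesis by simp
    qed
  qed
qed

lemma pos_shift_invertible:
  assumes "pos h" "l > 0"
  shows "invertible_elt (h + of_real l)"
proof -
  have "\<exists>v. v * v = h + of_real l \<and> invertible_elt v"
    by (rule pos_shift_sqrt[OF assms]) (intro exI conjI)
  then obtain v where v: "v * v = h + of_real l" "invertible_elt v" by (elim exE conjE)
  obtain u where u: "v * u = 1" "u * v = 1" using v(2) unfolding invertible_elt_def by blast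
  have "v * v * (u * u) = v * (v * u) * u" "u * u * (v * v) = u * (u * v) * v"
    by (simp_all only: mult.assoc)
  then have "v * v * (u * u) = 1" "u * u * (v * v) = 1" by (simp_all only: u mult_1_right)
  then show ?thesis unfolding v(1) by (rule invertible_eltI)
qed

text \<open>For commuting selfadjoint \<open>u\<close> and \<open>v\<close> the element \<open>w = u + i v\<close> satisfies \<open>w\<^sup>* w = u\<^sup>2 + v\<^sup>2\<close>,
  which gives its norm, and \<open>v\<close> is its imaginary part.\<close>

lemma norm_le_of_squares:
  fixes u v :: "'a :: star_banach_algebra"
  assumes "star u = u" "star v = v" "u * v = v * u" "u * u + v * v = of_real (c\<^sup>2)" "c \<ge> 0"
  shows "norm v \<le> c"
proof -
  let ?w = "u + im * v"
  have st: "star ?w = u - im * v"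
    using assms(1,2) by (simp add: star_add star_mult star_im im_central[of v])
  have a1: "u * (im * v) = im * (u * v)" by (simp add: im_central[of u] flip: mult.assoc)
  have "(im * v) * (im * v) = im * (v * im) * v" by (simp only: mult.assoc)
  also have "\<dots> = (im * im) * (v * v)" by (simp only: im_central[of v, symmetric] mult.assoc)
  finally have a2: "(im * v) * (im * v) = - (v * v)" by (simp add: im_im)
  have "star ?w * ?w = of_real (c\<^sup>2)"
  proof -
    have "star ?w * ?w = u * u + u * (im * v) - im * (v * u) - (im * v) * (im * v)"
      unfolding st by (simp only: distrib_left distrib_right left_diff_distrib mult.assoc) simp
    then show ?thesis by (simp add: a1 a2 assms(3,4))
  qed
  then have "(norm ?w)\<^sup>2 = norm (of_real (c\<^sup>2) :: 'a)" by (simp only: flip: cstar_norm)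
  then have "(norm ?w)\<^sup>2 = c\<^sup>2" by (simp only: norm_of_real) simp
  then have w: "norm ?w = c" using assms by simp
  have ni: "norm (im :: 'a) = 1"
  proof -
    have "(norm (im::'a))\<^sup>2 = 1" by (simp only: star_im im_im minus_mult_left[symmetric] flip: cstar_norm) simp
    then show ?thesis by (simp add: power2_eq_1_iff) (smt (verit) norm_ge_zero)
  qed
  have "?w - star ?w = 2 *\<^sub>R (im * v)" unfolding st by (simp add: scaleR_2)
  then have "2 * norm (im * v) \<le> 2 * c"
    using norm_triangle_ineq4[of ?w "star ?w"] w by simp
  moreover have "v = - (im * (im * v))" by (simp add: im_im flip: mult.assoc)
  then have "norm v \<le> norm (im * v)"
    by (metis mult_1 ni norm_minus_cancel norm_mult_ineq)
  ultimately show ?thesis by simp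
qed

text \<open>If \<open>c > norm u\<close>, then \<open>c\<^sup>2 - u\<^sup>2\<close> is the square of some \<open>v\<close> that commutes with \<open>u\<close>, and
  \<open>norm v \<le> c\<close> since \<open>u\<^sup>2 + v\<^sup>2 = c\<^sup>2\<close>. So \<open>u\<^sup>2\<close> has distance at most \<open>c\<^sup>2\<close> from \<open>c\<^sup>2\<close>.\<close>

lemma pos_square:
  fixes u :: "'a :: star_banach_algebra"
  assumes "star u = u"
  shows "pos (u * u)"
proof -
  define c where "c = norm u + 1"
  have c: "c > 0" unfolding c_def by (simp add: add_nonneg_pos)
  define g where "g = (1 / c\<^sup>2) *\<^sub>R (u * u)"
  have "norm (u * u) \<le> norm u * norm u" by (rule norm_mult_ineq)
  also have "\<dots> < c * c" unfolding c_def by (intro mult_strict_mono) (auto simp: add_nonneg_pos)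
  finally have "norm g < 1" using c unfolding g_def by (simp add: power2_eq_square divide_simps)
  moreover have "star g = g" unfolding g_def by (simp add: star_scaleR star_mult assms)
  ultimately obtain v where v: "star v = v" "v * v = 1 - g" "norm (1 - v) < 1"
    "\<And>x. g * x = x * g \<Longrightarrow> v * x = x * v" by - (rule sqrt_near_one[of g], assumption, assumption, rule that)
  have gu: "g * u = u * g" unfolding g_def by (simp add: mult.assoc)
  have cg: "c\<^sup>2 *\<^sub>R g = u * u" using c unfolding g_def by simp
  have sq: "(c *\<^sub>R v) * (c *\<^sub>R v) = of_real (c\<^sup>2) - u * u"
    by (simp add: v(2) of_real_def scaleR_diff_right power2_eq_square flip: cg)
  have "norm (c *\<^sub>R v) \<le> c"
  proof (rule norm_le_of_squares[of u])
    show "u * c *\<^sub>R v = c *\<^sub>R v * u" using v(4)[OF gu] by simp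
    show "u * u + c *\<^sub>R v * c *\<^sub>R v = of_real (c\<^sup>2)" by (subst sq) simp
  qed (use v(1) assms c in \<open>auto simp: star_scaleR\<close>)
  then have "norm ((c *\<^sub>R v) * (c *\<^sub>R v)) \<le> c * c"
    using c by (intro order_trans[OF norm_mult_ineq] mult_mono) auto
  then have "norm (of_real (c\<^sup>2) - u * u) \<le> c\<^sup>2" unfolding sq by (simp add: power2_eq_square)
  then show ?thesis unfolding pos_def using assms
    by (auto simp: star_mult intro!: exI[of _ "c\<^sup>2"])
qed

text \<open>The product of \<open>\<eta> + g\<close> and \<open>\<eta> - g\<close> is \<open>\<eta>\<^sup>2 - g\<^sup>2\<close>. With square roots \<open>v\<close> and \<open>u\<close> of the two
  (shifted) factors, \<open>(v u)\<^sup>2 + g\<^sup>2 = (\<eta> + d)\<^sup>2\<close>.\<close>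

lemma norm_le_of_pos:
  fixes g :: "'a :: star_banach_algebra"
  assumes "pos (of_real \<eta> + g)" "pos (of_real \<eta> - g)" and sa: "star g = g" and "\<eta> \<ge> 0"
  shows "norm g \<le> \<eta>"
proof (rule field_le_epsilon)
  fix d :: real assume d: "d > 0"
  obtain v where v: "star v = v" "v * v = of_real \<eta> + g + of_real d" "pos v" "invertible_elt v"
    "\<And>x. (of_real \<eta> + g) * x = x * (of_real \<eta> + g) \<Longrightarrow> v * x = x * v"
    by (rule pos_shift_sqrt[OF assms(1) d]) (rule that)
  obtain u where u: "star u = u" "u * u = of_real \<eta> - g + of_real d" "pos u" "invertible_elt u"
    "\<And>x. (of_real \<eta> - g) * x = x * (of_real \<eta> - g) \<Longrightarrow> u * x = x * u"
    by (rule pos_shift_sqrt[OF assms(2) d]) (rule that)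
  have vg: "v * g = g * v" by (rule v(5)) (simp add: algebra_simps of_real_def)
  have ug: "u * g = g * u" by (rule u(5)) (simp add: algebra_simps of_real_def)
  have vu: "v * u = u * v" by (rule v(5)) (use ug in \<open>simp add: algebra_simps of_real_def\<close>)
  have "(v * u) * (v * u) = v * (u * v) * u" by (simp only: mult.assoc)
  also have "\<dots> = (v * v) * (u * u)" by (simp only: vu[symmetric] mult.assoc)
  also have "\<dots> = of_real ((\<eta> + d)\<^sup>2) - g * g"
    unfolding v(2) u(2) by (simp add: algebra_simps of_real_def power2_eq_square flip: scaleR_add_left)
  finally have e: "(v * u) * (v * u) + g * g = of_real ((\<eta> + d)\<^sup>2)" by simp
  show "norm g \<le> \<eta> + d"
  proof (rule norm_le_of_squares[OF _ sa _ e])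
    have "v * u * g = v * (u * g)" "v * (g * u) = v * g * u" "g * v * u = g * (v * u)"
      by (simp_all only: mult.assoc)
    then show "v * u * g = g * (v * u)" by (simp only: ug vg)
    show "star (v * u) = v * u" by (simp only: star_mult u(1) v(1) vu)
  qed (use assms(4) d in simp)
qed

text \<open>A radius that depends continuously on \<open>h\<close>; it shows that the positive elements form a closed
  set.\<close>

lemma pos_iff_norm: "pos h \<longleftrightarrow> star h = h \<and> norm (of_real (norm h / 2) - h) \<le> norm h / 2"
proof
  assume p: "pos h"
  let ?R = "norm h"
  have "norm (h - of_real (?R/2)) \<le> ?R/2"
  proof (rule norm_le_of_pos)
    show "pos (of_real (?R / 2) + (h - of_real (?R / 2)))" using p by simp
    have "of_real (?R / 2) - (h - of_real (?R / 2)) = of_real ?R - h"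
      by (simp add: of_real_def algebra_simps flip: scaleR_add_left)
    then show "pos (of_real (?R / 2) - (h - of_real (?R / 2)))"
      using pos_norm_minus p pos_star by metis
  qed (use p in \<open>auto simp: star_diff pos_def\<close>)
  then show "star h = h \<and> norm (of_real (norm h / 2) - h) \<le> norm h / 2"
    using p by (simp add: norm_minus_commute pos_star)
next
  assume "star h = h \<and> norm (of_real (norm h / 2) - h) \<le> norm h / 2"
  then show "pos h" unfolding pos_def by (intro conjI exI[of _ "norm h / 2"]) auto
qed

lemma closed_pos: "closed {h :: 'a :: star_banach_algebra. pos h}"
  unfolding pos_iff_norm
  by (intro closed_Collect_conj closed_Collect_le closed_Collect_eq continuous_intros) auto

lemma pos_limit:
  fixes h g :: "'a :: star_banach_algebra"
  assumes "\<And>l. l > 0 \<Longrightarrow> pos (h + l *\<^sub>R g)"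
  shows "pos h"
proof -
  have "(\<lambda>n. h + (1 / real (Suc n)) *\<^sub>R g) \<longlonglongrightarrow> h + 0 *\<^sub>R g"
    by (intro tendsto_intros LIMSEQ_Suc lim_1_over_n)
  moreover have "h + (1 / real (Suc n)) *\<^sub>R g \<in> {h. pos h}" for n
    using assms by simp
  ultimately show ?thesis using closed_sequentially[OF closed_pos] by fastforce
qed

lemma pos_conj_commuting:
  fixes b k :: "'a :: star_banach_algebra"
  assumes "pos k" "star b = b" "b * k = k * b"
  shows "pos (b * k * b)"
proof (rule pos_limit[where g = "b * b"])
  fix l :: real assume "l > 0"
  then obtain v where v: "star v = v" "v * v = k + of_real l" "pos v" "invertible_elt v"
    "\<And>x. k * x = x * k \<Longrightarrow> v * x = x * v"
    by (rule pos_shift_sqrt[OF assms(1)]) (rule that)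
  have vb: "v * b = b * v" by (rule v(5)) (simp add: assms(3))
  have "b * k * b + l *\<^sub>R (b * b) = b * (v * v) * b"
    unfolding v(2) by (simp add: of_real_def algebra_simps)
  also have "\<dots> = (b * v) * (v * b)" by (simp only: mult.assoc)
  also have "\<dots> = (v * b) * (v * b)" by (simp only: vb)
  finally show "pos (b * k * b + l *\<^sub>R (b * b))"
    using pos_square[of "v * b"] by (simp only: star_mult vb v(1) assms(2))
qed

lemma star_inverse:
  fixes a y :: "'a :: star_banach_algebra"
  assumes "a * y = 1" "y * a = 1" "star a = a"
  shows "star y = y"
proof -
  have "star y * a = 1" using assms(1,3) star_mult[of a y] by simp
  then have "star y * (a * y) = y" by (simp flip: mult.assoc)
  then show ?thesis using assms(1) by simp
qed

text \<open>This replaces the fact that a selfadjoint element with spectrum in \<open>[0, \<infinity>)\<close> is positive.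
  Consider the least \<open>l \<ge> 0\<close> with \<open>g + l\<close> positive. If \<open>l > 0\<close>, the inverse \<open>y\<close> of \<open>a = g + l\<close> has
  some norm below \<open>C\<close>, and \<open>a \<ge> 1/C\<close> follows, which contradicts that \<open>l\<close> is least.\<close>

lemma pos_of_shifts_invertible:
  fixes g :: "'a :: star_banach_algebra"
  assumes sa: "star g = g" and inv: "\<And>l. l > 0 \<Longrightarrow> invertible_elt (g + of_real l)"
  shows "pos g"
proof -
  define L where "L = {l. l \<ge> 0 \<and> pos (g + of_real l)}"
  have "closed ({0..} \<inter> (\<lambda>l. g + of_real l) -` {h. pos h})"
    by (intro closed_Int closed_vimage closed_pos continuous_intros closed_atLeast)
  then have cl: "closed L" unfolding L_def by (simp add: vimage_def Int_def)
  have ne: "L \<noteq> {}" using pos_norm_plus[OF sa] unfolding L_def by (force simp: add.commute)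
  have bd: "bdd_below L" unfolding L_def by (auto intro: bdd_belowI[of _ 0])
  define l0 where "l0 = Inf L"
  have l0: "l0 \<in> L" unfolding l0_def by (rule closed_contains_Inf[OF ne bd cl])
  have "l0 = 0"
  proof (rule ccontr)
    assume "l0 \<noteq> 0"
    then have l0p: "l0 > 0" using l0 unfolding L_def by auto
    define a where "a = g + of_real l0"
    have pa: "pos a" using l0 unfolding L_def a_def by simp
    have sa': "star a = a" using pa pos_star by blast
    obtain y where y: "a * y = 1" "y * a = 1"
      using inv[OF l0p] unfolding invertible_elt_def a_def by blast
    have sy: "star y = y" using y sa' by (rule star_inverse)
    \<comment> \<open>With \<open>norm y < C\<close> one has \<open>y\<^sup>2 \<le> C\<^sup>2\<close>, hence \<open>a\<^sup>2 \<ge> 1/C\<^sup>2\<close>; dividing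
      \<open>a\<^sup>2 - 1/C\<^sup>2 = (a + 1/C) (a - 1/C)\<close> by the positive factor \<open>a + 1/C\<close> gives \<open>a \<ge> 1/C\<close>.\<close>
    define C where "C = norm y + 1"
    have C: "C > 0" unfolding C_def by (simp add: add_nonneg_pos)
    have "norm (y * y) \<le> C * C"
      unfolding C_def by (rule order_trans[OF norm_mult_ineq]) (intro mult_mono, auto)
    then have p1: "pos (of_real (C * C) - y * y)"
      using pos_add[OF pos_norm_minus[of "y * y"] pos_of_real[of "C*C - norm (y * y)"]] sy
      by (simp add: star_mult)
    have ayy: "a * (y * y) = y" "y * y * a = y" by (simp_all add: y flip: mult.assoc) (simp add: y mult.assoc)
    have "pos (a * (of_real (C * C) - y * y) * a)"
      by (rule pos_conj_commuting[OF p1 sa'])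
         (simp add: ayy right_diff_distrib left_diff_distrib of_real_def)
    moreover have "a * (of_real (C * C) - y * y) * a = (C * C) *\<^sub>R (a * a) - 1"
    proof -
      have "a * (y * y) * a = 1" by (simp only: ayy y)
      then show ?thesis by (simp add: right_diff_distrib left_diff_distrib of_real_def)
    qed
    ultimately have p2: "pos ((C * C) *\<^sub>R (a * a) - 1)" by simp
    have p3: "pos (a * a - of_real (1 / (C * C)))"
      using pos_scaleR[OF p2, of "1 / (C * C)"] C by (simp add: algebra_simps of_real_def)
    have c1: "1 / C > 0" using C by simp
    obtain v where v: "star v = v" "v * v = a + of_real (1 / C)" "pos v" "invertible_elt v"
      "\<And>x. a * x = x * a \<Longrightarrow> v * x = x * v"
      by (rule pos_shift_sqrt[OF pa c1]) (rule that)
    obtain u where u: "v * u = 1" "u * v = 1" using v(4) unfolding invertible_elt_def by blast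
    have su: "star u = u" using u v(1) by (rule star_inverse)
    have va: "v * a = a * v" by (rule v(5)) (rule refl)
    have ua: "u * a = a * u" using commutes_inverse[OF u va] .
    have "u * (a * a) = (u * a) * a" by (simp only: mult.assoc)
    also have "\<dots> = a * (u * a)" by (simp only: ua mult.assoc)
    also have "\<dots> = a * a * u" by (simp only: ua mult.assoc)
    finally have uaa: "u * (a * a) = a * a * u" .
    have "pos (u * (a * a - of_real (1 / (C * C))) * u)"
      by (rule pos_conj_commuting[OF p3 su])
         (simp add: right_diff_distrib left_diff_distrib of_real_def uaa)
    moreover have "u * (a * a - of_real (1 / (C * C))) * u = a - of_real (1 / C)"
    proof -
      have "a * a - of_real (1 / (C * C)) = (a + of_real (1 / C)) * (a - of_real (1 / C))"
        by (simp add: algebra_simps of_real_def)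
      also have "\<dots> = v * v * (a - of_real (1 / C))" by (simp add: v)
      finally have "u * (a * a - of_real (1 / (C * C))) = (u * v) * (v * (a - of_real (1 / C)))"
        by (simp only: mult.assoc)
      then have "u * (a * a - of_real (1 / (C * C))) * u = v * (a - of_real (1 / C)) * u"
        by (simp only: u mult_1_left)
      also have "\<dots> = (a - of_real (1 / C)) * v * u"
        by (simp add: va right_diff_distrib left_diff_distrib of_real_def)
      finally show ?thesis by (simp add: mult.assoc u)
    qed
    ultimately have p4: "pos (a - of_real (1 / C))" by simp
    define d where "d = min (1 / C) l0"
    have d: "d > 0" "d \<le> 1 / C" "d \<le> l0" using c1 l0p unfolding d_def by auto
    have "pos (a - of_real d)"
      using pos_add[OF p4 pos_of_real[of "1 / C - d"]] d by simp
    then have "l0 - d \<in> L" unfolding L_def a_def using d by (simp add: algebra_simps)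
    then have "l0 \<le> l0 - d" unfolding l0_def by (rule cInf_lower[OF _ bd])
    then show False using d by simp
  qed
  then show ?thesis using l0 unfolding L_def by simp
qed

text \<open>The identity behind this is \<open>(w z + m)\<^sup>-\<^sup>1 = (1 - w (z w + m)\<^sup>-\<^sup>1 z) / m\<close>: apart from \<open>0\<close>, the
  spectra of \<open>z w\<close> and \<open>w z\<close> agree.\<close>

lemma invertible_swap:
  fixes z :: "'a :: star_banach_algebra"
  assumes "m > 0" "invertible_elt (z * w + of_real m)"
  shows "invertible_elt (w * z + of_real m)"
proof -
  obtain y where y: "(z * w + of_real m) * y = 1" "y * (z * w + of_real m) = 1"
    using assms(2) unfolding invertible_elt_def by blast
  have y1: "z * w * y = 1 - m *\<^sub>R y" using y(1) by (simp add: algebra_simps of_real_def)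
  have y2: "y * z * w = 1 - m *\<^sub>R y" using y(2) by (simp add: algebra_simps of_real_def)
  let ?u = "(1 / m) *\<^sub>R (1 - w * y * z)"
  have "w * z * w * y * z = w * (z * w * y) * z" "w * y * z * w * z = w * (y * z * w) * z"
    by (simp_all add: mult.assoc)
  then have "w * z * w * y * z = w * z - m *\<^sub>R (w * y * z)"
    "w * y * z * w * z = w * z - m *\<^sub>R (w * y * z)"
    unfolding y1 y2 by (simp_all add: algebra_simps)
  then have "(w * z + of_real m) * (1 - w * y * z) = of_real m"
    "(1 - w * y * z) * (w * z + of_real m) = of_real m"
    by (simp_all add: algebra_simps of_real_def)
  then have "(w * z + of_real m) * ?u = 1" "?u * (w * z + of_real m) = 1"
    using assms(1) by (simp_all add: of_real_def)
  then show ?thesis by (rule invertible_eltI)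
qed

text \<open>If \<open>z = x + i y\<close> with \<open>x\<close> and \<open>y\<close> selfadjoint, then \<open>z\<^sup>* z + z z\<^sup>* = 2 x\<^sup>2 + 2 y\<^sup>2\<close>.\<close>

lemma pos_star_mult_add: "pos (star z * z + z * star z)"
proof -
  let ?a = "z + star z" and ?b = "im * (z - star z)"
  have sa: "star ?a = ?a" by (simp add: star_add)
  have sb: "star ?b = ?b"
    using im_central[of "star z - z"] by (simp add: star_mult star_diff star_im algebra_simps)
  have "?b * ?b = im * ((z - star z) * im) * (z - star z)" by (simp only: mult.assoc)
  also have "\<dots> = (im * im) * ((z - star z) * (z - star z))"
    by (simp only: im_central[of "z - star z", symmetric] mult.assoc)
  finally have bb: "?b * ?b = - ((z - star z) * (z - star z))" by (simp add: im_im)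
  have "?a * ?a + ?b * ?b = 2 *\<^sub>R (star z * z + z * star z)"
    unfolding bb by (simp add: algebra_simps scaleR_2)
  then have "star z * z + z * star z = (1/2) *\<^sub>R (?a * ?a + ?b * ?b)" by simp
  then show ?thesis using pos_scaleR[OF pos_add[OF pos_square[OF sa] pos_square[OF sb]], of "1/2"] by simp
qed

text \<open>Kaplansky's argument, with approximations in place of the functional calculus. Write
  \<open>h = y\<^sup>* y\<close> as \<open>p - n\<close> with \<open>p\<close> and \<open>n\<close> positive and \<open>p n\<close> small, and put \<open>z = y n\<close>. Then
  \<open>z\<^sup>* z = n h n\<close> is nearly \<open>- n\<^sup>3\<close>, so \<open>z z\<^sup>* = (z\<^sup>* z + z z\<^sup>*) - z\<^sup>* z\<close> is nearly positive. As \<open>z\<^sup>* z\<close>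
  and \<open>z z\<^sup>*\<close> have the same spectrum apart from \<open>0\<close>, \<open>z\<^sup>* z\<close> is nearly positive and nearly negative,
  hence small. So \<open>n\<close> is small, and \<open>h\<close> is nearly \<open>p\<close>.\<close>

theorem pos_star_mult:
  fixes y :: "'a :: star_banach_algebra"
  shows "pos (star y * y)"
proof (rule pos_limit[where g = 1])
  fix d :: real assume d: "d > 0"
  \<comment> \<open>The constant is chosen so that the estimate at the end reads \<open>norm n \<le> d\<close>.\<close>
  define l where "l = 2 * d\<^sup>2"
  have l: "l > 0" using d unfolding l_def by simp
  define h where "h = star y * y"
  have sh: "star h = h" unfolding h_def by (simp add: star_mult)
  \<comment> \<open>An approximation of \<open>\<bar>h\<bar>\<close>; the positive and negative parts of \<open>h\<close> will be \<open>(s \<plusminus> h)/2\<close>.\<close>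
  obtain s where s: "star s = s" "s * s = h * h + of_real l" "pos s" "invertible_elt s"
    "\<And>x. (h * h) * x = x * (h * h) \<Longrightarrow> s * x = x * s"
    by (rule pos_shift_sqrt[OF pos_square[OF sh] l]) (rule that)
  have hs: "s * h = h * s" by (rule s(5)) (simp only: mult.assoc)
  \<comment> \<open>The shifts of \<open>s + h\<close> are invertible because multiplication with the same shift of \<open>s - h\<close>
    yields a strictly positive element.\<close>
  have half: "pos (s + e *\<^sub>R h)" if e: "e = 1 \<or> e = -1" for e :: real
  proof (rule pos_of_shifts_invertible)
    show "star (s + e *\<^sub>R h) = s + e *\<^sub>R h" by (simp add: star_add star_scaleR s(1) sh)
    fix m :: real assume m: "m > 0"
    have prod: "(s + e *\<^sub>R h + of_real m) * (s - e *\<^sub>R h + of_real m) = (2 * m) *\<^sub>R s + of_real (l + m\<^sup>2)"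
      and comm: "(s + e *\<^sub>R h + of_real m) * (s - e *\<^sub>R h + of_real m) =
            (s - e *\<^sub>R h + of_real m) * (s + e *\<^sub>R h + of_real m)"
      using e by (auto simp: algebra_simps of_real_def hs s(2) power2_eq_square simp flip: scaleR_2)
    have "invertible_elt ((2 * m) *\<^sub>R s + of_real (l + m\<^sup>2))"
      using m l by (intro pos_shift_invertible pos_scaleR s(3)) (auto intro: add_pos_pos)
    then show "invertible_elt (s + e *\<^sub>R h + of_real m)"
      using invertible_commuting_factor[OF _ comm] prod by simp
  qed
  define n where "n = (1/2) *\<^sub>R (s - h)"
  define p where "p = (1/2) *\<^sub>R (s + h)"
  have pn: "pos n" unfolding n_def using pos_scaleR[OF half[of "-1"], of "1/2"] by simp
  have pp: "pos p" unfolding p_def using pos_scaleR[OF half[of 1], of "1/2"] by simp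
  have h: "h = p - n" unfolding p_def n_def by (simp add: algebra_simps flip: scaleR_add_left)
  have pnl: "p * n = of_real (l / 4)"
    unfolding p_def n_def by (simp add: algebra_simps hs s(2) of_real_def)
  have sn: "star n = n" using pn by (rule pos_star)
  have n3: "pos (n * n * n)" by (rule pos_conj_commuting[OF pn sn]) simp
  define z where "z = y * n"
  have "star z * z = n * h * n" unfolding z_def h_def by (simp add: star_mult sn mult.assoc)
  also have "\<dots> = n * (p * n) - n * n * n" unfolding h by (simp add: algebra_simps)
  finally have zz: "star z * z = (l / 4) *\<^sub>R n - n * n * n" by (simp add: pnl of_real_def)
  define \<kappa> where "\<kappa> = (l / 4) * norm n"
  have k0: "\<kappa> \<ge> 0" unfolding \<kappa>_def using l by simp
  have "pos ((l / 4) *\<^sub>R (of_real (norm n) - n))"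
    using l by (intro pos_scaleR pos_norm_minus sn) simp
  then have nk: "pos (of_real \<kappa> - (l / 4) *\<^sub>R n)"
    unfolding \<kappa>_def by (simp add: of_real_def algebra_simps)
  have "of_real \<kappa> - star z * z = (of_real \<kappa> - (l / 4) *\<^sub>R n) + n * n * n" unfolding zz by simp
  then have upper: "pos (of_real \<kappa> - star z * z)" by (simp only: pos_add[OF nk n3])
  have "z * star z + of_real \<kappa> =
      (star z * z + z * star z) + ((of_real \<kappa> - (l / 4) *\<^sub>R n) + n * n * n)"
    unfolding zz by simp
  then have swapped: "pos (z * star z + of_real \<kappa>)"
    by (simp only: pos_add[OF pos_star_mult_add pos_add[OF nk n3]])
  have "pos (star z * z + of_real \<kappa>)"
  proof (rule pos_of_shifts_invertible)
    fix m :: real assume m: "m > 0"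
    have "invertible_elt (z * star z + of_real (\<kappa> + m))"
      using pos_shift_invertible[OF swapped m] by (simp add: add.assoc)
    then have "invertible_elt (star z * z + of_real (\<kappa> + m))"
      by (rule invertible_swap[rotated]) (use k0 m in simp)
    then show "invertible_elt (star z * z + of_real \<kappa> + of_real m)" by (simp add: add.assoc)
  qed (simp add: star_add star_mult)
  then have "norm (star z * z) \<le> \<kappa>"
    using norm_le_of_pos[of \<kappa> "star z * z"] upper k0 by (simp add: add.commute star_mult)
  moreover have "n * n * n = (l / 4) *\<^sub>R n - star z * z" unfolding zz by simp
  ultimately have n3_le: "norm (n * n * n) \<le> 2 * \<kappa>"
    using norm_triangle_ineq4[of "(l / 4) *\<^sub>R n" "star z * z"] l unfolding \<kappa>_def by simp
  have "norm (n * n) = (norm n)\<^sup>2" using cstar_norm[of n] sn by simp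
  moreover have "norm (n * n * (n * n)) = (norm (n * n))\<^sup>2" using cstar_norm[of "n * n"] sn by (simp add: star_mult)
  moreover have "norm (n * n * (n * n)) \<le> norm (n * n * n) * norm n"
    using norm_mult_ineq[of "n * n * n" n] by (simp add: mult.assoc)
  ultimately have "((norm n)\<^sup>2)\<^sup>2 \<le> norm (n * n * n) * norm n" by simp
  also have "\<dots> \<le> 2 * \<kappa> * norm n" using n3_le by (intro mult_right_mono) auto
  also have "\<dots> = d\<^sup>2 * (norm n)\<^sup>2" unfolding \<kappa>_def l_def by (simp add: power2_eq_square)
  finally have le: "((norm n)\<^sup>2)\<^sup>2 \<le> d\<^sup>2 * (norm n)\<^sup>2" .
  have "norm n \<le> d"
  proof (cases "norm n = 0")
    case False
    then have "(norm n)\<^sup>2 > 0" by simp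
    then have "(norm n)\<^sup>2 \<le> d\<^sup>2"
      using le unfolding power2_eq_square[of "(norm n)\<^sup>2"] by (rule mult_right_le_imp_le[rotated])
    then show ?thesis by (rule power2_le_imp_le) (use d in simp)
  qed (use d in simp)
  then have "pos ((of_real (norm n) - n) + of_real (d - norm n))"
    by (intro pos_add pos_norm_minus sn pos_of_real) simp
  then have "pos (p + (of_real d - n))" using pos_add[OF pp] by simp
  then show "pos (star y * y + d *\<^sub>R 1)"
    unfolding h_def[symmetric] h by (simp add: of_real_def algebra_simps)
qed

text \<open>From \<open>\<Sum> (b\<^sub>j - r c\<^sub>j\<^sup>*)\<^sup>* (b\<^sub>j - r c\<^sub>j\<^sup>*) \<ge> 0\<close> one gets \<open>\<Sum> b\<^sub>j\<^sup>* b\<^sub>j \<ge> 2 r - r\<^sup>2 \<Sum> c\<^sub>j c\<^sub>j\<^sup>*\<close>, and for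
  small \<open>r > 0\<close> the right hand side is at least \<open>r\<close>.\<close>

lemma sum_star_mult_invertible:
  fixes b c :: "nat \<Rightarrow> 'a :: star_banach_algebra"
  assumes "(\<Sum>j<M. c j * b j) = 1"
  shows "invertible_elt (\<Sum>j<M. star (b j) * b j)"
proof -
  define C where "C = norm (\<Sum>j<M. c j * star (c j)) + 1"
  have C: "C > 0" unfolding C_def by (simp add: add_nonneg_pos)
  define r where "r = 1 / C"
  have r: "r > 0" using C unfolding r_def by simp
  let ?h = "\<Sum>j<M. star (b j) * b j" and ?K = "\<Sum>j<M. c j * star (c j)"
  have one: "(\<Sum>j<M. star (b j) * star (c j)) = 1"
    using arg_cong[OF assms, of star] by (simp add: star_sum star_mult)
  have "pos (\<Sum>j<M. star (b j - r *\<^sub>R star (c j)) * (b j - r *\<^sub>R star (c j)))"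
    by (intro pos_sum pos_star_mult)
  also have "(\<Sum>j<M. star (b j - r *\<^sub>R star (c j)) * (b j - r *\<^sub>R star (c j))) =
      (\<Sum>j<M. star (b j) * b j - r *\<^sub>R (star (b j) * star (c j)) - r *\<^sub>R (c j * b j) + r\<^sup>2 *\<^sub>R (c j * star (c j)))"
    by (intro sum.cong refl) (simp add: star_diff star_scaleR algebra_simps power2_eq_square)
  also have "\<dots> = ?h - r *\<^sub>R 1 - r *\<^sub>R 1 + r\<^sup>2 *\<^sub>R ?K"
    by (simp add: sum.distrib sum_subtractf one assms flip: scaleR_sum_right)
  finally have p1: "pos (?h - r *\<^sub>R 1 - r *\<^sub>R 1 + r\<^sup>2 *\<^sub>R ?K)" .
  have "pos (r\<^sup>2 *\<^sub>R ((of_real (norm ?K) - ?K) + of_real 1))"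
    by (intro pos_scaleR pos_add pos_norm_minus pos_of_real) (auto simp: star_sum star_mult)
  moreover have "r\<^sup>2 *\<^sub>R ((of_real (norm ?K) - ?K) + of_real 1) = r *\<^sub>R 1 - r\<^sup>2 *\<^sub>R ?K"
  proof -
    have "r\<^sup>2 * C = r" unfolding r_def using C by (simp add: power2_eq_square)
    then have "r\<^sup>2 * norm ?K + r\<^sup>2 = r" unfolding C_def by (simp add: algebra_simps)
    then have "(r\<^sup>2 * norm ?K) *\<^sub>R 1 + r\<^sup>2 *\<^sub>R 1 = r *\<^sub>R (1::'a)" by (simp flip: scaleR_add_left)
    then show ?thesis by (simp add: of_real_def algebra_simps)
  qed
  ultimately have p2: "pos (r *\<^sub>R 1 - r\<^sup>2 *\<^sub>R ?K)" by simp
  have "pos (?h - r *\<^sub>R 1)" using pos_add[OF p1 p2] by simp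
  then show ?thesis using pos_shift_invertible[of "?h - r *\<^sub>R 1" r] r by (simp add: of_real_def)
qed

section \<open>One C*-algebra that contains all unital ones on a given type\<close>

context star_algebra
begin

lemma zero_add: "x \<in> carrier A \<Longrightarrow> \<zero> \<oplus> x = x"
  using add_commute add_zero zero_closed by metis

lemma smult_0: assumes x: "x \<in> carrier A" shows "0 \<odot> x = \<zero>"
proof -
  have c: "0 \<odot> x \<in> carrier A" using x by (rule smult_closed)
  obtain y where y: "y \<in> carrier A" "0 \<odot> x \<oplus> y = \<zero>" using add_inverse[OF c] by blast
  have "0 \<odot> x \<oplus> 0 \<odot> x = 0 \<odot> x" using add_smult[OF x, of 0 0] by simp
  then have "(0 \<odot> x \<oplus> 0 \<odot> x) \<oplus> y = 0 \<odot> x \<oplus> y" by simp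
  then show ?thesis using add_assoc[OF c c y(1)] y add_zero[OF c] by simp
qed

lemma smult_zero: "c \<odot> \<zero> = \<zero>"
  using smult_0[OF zero_closed] smult_smult[OF zero_closed, of c 0] by simp

lemma add_neg: "x \<in> carrier A \<Longrightarrow> x \<oplus> (-1) \<odot> x = \<zero>"
  using add_smult[of x 1 "-1"] smult_one smult_0 by simp

lemma diff_closed: "x \<in> carrier A \<Longrightarrow> y \<in> carrier A \<Longrightarrow> x \<ominus> y \<in> carrier A"
  unfolding diff_def by (intro add_closed smult_closed)

lemma fin_sum_closed: "(\<And>i. i < n \<Longrightarrow> f i \<in> carrier A) \<Longrightarrow> fin_sum A f n \<in> carrier A"
  by (induction n) (auto intro: zero_closed add_closed)

lemma diff_add_diff:
  assumes "x \<in> carrier A" "y \<in> carrier A" "z \<in> carrier A"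
  shows "(x \<ominus> y) \<oplus> (y \<ominus> z) = x \<ominus> z"
proof -
  have cl: "(-1) \<odot> y \<in> carrier A" "(-1) \<odot> z \<in> carrier A" "y \<oplus> (-1) \<odot> z \<in> carrier A"
    using assms by (auto intro: add_closed smult_closed)
  have "(x \<oplus> (-1) \<odot> y) \<oplus> (y \<oplus> (-1) \<odot> z) = x \<oplus> ((-1) \<odot> y \<oplus> (y \<oplus> (-1) \<odot> z))"
    using assms cl by (intro add_assoc)
  also have "(-1) \<odot> y \<oplus> (y \<oplus> (-1) \<odot> z) = ((-1) \<odot> y \<oplus> y) \<oplus> (-1) \<odot> z"
    using add_assoc[OF cl(1) assms(2) cl(2)] by simp
  also have "(-1) \<odot> y \<oplus> y = \<zero>" using add_commute[OF cl(1) assms(2)] add_neg[OF assms(2)] by simp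
  finally show ?thesis unfolding diff_def using zero_add[OF cl(2)] by simp
qed

lemma diff_swap:
  assumes "x \<in> carrier A" "y \<in> carrier A"
  shows "y \<ominus> x = (-1) \<odot> (x \<ominus> y)"
  unfolding diff_def using assms
  by (simp add: smult_add smult_smult smult_closed smult_one add_commute)

end

context cstar_algebra
begin

lemma norm_zero: "cnorm A \<zero> = 0" using norm_eq_zero zero_closed by blast

lemma norm_diff_swap:
  assumes "x \<in> carrier A" "y \<in> carrier A"
  shows "cnorm A (y \<ominus> x) = cnorm A (x \<ominus> y)"
  using diff_swap[OF assms] norm_smult[of "x \<ominus> y" "-1"] diff_closed[OF assms] by simp

lemma norm_diff_triangle:
  assumes "x \<in> carrier A" "y \<in> carrier A" "z \<in> carrier A"
  shows "cnorm A (x \<ominus> z) \<le> cnorm A (x \<ominus> y) + cnorm A (y \<ominus> z)"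
  using diff_add_diff[OF assms] norm_triangle diff_closed assms by metis

lemma norm_adj:
  assumes "x \<in> carrier A"
  shows "cnorm A (adj A x) = cnorm A x"
proof -
  have le: "cnorm A y \<le> cnorm A (adj A y)" if y: "y \<in> carrier A" for y
  proof (cases "cnorm A y = 0")
    case False
    have "(cnorm A y)\<^sup>2 \<le> cnorm A (adj A y) * cnorm A y"
      using cstar_identity[OF y] norm_mult[OF adj_closed[OF y] y] by simp
    then show ?thesis using False norm_nonneg[OF y] by (simp add: power2_eq_square mult_le_cancel_right)
  qed (simp add: norm_nonneg adj_closed y)
  show ?thesis using le[OF assms] le[OF adj_closed[OF assms]] adj_adj[OF assms] by simp
qed

lemma norm_unit_le:
  assumes "is_unit_of A e"
  shows "adj A e = e" "cnorm A e \<le> 1"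
proof -
  have e: "e \<in> carrier A" "adj A e \<in> carrier A" using assms adj_closed unfolding is_unit_of_def by blast+
  have "e \<otimes> adj A e = adj A e" using assms e unfolding is_unit_of_def by blast
  then have "adj A (e \<otimes> adj A e) = e" using e by (simp add: adj_adj)
  then have "e \<otimes> adj A e = e" using e adj_mult[of e "adj A e"] by (simp add: adj_adj)
  then show 1: "adj A e = e" using assms e unfolding is_unit_of_def by metis
  have "e \<otimes> e = e" using assms e unfolding is_unit_of_def by blast
  then have "(cnorm A e)\<^sup>2 = cnorm A e" using cstar_identity[OF e(1)] 1 by simp
  then have "cnorm A e = 0 \<or> cnorm A e = 1" by (simp add: power2_eq_square)
  then show "cnorm A e \<le> 1" by auto
qed

end

lemma unit_unique: "is_unit_of A e \<Longrightarrow> is_unit_of A f \<Longrightarrow> e = f"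
  unfolding is_unit_of_def by metis

subsection \<open>Algebras of fields\<close>

lemma field_algebra_simps [simp]:
  "carrier (field_algebra T G S) = S"
  "zero (field_algebra T G S) = (\<lambda>t\<in>T. zero (G t))"
  "add (field_algebra T G S) a b = (\<lambda>t\<in>T. add (G t) (a t) (b t))"
  "smult (field_algebra T G S) c a = (\<lambda>t\<in>T. smult (G t) c (a t))"
  "mult (field_algebra T G S) a b = (\<lambda>t\<in>T. mult (G t) (a t) (b t))"
  "adj (field_algebra T G S) a = (\<lambda>t\<in>T. adj (G t) (a t))"
  "cnorm (field_algebra T G S) a = (SUP t\<in>T. cnorm (G t) (a t))"
  by (simp_all add: field_algebra_def)

lemma field_algebra_diff [simp]:
  "diff (field_algebra T G S) a b = (\<lambda>t\<in>T. diff (G t) (a t) (b t))"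
  by (auto simp: diff_def)

text \<open>The algebraic laws hold pointwise; only closure of the set \<open>S\<close> of fields has to be known.\<close>

lemma star_algebra_fields:
  assumes fib: "\<And>t. t \<in> T \<Longrightarrow> star_algebra (G t)"
    and sub: "S \<subseteq> (\<Pi>\<^sub>E t\<in>T. carrier (G t))"
    and "(\<lambda>t\<in>T. zero (G t)) \<in> S"
    and "\<And>a b. a \<in> S \<Longrightarrow> b \<in> S \<Longrightarrow> (\<lambda>t\<in>T. add (G t) (a t) (b t)) \<in> S"
    and "\<And>c a. a \<in> S \<Longrightarrow> (\<lambda>t\<in>T. smult (G t) c (a t)) \<in> S"
    and "\<And>a b. a \<in> S \<Longrightarrow> b \<in> S \<Longrightarrow> (\<lambda>t\<in>T. mult (G t) (a t) (b t)) \<in> S"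
    and "\<And>a. a \<in> S \<Longrightarrow> (\<lambda>t\<in>T. adj (G t) (a t)) \<in> S"
  shows "star_algebra (field_algebra T G S)"
proof -
  have mem: "a t \<in> carrier (G t)" if "a \<in> S" "t \<in> T" for a t using that sub by blast
  have ext: "(\<lambda>t\<in>T. a t) = a" if "a \<in> S" for a
    using that sub by (auto simp: PiE_def extensional_restrict)
  note ax = star_algebra.add_assoc[OF fib] star_algebra.add_zero[OF fib]
    star_algebra.smult_add[OF fib] star_algebra.add_smult[OF fib] star_algebra.smult_smult[OF fib]
    star_algebra.smult_one[OF fib] star_algebra.mult_assoc[OF fib] star_algebra.mult_add[OF fib]
    star_algebra.add_mult[OF fib] star_algebra.smult_mult[OF fib] star_algebra.mult_smult[OF fib]
    star_algebra.adj_adj[OF fib] star_algebra.adj_add[OF fib] star_algebra.adj_smult[OF fib]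
    star_algebra.adj_mult[OF fib]
  have out: "a t = undefined" if "a \<in> S" "t \<notin> T" for a t using that sub by auto
  have inv: "\<exists>b\<in>S. (\<lambda>t\<in>T. add (G t) (a t) (b t)) = (\<lambda>t\<in>T. zero (G t))" if a: "a \<in> S" for a
    by (rule bexI[of _ "\<lambda>t\<in>T. smult (G t) (-1) (a t)"])
       (auto simp: fun_eq_iff star_algebra.add_neg[OF fib] mem[OF a] assms(5)[OF a])
  show ?thesis
  proof unfold_locales
    fix x y assume "x \<in> carrier (field_algebra T G S)" "y \<in> carrier (field_algebra T G S)"
    then show "x \<oplus>\<^bsub>field_algebra T G S\<^esub> y = y \<oplus>\<^bsub>field_algebra T G S\<^esub> x"
      by (auto intro!: restrict_ext star_algebra.add_commute[OF fib] mem)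
  qed (simp_all only: field_algebra_simps assms(3-7) inv,
      (simp add: fun_eq_iff ax mem out)+)
qed

definition bounded_fields :: "'x set \<Rightarrow> ('x \<Rightarrow> 'b cstar) \<Rightarrow> ('x \<Rightarrow> 'b) set"
  where "bounded_fields T G =
    {a \<in> \<Pi>\<^sub>E t\<in>T. carrier (G t). \<exists>r. \<forall>t\<in>T. cnorm (G t) (a t) \<le> r}"

context
  fixes T :: "'x set" and G :: "'x \<Rightarrow> 'b cstar" and S :: "('x \<Rightarrow> 'b) set"
  assumes ne: "T \<noteq> {}"
    and fib: "\<And>t. t \<in> T \<Longrightarrow> cstar_algebra (G t)"
    and bd: "S \<subseteq> bounded_fields T G"
begin

lemma fields_mem: "a \<in> S \<Longrightarrow> t \<in> T \<Longrightarrow> a t \<in> carrier (G t)"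
  using bd unfolding bounded_fields_def by blast

lemma fields_norm_ge:
  assumes "a \<in> S" "t \<in> T"
  shows "cnorm (G t) (a t) \<le> (SUP t\<in>T. cnorm (G t) (a t))"
proof -
  obtain r where "\<forall>t\<in>T. cnorm (G t) (a t) \<le> r" using assms bd unfolding bounded_fields_def by blast
  then show ?thesis using assms(2) by (intro cSUP_upper) (auto intro!: bdd_aboveI[of _ r])
qed

lemma fields_norm_le:
  assumes "\<And>t. t \<in> T \<Longrightarrow> cnorm (G t) (a t) \<le> r"
  shows "(SUP t\<in>T. cnorm (G t) (a t)) \<le> r"
  using ne assms by (rule cSUP_least)

text \<open>A Cauchy sequence of fields converges uniformly to its pointwise limit, so completeness
  comes down to \<open>S\<close> being closed under uniform limits.\<close>

lemma norm_complete_fields: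
  assumes star: "star_algebra (field_algebra T G S)"
    and lim: "\<And>c. c \<in> (\<Pi>\<^sub>E t\<in>T. carrier (G t)) \<Longrightarrow>
      (\<And>\<epsilon>. \<epsilon> > 0 \<Longrightarrow> \<exists>a\<in>S. \<forall>t\<in>T. cnorm (G t) (a t \<ominus>\<^bsub>G t\<^esub> c t) \<le> \<epsilon>) \<Longrightarrow> c \<in> S"
  shows "norm_complete (field_algebra T G S)"
  unfolding norm_complete_def
proof (intro allI impI)
  fix f :: "nat \<Rightarrow> 'x \<Rightarrow> 'b"
  let ?P = "field_algebra T G S"
  assume "(\<forall>n. f n \<in> carrier ?P) \<and>
    (\<forall>\<epsilon>>0. \<exists>N. \<forall>m\<ge>N. \<forall>n\<ge>N. cnorm ?P (f m \<ominus>\<^bsub>?P\<^esub> f n) < \<epsilon>)"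
  then have f: "\<And>n. f n \<in> S"
    and cau: "\<And>\<epsilon>. \<epsilon> > 0 \<Longrightarrow> \<exists>N. \<forall>m\<ge>N. \<forall>n\<ge>N. cnorm ?P (f m \<ominus>\<^bsub>?P\<^esub> f n) < \<epsilon>" by auto
  have fm: "f n t \<in> carrier (G t)" if "t \<in> T" for n t using fields_mem[OF f that] .
  have cl: "(f m \<ominus>\<^bsub>?P\<^esub> f n) \<in> S" for m n
    using star_algebra.diff_closed[OF star] f by simp
  have pt: "cnorm (G t) (f m t \<ominus>\<^bsub>G t\<^esub> f n t) \<le> cnorm ?P (f m \<ominus>\<^bsub>?P\<^esub> f n)" if "t \<in> T" for m n t
    using fields_norm_ge[OF cl[of m n] that] that by simp
  have "\<exists>x\<in>carrier (G t). (\<lambda>n. cnorm (G t) (f n t \<ominus>\<^bsub>G t\<^esub> x)) \<longlonglongrightarrow> 0" if t: "t \<in> T" for t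
  proof -
    interpret cstar_algebra "G t" using fib[OF t] .
    have "\<exists>N. \<forall>m\<ge>N. \<forall>n\<ge>N. cnorm (G t) (f m t \<ominus>\<^bsub>G t\<^esub> f n t) < e" if "e > 0" for e
      using cau[OF that] pt[OF t] by (meson le_less_trans)
    then show ?thesis using fm[OF t]
      by (intro complete[unfolded norm_complete_def, rule_format, of "\<lambda>n. f n t"]) auto
  qed
  then obtain c0 where c0: "\<And>t. t \<in> T \<Longrightarrow> c0 t \<in> carrier (G t)"
    "\<And>t. t \<in> T \<Longrightarrow> (\<lambda>n. cnorm (G t) (f n t \<ominus>\<^bsub>G t\<^esub> c0 t)) \<longlonglongrightarrow> 0" by metis
  define c where "c = restrict c0 T"
  have cm: "c \<in> (\<Pi>\<^sub>E t\<in>T. carrier (G t))" unfolding c_def using c0(1) by auto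
  have unif: "\<exists>N. \<forall>n\<ge>N. \<forall>t\<in>T. cnorm (G t) (f n t \<ominus>\<^bsub>G t\<^esub> c t) \<le> e" if e: "e > 0" for e
  proof -
    obtain N where N: "\<And>m n. m \<ge> N \<Longrightarrow> n \<ge> N \<Longrightarrow> cnorm ?P (f m \<ominus>\<^bsub>?P\<^esub> f n) < e / 2"
      using cau[of "e/2"] e by auto
    have "cnorm (G t) (f n t \<ominus>\<^bsub>G t\<^esub> c t) \<le> e" if n: "n \<ge> N" and t: "t \<in> T" for n t
    proof -
      interpret cstar_algebra "G t" using fib[OF t] .
      have "eventually (\<lambda>m. cnorm (G t) (f m t \<ominus>\<^bsub>G t\<^esub> c0 t) < e / 2) sequentially"
        using order_tendstoD(2)[OF c0(2)[OF t], of "e/2"] e by simp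
      then obtain m where m: "m \<ge> N" "cnorm (G t) (f m t \<ominus>\<^bsub>G t\<^esub> c0 t) < e / 2"
        unfolding eventually_sequentially by (meson nle_le order_refl)
      have "cnorm (G t) (f n t \<ominus>\<^bsub>G t\<^esub> c0 t) \<le>
          cnorm (G t) (f n t \<ominus>\<^bsub>G t\<^esub> f m t) + cnorm (G t) (f m t \<ominus>\<^bsub>G t\<^esub> c0 t)"
        using fm[OF t] c0(1)[OF t] by (intro norm_diff_triangle)
      also have "\<dots> \<le> e" using m(2) N[OF n m(1)] pt[OF t, of n m] by linarith
      finally show ?thesis using t by (simp add: c_def)
    qed
    then show ?thesis by blast
  qed
  have cS: "c \<in> S" by (rule lim[OF cm]) (use unif f in blast)
  have "(\<lambda>n. cnorm ?P (f n \<ominus>\<^bsub>?P\<^esub> c)) \<longlonglongrightarrow> 0"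
  proof (rule LIMSEQ_I)
    fix e :: real assume e: "e > 0"
    obtain N where N: "\<And>n t. n \<ge> N \<Longrightarrow> t \<in> T \<Longrightarrow> cnorm (G t) (f n t \<ominus>\<^bsub>G t\<^esub> c t) \<le> e / 2"
      using unif[of "e/2"] e by auto
    have "norm (cnorm ?P (f n \<ominus>\<^bsub>?P\<^esub> c) - 0) < e" if n: "n \<ge> N" for n
    proof -
      have d: "(f n \<ominus>\<^bsub>?P\<^esub> c) \<in> S" using star_algebra.diff_closed[OF star] f cS by simp
      obtain t where t: "t \<in> T" using ne by blast
      have "0 \<le> cnorm (G t) ((f n \<ominus>\<^bsub>?P\<^esub> c) t)"
        using cstar_algebra.norm_nonneg[OF fib[OF t]] fields_mem[OF d t] .
      also have "\<dots> \<le> cnorm ?P (f n \<ominus>\<^bsub>?P\<^esub> c)" using fields_norm_ge[OF d t] by simp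
      finally have "0 \<le> cnorm ?P (f n \<ominus>\<^bsub>?P\<^esub> c)" .
      moreover have "cnorm ?P (f n \<ominus>\<^bsub>?P\<^esub> c) \<le> e / 2"
        using fields_norm_le[of "f n \<ominus>\<^bsub>?P\<^esub> c" "e/2"] N[OF n] by simp
      ultimately show ?thesis using e by simp
    qed
    then show "\<exists>N. \<forall>n\<ge>N. norm (cnorm ?P (f n \<ominus>\<^bsub>?P\<^esub> c) - 0) < e" by blast
  qed
  then show "\<exists>x\<in>carrier ?P. (\<lambda>n. cnorm ?P (f n \<ominus>\<^bsub>?P\<^esub> x)) \<longlonglongrightarrow> 0" using cS by auto
qed

end

subsection \<open>The product of all unital C*-algebras\<close>

text \<open>With the summand \<open>\<complex>\<close> the unit of each factor of the product below has norm 1, even if the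
  algebra \<open>A\<close> is zero.\<close>

definition plus_complex :: "'b cstar \<Rightarrow> ('b \<times> complex) cstar"
  where "plus_complex A = \<lparr>
    carrier = carrier A \<times> UNIV,
    zero = (\<zero>\<^bsub>A\<^esub>, 0),
    add = (\<lambda>(a, p) (b, q). (a \<oplus>\<^bsub>A\<^esub> b, p + q)),
    smult = (\<lambda>c (a, p). (c \<odot>\<^bsub>A\<^esub> a, c * p)),
    mult = (\<lambda>(a, p) (b, q). (a \<otimes>\<^bsub>A\<^esub> b, p * q)),
    adj = (\<lambda>(a, p). (adj A a, cnj p)),
    cnorm = (\<lambda>(a, p). max (cnorm A a) (cmod p)) \<rparr>"

lemma plus_complex_simps [simp]:
  "carrier (plus_complex A) = carrier A \<times> UNIV"
  "zero (plus_complex A) = (zero A, 0)"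
  "add (plus_complex A) (a, p) (b, q) = (add A a b, p + q)"
  "smult (plus_complex A) c (a, p) = (smult A c a, c * p)"
  "mult (plus_complex A) (a, p) (b, q) = (mult A a b, p * q)"
  "adj (plus_complex A) (a, p) = (adj A a, cnj p)"
  "cnorm (plus_complex A) (a, p) = max (cnorm A a) (cmod p)"
  by (simp_all add: plus_complex_def)

lemma plus_complex_diff [simp]:
  "diff (plus_complex A) (a, p) (b, q) = (diff A a b, p - q)"
  by (simp add: diff_def)

lemma cstar_plus_complex:
  assumes "cstar_algebra A"
  shows "cstar_algebra (plus_complex A)"
proof -
  interpret A: cstar_algebra A by (rule assms)
  let ?B = "plus_complex A"
  have star: "star_algebra ?B"
  proof unfold_locales
    fix x assume "x \<in> carrier ?B"
    then show "\<exists>y\<in>carrier ?B. x \<oplus>\<^bsub>?B\<^esub> y = \<zero>\<^bsub>?B\<^esub>"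
      by (intro bexI[of _ "(-1) \<odot>\<^bsub>?B\<^esub> x"]) (auto simp: A.add_neg A.smult_closed)
  next
    fix x y assume "x \<in> carrier ?B" "y \<in> carrier ?B"
    then show "x \<oplus>\<^bsub>?B\<^esub> y = y \<oplus>\<^bsub>?B\<^esub> x" by (auto intro: A.add_commute)
  qed (auto simp: A.zero_closed A.add_closed A.smult_closed A.mult_closed A.adj_closed
      A.add_assoc A.add_zero A.smult_add A.add_smult A.smult_smult A.smult_one A.mult_assoc
      A.mult_add A.add_mult A.smult_mult A.mult_smult A.adj_adj A.adj_add A.adj_smult A.adj_mult
      algebra_simps)
  have "norm_complete ?B"
    unfolding norm_complete_def
  proof (intro allI impI)
    fix f :: "nat \<Rightarrow> 'a \<times> complex"
    assume f: "(\<forall>n. f n \<in> carrier ?B) \<and>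
      (\<forall>\<epsilon>>0. \<exists>N. \<forall>m\<ge>N. \<forall>n\<ge>N. cnorm ?B (f m \<ominus>\<^bsub>?B\<^esub> f n) < \<epsilon>)"
    obtain g h where fe: "\<And>n. f n = (g n, h n)" by (rule that[of "\<lambda>n. fst (f n)" "\<lambda>n. snd (f n)"]) simp
    have g: "g n \<in> carrier A" for n using f[THEN conjunct1, rule_format, of n] fe[of n] by simp
    have cau: "\<exists>N. \<forall>m\<ge>N. \<forall>n\<ge>N. cnorm A (g m \<ominus>\<^bsub>A\<^esub> g n) < \<epsilon> \<and> cmod (h m - h n) < \<epsilon>"
      if "\<epsilon> > 0" for \<epsilon> using f that by (simp add: fe)
    have "\<exists>N. \<forall>m\<ge>N. \<forall>n\<ge>N. cnorm A (g m \<ominus>\<^bsub>A\<^esub> g n) < \<epsilon>" if "\<epsilon> > 0" for \<epsilon>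
      using cau[OF that] by meson
    then have "(\<forall>n. g n \<in> carrier A) \<and>
        (\<forall>\<epsilon>>0. \<exists>N. \<forall>m\<ge>N. \<forall>n\<ge>N. cnorm A (g m \<ominus>\<^bsub>A\<^esub> g n) < \<epsilon>)" using g by simp
    then obtain x where x: "x \<in> carrier A" "(\<lambda>n. cnorm A (g n \<ominus>\<^bsub>A\<^esub> x)) \<longlonglongrightarrow> 0"
      using spec[OF A.complete[unfolded norm_complete_def], of g] by auto
    have "\<exists>N. \<forall>m\<ge>N. \<forall>n\<ge>N. cmod (h m - h n) < \<epsilon>" if "\<epsilon> > 0" for \<epsilon>
      using cau[OF that] by meson
    then have "Cauchy h" unfolding Cauchy_def dist_norm by simp
    then obtain p where p: "h \<longlonglongrightarrow> p" using Cauchy_convergent convergentD by blast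
    then have "(\<lambda>n. cmod (h n - p)) \<longlonglongrightarrow> 0" using LIM_zero tendsto_norm_zero by blast
    from tendsto_max[OF x(2) this]
    show "\<exists>x\<in>carrier ?B. (\<lambda>n. cnorm ?B (f n \<ominus>\<^bsub>?B\<^esub> x)) \<longlonglongrightarrow> 0"
      using x(1) by (intro bexI[of _ "(x, p)"]) (auto simp: fe)
  qed
  then show ?thesis
  proof (intro cstar_algebra.intro star cstar_algebra_axioms.intro)
    fix x assume x: "x \<in> carrier ?B"
    show "cnorm ?B (adj ?B x \<otimes>\<^bsub>?B\<^esub> x) = (cnorm ?B x)\<^sup>2"
    proof -
      obtain a p where ap: "x = (a, p)" by fastforce
      then have a: "cnorm A a \<ge> 0" "a \<in> carrier A" using x A.norm_nonneg by auto
      have "max ((cnorm A a)\<^sup>2) ((cmod p)\<^sup>2) = (max (cnorm A a) (cmod p))\<^sup>2"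
        using a(1) by (cases "cnorm A a \<le> cmod p") (simp_all add: max_absorb1 max_absorb2 power_mono)
      then show ?thesis
        unfolding ap by (simp add: A.cstar_identity[OF a(2)] norm_mult power2_eq_square)
    qed
    show "cnorm ?B x = 0 \<longleftrightarrow> x = \<zero>\<^bsub>?B\<^esub>"
    proof -
      obtain a p where ap: "x = (a, p)" by fastforce
      then have "cnorm A a \<ge> 0" "a \<in> carrier A" using x A.norm_nonneg by auto
      then have "max (cnorm A a) (cmod p) = 0 \<longleftrightarrow> cnorm A a = 0 \<and> cmod p = 0"
        using norm_ge_zero[of p] by linarith
      then show ?thesis using ap A.norm_eq_zero[OF \<open>a \<in> carrier A\<close>] by simp
    qed
    fix c show "cnorm ?B (c \<odot>\<^bsub>?B\<^esub> x) = cmod c * cnorm ?B x"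
      using x by (auto simp: A.norm_smult norm_mult max_mult_distrib_left)
    fix y assume y: "y \<in> carrier ?B"
    obtain a p b q where xy: "x = (a, p)" "y = (b, q)" by fastforce
    then have ab: "a \<in> carrier A" "b \<in> carrier A" "0 \<le> cnorm A a" "0 \<le> cnorm A b"
      using x y A.norm_nonneg by auto
    show "cnorm ?B (x \<oplus>\<^bsub>?B\<^esub> y) \<le> cnorm ?B x + cnorm ?B y"
      using A.norm_triangle[OF ab(1,2)] norm_triangle_ineq[of p q] unfolding xy by (auto simp: max_def)
    have "cnorm A a * cnorm A b \<le> max (cnorm A a) (cmod p) * max (cnorm A b) (cmod q)"
      "cmod p * cmod q \<le> max (cnorm A a) (cmod p) * max (cnorm A b) (cmod q)"
      using ab by (auto intro!: mult_mono simp: le_max_iff_disj)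
    then show "cnorm ?B (x \<otimes>\<^bsub>?B\<^esub> y) \<le> cnorm ?B x * cnorm ?B y"
      using A.norm_mult[OF ab(1,2)] unfolding xy by (simp add: norm_mult)
  qed (auto simp: A.norm_nonneg le_max_iff_disj)
qed

definition zero_cstar :: "'b cstar"
  where "zero_cstar = \<lparr> carrier = {undefined}, zero = undefined, add = (\<lambda>_ _. undefined),
    smult = (\<lambda>_ _. undefined), mult = (\<lambda>_ _. undefined), adj = (\<lambda>_. undefined), cnorm = (\<lambda>_. 0) \<rparr>"

lemma zero_cstar: "cstar_algebra (zero_cstar :: 'b cstar)" "unital (zero_cstar :: 'b cstar)"
proof -
  have "norm_complete (zero_cstar :: 'b cstar)"
    by (auto simp: norm_complete_def zero_cstar_def)
  then show "cstar_algebra (zero_cstar :: 'b cstar)"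
    by (unfold_locales) (auto simp: zero_cstar_def)
  show "unital (zero_cstar :: 'b cstar)"
    by (auto simp: unital_def is_unit_of_def zero_cstar_def)
qed

definition unital_cstar :: "'b cstar \<Rightarrow> bool"
  where "unital_cstar A \<longleftrightarrow> cstar_algebra A \<and> unital A"

definition one_of :: "'b cstar \<Rightarrow> 'b"
  where "one_of A = (SOME e. is_unit_of A e)"

lemma one_of: "unital A \<Longrightarrow> is_unit_of A (one_of A)"
  unfolding unital_def one_of_def by (rule someI_ex)

text \<open>The product below runs over all records of type \<open>'b cstar\<close>. Those that are not unital
  C*-algebras contribute a zero algebra.\<close>

definition factor :: "'b cstar \<Rightarrow> 'b cstar"
  where "factor A = (if unital_cstar A then A else zero_cstar)"

lemma unital_cstar_factor: "unital_cstar (factor A)"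
  by (simp add: factor_def unital_cstar_def zero_cstar)

definition product_cstar :: "('b cstar \<Rightarrow> 'b \<times> complex) cstar"
  where "product_cstar = field_algebra UNIV (\<lambda>A. plus_complex (factor A))
    (bounded_fields UNIV (\<lambda>A. plus_complex (factor A)))"

lemma cstar_factor: "cstar_algebra (plus_complex (factor A))"
  using unital_cstar_factor by (auto intro: cstar_plus_complex simp: unital_cstar_def)

lemma product_carrier:
  "f \<in> carrier product_cstar \<longleftrightarrow>
    (\<forall>A. f A \<in> carrier (plus_complex (factor A))) \<and> (\<exists>r. \<forall>A. cnorm (plus_complex (factor A)) (f A) \<le> r)"
  by (auto simp: product_cstar_def bounded_fields_def)

lemma product_norm_le:
  "(\<And>A. cnorm (plus_complex (factor A)) (f A) \<le> r) \<Longrightarrow> cnorm product_cstar f \<le> r"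
  unfolding product_cstar_def by (simp add: cSUP_least)

lemma product_norm_ge:
  assumes "f \<in> carrier product_cstar"
  shows "cnorm (plus_complex (factor A)) (f A) \<le> cnorm product_cstar f"
  using assms unfolding product_cstar_def field_algebra_simps
  by (intro fields_norm_ge[OF _ cstar_factor order_refl]) auto

lemma product_simps:
  "zero product_cstar A = zero (plus_complex (factor A))"
  "add product_cstar f g A = add (plus_complex (factor A)) (f A) (g A)"
  "smult product_cstar c f A = smult (plus_complex (factor A)) c (f A)"
  "mult product_cstar f g A = mult (plus_complex (factor A)) (f A) (g A)"
  "adj product_cstar f A = adj (plus_complex (factor A)) (f A)"
  "diff product_cstar f g A = diff (plus_complex (factor A)) (f A) (g A)"
  by (simp_all add: product_cstar_def)

lemma cstar_product: "cstar_algebra (product_cstar :: ('b cstar \<Rightarrow> 'b \<times> complex) cstar)"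
proof -
  let ?G = "\<lambda>A :: 'b cstar. plus_complex (factor A)"
  let ?S = "bounded_fields UNIV ?G"
  let ?P = "product_cstar :: ('b cstar \<Rightarrow> 'b \<times> complex) cstar"
  note ca = cstar_factor
  note sa = cstar_algebra.axioms(1)[OF cstar_factor]
  have bI: "f \<in> ?S" if "\<And>A. f A \<in> carrier (?G A)" "\<And>A. cnorm (?G A) (f A) \<le> r" for f r
    using that unfolding bounded_fields_def by auto
  have bE: "\<exists>r. (\<forall>A. cnorm (?G A) (f A) \<le> r) \<and> r \<ge> 0" if "f \<in> ?S" for f
  proof -
    obtain r where "\<forall>A. cnorm (?G A) (f A) \<le> r" using \<open>f \<in> ?S\<close> unfolding bounded_fields_def by auto
    then show ?thesis by (intro exI[of _ "max r 0"]) (auto simp: le_max_iff_disj)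
  qed
  have m: "f A \<in> carrier (?G A)" if "f \<in> ?S" for f A using that unfolding bounded_fields_def by auto
  have star: "star_algebra (field_algebra UNIV ?G ?S)"
  proof (rule star_algebra_fields[OF sa])
    show "?S \<subseteq> (\<Pi>\<^sub>E A\<in>UNIV. carrier (?G A))" unfolding bounded_fields_def by blast
    show "(\<lambda>A\<in>UNIV. \<zero>\<^bsub>?G A\<^esub>) \<in> ?S"
      by (rule bI[of _ 0])
         (simp_all only: restrict_UNIV cstar_algebra.norm_zero[OF ca] star_algebra.zero_closed[OF sa] order_refl)
  next
    fix f g assume fg: "f \<in> ?S" "g \<in> ?S"
    obtain r s where r: "\<forall>A. cnorm (?G A) (f A) \<le> r" "r \<ge> 0" and s: "\<forall>A. cnorm (?G A) (g A) \<le> s"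
      using bE[OF fg(1)] bE[OF fg(2)] by blast
    have "cnorm (?G A) (f A \<oplus>\<^bsub>?G A\<^esub> g A) \<le> r + s" for A
      using cstar_algebra.norm_triangle[OF ca m[OF fg(1)] m[OF fg(2)], of A] r s
      by (meson add_mono order_trans)
    then show "(\<lambda>A\<in>UNIV. f A \<oplus>\<^bsub>?G A\<^esub> g A) \<in> ?S"
      unfolding restrict_UNIV by (rule bI[OF star_algebra.add_closed[OF sa m[OF fg(1)] m[OF fg(2)]]])
    have "cnorm (?G A) (f A \<otimes>\<^bsub>?G A\<^esub> g A) \<le> r * s" for A
    proof -
      have "cnorm (?G A) (f A) * cnorm (?G A) (g A) \<le> r * s"
        using r s cstar_algebra.norm_nonneg[OF ca m[OF fg(2)]] by (intro mult_mono) auto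
      then show ?thesis using cstar_algebra.norm_mult[OF ca m[OF fg(1)] m[OF fg(2)], of A] by linarith
    qed
    then show "(\<lambda>A\<in>UNIV. f A \<otimes>\<^bsub>?G A\<^esub> g A) \<in> ?S"
      unfolding restrict_UNIV by (rule bI[OF star_algebra.mult_closed[OF sa m[OF fg(1)] m[OF fg(2)]]])
  next
    fix f :: "'b cstar \<Rightarrow> 'b \<times> complex" and c assume f: "f \<in> ?S"
    obtain r where r: "\<forall>A. cnorm (?G A) (f A) \<le> r" using bE[OF f] by blast
    have "cnorm (?G A) (c \<odot>\<^bsub>?G A\<^esub> f A) \<le> cmod c * r" for A
      using r by (simp only: cstar_algebra.norm_smult[OF ca m[OF f]] mult_left_mono norm_ge_zero)
    then show "(\<lambda>A\<in>UNIV. c \<odot>\<^bsub>?G A\<^esub> f A) \<in> ?S"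
      unfolding restrict_UNIV by (rule bI[OF star_algebra.smult_closed[OF sa m[OF f]]])
  next
    fix f :: "'b cstar \<Rightarrow> 'b \<times> complex" assume f: "f \<in> ?S"
    obtain r where r: "\<forall>A. cnorm (?G A) (f A) \<le> r" using bE[OF f] by blast
    then have "cnorm (?G A) (adj (?G A) (f A)) \<le> r" for A
      by (simp only: cstar_algebra.norm_adj[OF ca m[OF f]])
    then show "(\<lambda>A\<in>UNIV. adj (?G A) (f A)) \<in> ?S"
      unfolding restrict_UNIV by (rule bI[OF star_algebra.adj_closed[OF sa m[OF f]]])
  qed
  have comp: "norm_complete (field_algebra UNIV ?G ?S)"
  proof (rule norm_complete_fields[OF _ ca _ star])
    fix c assume c: "c \<in> (\<Pi>\<^sub>E A\<in>UNIV. carrier (?G A))"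
      and ap: "\<And>\<epsilon>. \<epsilon> > 0 \<Longrightarrow> \<exists>a\<in>?S. \<forall>A\<in>UNIV. cnorm (?G A) (a A \<ominus>\<^bsub>?G A\<^esub> c A) \<le> \<epsilon>"
    have cm: "c A \<in> carrier (?G A)" for A using c by auto
    obtain a where a: "a \<in> ?S" "\<And>A. cnorm (?G A) (a A \<ominus>\<^bsub>?G A\<^esub> c A) \<le> 1" using ap[of 1] by auto
    obtain r where r: "\<And>A. cnorm (?G A) (a A) \<le> r" using bE[OF a(1)] by blast
    show "c \<in> ?S"
    proof (rule bI[OF cm])
      fix A
      interpret cstar_algebra "?G A" by (rule ca)
      have "cnorm (?G A) (c A \<ominus>\<^bsub>?G A\<^esub> \<zero>\<^bsub>?G A\<^esub>) \<le> cnorm (?G A) (c A \<ominus>\<^bsub>?G A\<^esub> a A) + cnorm (?G A) (a A \<ominus>\<^bsub>?G A\<^esub> \<zero>\<^bsub>?G A\<^esub>)"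
        by (rule norm_diff_triangle[OF cm m[OF a(1)] zero_closed])
      also have "cnorm (?G A) (c A \<ominus>\<^bsub>?G A\<^esub> a A) \<le> 1"
        using a(2)[of A] norm_diff_swap[OF cm m[OF a(1)]] by linarith
      also have "a A \<ominus>\<^bsub>?G A\<^esub> \<zero>\<^bsub>?G A\<^esub> = a A"
        unfolding diff_def smult_zero by (rule add_zero[OF m[OF a(1)]])
      also have "c A \<ominus>\<^bsub>?G A\<^esub> \<zero>\<^bsub>?G A\<^esub> = c A"
        unfolding diff_def smult_zero by (rule add_zero[OF cm])
      finally show "cnorm (?G A) (c A) \<le> 1 + r" using r[of A] by linarith
    qed
  qed auto
  have le: "cnorm ?P f \<le> r" if "\<And>A. cnorm (?G A) (f A) \<le> r" for f r using that by (rule product_norm_le)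
  have ge: "cnorm (?G A) (f A) \<le> cnorm ?P f" if "f \<in> carrier ?P" for f A
    using that by (rule product_norm_ge)
  have car: "f A \<in> carrier (?G A)" if "f \<in> carrier ?P" for f A
    using that unfolding product_carrier by blast
  have nn: "0 \<le> cnorm ?P f" if "f \<in> carrier ?P" for f
    using cstar_algebra.norm_nonneg[OF ca car[OF that]] ge[OF that] by (meson order_trans)
  have starP: "star_algebra ?P" using star unfolding product_cstar_def .
  show ?thesis
  proof (intro cstar_algebra.intro starP cstar_algebra_axioms.intro nn)
    show "norm_complete ?P" using comp unfolding product_cstar_def .
    fix f assume f: "f \<in> carrier ?P"
    show "cnorm ?P f = 0 \<longleftrightarrow> f = \<zero>\<^bsub>?P\<^esub>"
    proof
      assume "cnorm ?P f = 0"
      then have "cnorm (?G A) (f A) = 0" for A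
        using ge[OF f, of A] cstar_algebra.norm_nonneg[OF ca car[OF f], of A] by linarith
      then have "f A = \<zero>\<^bsub>?G A\<^esub>" for A using cstar_algebra.norm_eq_zero[OF ca car[OF f]] by blast
      then show "f = \<zero>\<^bsub>?P\<^esub>" by (simp add: fun_eq_iff product_simps del: plus_complex_simps)
    next
      assume z: "f = \<zero>\<^bsub>?P\<^esub>"
      have "cnorm ?P f \<le> 0" unfolding z
        by (rule le) (simp only: product_simps cstar_algebra.norm_zero[OF ca] order_refl)
      then show "cnorm ?P f = 0" using nn[OF f] by linarith
    qed
    fix c
    show "cnorm ?P (c \<odot>\<^bsub>?P\<^esub> f) = cmod c * cnorm ?P f"
    proof (rule antisym)
      show "cnorm ?P (c \<odot>\<^bsub>?P\<^esub> f) \<le> cmod c * cnorm ?P f"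
        by (rule le) (simp only: product_simps cstar_algebra.norm_smult[OF ca car[OF f]] mult_left_mono[OF ge[OF f]] norm_ge_zero)
      show "cmod c * cnorm ?P f \<le> cnorm ?P (c \<odot>\<^bsub>?P\<^esub> f)"
      proof (cases "c = 0")
        case False
        have cf: "c \<odot>\<^bsub>?P\<^esub> f \<in> carrier ?P" using star_algebra.smult_closed[OF starP f] .
        have "cnorm ?P f \<le> cnorm ?P (c \<odot>\<^bsub>?P\<^esub> f) / cmod c"
        proof (rule le)
          fix A
          have "cmod c * cnorm (?G A) (f A) \<le> cnorm ?P (c \<odot>\<^bsub>?P\<^esub> f)"
            using ge[OF cf, of A] by (simp only: product_simps cstar_algebra.norm_smult[OF ca car[OF f]])
          then show "cnorm (?G A) (f A) \<le> cnorm ?P (c \<odot>\<^bsub>?P\<^esub> f) / cmod c"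
            using False by (simp add: field_simps)
        qed
        then show ?thesis using False by (simp add: field_simps)
      qed (use nn[OF star_algebra.smult_closed[OF starP f]] in simp)
    qed
    show "cnorm ?P (adj ?P f \<otimes>\<^bsub>?P\<^esub> f) = (cnorm ?P f)\<^sup>2"
    proof (rule antisym)
      have pt: "cnorm (?G A) ((adj ?P f \<otimes>\<^bsub>?P\<^esub> f) A) = (cnorm (?G A) (f A))\<^sup>2" for A
        by (simp only: product_simps cstar_algebra.cstar_identity[OF ca car[OF f]])
      have n0: "0 \<le> cnorm (?G A) (f A)" for A using cstar_algebra.norm_nonneg[OF ca car[OF f]] .
      show "cnorm ?P (adj ?P f \<otimes>\<^bsub>?P\<^esub> f) \<le> (cnorm ?P f)\<^sup>2"
        by (rule le) (simp only: pt power_mono[OF ge[OF f] n0])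
      let ?h = "adj ?P f \<otimes>\<^bsub>?P\<^esub> f"
      have h: "?h \<in> carrier ?P"
        using star_algebra.mult_closed[OF starP] star_algebra.adj_closed[OF starP] f by blast
      have "cnorm ?P f \<le> sqrt (cnorm ?P ?h)"
        by (rule le) (use ge[OF h] pt in \<open>auto intro: real_le_rsqrt\<close>)
      then have "(cnorm ?P f)\<^sup>2 \<le> (sqrt (cnorm ?P ?h))\<^sup>2" using nn[OF f] by (rule power_mono)
      then show "(cnorm ?P f)\<^sup>2 \<le> cnorm ?P ?h" using nn[OF h] by simp
    qed
    fix g assume g: "g \<in> carrier ?P"
    show "cnorm ?P (f \<oplus>\<^bsub>?P\<^esub> g) \<le> cnorm ?P f + cnorm ?P g"
    proof (rule le)
      fix A show "cnorm (?G A) ((f \<oplus>\<^bsub>?P\<^esub> g) A) \<le> cnorm ?P f + cnorm ?P g"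
        unfolding product_simps
        using cstar_algebra.norm_triangle[OF ca car[OF f] car[OF g], of A] ge[OF f, of A] ge[OF g, of A]
        by linarith
    qed
    show "cnorm ?P (f \<otimes>\<^bsub>?P\<^esub> g) \<le> cnorm ?P f * cnorm ?P g"
    proof (rule le)
      fix A
      have "cnorm (?G A) (f A) * cnorm (?G A) (g A) \<le> cnorm ?P f * cnorm ?P g"
        by (intro mult_mono ge f g nn cstar_algebra.norm_nonneg[OF ca] car)
      then show "cnorm (?G A) ((f \<otimes>\<^bsub>?P\<^esub> g) A) \<le> cnorm ?P f * cnorm ?P g"
        unfolding product_simps
        using cstar_algebra.norm_mult[OF ca car[OF f] car[OF g], of A] by linarith
    qed
  qed
qed

interpretation product: cstar_algebra "product_cstar :: ('b cstar \<Rightarrow> 'b \<times> complex) cstar"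
  by (rule cstar_product)

lemma product_unit:
  "is_unit_of (product_cstar :: ('b cstar \<Rightarrow> 'b \<times> complex) cstar) (\<lambda>A. (one_of (factor A), 1))"
proof -
  have u: "is_unit_of (factor A) (one_of (factor A))" "cstar_algebra (factor A)" for A :: "'b cstar"
    using unital_cstar_factor[of A] one_of[of "factor A"] unfolding unital_cstar_def by simp_all
  have c: "one_of (factor A) \<in> carrier (factor A)" "cnorm (factor A) (one_of (factor A)) \<le> 1"
    for A :: "'b cstar"
    using u(1)[of A] cstar_algebra.norm_unit_le(2)[OF u(2,1)] unfolding is_unit_of_def by simp_all
  have car: "(\<lambda>A. (one_of (factor A), 1)) \<in> carrier (product_cstar :: ('b cstar \<Rightarrow> 'b \<times> complex) cstar)"
    unfolding product_carrier using c by (intro conjI exI[of _ 1]) simp_all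
  show ?thesis
    unfolding is_unit_of_def
  proof (intro conjI ballI car)
    fix f :: "'b cstar \<Rightarrow> 'b \<times> complex" assume f: "f \<in> carrier product_cstar"
    have *: "mult (plus_complex (factor A)) (one_of (factor A), 1) (f A) = f A \<and>
      mult (plus_complex (factor A)) (f A) (one_of (factor A), 1) = f A" for A
    proof -
      obtain a p where ap: "f A = (a, p)" by (rule prod.exhaust)
      have "f A \<in> carrier (plus_complex (factor A))" using f unfolding product_carrier by simp
      then have "a \<in> carrier (factor A)" by (simp add: ap)
      then show ?thesis using u(1)[of A] unfolding is_unit_of_def by (simp add: ap)
    qed
    show "(\<lambda>A. (one_of (factor A), 1)) \<otimes>\<^bsub>product_cstar\<^esub> f = f"
      "f \<otimes>\<^bsub>product_cstar\<^esub> (\<lambda>A. (one_of (factor A), 1)) = f"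
      by (rule ext, simp only: product_simps *)+
  qed
qed

text \<open>A type of bounded families that contains a copy of every unital C*-algebra with carrier in
  \<open>'b\<close>. In this way elements of different fibres can be multiplied and compared, and the type
  class machinery for continuity and completeness applies to all of them at once.\<close>

typedef 'b universal_cstar = "carrier (product_cstar :: ('b cstar \<Rightarrow> 'b \<times> complex) cstar)"
  morphisms comps Abs_universal
  using product.zero_closed by blast

declare comps [simp]

instantiation universal_cstar :: (type) real_normed_algebra_1
begin

definition "0 = Abs_universal (zero product_cstar)"
definition "1 = Abs_universal (\<lambda>A. (one_of (factor A), 1))"
definition "x + y = Abs_universal (add product_cstar (comps x) (comps y))"
definition "x - y = Abs_universal (diff product_cstar (comps x) (comps y))"
definition "- x = Abs_universal (smult product_cstar (-1) (comps x))"
definition "x * y = Abs_universal (mult product_cstar (comps x) (comps y))"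
definition "r *\<^sub>R x = Abs_universal (smult product_cstar (complex_of_real r) (comps x))"
definition "norm x = cnorm product_cstar (comps x)"
definition "dist x (y :: 'a universal_cstar) = norm (x - y)"
definition "sgn (x :: 'a universal_cstar) = inverse (norm x) *\<^sub>R x"
definition "(uniformity :: ('a universal_cstar \<times> 'a universal_cstar) filter) = (INF e\<in>{0<..}. principal {(x, y). dist x y < e})"
definition "open (U :: 'a universal_cstar set) \<longleftrightarrow> (\<forall>x\<in>U. eventually (\<lambda>(x', y). x' = x \<longrightarrow> y \<in> U) uniformity)"

lemma one_carrier: "(\<lambda>A. (one_of (factor A), 1)) \<in> carrier product_cstar"
  using product_unit unfolding is_unit_of_def by blast

lemma comps_ops:
  "comps (0 :: 'a universal_cstar) = zero product_cstar"
  "comps (1 :: 'a universal_cstar) = (\<lambda>A. (one_of (factor A), 1))"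
  "comps (x + y) = add product_cstar (comps x) (comps y)"
  "comps (x - y) = diff product_cstar (comps x) (comps y)"
  "comps (- x) = smult product_cstar (-1) (comps x)"
  "comps (x * y) = mult product_cstar (comps x) (comps y)"
  "comps (r *\<^sub>R x) = smult product_cstar (complex_of_real r) (comps x)"
  for x y :: "'a universal_cstar"
  unfolding zero_universal_cstar_def one_universal_cstar_def plus_universal_cstar_def
    minus_universal_cstar_def uminus_universal_cstar_def times_universal_cstar_def
    scaleR_universal_cstar_def
  by (simp_all add: Abs_universal_inverse product.zero_closed product.add_closed product.smult_closed
      product.mult_closed product.adj_closed product.diff_closed one_carrier)

lemma unit_mult:
  "f \<in> carrier product_cstar \<Longrightarrow> mult product_cstar (\<lambda>A. (one_of (factor A), 1)) f = f"
  "f \<in> carrier product_cstar \<Longrightarrow> mult product_cstar f (\<lambda>A. (one_of (factor A), 1)) = f"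
  using product_unit unfolding is_unit_of_def by blast+

lemma norm_diff_comps: "norm (x - y) = cnorm product_cstar (diff product_cstar (comps x) (comps y))"
  for x y :: "'a universal_cstar"
  by (simp only: norm_universal_cstar_def comps_ops)

instance
proof
  fix x y z :: "'a universal_cstar" and r s :: real and U :: "'a universal_cstar set"
  note eq = comps_inject[symmetric] comps_ops
  note cl = product.zero_closed product.add_closed product.smult_closed product.mult_closed
    product.adj_closed product.diff_closed one_carrier comps
  show "x + y + z = x + (y + z)" by (simp only: eq product.add_assoc cl)
  show "x + y = y + x" by (simp only: eq) (rule product.add_commute; rule comps)
  show "0 + x = x" by (simp only: eq product.zero_add cl)
  show "- x + x = 0"
    by (simp only: eq product.add_neg[OF comps]
        product.add_commute[OF product.smult_closed[OF comps[of x], of "-1"] comps[of x]])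
  show "x - y = x + - y" by (simp only: eq diff_def)
  show "r *\<^sub>R (x + y) = r *\<^sub>R x + r *\<^sub>R y" by (simp only: eq product.smult_add cl)
  show "(r + s) *\<^sub>R x = r *\<^sub>R x + s *\<^sub>R x" by (simp only: eq of_real_add product.add_smult cl)
  show "r *\<^sub>R s *\<^sub>R x = (r * s) *\<^sub>R x" by (simp only: eq of_real_mult product.smult_smult cl)
  show "1 *\<^sub>R x = x" by (simp only: eq of_real_1 product.smult_one cl)
  show "dist x y = norm (x - y)" by (rule dist_universal_cstar_def)
  show "sgn x = inverse (norm x) *\<^sub>R x" by (rule sgn_universal_cstar_def)
  show "(uniformity :: ('a universal_cstar \<times> 'a universal_cstar) filter) = (INF e\<in>{0<..}. principal {(x, y). dist x y < e})"
    by (rule uniformity_universal_cstar_def)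
  show "open U \<longleftrightarrow> (\<forall>x\<in>U. eventually (\<lambda>(x', y). x' = x \<longrightarrow> y \<in> U) uniformity)"
    by (rule open_universal_cstar_def)
  show "norm x = 0 \<longleftrightarrow> x = 0"
    by (simp only: norm_universal_cstar_def eq product.norm_eq_zero cl)
  show "norm (x + y) \<le> norm x + norm y"
    by (simp only: norm_universal_cstar_def eq product.norm_triangle cl)
  show "norm (r *\<^sub>R x) = \<bar>r\<bar> * norm x"
    by (simp only: norm_universal_cstar_def eq product.norm_smult cl norm_of_real real_norm_def)
  show "x * y * z = x * (y * z)" by (simp only: eq product.mult_assoc cl)
  show "(x + y) * z = x * z + y * z" by (simp only: eq product.add_mult cl)
  show "x * (y + z) = x * y + x * z" by (simp only: eq product.mult_add cl)
  show "r *\<^sub>R x * y = r *\<^sub>R (x * y)" by (simp only: eq product.smult_mult cl)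
  show "x * r *\<^sub>R y = r *\<^sub>R (x * y)" by (simp only: eq product.mult_smult cl)
  show "1 * x = x" "x * 1 = x" by (simp_all only: eq unit_mult cl)
  show "norm (x * y) \<le> norm x * norm y"
    by (simp only: norm_universal_cstar_def eq product.norm_mult cl)
  have ne: "(0 :: 'a universal_cstar) \<noteq> 1"
  proof
    assume "(0 :: 'a universal_cstar) = 1"
    then have "zero product_cstar A = (one_of (factor A), 1)" for A :: "'a cstar"
      by (simp only: eq)
    then show False by (simp add: product_simps)
  qed
  then show "(0 :: 'a universal_cstar) \<noteq> 1" .
  have "norm (1 :: 'a universal_cstar) \<le> 1"
    using product.norm_unit_le(2)[OF product_unit] by (simp only: norm_universal_cstar_def eq)
  moreover have "norm (1 :: 'a universal_cstar) \<ge> 1"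
    using product_norm_ge[OF one_carrier, of "undefined :: 'a cstar"]
    by (simp add: norm_universal_cstar_def comps_ops)
  ultimately show "norm (1 :: 'a universal_cstar) = 1" by simp
qed

end

instance universal_cstar :: (type) banach
proof
  fix X :: "nat \<Rightarrow> 'a universal_cstar"
  assume X: "Cauchy X"
  have "(\<forall>n. comps (X n) \<in> carrier product_cstar) \<and>
      (\<forall>\<epsilon>>0. \<exists>N. \<forall>m\<ge>N. \<forall>n\<ge>N. cnorm product_cstar (diff product_cstar (comps (X m)) (comps (X n))) < \<epsilon>)"
    using X by (simp only: Cauchy_def dist_universal_cstar_def norm_diff_comps comps) simp
  then obtain f where f: "f \<in> carrier product_cstar"
    "(\<lambda>n. cnorm product_cstar (diff product_cstar (comps (X n)) f)) \<longlonglongrightarrow> 0"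
    using spec[OF product.complete[unfolded norm_complete_def], of "\<lambda>n. comps (X n)"] by auto
  have "(\<lambda>n. norm (X n - Abs_universal f)) \<longlonglongrightarrow> 0"
    using f by (simp only: norm_diff_comps Abs_universal_inverse)
  then show "convergent X"
    unfolding convergent_def
    by (intro exI[of _ "Abs_universal f"]) (simp add: tendsto_iff dist_universal_cstar_def)
qed

instantiation universal_cstar :: (type) star_banach_algebra
begin

definition "star x = Abs_universal (adj product_cstar (comps x))"
definition "im = Abs_universal (smult product_cstar \<i> (\<lambda>A. (one_of (factor A), 1)))"

lemma comps_star_ops:
  "comps (star x) = adj product_cstar (comps x)"
  "comps (im :: 'a universal_cstar) = smult product_cstar \<i> (\<lambda>A. (one_of (factor A), 1))"
  for x :: "'a universal_cstar"
  unfolding star_universal_cstar_def im_universal_cstar_def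
  by (simp_all add: Abs_universal_inverse product.smult_closed product.adj_closed one_carrier)

instance
proof
  fix x y :: "'a universal_cstar" and r :: real
  note eq = comps_inject[symmetric] comps_ops comps_star_ops
  note cl = product.zero_closed product.add_closed product.smult_closed product.mult_closed
    product.adj_closed product.diff_closed one_carrier comps
  show "star (x + y) = star x + star y" by (simp only: eq product.adj_add cl)
  show "star (x * y) = star y * star x" by (simp only: eq product.adj_mult cl)
  show "star (star x) = x" by (simp only: eq product.adj_adj cl)
  show "star (r *\<^sub>R x) = r *\<^sub>R star x" by (simp only: eq product.adj_smult cl complex_cnj_complex_of_real)
  show "im * x = x * im" by (simp only: eq product.smult_mult product.mult_smult unit_mult cl)
  show "im * im = - (1 :: 'a universal_cstar)"
    by (simp only: eq product.smult_mult product.mult_smult product.smult_smult unit_mult cl i_squared)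
  show "star im = - (im :: 'a universal_cstar)"
    by (simp only: eq product.adj_smult product.smult_smult cl product.norm_unit_le(1)[OF product_unit]) simp
  show "norm (star x * x) = (norm x)\<^sup>2"
    by (simp only: norm_universal_cstar_def eq product.cstar_identity cl)
qed

end

subsection \<open>The scalars\<close>

text \<open>The copy of the complex numbers in the centre.\<close>

definition cx :: "complex \<Rightarrow> 'a :: star_banach_algebra"
  where "cx c = of_real (Re c) + of_real (Im c) * im"

lemma cx_simps [simp]: "cx 0 = 0" "cx 1 = 1"
  by (simp_all add: cx_def)

lemma cx_add: "cx (c + d) = cx c + cx d"
  by (simp add: cx_def algebra_simps)

lemma cx_central: "cx c * x = x * cx c"
proof -
  have "of_real (Im c) * im * x = x * (of_real (Im c) * im)"
    by (simp add: of_real_def im_central[of x])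
  then show ?thesis by (simp add: cx_def of_real_def distrib_left distrib_right)
qed

lemma cx_mult: "cx (c * d) = cx c * cx d"
  by (simp add: cx_def of_real_def algebra_simps im_im)

lemma star_cx: "star (cx c) = cx (cnj c)"
  by (simp add: cx_def of_real_def star_add star_mult star_scaleR star_im)

lemma cx_of_real: "cx (complex_of_real r) = of_real r"
  by (simp add: cx_def)

lemma norm_cx_mult: "norm (cx c * x) = cmod c * norm x"
proof -
  have "star (cx c * x) * (cx c * x) = star x * (cx (cnj c) * cx c) * x"
    by (simp only: star_mult star_cx mult.assoc)
  also have "cx (cnj c) * cx c = (of_real ((cmod c)\<^sup>2) :: 'a)"
    by (simp only: mult.commute[of "cnj c"] complex_norm_square[symmetric] cx_of_real flip: cx_mult of_real_power)
  also have "star x * of_real ((cmod c)\<^sup>2) * x = (cmod c)\<^sup>2 *\<^sub>R (star x * x)" by (simp add: of_real_def)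
  finally have "(norm (cx c * x))\<^sup>2 = (cmod c * norm x)\<^sup>2"
    by (simp only: norm_scaleR cstar_norm power_mult_distrib flip: cstar_norm[of "cx c * x"]) simp
  then show ?thesis by (simp add: power2_eq_iff_nonneg)
qed

subsection \<open>The fibres as ideals\<close>

definition emb_comps :: "'b cstar \<Rightarrow> 'b \<Rightarrow> 'b cstar \<Rightarrow> 'b \<times> complex"
  where "emb_comps A x = (\<lambda>A'. if A' = A then (x, 0) else zero (plus_complex (factor A')))"

definition emb :: "'b cstar \<Rightarrow> 'b \<Rightarrow> 'b universal_cstar"
  where "emb A x = Abs_universal (emb_comps A x)"

text \<open>A central projection; the copy of \<open>A\<close> is the ideal that it generates.\<close>

definition fibre_one :: "'b cstar \<Rightarrow> 'b universal_cstar"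
  where "fibre_one A = emb A (one_of A)"

context
  fixes A :: "'b cstar"
  assumes A: "unital_cstar A"
begin

interpretation cstar_algebra A using A unfolding unital_cstar_def by simp

lemma factor_eq: "factor A = A" using A unfolding factor_def by simp

lemma comps_emb: "x \<in> carrier A \<Longrightarrow> comps (emb A x) = emb_comps A x"
proof -
  assume x: "x \<in> carrier A"
  have z: "cnorm (factor B) (zero (factor B)) = 0" "zero (factor B) \<in> carrier (factor B)" for B :: "'b cstar"
    using unital_cstar_factor[of B] cstar_algebra.norm_zero star_algebra.zero_closed cstar_algebra.axioms(1)
    unfolding unital_cstar_def by blast+
  have "emb_comps A x \<in> carrier product_cstar"
    unfolding product_carrier using x norm_nonneg[OF x]
    by (auto simp: emb_comps_def factor_eq z intro!: exI[of _ "cnorm A x"])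
  then show ?thesis unfolding emb_def by (rule Abs_universal_inverse)
qed

lemma zero_props:
  "add (plus_complex (factor B)) (zero (plus_complex (factor B))) (zero (plus_complex (factor B))) = zero (plus_complex (factor B))"
  "smult (plus_complex (factor B)) c (zero (plus_complex (factor B))) = zero (plus_complex (factor B))"
  "y \<in> carrier (plus_complex (factor B)) \<Longrightarrow>
    mult (plus_complex (factor B)) (zero (plus_complex (factor B))) y = zero (plus_complex (factor B))"
  "y \<in> carrier (plus_complex (factor B)) \<Longrightarrow>
    mult (plus_complex (factor B)) y (zero (plus_complex (factor B))) = zero (plus_complex (factor B))"
  "adj (plus_complex (factor B)) (zero (plus_complex (factor B))) = zero (plus_complex (factor B))"
proof -
  interpret B: cstar_algebra "plus_complex (factor B)" by (rule cstar_factor)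
  show "add (plus_complex (factor B)) (zero (plus_complex (factor B))) (zero (plus_complex (factor B))) = zero (plus_complex (factor B))"
    by (rule B.add_zero[OF B.zero_closed])
  show "smult (plus_complex (factor B)) c (zero (plus_complex (factor B))) = zero (plus_complex (factor B))"
    by (rule B.smult_zero)
  have n: "z = zero (plus_complex (factor B))"
    if "z \<in> carrier (plus_complex (factor B))" "cnorm (plus_complex (factor B)) z \<le> 0" for z
    using B.norm_eq_zero[OF that(1)] B.norm_nonneg[OF that(1)] that(2) by (meson antisym)
  show "mult (plus_complex (factor B)) (zero (plus_complex (factor B))) y = zero (plus_complex (factor B))"
    if "y \<in> carrier (plus_complex (factor B))"
    using B.norm_mult[OF B.zero_closed that]
    by (intro n B.mult_closed B.zero_closed that) (simp only: B.norm_zero mult_zero_left)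
  show "mult (plus_complex (factor B)) y (zero (plus_complex (factor B))) = zero (plus_complex (factor B))"
    if "y \<in> carrier (plus_complex (factor B))"
    using B.norm_mult[OF that B.zero_closed]
    by (intro n B.mult_closed B.zero_closed that) (simp only: B.norm_zero mult_zero_right)
  show "adj (plus_complex (factor B)) (zero (plus_complex (factor B))) = zero (plus_complex (factor B))"
    by (rule n[OF B.adj_closed[OF B.zero_closed]]) (simp only: B.norm_adj[OF B.zero_closed] B.norm_zero order_refl)
qed

lemma comps_at: "comps u B \<in> carrier (plus_complex (factor B))"
  using comps[of u] unfolding product_carrier by blast

lemma emb_eqI:
  assumes "x \<in> carrier A" "comps u A = (x, 0)" "\<And>B. B \<noteq> A \<Longrightarrow> comps u B = zero (plus_complex (factor B))"
  shows "u = emb A x"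
  unfolding comps_inject[symmetric] comps_emb[OF assms(1)] emb_comps_def using assms(2,3) by auto

lemma emb_zero: "emb A (zero A) = 0"
  by (rule sym, rule emb_eqI)
     (simp_all add: zero_closed comps_ops product_simps factor_eq)

lemma emb_add:
  assumes "x \<in> carrier A" "y \<in> carrier A"
  shows "emb A (x \<oplus>\<^bsub>A\<^esub> y) = emb A x + emb A y"
  by (rule sym, rule emb_eqI)
     (use assms in \<open>simp_all add: comps_ops product_simps comps_emb emb_comps_def factor_eq add_closed
       zero_props del: plus_complex_simps(2)\<close>)

lemma emb_mult:
  assumes "x \<in> carrier A" "y \<in> carrier A"
  shows "emb A (x \<otimes>\<^bsub>A\<^esub> y) = emb A x * emb A y"
  by (rule sym, rule emb_eqI)
     (use assms in \<open>simp_all add: comps_ops product_simps comps_emb emb_comps_def factor_eq mult_closed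
       zero_props(3)[OF star_algebra.zero_closed[OF cstar_algebra.axioms(1)[OF cstar_factor]]]
       del: plus_complex_simps(2)\<close>)

lemma emb_adj:
  assumes "x \<in> carrier A"
  shows "emb A (adj A x) = star (emb A x)"
  by (rule sym, rule emb_eqI)
     (use assms in \<open>simp_all add: comps_star_ops product_simps comps_emb emb_comps_def factor_eq adj_closed
       zero_props del: plus_complex_simps(2)\<close>)

lemma comps_cx: "comps (cx c * u) = smult product_cstar c (comps u)"
proof -
  have "comps (cx c * u) = mult product_cstar
      (add product_cstar (smult product_cstar (complex_of_real (Re c)) (comps 1))
        (smult product_cstar (complex_of_real (Im c)) (comps im))) (comps u)"
    by (simp add: cx_def of_real_def comps_ops(3,6,7) del: comps)
  also have "comps im = smult product_cstar \<i> (comps 1)" by (simp add: comps_ops comps_star_ops)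
  also have "add product_cstar (smult product_cstar (complex_of_real (Re c)) (comps 1))
        (smult product_cstar (complex_of_real (Im c)) (smult product_cstar \<i> (comps 1))) = smult product_cstar c (comps 1)"
    by (subst product.smult_smult[OF comps], subst product.add_smult[OF comps, symmetric])
       (simp add: complex_eq[of c, symmetric] mult.commute)
  also have "mult product_cstar (smult product_cstar c (comps 1)) (comps u) = smult product_cstar c (comps u)"
    by (simp add: product.smult_mult comps_ops(2) unit_mult one_carrier)
  finally show ?thesis .
qed

lemma emb_smult:
  assumes "x \<in> carrier A"
  shows "emb A (c \<odot>\<^bsub>A\<^esub> x) = cx c * emb A x"
  by (rule sym, rule emb_eqI)
     (use assms in \<open>simp_all add: comps_cx product_simps comps_emb emb_comps_def factor_eq smult_closed
       zero_props del: plus_complex_simps(2)\<close>)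

lemma emb_diff:
  assumes "x \<in> carrier A" "y \<in> carrier A"
  shows "emb A (x \<ominus>\<^bsub>A\<^esub> y) = emb A x - emb A y"
proof -
  have "cx (-1) = (-1 :: 'b universal_cstar)" using cx_of_real[of "-1"] by simp
  then show ?thesis using assms by (simp add: diff_def emb_add emb_smult smult_closed)
qed

lemma norm_emb:
  assumes "x \<in> carrier A"
  shows "norm (emb A x) = cnorm A x"
proof (rule antisym)
  have z: "cnorm (plus_complex (factor B)) (zero (plus_complex (factor B))) = 0" for B :: "'b cstar"
    by (rule cstar_algebra.norm_zero[OF cstar_factor])
  show "norm (emb A x) \<le> cnorm A x"
    unfolding norm_universal_cstar_def comps_emb[OF assms]
    by (rule product_norm_le)
       (use norm_nonneg[OF assms] z in \<open>auto simp: emb_comps_def factor_eq simp del: plus_complex_simps(2)\<close>)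
  have "cnorm (plus_complex (factor A)) (comps (emb A x) A) \<le> norm (emb A x)"
    unfolding norm_universal_cstar_def by (rule product_norm_ge[OF comps])
  then show "cnorm A x \<le> norm (emb A x)"
    by (simp add: comps_emb[OF assms] emb_comps_def factor_eq)
qed

lemma emb_inject:
  assumes "x \<in> carrier A" "y \<in> carrier A" "emb A x = emb A y"
  shows "x = y"
  using arg_cong[OF assms(3), of "\<lambda>u. comps u A"]
  by (simp add: comps_emb[OF assms(1)] comps_emb[OF assms(2)] emb_comps_def)

lemma one_of_unit: "is_unit_of A (one_of A)"
  using A one_of unfolding unital_cstar_def by blast

lemma one_of_closed: "one_of A \<in> carrier A"
  using one_of_unit unfolding is_unit_of_def by blast

lemma fibre_one_emb:
  assumes "x \<in> carrier A"
  shows "fibre_one A * emb A x = emb A x"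
  using one_of_unit assms unfolding fibre_one_def is_unit_of_def by (metis emb_mult)

lemma fibre_one_central: "fibre_one A * u = u * fibre_one A"
  and fibre_one_range: "\<exists>x\<in>carrier A. fibre_one A * u = emb A x"
proof -
  obtain x p where xp: "comps u A = (x, p)" by fastforce
  then have x: "x \<in> carrier A" using comps_at[of u A] by (simp add: factor_eq)
  have one: "one_of A \<otimes>\<^bsub>A\<^esub> x = x" "x \<otimes>\<^bsub>A\<^esub> one_of A = x"
    using one_of_unit x unfolding is_unit_of_def by blast+
  have l: "fibre_one A * u = emb A x"
    by (rule emb_eqI[OF x])
       (simp_all add: fibre_one_def comps_ops product_simps comps_emb one_of_closed emb_comps_def
         factor_eq xp one zero_props(3,4)[OF comps_at] del: plus_complex_simps(2))
  have r: "u * fibre_one A = emb A x"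
    by (rule emb_eqI[OF x])
       (simp_all add: fibre_one_def comps_ops product_simps comps_emb one_of_closed emb_comps_def
         factor_eq xp one zero_props(3,4)[OF comps_at] del: plus_complex_simps(2))
  show "fibre_one A * u = u * fibre_one A" using l r by simp
  show "\<exists>x\<in>carrier A. fibre_one A * u = emb A x" using l x by blast
qed

lemma fibre_one_idem: "fibre_one A * fibre_one A = fibre_one A"
  using fibre_one_emb[OF one_of_closed] by (simp add: fibre_one_def)

lemma star_fibre_one: "star (fibre_one A) = fibre_one A"
  unfolding fibre_one_def using norm_unit_le(1)[OF one_of_unit] emb_adj[OF one_of_closed] by simp

end

section \<open>Systems of operator fields\<close>

lemma openin_less:
  assumes "continuous_map X euclideanreal f"
  shows "openin X {t \<in> topspace X. f t < r}"
  using openin_continuous_map_preimage[OF assms, of "{..<r}"] by simp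

text \<open>What is used of a maximal full algebra of operator fields: the fibre at \<open>t\<close> is the ideal
  \<open>e t * UNIV\<close>, and \<open>S\<close> is the set of fields. Maximality is expressed by \<open>local_field\<close>: a field
  belongs to \<open>S\<close> as soon as it vanishes at infinity and is uniformly close to members of \<open>S\<close> near
  each point. The values of fields outside \<open>topspace X\<close> are not controlled.\<close>

locale operator_field_system =
  fixes X :: "'x topology" and e :: "'x \<Rightarrow> 'u :: star_banach_algebra" and S :: "('x \<Rightarrow> 'u) set"
  assumes e_idem: "t \<in> topspace X \<Longrightarrow> e t * e t = e t"
    and e_star: "t \<in> topspace X \<Longrightarrow> star (e t) = e t"
    and e_central: "t \<in> topspace X \<Longrightarrow> e t * u = u * e t"
    and field: "a \<in> S \<Longrightarrow> t \<in> topspace X \<Longrightarrow> e t * a t = a t"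
    and zero_field: "(\<lambda>t. 0) \<in> S"
    and add_field: "a \<in> S \<Longrightarrow> b \<in> S \<Longrightarrow> (\<lambda>t. a t + b t) \<in> S"
    and mult_field: "a \<in> S \<Longrightarrow> b \<in> S \<Longrightarrow> (\<lambda>t. a t * b t) \<in> S"
    and star_field: "a \<in> S \<Longrightarrow> (\<lambda>t. star (a t)) \<in> S"
    and scale_field: "a \<in> S \<Longrightarrow> (\<lambda>t. cx c * a t) \<in> S"
    and norm_field_continuous: "a \<in> S \<Longrightarrow> continuous_map X euclideanreal (\<lambda>t. norm (a t))"
    and norm_field_vanishes: "a \<in> S \<Longrightarrow> vanishes_at_infinity X (\<lambda>t. norm (a t))"
    and dense_field: "t \<in> topspace X \<Longrightarrow> e t * u = u \<Longrightarrow> \<eta> > 0 \<Longrightarrow> \<exists>a\<in>S. norm (a t - u) < \<eta>"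
    and local_field: "(\<And>t. t \<in> topspace X \<Longrightarrow> e t * d t = d t) \<Longrightarrow>
      (\<And>t \<eta>. t \<in> topspace X \<Longrightarrow> \<eta> > 0 \<Longrightarrow>
        \<exists>a\<in>S. \<exists>G. openin X G \<and> t \<in> G \<and> (\<forall>s\<in>G. norm (d s - a s) < \<eta>)) \<Longrightarrow>
      vanishes_at_infinity X (\<lambda>t. norm (d t)) \<Longrightarrow> d \<in> S"
begin

abbreviation T where "T \<equiv> topspace X"

lemma scaleR_field: "a \<in> S \<Longrightarrow> (\<lambda>t. r *\<^sub>R a t) \<in> S"
  using scale_field[of a "complex_of_real r"] by (simp add: cx_of_real scaleR_conv_of_real)

lemma sum_field: "(\<And>i. i \<in> I \<Longrightarrow> a i \<in> S) \<Longrightarrow> (\<lambda>t. \<Sum>i\<in>I. a i t) \<in> S"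
  by (induction I rule: infinite_finite_induct) (simp_all add: zero_field add_field)

lemma norm_e: "t \<in> T \<Longrightarrow> norm (e t) \<le> 1"
proof -
  assume t: "t \<in> T"
  have "(norm (e t))\<^sup>2 = norm (e t)" using cstar_norm[of "e t"] e_star[OF t] e_idem[OF t] by simp
  then have "norm (e t) = 0 \<or> norm (e t) = 1" by (simp add: power2_eq_square)
  then show ?thesis by auto
qed

lemma vanishes_mono:
  assumes "vanishes_at_infinity X f" "\<And>t. t \<in> T \<Longrightarrow> \<bar>g t\<bar> \<le> B * \<bar>f t\<bar>" "B > 0"
  shows "vanishes_at_infinity X g"
  unfolding vanishes_at_infinity_def
proof (intro allI impI)
  fix \<epsilon> :: real assume "\<epsilon> > 0"
  then obtain K where K: "compactin X K" "\<forall>t\<in>T - K. \<bar>f t\<bar> < \<epsilon> / B"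
    using assms(1,3) unfolding vanishes_at_infinity_def by (meson divide_pos_pos)
  have "\<bar>g t\<bar> < \<epsilon>" if "t \<in> T - K" for t
  proof -
    have "B * \<bar>f t\<bar> < \<epsilon>" using K(2) that assms(3) by (simp add: field_simps)
    then show ?thesis using assms(2)[of t] that by simp
  qed
  then show "\<exists>K. compactin X K \<and> (\<forall>t\<in>T - K. \<bar>g t\<bar> < \<epsilon>)" using K(1) by blast
qed

lemma field_bounded: assumes "a \<in> S" obtains r where "r \<ge> 0" "\<And>t. t \<in> T \<Longrightarrow> norm (a t) \<le> r"
proof -
  obtain K where K: "compactin X K" "\<forall>t\<in>T - K. \<bar>norm (a t)\<bar> < 1"
    using norm_field_vanishes[OF assms] unfolding vanishes_at_infinity_def by (meson zero_less_one)
  have "compact ((\<lambda>t. norm (a t)) ` K)"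
    using image_compactin[OF K(1) norm_field_continuous[OF assms]] by simp
  then have "bounded ((\<lambda>t. norm (a t)) ` K)" by (rule compact_imp_bounded)
  then obtain B where "\<forall>x\<in>(\<lambda>t. norm (a t)) ` K. norm x \<le> B" unfolding bounded_iff by blast
  then have B: "\<And>t. t \<in> K \<Longrightarrow> norm (a t) \<le> B" by simp
  have "norm (a t) \<le> max 1 B" if "t \<in> T" for t
    using B[of t] K(2) that by (cases "t \<in> K") (auto simp: le_max_iff_disj less_imp_le)
  then show ?thesis using that[of "max 1 B"] by auto
qed

lemma fields_bounded:
  assumes "\<And>j. j < (M::nat) \<Longrightarrow> a j \<in> S"
  obtains r where "r > 0" "\<And>j t. j < M \<Longrightarrow> t \<in> T \<Longrightarrow> norm (a j t) \<le> r"
proof -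
  have "\<exists>r. r \<ge> 0 \<and> (\<forall>t\<in>T. norm (a j t) \<le> r)" if "j < M" for j
    using field_bounded[OF assms[OF that]] by metis
  then obtain r where r: "\<And>j. j < M \<Longrightarrow> r j \<ge> 0" "\<And>j t. j < M \<Longrightarrow> t \<in> T \<Longrightarrow> norm (a j t) \<le> r j" by metis
  have "norm (a j t) \<le> (\<Sum>j<M. r j) + 1" if "j < M" "t \<in> T" for j t
    using r(2)[OF that] member_le_sum[of j "{..<M}" r] r(1) that by fastforce
  moreover have "(\<Sum>j<M. r j) \<ge> 0" using r(1) by (intro sum_nonneg) simp
  then have "(\<Sum>j<M. r j) + 1 > 0" by simp
  ultimately show ?thesis using that by blast
qed

text \<open>Near \<open>t\<close> the field \<open>\<phi> a\<close> is close to \<open>\<phi>(t) a\<close>, so \<open>local_field\<close> applies.\<close>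

lemma module_field:
  assumes a: "a \<in> S" and \<phi>: "continuous_map X euclideanreal \<phi>" "\<And>t. t \<in> T \<Longrightarrow> \<bar>\<phi> t\<bar> \<le> 1"
  shows "(\<lambda>t. \<phi> t *\<^sub>R a t) \<in> S"
proof (rule local_field)
  show "e t * (\<phi> t *\<^sub>R a t) = \<phi> t *\<^sub>R a t" if "t \<in> T" for t using field[OF a that] by simp
  show "vanishes_at_infinity X (\<lambda>t. norm (\<phi> t *\<^sub>R a t))"
    by (rule vanishes_mono[OF norm_field_vanishes[OF a], of _ 1]) (simp_all add: \<phi>(2) mult_left_le_one_le)
  fix t \<eta> assume t: "t \<in> T" and \<eta>: "\<eta> > (0::real)"
  obtain r where r: "r \<ge> 0" "\<And>t. t \<in> T \<Longrightarrow> norm (a t) \<le> r" using field_bounded[OF a] by blast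
  define G where "G = {s \<in> T. \<bar>\<phi> s - \<phi> t\<bar> < \<eta> / (r + 1)}"
  have "openin X G"
    unfolding G_def by (intro openin_less continuous_intros \<phi>(1))
  moreover have "t \<in> G" using t \<eta> r unfolding G_def by simp
  moreover have "norm (\<phi> s *\<^sub>R a s - \<phi> t *\<^sub>R a s) < \<eta>" if "s \<in> G" for s
  proof -
    have s: "s \<in> T" "\<bar>\<phi> s - \<phi> t\<bar> < \<eta> / (r + 1)" using that unfolding G_def by auto
    have "norm (\<phi> s *\<^sub>R a s - \<phi> t *\<^sub>R a s) = \<bar>\<phi> s - \<phi> t\<bar> * norm (a s)" by (simp flip: scaleR_diff_left)
    also have "\<dots> \<le> \<bar>\<phi> s - \<phi> t\<bar> * (r + 1)" using r(2)[OF s(1)] by (intro mult_left_mono) auto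
    also have "\<dots> < \<eta>" using s(2) r(1) by (simp add: field_simps)
    finally show ?thesis .
  qed
  ultimately show "\<exists>b\<in>S. \<exists>G. openin X G \<and> t \<in> G \<and> (\<forall>s\<in>G. norm (\<phi> s *\<^sub>R a s - b s) < \<eta>)"
    by (intro bexI[OF _ scaleR_field[OF a, of "\<phi> t"]] exI[of _ G] conjI ballI)
qed

text \<open>A field through a point close to \<open>u\<close> is cut down by a continuous scalar function so that its
  norm does not exceed that of \<open>u\<close> by more than \<open>\<eta>\<close> anywhere.\<close>

lemma lift_field:
  assumes x: "x \<in> T" "e x * u = u" and \<eta>: "\<eta> > 0"
  obtains a where "a \<in> S" "norm (a x - u) < \<eta>" "\<And>t. t \<in> T \<Longrightarrow> norm (a t) \<le> norm u + \<eta>"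
proof -
  obtain b where b: "b \<in> S" "norm (b x - u) < \<eta>" using dense_field[OF x \<eta>] by blast
  define R where "R = norm u + \<eta>"
  have R: "R > 0" using \<eta> unfolding R_def by (simp add: add_nonneg_pos)
  define \<phi> where "\<phi> = (\<lambda>t. R / max R (norm (b t)))"
  have \<phi>: "continuous_map X euclideanreal \<phi>" unfolding \<phi>_def
    using R by (intro continuous_intros norm_field_continuous b(1)) (auto simp: max_def)
  have m: "max R (norm (b t)) > 0" for t using R by simp
  have le1: "\<bar>\<phi> t\<bar> \<le> 1" for t unfolding \<phi>_def using R m by (auto simp: divide_le_eq)
  have "norm (b x) \<le> norm u + norm (b x - u)" by (metis norm_triangle_sub)
  then have "norm (b x) \<le> R" using b(2) unfolding R_def by simp
  then have "\<phi> x = 1" unfolding \<phi>_def using R by (simp add: max_def)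
  moreover have "norm (\<phi> t *\<^sub>R b t) \<le> R" for t
  proof -
    have "\<phi> t * max R (norm (b t)) = R" unfolding \<phi>_def using m[of t] by simp
    moreover have "\<phi> t \<ge> 0" unfolding \<phi>_def using R m[of t] by simp
    ultimately show ?thesis using mult_left_mono[of "norm (b t)" "max R (norm (b t))" "\<phi> t"] by simp
  qed
  ultimately show ?thesis
    using that[OF module_field[OF b(1) \<phi> le1]] b(2) unfolding R_def by simp
qed

end

subsection \<open>Left invertible tuples\<close>

text \<open>The scalar parts \<open>p j\<close> are fixed, and only the parts in \<open>S\<close> are varied. The assumption
  \<open>P > 0\<close> makes the scalar tuple itself left invertible.\<close>

locale shifted_tuples = operator_field_system X e S
  for X :: "'x topology" and e :: "'x \<Rightarrow> 'u :: star_banach_algebra" and S :: "('x \<Rightarrow> 'u) set" +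
  fixes M :: nat and p :: "nat \<Rightarrow> complex" and P :: real
  assumes P_def: "P = (\<Sum>j<M. (cmod (p j))\<^sup>2)" and P_pos: "P > 0"
begin

text \<open>Left invertibility at \<open>t\<close> of the tuple with entries \<open>b j + p j\<close>. The coefficients range over
  the whole algebra; multiplication with \<open>e t\<close> brings them into the fibre.\<close>

definition LI :: "'x \<Rightarrow> (nat \<Rightarrow> 'u) \<Rightarrow> bool"
  where "LI t b \<longleftrightarrow> (\<exists>c. (\<Sum>j<M. c j * (b j + cx (p j) * e t)) = e t)"

text \<open>An approximate left inverse is enough: if \<open>W\<close> is close to \<open>e t\<close>, then \<open>1 - (e t - W)\<close> has an
  inverse \<open>y\<close>, and \<open>y W = e t\<close> because \<open>W e t = W\<close>.\<close>

lemma LI_near: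
  assumes t: "t \<in> T" and b: "\<And>j. j < M \<Longrightarrow> e t * b j = b j"
    and n: "norm ((\<Sum>j<M. c j * (b j + cx (p j) * e t)) - e t) < 1"
  shows "LI t b"
proof -
  let ?W = "\<Sum>j<M. c j * (b j + cx (p j) * e t)"
  have bt: "(b j + cx (p j) * e t) * e t = b j + cx (p j) * e t" if "j < M" for j
    using b[OF that] e_central[OF t, of "b j"] e_idem[OF t] by (simp add: distrib_right mult.assoc)
  have "?W * e t = ?W" unfolding sum_distrib_right by (rule sum.cong) (simp_all add: bt mult.assoc)
  then have w: "(e t - ?W) * e t = e t - ?W" using e_idem[OF t] by (simp add: left_diff_distrib)
  have "norm (e t - ?W) < 1" using n by (simp add: norm_minus_commute)
  then obtain y where "y * (1 - (e t - ?W)) = 1" by (metis neumann)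
  then have "y * ((1 - (e t - ?W)) * e t) = e t" by (simp flip: mult.assoc)
  then have "y * (e t - (e t - ?W)) = e t" using w by (simp add: left_diff_distrib)
  then have "(\<Sum>j<M. (y * c j) * (b j + cx (p j) * e t)) = e t"
    by (simp add: sum_distrib_left mult.assoc)
  then show ?thesis unfolding LI_def by (rule exI[of _ "\<lambda>j. y * c j"])
qed

lemma LI_margin:
  assumes t: "t \<in> T" and "LI t b"
  obtains \<eta> where "\<eta> > 0"
    "\<And>c. (\<And>j. j < M \<Longrightarrow> e t * c j = c j \<and> norm (c j - b j) < \<eta>) \<Longrightarrow> LI t c"
proof -
  obtain d where d: "(\<Sum>j<M. d j * (b j + cx (p j) * e t)) = e t" using assms(2) unfolding LI_def by blast
  define C where "C = (\<Sum>j<M. norm (d j)) + 1"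
  have C: "C > 0" unfolding C_def by (simp add: add_nonneg_pos sum_nonneg)
  show ?thesis
  proof (rule that[of "1 / C"])
    show "1 / C > 0" using C by simp
    fix c assume c: "\<And>j. j < M \<Longrightarrow> e t * c j = c j \<and> norm (c j - b j) < 1 / C"
    have "(\<Sum>j<M. d j * (c j + cx (p j) * e t)) - e t =
        (\<Sum>j<M. d j * (c j + cx (p j) * e t)) - (\<Sum>j<M. d j * (b j + cx (p j) * e t))" by (simp only: d)
    also have "\<dots> = (\<Sum>j<M. d j * (c j - b j))"
      unfolding sum_subtractf[symmetric] by (rule sum.cong) (simp_all add: algebra_simps)
    also have "norm \<dots> \<le> (\<Sum>j<M. norm (d j) * (1 / C))"
      using c by (intro sum_norm_le order_trans[OF norm_mult_ineq] mult_left_mono) (auto intro: less_imp_le)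
    also have "\<dots> = (\<Sum>j<M. norm (d j)) / C" by (simp add: sum_divide_distrib)
    also have "\<dots> < 1" using C unfolding C_def by simp
    finally show "LI t c" using LI_near[OF t, of c d] c by blast
  qed
qed

text \<open>The scalar left inverse of the tuple \<open>p\<close> of least Euclidean norm.\<close>

definition q where "q j = cnj (p j) / complex_of_real P"

lemma sum_q_p: "(\<Sum>j<M. q j * p j) = 1"
proof -
  have "(\<Sum>j<M. q j * p j) = (\<Sum>j<M. complex_of_real ((cmod (p j))\<^sup>2)) / complex_of_real P"
    unfolding q_def sum_divide_distrib complex_norm_square by (simp add: mult.commute)
  also have "\<dots> = 1" using P_pos by (simp only: P_def[symmetric] flip: of_real_sum) simp
  finally show ?thesis .
qed

lemma sum_cx_q_p: "(\<Sum>j<M. cx (q j) * cx (p j)) = 1"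
proof -
  have "(\<Sum>j<N. cx (f j)) = cx (\<Sum>j<N. f j)" for f :: "nat \<Rightarrow> complex" and N
    by (induction N) (simp_all add: cx_add)
  from this[of "\<lambda>j. q j * p j" M] show ?thesis by (simp add: sum_q_p flip: cx_mult)
qed

lemma LI_small:
  obtains r where "r > 0"
    "\<And>t b. t \<in> T \<Longrightarrow> (\<And>j. j < M \<Longrightarrow> e t * b j = b j \<and> norm (b j) < r) \<Longrightarrow> LI t b"
proof -
  define C where "C = (\<Sum>j<M. cmod (q j)) + 1"
  have C: "C > 0" unfolding C_def by (simp add: add_nonneg_pos sum_nonneg)
  show ?thesis
  proof (rule that[of "1 / C"])
    show "1 / C > 0" using C by simp
    fix t b assume t: "t \<in> T" and b: "\<And>j. j < M \<Longrightarrow> e t * b j = b j \<and> norm (b j) < 1 / C"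
    have "(\<Sum>j<M. cx (q j) * (b j + cx (p j) * e t)) =
        (\<Sum>j<M. cx (q j) * b j) + (\<Sum>j<M. cx (q j) * cx (p j)) * e t"
      by (simp add: distrib_left sum.distrib sum_distrib_right mult.assoc)
    then have "(\<Sum>j<M. cx (q j) * (b j + cx (p j) * e t)) - e t = (\<Sum>j<M. cx (q j) * b j)"
      by (simp add: sum_cx_q_p)
    also have "norm \<dots> \<le> (\<Sum>j<M. cmod (q j) * (1 / C))"
    proof (rule sum_norm_le)
      fix j assume "j \<in> {..<M}"
      then have "norm (b j) \<le> 1 / C" using b by (simp add: less_imp_le)
      then show "norm (cx (q j) * b j) \<le> cmod (q j) * (1 / C)"
        unfolding norm_cx_mult by (rule mult_left_mono) simp
    qed
    also have "\<dots> = (\<Sum>j<M. cmod (q j)) / C" by (simp add: sum_divide_distrib)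
    also have "\<dots> < 1" using C unfolding C_def by simp
    finally show "LI t b" using LI_near[OF t, of b "\<lambda>j. cx (q j)"] b by blast
  qed
qed

text \<open>Let \<open>c\<close> be a left inverse at \<open>x\<close>. The coefficients \<open>c\<^sub>j - q\<^sub>j\<close> are approximated at \<open>x\<close> by
  fields \<open>a\<^sub>j\<close>. Then \<open>w = \<Sum>\<^sub>j (a\<^sub>j + q\<^sub>j)(b\<^sub>j + p\<^sub>j) - 1\<close> is a field since \<open>\<Sum>\<^sub>j q\<^sub>j p\<^sub>j = 1\<close>; so its norm
  is continuous, and being small at \<open>x\<close> it is small near \<open>x\<close>. Subtracting \<open>q\<close> is what makes this
  work: the norms of \<open>a\<^sub>j + q\<^sub>j\<close> need not be continuous in \<open>t\<close>.\<close>

lemma LI_open: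
  assumes b: "\<And>j. j < M \<Longrightarrow> b j \<in> S" and x: "x \<in> T" and "LI x (\<lambda>j. b j x)"
  obtains \<eta> G where "\<eta> > 0" "openin X G" "x \<in> G"
    "\<And>t c. t \<in> G \<Longrightarrow> (\<And>j. j < M \<Longrightarrow> e t * c j = c j \<and> norm (c j - b j t) < \<eta>) \<Longrightarrow> LI t c"
proof -
  obtain c where c: "(\<Sum>j<M. c j * (b j x + cx (p j) * e x)) = e x" using assms(3) unfolding LI_def by blast
  \<comment> \<open>Multiplication with \<open>e x\<close> brings the coefficient into the fibre, where values of fields are
    dense.\<close>
  define c' where "c' j = e x * c j - cx (q j) * e x" for j
  define B where "B = (\<Sum>j<M. norm (b j x) + cmod (p j))"
  have B: "B \<ge> 0" unfolding B_def by (intro sum_nonneg) auto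
  define \<zeta> where "\<zeta> = 1 / (2 * (B + 1))"
  have \<zeta>: "\<zeta> > 0" using B unfolding \<zeta>_def by simp
  have ec: "e x * c' j = c' j" for j
  proof -
    have "e x * (cx (q j) * e x) = cx (q j) * e x"
      using e_idem[OF x] cx_central[of "q j" "e x"] by (metis mult.assoc)
    moreover have "e x * (e x * c j) = e x * c j" using e_idem[OF x] by (simp flip: mult.assoc)
    ultimately show ?thesis unfolding c'_def by (simp add: right_diff_distrib)
  qed
  have "\<exists>a. a \<in> S \<and> norm (a x - c' j) < \<zeta>" for j using dense_field[OF x ec \<zeta>] by blast
  then obtain a where a: "\<And>j. a j \<in> S" "\<And>j. norm (a j x - c' j) < \<zeta>" by metis
  define w where "w t = (\<Sum>j<M. a j t * b j t + cx (p j) * a j t + cx (q j) * b j t)" for t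
  have wS: "w \<in> S"
    unfolding w_def[abs_def] using a(1) b by (intro sum_field add_field mult_field scale_field) auto
  have ident: "(\<Sum>j<M. (a' j + cx (q j) * e t) * (b' j + cx (p j) * e t)) =
      (\<Sum>j<M. a' j * b' j + cx (p j) * a' j + cx (q j) * b' j) + e t"
    if t: "t \<in> T" and a': "\<And>j. j < M \<Longrightarrow> e t * a' j = a' j" and b': "\<And>j. j < M \<Longrightarrow> e t * b' j = b' j"
    for t a' b'
  proof -
    have "(\<Sum>j<M. (a' j + cx (q j) * e t) * (b' j + cx (p j) * e t)) =
      (\<Sum>j<M. (a' j * b' j + cx (p j) * a' j + cx (q j) * b' j) + cx (q j) * cx (p j) * e t)"
    proof (rule sum.cong[OF refl])
      fix j assume "j \<in> {..<M}"
      then have j: "j < M" by simp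
      have 1: "a' j * (cx (p j) * e t) = cx (p j) * a' j"
      proof -
        have "a' j * (cx (p j) * e t) = (a' j * cx (p j)) * e t" by (simp only: mult.assoc)
        also have "\<dots> = cx (p j) * (a' j * e t)" by (simp only: cx_central[of "p j" "a' j", symmetric] mult.assoc)
        also have "a' j * e t = a' j" using e_central[OF t, of "a' j"] a'[OF j] by simp
        finally show ?thesis .
      qed
      have 2: "cx (q j) * e t * b' j = cx (q j) * b' j" using b'[OF j] by (simp add: mult.assoc)
      have "cx (q j) * e t * (cx (p j) * e t) = cx (q j) * (e t * cx (p j)) * e t" by (simp only: mult.assoc)
      also have "\<dots> = cx (q j) * cx (p j) * (e t * e t)"
        by (simp only: cx_central[of "p j" "e t", symmetric] mult.assoc)
      finally have 3: "cx (q j) * e t * (cx (p j) * e t) = cx (q j) * cx (p j) * e t" using e_idem[OF t] by simp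
      show "(a' j + cx (q j) * e t) * (b' j + cx (p j) * e t) =
        (a' j * b' j + cx (p j) * a' j + cx (q j) * b' j) + cx (q j) * cx (p j) * e t"
        by (simp only: distrib_left distrib_right 1 2 3) simp
    qed
    also have "\<dots> = (\<Sum>j<M. a' j * b' j + cx (p j) * a' j + cx (q j) * b' j) + (\<Sum>j<M. cx (q j) * cx (p j)) * e t"
      by (simp only: sum.distrib sum_distrib_right)
    finally show ?thesis by (simp add: sum_cx_q_p)
  qed
  have "w x = (\<Sum>j<M. (a j x - c' j) * (b j x + cx (p j)))"
  proof -
    have "(\<Sum>j<M. (c' j + cx (q j) * e x) * (b j x + cx (p j) * e x)) = e x"
    proof -
      have "(\<Sum>j<M. (c' j + cx (q j) * e x) * (b j x + cx (p j) * e x)) = e x * (\<Sum>j<M. c j * (b j x + cx (p j) * e x))"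
        unfolding c'_def by (simp add: sum_distrib_left mult.assoc)
      then show ?thesis using c e_idem[OF x] by simp
    qed
    then have z: "(\<Sum>j<M. c' j * b j x + cx (p j) * c' j + cx (q j) * b j x) = 0"
      using ident[OF x ec, of "\<lambda>j. b j x"] field[OF b x] by simp
    have "w x = w x - (\<Sum>j<M. c' j * b j x + cx (p j) * c' j + cx (q j) * b j x)" using z by simp
    also have "\<dots> = (\<Sum>j<M. (a j x - c' j) * (b j x + cx (p j)))"
      unfolding w_def sum_subtractf[symmetric]
    proof (rule sum.cong[OF refl])
      fix j
      show "a j x * b j x + cx (p j) * a j x + cx (q j) * b j x - (c' j * b j x + cx (p j) * c' j + cx (q j) * b j x)
        = (a j x - c' j) * (b j x + cx (p j))"
        by (simp add: cx_central[of "p j"] algebra_simps)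
    qed
    finally show ?thesis .
  qed
  also have "norm \<dots> \<le> (\<Sum>j<M. \<zeta> * (norm (b j x) + cmod (p j)))"
  proof (rule sum_norm_le)
    fix j
    have "norm (b j x + cx (p j)) \<le> norm (b j x) + cmod (p j)"
      using norm_cx_mult[of "p j" "1::'u"] norm_triangle_ineq[of "b j x" "cx (p j)"] by simp
    then show "norm ((a j x - c' j) * (b j x + cx (p j))) \<le> \<zeta> * (norm (b j x) + cmod (p j))"
      using a(2)[of j] \<zeta> by (intro order_trans[OF norm_mult_ineq] mult_mono) (auto intro: less_imp_le)
  qed
  also have "\<dots> = \<zeta> * B" unfolding B_def by (simp add: sum_distrib_left)
  also have "\<dots> < 1/2" unfolding \<zeta>_def using B by (simp add: field_simps)
  finally have wx: "norm (w x) < 1/2" .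
  define G where "G = {t \<in> T. norm (w t) < 1/2}"
  obtain R where R: "R > 0" "\<And>j t. j < M \<Longrightarrow> t \<in> T \<Longrightarrow> norm (a j t) \<le> R"
    using fields_bounded[of M a] a(1) by blast
  define C where "C = (\<Sum>j<M. R + cmod (q j)) + 1"
  have "(\<Sum>j<M. R + cmod (q j)) \<ge> 0" using R(1) by (intro sum_nonneg) auto
  then have C: "C > 0" unfolding C_def by simp
  show ?thesis
  proof (rule that[of "1 / (2 * C)" G])
    show "1 / (2 * C) > 0" using C by simp
    show "openin X G" unfolding G_def by (intro openin_less norm_field_continuous wS)
    show "x \<in> G" unfolding G_def using x wx by simp
    fix t c assume "t \<in> G" and c: "\<And>j. j < M \<Longrightarrow> e t * c j = c j \<and> norm (c j - b j t) < 1 / (2 * C)"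
    then have t: "t \<in> T" "norm (w t) < 1/2" unfolding G_def by auto
    let ?d = "\<lambda>j. a j t + cx (q j) * e t"
    have dn: "norm (?d j) \<le> R + cmod (q j)" if "j < M" for j
    proof -
      have "norm (cx (q j) * e t) \<le> cmod (q j) * 1"
        unfolding norm_cx_mult using norm_e[OF t(1)] by (intro mult_left_mono) auto
      then show ?thesis using norm_triangle_ineq[of "a j t" "cx (q j) * e t"] R(2)[OF that t(1)] by simp
    qed
    have "(\<Sum>j<M. ?d j * (c j + cx (p j) * e t)) =
       (\<Sum>j<M. ?d j * (b j t + cx (p j) * e t)) + (\<Sum>j<M. ?d j * (c j - b j t))"
      unfolding sum.distrib[symmetric] by (rule sum.cong) (simp_all add: algebra_simps)
    also have "(\<Sum>j<M. ?d j * (b j t + cx (p j) * e t)) = w t + e t"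
      unfolding w_def using field[OF a(1) t(1)] field[OF b t(1)] by (intro ident t(1)) auto
    finally have eq: "(\<Sum>j<M. ?d j * (c j + cx (p j) * e t)) - e t = w t + (\<Sum>j<M. ?d j * (c j - b j t))" by simp
    have "norm (\<Sum>j<M. ?d j * (c j - b j t)) \<le> (\<Sum>j<M. (R + cmod (q j)) * (1 / (2 * C)))"
    proof (rule sum_norm_le)
      fix j assume "j \<in> {..<M}"
      then have j: "j < M" by simp
      show "norm (?d j * (c j - b j t)) \<le> (R + cmod (q j)) * (1 / (2 * C))"
        using dn[OF j] c[OF j] R(1) by (intro order_trans[OF norm_mult_ineq] mult_mono) (auto intro: less_imp_le)
    qed
    also have "\<dots> = (\<Sum>j<M. R + cmod (q j)) / (2 * C)" by (simp add: sum_divide_distrib)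
    also have "\<dots> < 1/2" using C unfolding C_def by simp
    finally have "norm (w t + (\<Sum>j<M. ?d j * (c j - b j t))) < 1"
      using t(2) norm_triangle_ineq[of "w t" "\<Sum>j<M. ?d j * (c j - b j t)"] by linarith
    then show "LI t c" using LI_near[OF t(1), of c ?d] c unfolding eq by blast
  qed
qed


subsection \<open>Families of tuples of fields\<close>

text \<open>A norm continuous map from the space of sequences to \<open>M\<close>-tuples of fields. The parameters
  are taken from the whole space, and points of a simplex are given by their barycentric
  coordinates, so that no extension from subcomplexes is ever needed.\<close>

definition family :: "((nat \<Rightarrow> real) \<Rightarrow> nat \<Rightarrow> 'x \<Rightarrow> 'u) \<Rightarrow> bool"
  where "family F \<longleftrightarrow> (\<forall>s j. j < M \<longrightarrow> F s j \<in> S) \<and>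
    (\<forall>s0 \<eta>. \<eta> > 0 \<longrightarrow> eventually (\<lambda>s. \<forall>j<M. \<forall>t\<in>T. norm (F s j t - F s0 j t) < \<eta>) (nhds s0))"

lemma family_field: "family F \<Longrightarrow> j < M \<Longrightarrow> F s j \<in> S"
  unfolding family_def by blast

lemma family_eventually:
  "family F \<Longrightarrow> \<eta> > 0 \<Longrightarrow> eventually (\<lambda>s. \<forall>j<M. \<forall>t\<in>T. norm (F s j t - F s0 j t) < \<eta>) (nhds s0)"
  unfolding family_def by blast

lemma family_const: "(\<And>j. j < M \<Longrightarrow> a j \<in> S) \<Longrightarrow> family (\<lambda>s. a)"
  unfolding family_def by simp

lemma family_add:
  assumes "family F" "family H"
  shows "family (\<lambda>s j t. F s j t + H s j t)"
  unfolding family_def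
proof (intro conjI allI impI)
  show "(\<lambda>t. F s j t + H s j t) \<in> S" if "j < M" for s j
    using family_field[OF assms(1) that] family_field[OF assms(2) that] by (rule add_field)
  fix s0 and \<eta> :: real assume \<eta>: "\<eta> > 0"
  then have "\<eta> / 2 > 0" by simp
  from family_eventually[OF assms(1) this] family_eventually[OF assms(2) this]
  show "eventually (\<lambda>s. \<forall>j<M. \<forall>t\<in>T. norm (F s j t + H s j t - (F s0 j t + H s0 j t)) < \<eta>) (nhds s0)"
  proof eventually_elim
    case (elim s)
    show ?case
    proof (intro allI impI ballI)
      fix j t assume "j < M" "t \<in> T"
      then have "norm (F s j t - F s0 j t) < \<eta> / 2" "norm (H s j t - H s0 j t) < \<eta> / 2" using elim by auto
      then show "norm (F s j t + H s j t - (F s0 j t + H s0 j t)) < \<eta>"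
        using norm_triangle_ineq[of "F s j t - F s0 j t" "H s j t - H s0 j t"] by (simp add: algebra_simps)
    qed
  qed
qed

lemma family_sum: "finite I \<Longrightarrow> (\<And>i. i \<in> I \<Longrightarrow> family (H i)) \<Longrightarrow> family (\<lambda>s j t. \<Sum>i\<in>I. H i s j t)"
  by (induction I rule: finite_induct) (auto intro: family_add family_const zero_field)

lemma family_compose:
  assumes "family F" "continuous_on UNIV \<rho>"
  shows "family (\<lambda>s. F (\<rho> s))"
  unfolding family_def
proof (intro conjI allI impI)
  show "F (\<rho> s) j \<in> S" if "j < M" for s j using family_field[OF assms(1) that] .
  fix s0 and \<eta> :: real assume \<eta>: "\<eta> > 0"
  have "filterlim \<rho> (nhds (\<rho> s0)) (nhds s0)"
    using assms(2) by (auto simp: continuous_on_def tendsto_at_iff_tendsto_nhds)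
  from eventually_compose_filterlim[OF family_eventually[OF assms(1) \<eta>] this]
  show "eventually (\<lambda>s. \<forall>j<M. \<forall>t\<in>T. norm (F (\<rho> s) j t - F (\<rho> s0) j t) < \<eta>) (nhds s0)" .
qed

lemma family_scale:
  fixes \<mu> :: "(nat \<Rightarrow> real) \<Rightarrow> real"
  assumes "family F" and \<mu>: "continuous_on UNIV \<mu>" "\<And>s. \<bar>\<mu> s\<bar> \<le> 1"
  shows "family (\<lambda>s j t. \<mu> s *\<^sub>R F s j t)"
  unfolding family_def
proof (intro conjI allI impI)
  show "(\<lambda>t. \<mu> s *\<^sub>R F s j t) \<in> S" if "j < M" for s j
    using family_field[OF assms(1) that] by (rule scaleR_field)
  fix s0 and \<eta> :: real assume \<eta>: "\<eta> > 0"
  obtain r where r: "r > 0" "\<And>j t. j < M \<Longrightarrow> t \<in> T \<Longrightarrow> norm (F s0 j t) \<le> r"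
    using fields_bounded[of M "F s0"] family_field[OF assms(1)] by blast
  have "filterlim \<mu> (nhds (\<mu> s0)) (nhds s0)"
    using \<mu>(1) by (auto simp: continuous_on_def tendsto_at_iff_tendsto_nhds)
  then have "eventually (\<lambda>s. dist (\<mu> s) (\<mu> s0) < \<eta> / (2 * r)) (nhds s0)"
    using \<eta> r(1) by (intro tendstoD) auto
  moreover have "eventually (\<lambda>s. \<forall>j<M. \<forall>t\<in>T. norm (F s j t - F s0 j t) < \<eta> / 2) (nhds s0)"
    using \<eta> by (intro family_eventually assms(1)) simp
  ultimately show "eventually (\<lambda>s. \<forall>j<M. \<forall>t\<in>T. norm (\<mu> s *\<^sub>R F s j t - \<mu> s0 *\<^sub>R F s0 j t) < \<eta>) (nhds s0)"
  proof eventually_elim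
    case (elim s)
    show ?case
    proof (intro allI impI ballI)
      fix j t assume jt: "j < M" "t \<in> T"
      have "\<mu> s *\<^sub>R F s j t - \<mu> s0 *\<^sub>R F s0 j t = \<mu> s *\<^sub>R (F s j t - F s0 j t) + (\<mu> s - \<mu> s0) *\<^sub>R F s0 j t"
        by (simp add: algebra_simps)
      also have "norm \<dots> \<le> \<bar>\<mu> s\<bar> * norm (F s j t - F s0 j t) + \<bar>\<mu> s - \<mu> s0\<bar> * norm (F s0 j t)"
        by (metis norm_triangle_ineq norm_scaleR)
      also have "\<dots> < \<eta> / 2 + \<eta> / 2"
      proof (rule add_less_le_mono)
        have "\<bar>\<mu> s\<bar> * norm (F s j t - F s0 j t) \<le> 1 * norm (F s j t - F s0 j t)"
          by (rule mult_right_mono[OF \<mu>(2) norm_ge_zero])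
        then show "\<bar>\<mu> s\<bar> * norm (F s j t - F s0 j t) < \<eta> / 2" using elim(2) jt by fastforce
        have "\<bar>\<mu> s - \<mu> s0\<bar> * norm (F s0 j t) \<le> \<eta> / (2 * r) * r"
          using elim(1) r(1) r(2)[OF jt] by (intro mult_mono) (auto simp: dist_real_def)
        then show "\<bar>\<mu> s - \<mu> s0\<bar> * norm (F s0 j t) \<le> \<eta> / 2" using r(1) by simp
      qed
      finally show "norm (\<mu> s *\<^sub>R F s j t - \<mu> s0 *\<^sub>R F s0 j t) < \<eta>" by simp
    qed
  qed
qed

lemma family_continuous_at:
  assumes "family F" "j < M" "x \<in> T"
  shows "continuous_on UNIV (\<lambda>s. F s j x)"
  unfolding continuous_on_def tendsto_iff
proof (intro ballI allI impI)
  fix s0 and \<eta> :: real assume "\<eta> > 0"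
  from family_eventually[OF assms(1) this, of s0]
  have "eventually (\<lambda>s. dist (F s j x) (F s0 j x) < \<eta>) (nhds s0)"
    by eventually_elim (use assms in \<open>simp add: dist_norm\<close>)
  then show "eventually (\<lambda>s. dist (F s j x) (F s0 j x) < \<eta>) (at s0)"
    by (simp add: eventually_at_filter eventually_mono)
qed

text \<open>The points \<open>s\<close> of \<open>L\<close> have neighbourhoods \<open>U s\<close> with a common margin near \<open>x\<close> by \<open>LI_open\<close>;
  finitely many of them cover \<open>L\<close>.\<close>

lemma family_margin:
  assumes F: "family F" and x: "x \<in> T" and L: "compact L"
    and LI: "\<And>s. s \<in> L \<Longrightarrow> LI x (\<lambda>j. F s j x)"
  obtains \<eta> G U where "\<eta> > 0" "openin X G" "x \<in> G" "open U" "L \<subseteq> U"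
    "\<And>t s c. t \<in> G \<Longrightarrow> s \<in> U \<Longrightarrow> (\<And>j. j < M \<Longrightarrow> e t * c j = c j \<and> norm (c j - F s j t) < \<eta>) \<Longrightarrow> LI t c"
proof -
  define good where "good \<eta> G U \<longleftrightarrow> \<eta> > 0 \<and> openin X G \<and> x \<in> G \<and> open U \<and>
    (\<forall>t\<in>G. \<forall>s\<in>U. \<forall>c. (\<forall>j<M. e t * c j = c j \<and> norm (c j - F s j t) < \<eta>) \<longrightarrow> LI t c)" for \<eta> G U
  have "\<exists>\<eta> G U. good \<eta> G U \<and> s0 \<in> U" if s0: "s0 \<in> L" for s0
  proof -
    obtain \<eta> G where G: "\<eta> > 0" "openin X G" "x \<in> G"
      "\<And>t c. t \<in> G \<Longrightarrow> (\<And>j. j < M \<Longrightarrow> e t * c j = c j \<and> norm (c j - F s0 j t) < \<eta>) \<Longrightarrow> LI t c"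
      using LI_open[of "F s0" x] family_field[OF F] x LI[OF s0] by blast
    have "\<eta> / 2 > 0" using G(1) by simp
    from family_eventually[OF F this, of s0] obtain U where U: "open U" "s0 \<in> U"
      "\<And>s j t. s \<in> U \<Longrightarrow> j < M \<Longrightarrow> t \<in> T \<Longrightarrow> norm (F s j t - F s0 j t) < \<eta> / 2"
      unfolding eventually_nhds by blast
    have "LI t c" if t: "t \<in> G" and s: "s \<in> U"
      and c: "\<forall>j<M. e t * c j = c j \<and> norm (c j - F s j t) < \<eta> / 2" for t s c
    proof (rule G(4)[OF t])
      fix j assume j: "j < M"
      have "norm (F s j t - F s0 j t) < \<eta> / 2" using U(3)[OF s j] openin_subset[OF G(2)] t by blast
      moreover have "e t * c j = c j" "norm (c j - F s j t) < \<eta> / 2" using c j by auto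
      ultimately show "e t * c j = c j \<and> norm (c j - F s0 j t) < \<eta>"
        using norm_triangle_ineq[of "c j - F s j t" "F s j t - F s0 j t"] by simp
    qed
    then have "good (\<eta> / 2) G U" unfolding good_def using G(1-3) U(1) by auto
    then show ?thesis using U(2) by blast
  qed
  then obtain \<eta> G U where g: "\<And>s. s \<in> L \<Longrightarrow> good (\<eta> s) (G s) (U s)" "\<And>s. s \<in> L \<Longrightarrow> s \<in> U s" by metis
  obtain D where D: "D \<subseteq> L" "finite D" "L \<subseteq> (\<Union>s\<in>D. U s)"
    by (rule compactE_image[OF L, of L U]) (use g good_def in auto)
  define \<eta>' where "\<eta>' = Min (insert 1 (\<eta> ` D))"
  have pos: "\<eta>' > 0" unfolding \<eta>'_def using D(1,2) g(1) by (subst Min_gr_iff) (auto simp: good_def)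
  have le: "\<eta>' \<le> \<eta> s" if "s \<in> D" for s unfolding \<eta>'_def using D(2) that by simp
  define G' where "G' = (if D = {} then T else \<Inter>(G ` D))"
  have G': "openin X G'" "x \<in> G'" unfolding G'_def
    using D(1,2) g(1) x by (auto simp: good_def intro!: openin_Inter)
  have sub: "G' \<subseteq> G s" if "s \<in> D" for s unfolding G'_def using that by auto
  show ?thesis
  proof (rule that[OF pos G'])
    show "open (\<Union>s\<in>D. U s)" using g(1) D(1) by (auto simp: good_def)
    show "L \<subseteq> (\<Union>s\<in>D. U s)" by (rule D(3))
    fix t s c assume t: "t \<in> G'" and s: "s \<in> (\<Union>s\<in>D. U s)"
      and c: "\<And>j. j < M \<Longrightarrow> e t * c j = c j \<and> norm (c j - F s j t) < \<eta>'"
    obtain s0 where s0: "s0 \<in> D" "s \<in> U s0" using s by blast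
    have gd: "good (\<eta> s0) (G s0) (U s0)" using g(1) s0(1) D(1) by blast
    have "\<forall>j<M. e t * c j = c j \<and> norm (c j - F s j t) < \<eta> s0"
      using c le[OF s0(1)] by (meson less_le_trans)
    then show "LI t c" using gd sub[OF s0(1)] t s0(2) unfolding good_def by blast
  qed
qed

lemma LI_margin_compact:
  fixes g :: "(nat \<Rightarrow> real) \<Rightarrow> nat \<Rightarrow> 'u"
  assumes x: "x \<in> T" and L: "compact L" and g: "\<And>j. j < M \<Longrightarrow> continuous_on L (\<lambda>s. g s j)"
    and LI: "\<And>s. s \<in> L \<Longrightarrow> LI x (g s)"
  obtains \<eta> where "\<eta> > 0"
    "\<And>s c. s \<in> L \<Longrightarrow> (\<And>j. j < M \<Longrightarrow> e x * c j = c j \<and> norm (c j - g s j) < \<eta>) \<Longrightarrow> LI x c"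
proof -
  define good where "good \<eta> U \<longleftrightarrow> \<eta> > 0 \<and> open U \<and>
    (\<forall>s\<in>U \<inter> L. \<forall>c. (\<forall>j<M. e x * c j = c j \<and> norm (c j - g s j) < \<eta>) \<longrightarrow> LI x c)" for \<eta> U
  have "\<exists>\<eta> U. good \<eta> U \<and> s0 \<in> U" if s0: "s0 \<in> L" for s0
  proof -
    obtain \<eta> where \<eta>: "\<eta> > 0"
      "\<And>c. (\<And>j. j < M \<Longrightarrow> e x * c j = c j \<and> norm (c j - g s0 j) < \<eta>) \<Longrightarrow> LI x c"
      using LI_margin[OF x LI[OF s0]] by blast
    have "eventually (\<lambda>s. \<forall>j\<in>{..<M}. dist (g s j) (g s0 j) < \<eta> / 2) (at s0 within L)"
    proof (intro eventually_ball_finite finite_lessThan ballI)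
      fix j assume "j \<in> {..<M}"
      then have "((\<lambda>s. g s j) \<longlongrightarrow> g s0 j) (at s0 within L)"
        using g s0 by (simp add: continuous_on_def)
      then show "eventually (\<lambda>s. dist (g s j) (g s0 j) < \<eta> / 2) (at s0 within L)"
        by (rule tendstoD) (use \<eta>(1) in simp)
    qed
    then obtain U where U: "open U" "s0 \<in> U"
      "\<And>s j. s \<in> U \<Longrightarrow> s \<in> L \<Longrightarrow> s \<noteq> s0 \<Longrightarrow> j < M \<Longrightarrow> dist (g s j) (g s0 j) < \<eta> / 2"
      unfolding eventually_at_topological by (metis lessThan_iff)
    have "LI x c" if s: "s \<in> U \<inter> L" and c: "\<forall>j<M. e x * c j = c j \<and> norm (c j - g s j) < \<eta> / 2" for s c
    proof (rule \<eta>(2))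
      fix j assume j: "j < M"
      have "norm (g s j - g s0 j) < \<eta> / 2"
        using U(3)[of s j] s j \<eta>(1) by (cases "s = s0") (auto simp: dist_norm)
      moreover have "e x * c j = c j" "norm (c j - g s j) < \<eta> / 2" using c j by auto
      ultimately show "e x * c j = c j \<and> norm (c j - g s0 j) < \<eta>"
        using norm_triangle_ineq[of "c j - g s j" "g s j - g s0 j"] by simp
    qed
    then have "good (\<eta> / 2) U" unfolding good_def using \<eta>(1) U(1) by auto
    then show ?thesis using U(2) by blast
  qed
  then obtain \<eta> U where gd: "\<And>s. s \<in> L \<Longrightarrow> good (\<eta> s) (U s)" "\<And>s. s \<in> L \<Longrightarrow> s \<in> U s" by metis
  obtain D where D: "D \<subseteq> L" "finite D" "L \<subseteq> (\<Union>s\<in>D. U s)"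
    by (rule compactE_image[OF L, of L U]) (use gd good_def in auto)
  define \<eta>' where "\<eta>' = Min (insert 1 (\<eta> ` D))"
  have pos: "\<eta>' > 0" unfolding \<eta>'_def using D(1,2) gd(1) by (subst Min_gr_iff) (auto simp: good_def)
  have le: "\<eta>' \<le> \<eta> s" if "s \<in> D" for s unfolding \<eta>'_def using D(2) that by simp
  show ?thesis
  proof (rule that[OF pos])
    fix s c assume s: "s \<in> L" and c: "\<And>j. j < M \<Longrightarrow> e x * c j = c j \<and> norm (c j - g s j) < \<eta>'"
    obtain s0 where s0: "s0 \<in> D" "s \<in> U s0" using s D(3) by blast
    have "\<forall>j<M. e x * c j = c j \<and> norm (c j - g s j) < \<eta> s0"
      using c le[OF s0(1)] by (meson less_le_trans)
    moreover have "good (\<eta> s0) (U s0)" using gd(1) s0(1) D(1) by blast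
    ultimately show "LI x c" using s s0(2) unfolding good_def by blast
  qed
qed

text \<open>All families can be moved, by as little as one likes and uniformly over the base space, to
  families left invertible at \<open>x\<close> for all parameters in \<open>L\<close>.\<close>

definition perturbable :: "'x \<Rightarrow> (nat \<Rightarrow> real) set \<Rightarrow> bool"
  where "perturbable x L \<longleftrightarrow> (\<forall>F \<delta>. family F \<longrightarrow> \<delta> > 0 \<longrightarrow>
    (\<exists>H. family H \<and> (\<forall>s. \<forall>j<M. \<forall>t\<in>T. norm (H s j t) \<le> \<delta>) \<and>
      (\<forall>s\<in>L. LI x (\<lambda>j. F s j x + H s j x))))"

lemma perturbableE:
  assumes "perturbable x L" "family F" "\<delta> > 0"
  obtains H where "family H" "\<And>s j t. j < M \<Longrightarrow> t \<in> T \<Longrightarrow> norm (H s j t) \<le> \<delta>"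
    "\<And>s. s \<in> L \<Longrightarrow> LI x (\<lambda>j. F s j x + H s j x)"
proof -
  have "\<exists>H. family H \<and> (\<forall>s. \<forall>j<M. \<forall>t\<in>T. norm (H s j t) \<le> \<delta>) \<and>
      (\<forall>s\<in>L. LI x (\<lambda>j. F s j x + H s j x))"
    using assms unfolding perturbable_def by simp
  then show ?thesis by (elim exE conjE) (rule that, assumption, blast, blast)
qed

lemma perturbable_empty: "perturbable x {}"
  unfolding perturbable_def
  by (auto intro!: exI[of _ "\<lambda>s j t. 0"] family_const zero_field)

text \<open>First make the family good on \<open>L1\<close>. By compactness it stays good there under all further
  perturbations below some margin, so a second one can take care of \<open>L2\<close>.\<close>

lemma perturbable_Un:
  assumes "perturbable x L1" "perturbable x L2" "compact L1" and x: "x \<in> T"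
  shows "perturbable x (L1 \<union> L2)"
  unfolding perturbable_def
proof (intro allI impI)
  fix F and \<delta> :: real assume F: "family F" and \<delta>: "\<delta> > 0"
  then have \<delta>2: "\<delta> / 2 > 0" by simp
  obtain H1 where H1: "family H1" "\<And>s j t. j < M \<Longrightarrow> t \<in> T \<Longrightarrow> norm (H1 s j t) \<le> \<delta> / 2"
    "\<And>s. s \<in> L1 \<Longrightarrow> LI x (\<lambda>j. F s j x + H1 s j x)" by (rule perturbableE[OF assms(1) F \<delta>2]) (rule that)
  let ?F = "\<lambda>s j t. F s j t + H1 s j t"
  have F1: "family ?F" by (rule family_add[OF F H1(1)])
  obtain \<eta> G U where \<eta>: "\<eta> > 0" "openin X G" "x \<in> G" "open U" "L1 \<subseteq> U"
    "\<And>t s c. t \<in> G \<Longrightarrow> s \<in> U \<Longrightarrow> (\<And>j. j < M \<Longrightarrow> e t * c j = c j \<and> norm (c j - ?F s j t) < \<eta>) \<Longrightarrow> LI t c"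
    using family_margin[OF F1 x assms(3) H1(3)] by blast
  have "min (\<eta> / 2) (\<delta> / 2) > 0" using \<eta>(1) \<delta> by simp
  then obtain H2 where H2: "family H2"
    "\<And>s j t. j < M \<Longrightarrow> t \<in> T \<Longrightarrow> norm (H2 s j t) \<le> min (\<eta> / 2) (\<delta> / 2)"
    "\<And>s. s \<in> L2 \<Longrightarrow> LI x (\<lambda>j. ?F s j x + H2 s j x)" by (rule perturbableE[OF assms(2) F1]) (rule that)
  let ?H = "\<lambda>s j t. H1 s j t + H2 s j t"
  have "family ?H" by (rule family_add[OF H1(1) H2(1)])
  moreover have "norm (?H s j t) \<le> \<delta>" if "j < M" "t \<in> T" for s j t
    using norm_triangle_ineq[of "H1 s j t" "H2 s j t"] H1(2)[OF that, of s] H2(2)[OF that, of s] by simp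
  moreover have "LI x (\<lambda>j. F s j x + ?H s j x)" if s: "s \<in> L1 \<union> L2" for s
  proof (cases "s \<in> L2")
    case True
    then show ?thesis using H2(3)[of s] by (simp add: add.assoc)
  next
    case False
    then have sU: "s \<in> U" using s \<eta>(5) by blast
    have bd: "e x * (F s j x + ?H s j x) = F s j x + ?H s j x \<and>
        norm (F s j x + ?H s j x - ?F s j x) < \<eta>" if j: "j < M" for j
      using field[OF family_field[OF F j] x] field[OF family_field[OF H1(1) j] x]
        field[OF family_field[OF H2(1) j] x] H2(2)[OF j x, of s] \<eta>(1)
      by (simp add: distrib_left)
    show ?thesis by (rule \<eta>(6)[OF \<eta>(3) sU]) (rule bd)
  qed
  ultimately show "\<exists>H. family H \<and> (\<forall>s. \<forall>j<M. \<forall>t\<in>T. norm (H s j t) \<le> \<delta>) \<and>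
      (\<forall>s\<in>L1 \<union> L2. LI x (\<lambda>j. F s j x + H s j x))" by (intro exI[of _ ?H]) blast
qed

lemma perturbable_Union:
  assumes "finite C" "\<And>L. L \<in> C \<Longrightarrow> perturbable x L \<and> compact L" "x \<in> T"
  shows "perturbable x (\<Union>C)"
  using assms(1,2) by (induction C rule: finite_induct) (auto intro: perturbable_empty perturbable_Un assms(3))

end

section \<open>Perturbation over simplices\<close>

text \<open>The simplex with vertex set \<open>c\<close> in barycentric coordinates. All simplices are subsets of the
  same space, so a complex is a union of such sets.\<close>

definition std_simplex :: "nat set \<Rightarrow> (nat \<Rightarrow> real) set"
  where "std_simplex c = {s. (\<forall>n. 0 \<le> s n) \<and> (\<forall>n. n \<notin> c \<longrightarrow> s n = 0) \<and> (\<Sum>n\<in>c. s n) = 1}"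

lemma std_simplex_le_1:
  assumes "finite c" "s \<in> std_simplex c"
  shows "s n \<le> 1"
proof (cases "n \<in> c")
  case True
  then show ?thesis using member_le_sum[of n c s] assms unfolding std_simplex_def by simp
next
  case False
  then show ?thesis using assms unfolding std_simplex_def by simp
qed

lemma compact_box:
  fixes B :: "nat \<Rightarrow> real set"
  assumes "\<And>n. compact (B n)"
  shows "compact {s. \<forall>n. s n \<in> B n}"
proof -
  have "compactin (product_topology (\<lambda>_. euclidean) UNIV) (PiE UNIV B)"
    unfolding compactin_PiE using assms by simp
  then show ?thesis by (simp add: euclidean_product_topology PiE_UNIV_domain Pi_def)
qed

lemma compact_std_simplex:
  assumes "finite c"
  shows "compact (std_simplex c)"
proof -
  have "closed {s :: nat \<Rightarrow> real. (\<forall>n. 0 \<le> s n) \<and> (\<Sum>n\<in>c. s n) = 1}"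
    by (intro closed_Collect_conj closed_Collect_all closed_Collect_le closed_Collect_eq continuous_intros)
       auto
  moreover have "compact {s :: nat \<Rightarrow> real. \<forall>n. s n \<in> (if n \<in> c then {0..1} else {0})}"
    by (rule compact_box) simp
  ultimately have "compact ({s :: nat \<Rightarrow> real. \<forall>n. s n \<in> (if n \<in> c then {0..1} else {0})} \<inter>
      {s. (\<forall>n. 0 \<le> s n) \<and> (\<Sum>n\<in>c. s n) = 1})"
    by (rule compact_Int_closed[rotated])
  also have "{s :: nat \<Rightarrow> real. \<forall>n. s n \<in> (if n \<in> c then {0..1} else {0})} \<inter>
      {s. (\<forall>n. 0 \<le> s n) \<and> (\<Sum>n\<in>c. s n) = 1} = std_simplex c" (is "?L = ?R")
  proof
    show "?R \<subseteq> ?L"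
    proof
      fix s assume s: "s \<in> ?R"
      then show "s \<in> ?L" using std_simplex_le_1[OF assms s] unfolding std_simplex_def by auto
    qed
    show "?L \<subseteq> ?R" unfolding std_simplex_def by (auto split: if_splits)
  qed
  finally show ?thesis .
qed

text \<open>A partition of unity on \<open>L\<close>, subordinate to a cover by balls on which \<open>D\<close> varies little. The
  weights are divided by \<open>max m (H s)\<close> rather than by their sum \<open>H s\<close>, so that they are defined
  and continuous everywhere.\<close>

lemma finite_rank_approximation:
  fixes D :: "(nat \<Rightarrow> real) \<Rightarrow> nat \<Rightarrow> 'u :: real_normed_vector"
  assumes L: "compact L" and D: "\<And>j. j < M \<Longrightarrow> continuous_on L (\<lambda>s. D s j)" and \<eta>: "\<eta> > 0"
  obtains l :: "(nat \<Rightarrow> real) \<Rightarrow> (nat \<Rightarrow> real) \<Rightarrow> real" and A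
  where "finite A" "A \<subseteq> L" "\<And>i. continuous_on UNIV (l i)" "\<And>i s. 0 \<le> l i s"
    "\<And>s. (\<Sum>i\<in>A. l i s) \<le> 1"
    "\<And>s j. s \<in> L \<Longrightarrow> j < M \<Longrightarrow> norm ((\<Sum>i\<in>A. l i s *\<^sub>R D i j) - D s j) \<le> \<eta>"
proof -
  have "\<exists>r>0. \<forall>s'\<in>L. dist s' s < r \<longrightarrow> (\<forall>j<M. dist (D s' j) (D s j) < \<eta>)" if s: "s \<in> L" for s
  proof -
    have "eventually (\<lambda>s'. \<forall>j\<in>{..<M}. dist (D s' j) (D s j) < \<eta>) (at s within L)"
    proof (intro eventually_ball_finite finite_lessThan ballI)
      fix j assume "j \<in> {..<M}"
      then have "((\<lambda>s. D s j) \<longlongrightarrow> D s j) (at s within L)" using D s by (simp add: continuous_on_def)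
      then show "eventually (\<lambda>s'. dist (D s' j) (D s j) < \<eta>) (at s within L)" by (rule tendstoD) (rule \<eta>)
    qed
    then obtain r where r: "r > 0" "\<And>s'. s' \<in> L \<Longrightarrow> s' \<noteq> s \<Longrightarrow> dist s' s < r \<Longrightarrow> \<forall>j\<in>{..<M}. dist (D s' j) (D s j) < \<eta>"
      unfolding eventually_at by blast
    have "\<forall>j<M. dist (D s' j) (D s j) < \<eta>" if "s' \<in> L" "dist s' s < r" for s'
      using r(2)[OF that(1) _ that(2)] \<eta> by (cases "s' = s") auto
    then show ?thesis using r(1) by blast
  qed
  then obtain r where r: "\<And>s. s \<in> L \<Longrightarrow> r s > 0"
    "\<And>s s' j. s \<in> L \<Longrightarrow> s' \<in> L \<Longrightarrow> dist s' s < r s \<Longrightarrow> j < M \<Longrightarrow> dist (D s' j) (D s j) < \<eta>"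
    by metis
  obtain A where A: "A \<subseteq> L" "finite A" "L \<subseteq> (\<Union>s\<in>A. ball s (r s))"
    by (rule compactE_image[OF L, of L "\<lambda>s. ball s (r s)"]) (use r(1) in auto)
  define h where "h i s = max 0 (r i - dist s i)" for i s
  have hc: "continuous_on UNIV (h i)" for i
    unfolding h_def[abs_def] by (intro continuous_intros)
  have h0: "h i s \<ge> 0" for i s unfolding h_def by simp
  define H where "H s = (\<Sum>i\<in>A. h i s)" for s
  have Hc: "continuous_on UNIV H" unfolding H_def[abs_def] by (intro continuous_on_sum hc)
  have Hpos: "H s > 0" if s: "s \<in> L" for s
  proof -
    obtain i where i: "i \<in> A" "dist i s < r i" using A(3) s by auto
    then have "h i s > 0" unfolding h_def by (simp add: dist_commute)
    also have "h i s \<le> H s" unfolding H_def using i(1) A(2) h0 by (intro member_le_sum) auto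
    finally show ?thesis .
  qed
  obtain m where m: "m > 0" "\<And>s. s \<in> L \<Longrightarrow> m \<le> H s"
  proof (cases "L = {}")
    case True
    then show ?thesis using that[of 1] by simp
  next
    case False
    have "continuous_on L H" using Hc by (rule continuous_on_subset) simp
    from continuous_attains_inf[OF L False this]
    obtain s0 where "s0 \<in> L" "\<forall>s\<in>L. H s0 \<le> H s" by blast
    then show ?thesis using that[of "H s0"] Hpos by blast
  qed
  define l where "l i s = h i s / max m (H s)" for i s
  have mp: "max m (H s) > 0" for s using m(1) by simp
  show ?thesis
  proof (rule that[OF A(2,1), of l])
    show "continuous_on UNIV (l i)" for i
      unfolding l_def[abs_def] using m(1)
      by (intro continuous_intros hc Hc) (auto simp: max_def)
    show "0 \<le> l i s" for i s unfolding l_def using h0 mp[of s] by simp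
    have sum: "(\<Sum>i\<in>A. l i s) = H s / max m (H s)" for s
      unfolding l_def H_def by (rule sum_divide_distrib[symmetric])
    show "(\<Sum>i\<in>A. l i s) \<le> 1" for s unfolding sum using mp[of s] by (simp add: divide_le_eq)
    fix s j assume s: "s \<in> L" and j: "j < M"
    have one: "(\<Sum>i\<in>A. l i s) = 1" unfolding sum using m(2)[OF s] Hpos[OF s] by (simp add: max_absorb2)
    have "(\<Sum>i\<in>A. l i s *\<^sub>R D i j) - D s j = (\<Sum>i\<in>A. l i s *\<^sub>R D i j) - (\<Sum>i\<in>A. l i s) *\<^sub>R D s j"
      by (simp add: one)
    also have "\<dots> = (\<Sum>i\<in>A. l i s *\<^sub>R (D i j - D s j))"
      by (simp add: scaleR_sum_left sum_subtractf scaleR_diff_right)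
    also have "norm \<dots> \<le> (\<Sum>i\<in>A. l i s * \<eta>)"
    proof (rule sum_norm_le)
      fix i assume i: "i \<in> A"
      show "norm (l i s *\<^sub>R (D i j - D s j)) \<le> l i s * \<eta>"
      proof (cases "h i s > 0")
        case True
        then have "dist s i < r i" unfolding h_def by (simp split: if_splits add: max_def)
        then have "norm (D i j - D s j) \<le> \<eta>"
          using r(2)[of i s j] i A(1) s j by (force simp: dist_norm norm_minus_commute)
        moreover have "0 \<le> l i s" unfolding l_def using h0 mp[of s] by simp
        ultimately show ?thesis by (simp add: mult_left_mono)
      next
        case False
        then show ?thesis using h0[of i s] unfolding l_def by simp
      qed
    qed
    also have "\<dots> = (\<Sum>i\<in>A. l i s) * \<eta>" by (rule sum_distrib_right[symmetric])
    finally show "norm ((\<Sum>i\<in>A. l i s *\<^sub>R D i j) - D s j) \<le> \<eta>" by (simp add: one)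
  qed
qed

text \<open>The assumption \<open>dens\<close> is the form in which the stable rank of \<open>C([0,1]\<^sup>k) \<otimes> \<A>\<^sub>x\<close> enters, with
  simplices in place of the cube.\<close>

locale dense_tuples = shifted_tuples X e S M p P
  for X :: "'x topology" and e :: "'x \<Rightarrow> 'u :: star_banach_algebra" and S :: "('x \<Rightarrow> 'u) set"
    and M :: nat and p :: "nat \<Rightarrow> complex" and P :: real +
  fixes k :: nat
  assumes regular: "regular_space X"
    and dens: "x \<in> topspace X \<Longrightarrow> finite c \<Longrightarrow> card c \<le> k + 1 \<Longrightarrow>
      (\<And>j. j < M \<Longrightarrow> continuous_on (std_simplex c) (\<lambda>s. f s j)) \<Longrightarrow>
      (\<And>s j. s \<in> std_simplex c \<Longrightarrow> j < M \<Longrightarrow> e x * f s j = f s j) \<Longrightarrow> \<delta> > 0 \<Longrightarrow>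
      \<exists>g. (\<forall>j<M. continuous_on (std_simplex c) (\<lambda>s. g s j)) \<and>
        (\<forall>s\<in>std_simplex c. (\<exists>d. (\<Sum>j<M. d j * (g s j + cx (p j) * e x)) = e x) \<and>
          (\<forall>j<M. e x * g s j = g s j \<and> norm (g s j - f s j) < \<delta>))"
begin

text \<open>At the point \<open>x\<close> the family is a continuous map from the simplex to tuples over the fibre,
  and \<open>dens\<close> yields a left invertible map \<open>g\<close> near it. The difference of the two is approximated
  by a finite sum of constant tuples with continuous weights, and the constants are lifted to
  fields that are small everywhere.\<close>

lemma perturbable_simplex:
  assumes x: "x \<in> T" and c: "finite c" "card c \<le> k + 1"
  shows "perturbable x (std_simplex c)"
  unfolding perturbable_def
proof (intro allI impI)
  let ?L = "std_simplex c"
  fix F and \<delta> :: real assume F: "family F" and \<delta>: "\<delta> > 0"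
  have L: "compact ?L" using c(1) by (rule compact_std_simplex)
  have Fc: "continuous_on ?L (\<lambda>s. F s j x)" if "j < M" for j
    using family_continuous_at[OF F that x] by (rule continuous_on_subset) simp
  have Fe: "e x * F s j x = F s j x" if "j < M" for s j using field[OF family_field[OF F that] x] .
  have \<delta>2: "\<delta> / 2 > 0" using \<delta> by simp
  obtain g where gc: "\<And>j. j < M \<Longrightarrow> continuous_on ?L (\<lambda>s. g s j)"
    and gL: "\<And>s. s \<in> ?L \<Longrightarrow> LI x (g s)"
    and ge: "\<And>s j. s \<in> ?L \<Longrightarrow> j < M \<Longrightarrow> e x * g s j = g s j"
    and gn: "\<And>s j. s \<in> ?L \<Longrightarrow> j < M \<Longrightarrow> norm (g s j - F s j x) < \<delta> / 2"
    using dens[OF x c, of "\<lambda>s j. F s j x" "\<delta> / 2", OF Fc Fe \<delta>2] unfolding LI_def by blast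
  obtain \<eta> where \<eta>: "\<eta> > 0"
    "\<And>s c. s \<in> ?L \<Longrightarrow> (\<And>j. j < M \<Longrightarrow> e x * c j = c j \<and> norm (c j - g s j) < \<eta>) \<Longrightarrow> LI x c"
    using LI_margin_compact[OF x L gc gL] by blast
  define D where "D s j = g s j - F s j x" for s j
  have Dc: "continuous_on ?L (\<lambda>s. D s j)" if "j < M" for j
    unfolding D_def using gc Fc that by (intro continuous_intros) auto
  have \<eta>3: "\<eta> / 3 > 0" using \<eta>(1) by simp
  obtain l A where A: "finite A" "A \<subseteq> ?L" "\<And>i. continuous_on UNIV (l i)" "\<And>i s. 0 \<le> l i s"
    "\<And>s. (\<Sum>i\<in>A. l i s) \<le> 1"
    "\<And>s j. s \<in> ?L \<Longrightarrow> j < M \<Longrightarrow> norm ((\<Sum>i\<in>A. l i s *\<^sub>R D i j) - D s j) \<le> \<eta> / 3"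
    by (rule finite_rank_approximation[where M = M and D = D, OF L Dc \<eta>3]) (assumption, rule that)
  define \<zeta> where "\<zeta> = min (\<delta> / 2) (\<eta> / 3)"
  have \<zeta>: "\<zeta> > 0" "\<zeta> \<le> \<delta> / 2" "\<zeta> \<le> \<eta> / 3" using \<delta> \<eta>(1) unfolding \<zeta>_def by auto
  have "\<exists>a. a \<in> S \<and> norm (a x - D i j) < \<zeta> \<and> (\<forall>t\<in>T. norm (a t) \<le> \<delta>)" if i: "i \<in> A" and j: "j < M" for i j
  proof -
    have iL: "i \<in> ?L" using i A(2) by blast
    have "e x * D i j = D i j" unfolding D_def by (simp add: right_diff_distrib ge[OF iL j] Fe[OF j])
    then obtain a where a: "a \<in> S" "norm (a x - D i j) < \<zeta>" "\<And>t. t \<in> T \<Longrightarrow> norm (a t) \<le> norm (D i j) + \<zeta>"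
      using lift_field[OF x _ \<zeta>(1)] by blast
    have "norm (D i j) + \<zeta> \<le> \<delta>" using gn[OF iL j] \<zeta>(2) unfolding D_def by simp
    then show ?thesis using a by (meson order_trans)
  qed
  then obtain v where v: "\<And>i j. i \<in> A \<Longrightarrow> j < M \<Longrightarrow> v i j \<in> S"
    "\<And>i j. i \<in> A \<Longrightarrow> j < M \<Longrightarrow> norm (v i j x - D i j) < \<zeta>"
    "\<And>i j t. i \<in> A \<Longrightarrow> j < M \<Longrightarrow> t \<in> T \<Longrightarrow> norm (v i j t) \<le> \<delta>" by metis
  define H where "H s j t = (\<Sum>i\<in>A. l i s *\<^sub>R v i j t)" for s j t
  have l1: "\<bar>l i s\<bar> \<le> 1" if "i \<in> A" for i s
  proof -
    have "l i s \<le> (\<Sum>i\<in>A. l i s)" by (rule member_le_sum) (use that A(1,4) in auto)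
    then show ?thesis using A(5)[of s] A(4)[of i s] by simp
  qed
  have fH: "family H"
    unfolding H_def[abs_def]
  proof (rule family_sum[OF A(1)])
    fix i assume i: "i \<in> A"
    show "family (\<lambda>s j t. l i s *\<^sub>R v i j t)"
      by (rule family_scale[OF family_const A(3) l1[OF i]]) (rule v(1)[OF i])
  qed
  have Hn: "norm (H s j t) \<le> \<delta>" if j: "j < M" and t: "t \<in> T" for s j t
  proof -
    have "norm (H s j t) \<le> (\<Sum>i\<in>A. l i s * \<delta>)"
      unfolding H_def
    proof (rule sum_norm_le)
      fix i assume "i \<in> A"
      then show "norm (l i s *\<^sub>R v i j t) \<le> l i s * \<delta>" using v(3) j t A(4) by (simp add: mult_left_mono)
    qed
    also have "\<dots> = (\<Sum>i\<in>A. l i s) * \<delta>" by (rule sum_distrib_right[symmetric])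
    also have "\<dots> \<le> 1 * \<delta>" by (rule mult_right_mono[OF A(5)]) (use \<delta> in simp)
    finally show ?thesis by simp
  qed
  have HL: "LI x (\<lambda>j. F s j x + H s j x)" if s: "s \<in> ?L" for s
  proof (rule \<eta>(2)[OF s])
    fix j assume j: "j < M"
    have "norm (H s j x - (\<Sum>i\<in>A. l i s *\<^sub>R D i j)) = norm (\<Sum>i\<in>A. l i s *\<^sub>R (v i j x - D i j))"
      unfolding H_def by (simp add: sum_subtractf scaleR_diff_right)
    also have "\<dots> \<le> (\<Sum>i\<in>A. l i s * \<zeta>)"
    proof (rule sum_norm_le)
      fix i assume "i \<in> A"
      then have "norm (v i j x - D i j) \<le> \<zeta>" using v(2) j by (simp add: less_imp_le)
      then show "norm (l i s *\<^sub>R (v i j x - D i j)) \<le> l i s * \<zeta>" using A(4) by (simp add: mult_left_mono)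
    qed
    also have "\<dots> = (\<Sum>i\<in>A. l i s) * \<zeta>" by (rule sum_distrib_right[symmetric])
    also have "\<dots> \<le> 1 * \<zeta>" by (rule mult_right_mono[OF A(5)]) (use \<zeta> in simp)
    finally have h1: "norm (H s j x - (\<Sum>i\<in>A. l i s *\<^sub>R D i j)) \<le> \<eta> / 3" using \<zeta>(3) by simp
    have eq: "F s j x + H s j x - g s j =
        (H s j x - (\<Sum>i\<in>A. l i s *\<^sub>R D i j)) + ((\<Sum>i\<in>A. l i s *\<^sub>R D i j) - D s j)"
      unfolding D_def[of s j] by simp
    have "norm (F s j x + H s j x - g s j) \<le> \<eta> / 3 + \<eta> / 3"
      unfolding eq by (rule norm_triangle_mono[OF h1 A(6)[OF s j]])
    moreover have "e x * H s j x = H s j x"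
      using field[OF family_field[OF fH j] x] .
    ultimately show "e x * (F s j x + H s j x) = F s j x + H s j x \<and> norm (F s j x + H s j x - g s j) < \<eta>"
      using \<eta>(1) Fe[OF j] by (simp add: distrib_left)
  qed
  show "\<exists>H. family H \<and> (\<forall>s. \<forall>j<M. \<forall>t\<in>T. norm (H s j t) \<le> \<delta>) \<and>
      (\<forall>s\<in>?L. LI x (\<lambda>j. F s j x + H s j x))"
    by (intro exI[of _ H] conjI allI impI ballI fH) (erule (1) Hn, erule HL)
qed

section \<open>Extension over the levels of a complex\<close>

subsection \<open>The cone with a new vertex\<close>

text \<open>The cone, with vertex \<open>N\<close>, over the complex of those simplices that have vertices below \<open>N\<close>
  with \<open>x \<in> C n\<close> and at most one vertex on each level. The base consists of the points with
  \<open>s N = 0\<close>.\<close>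

definition vertex_star :: "nat \<Rightarrow> (nat \<Rightarrow> nat) \<Rightarrow> (nat \<Rightarrow> 'x set) \<Rightarrow> 'x \<Rightarrow> (nat \<Rightarrow> real) set"
  where "vertex_star N lev C x =
    \<Union>(std_simplex ` {c. c \<subseteq> {..N} \<and> (\<forall>n\<in>c. n < N \<longrightarrow> x \<in> C n) \<and> inj_on lev (c - {N})})"

text \<open>A simplex of the cone has at most \<open>j\<close> vertices in the base, one for each level below \<open>j\<close>,
  and hence at most \<open>j + 1 \<le> k + 1\<close> in all. This is where the number of levels is limited by \<open>k\<close>.\<close>

lemma vertex_star_perturbable:
  assumes x: "x \<in> T" and lev: "\<And>n. n < N \<Longrightarrow> lev n < j" and j: "j \<le> k"
  shows "compact (vertex_star N lev C x)" "perturbable x (vertex_star N lev C x)"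
proof -
  let ?I = "{c. c \<subseteq> {..N} \<and> (\<forall>n\<in>c. n < N \<longrightarrow> x \<in> C n) \<and> inj_on lev (c - {N})}"
  have "finite ?I" by (rule finite_subset[of _ "Pow {..N}"]) auto
  then have fin: "finite (std_simplex ` ?I)" by simp
  have each: "perturbable x L \<and> compact L" if L: "L \<in> std_simplex ` ?I" for L
  proof -
    obtain c where c: "L = std_simplex c" "c \<subseteq> {..N}" "inj_on lev (c - {N})" using L by blast
    have fc: "finite c" using c(2) by (rule finite_subset) simp
    have "lev ` (c - {N}) \<subseteq> {..<j}" using c(2) lev by (force simp: less_le)
    then have "card (lev ` (c - {N})) \<le> j" using card_mono[of "{..<j}"] by fastforce
    then have "card (c - {N}) \<le> j" using card_image[OF c(3)] by simp
    moreover have "card c \<le> card (c - {N}) + 1" using card_Diff1_le card_Diff_singleton_if[of c N] fc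
      by (cases "N \<in> c") auto
    ultimately have "card c \<le> k + 1" using j by simp
    then show ?thesis using perturbable_simplex[OF x fc] compact_std_simplex[OF fc] c(1) by simp
  qed
  show "perturbable x (vertex_star N lev C x)"
    unfolding vertex_star_def by (rule perturbable_Union[OF fin each x])
  show "compact (vertex_star N lev C x)"
    unfolding vertex_star_def using fin each by (intro compact_Union) auto
qed

text \<open>The perturbation vanishes on the base \<open>s N = 0\<close>, so that nothing is changed on simplices
  without the new vertex. The closed set \<open>C'\<close> is a neighbourhood of \<open>x\<close> that avoids every \<open>C n\<close>
  with \<open>x \<notin> C n\<close>: for \<open>t \<in> C'\<close> the cone at \<open>x\<close> contains the cone at \<open>t\<close>.\<close>

lemma extend_family:
  assumes F: "family F" and x: "x \<in> T" and lev: "\<And>n. n < N \<Longrightarrow> lev n < j" and j: "j \<le> k"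
    and C: "\<And>n. n < N \<Longrightarrow> closedin X (C n)" and \<delta>: "\<delta> > 0"
    and base: "\<And>s. s \<in> vertex_star N lev C x \<Longrightarrow> s N = 0 \<Longrightarrow> LI x (\<lambda>i. F s i x)"
  shows "\<exists>H W C'. family H \<and> (\<forall>s i t. s N = 0 \<longrightarrow> H s i t = 0) \<and>
    (\<forall>s i t. i < M \<longrightarrow> t \<in> T \<longrightarrow> norm (H s i t) \<le> \<delta>) \<and>
    openin X W \<and> closedin X C' \<and> x \<in> W \<and> W \<subseteq> C' \<and>
    (\<forall>t\<in>C'. \<forall>s\<in>vertex_star N lev C x. LI t (\<lambda>i. F s i t + H s i t)) \<and>
    (\<forall>t\<in>C'. \<forall>n<N. t \<in> C n \<longrightarrow> x \<in> C n)"
proof -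
  let ?L = "vertex_star N lev C x"
  have cL: "compact ?L" and pL: "perturbable x ?L"
    by (rule vertex_star_perturbable[OF x lev j]; assumption)+
  have "closed {s :: nat \<Rightarrow> real. s N = 0}" by (intro closed_Collect_eq continuous_intros) auto
  then have c0: "compact (?L \<inter> {s. s N = 0})" by (rule compact_Int_closed[OF cL])
  have LI0: "LI x (\<lambda>i. F s i x)" if "s \<in> ?L \<inter> {s. s N = 0}" for s using base that by blast
  \<comment> \<open>Near the base of the cone every perturbation below \<open>\<eta>\<close> keeps left invertibility at \<open>x\<close>.\<close>
  obtain \<eta> G0 U where \<eta>: "\<eta> > 0" "openin X G0" "x \<in> G0" "open U" "?L \<inter> {s. s N = 0} \<subseteq> U"
    "\<And>t s c. t \<in> G0 \<Longrightarrow> s \<in> U \<Longrightarrow> (\<And>i. i < M \<Longrightarrow> e t * c i = c i \<and> norm (c i - F s i t) < \<eta>) \<Longrightarrow> LI t c"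
    using family_margin[OF F x c0 LI0] by blast
  have nonneg: "s N \<ge> 0" if "s \<in> ?L" for s using that unfolding vertex_star_def std_simplex_def by auto
  \<comment> \<open>By compactness the part of the cone below some height \<open>\<theta>\<close> lies in this neighbourhood.\<close>
  obtain \<theta> where \<theta>: "\<theta> > 0" "\<And>s. s \<in> ?L \<Longrightarrow> s N < \<theta> \<Longrightarrow> s \<in> U"
  proof (cases "?L - U = {}")
    case True
    then show ?thesis using that[of 1] by auto
  next
    case False
    have "compact (?L - U)" using cL \<eta>(4) by (rule compact_diff)
    moreover have "continuous_on (?L - U) (\<lambda>s. s N)" by (rule continuous_on_subset[of UNIV]) auto
    ultimately obtain s0 where s0: "s0 \<in> ?L - U" "\<forall>s\<in>?L - U. s0 N \<le> s N"
      using continuous_attains_inf[of "?L - U" "\<lambda>s. s N"] False by blast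
    have "s0 N \<noteq> 0" using s0(1) \<eta>(5) by blast
    then have "s0 N > 0" using nonneg s0(1) by fastforce
    then show ?thesis using that[of "s0 N"] s0(2) by force
  qed
  define \<delta>' where "\<delta>' = min \<delta> (\<eta> / 2)"
  have \<delta>': "\<delta>' > 0" "\<delta>' \<le> \<delta>" "\<delta>' < \<eta>" using \<delta> \<eta>(1) unfolding \<delta>'_def by auto
  obtain H0 where H0: "family H0" "\<And>s i t. i < M \<Longrightarrow> t \<in> T \<Longrightarrow> norm (H0 s i t) \<le> \<delta>'"
    "\<And>s. s \<in> ?L \<Longrightarrow> LI x (\<lambda>i. F s i x + H0 s i x)"
    by (rule perturbableE[OF pL F \<delta>'(1)]) (rule that)
  \<comment> \<open>The perturbation \<open>H0\<close> acts fully above height \<open>\<theta>\<close> and is faded out below, where any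
    perturbation of its size is harmless.\<close>
  define \<mu> where "\<mu> s = min 1 (max 0 (s N / \<theta>))" for s :: "nat \<Rightarrow> real"
  have \<mu>c: "continuous_on UNIV \<mu>" unfolding \<mu>_def[abs_def] using \<theta>(1) by (intro continuous_intros) auto
  have \<mu>1: "\<bar>\<mu> s\<bar> \<le> 1" for s unfolding \<mu>_def by auto
  define H where "H s i t = \<mu> s *\<^sub>R H0 s i t" for s i t
  have fH: "family H" unfolding H_def[abs_def] by (rule family_scale[OF H0(1) \<mu>c \<mu>1])
  have Hn: "norm (H s i t) \<le> \<delta>'" if "i < M" "t \<in> T" for s i t
  proof -
    have "norm (H s i t) \<le> 1 * norm (H0 s i t)"
      unfolding H_def norm_scaleR by (rule mult_right_mono[OF \<mu>1 norm_ge_zero])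
    then show ?thesis using H0(2)[OF that, of s] by simp
  qed
  have HL: "LI x (\<lambda>i. F s i x + H s i x)" if s: "s \<in> ?L" for s
  proof (cases "s N < \<theta>")
    case True
    show ?thesis
    proof (rule \<eta>(6)[OF \<eta>(3) \<theta>(2)[OF s True]])
      fix i assume i: "i < M"
      show "e x * (F s i x + H s i x) = F s i x + H s i x \<and> norm (F s i x + H s i x - F s i x) < \<eta>"
        using field[OF family_field[OF F i] x, of s] field[OF family_field[OF fH i] x, of s] Hn[OF i x, of s] \<delta>'(3)
        by (simp add: distrib_left)
    qed
  next
    case False
    then have "\<mu> s = 1" using \<theta>(1) unfolding \<mu>_def by simp
    then show ?thesis using H0(3)[OF s] unfolding H_def by simp
  qed
  obtain \<eta>1 G1 U1 where G1: "\<eta>1 > 0" "openin X G1" "x \<in> G1" "open U1" "?L \<subseteq> U1"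
    "\<And>t s c. t \<in> G1 \<Longrightarrow> s \<in> U1 \<Longrightarrow>
      (\<And>i. i < M \<Longrightarrow> e t * c i = c i \<and> norm (c i - (F s i t + H s i t)) < \<eta>1) \<Longrightarrow> LI t c"
    using family_margin[OF family_add[OF F fH] x cL HL] by blast
  define G where "G = G1 \<inter> (T - \<Union>(C ` {n. n < N \<and> x \<notin> C n}))"
  have "closedin X (\<Union>(C ` {n. n < N \<and> x \<notin> C n}))" by (rule closedin_Union) (auto simp: C)
  then have "openin X G" unfolding G_def using G1(2) by (intro openin_Int) (auto intro: openin_diff)
  moreover have "x \<in> G" unfolding G_def using x G1(3) by auto
  ultimately obtain W C' where W: "openin X W" "closedin X C'" "x \<in> W" "W \<subseteq> C'" "C' \<subseteq> G"
    using regular unfolding neighbourhood_base_of_closedin[symmetric] neighbourhood_base_of by metis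
  show ?thesis
  proof (rule exI[of _ H], rule exI[of _ W], rule exI[of _ C'], intro conjI allI impI ballI fH W(1-4))
    show "H s i t = 0" if "s N = 0" for s i t using that unfolding H_def \<mu>_def by simp
    show "norm (H s i t) \<le> \<delta>" if "i < M" "t \<in> T" for s i t using Hn[OF that, of s] \<delta>'(2) by simp
    show "LI t (\<lambda>i. F s i t + H s i t)" if t: "t \<in> C'" and s: "s \<in> ?L" for t s
    proof (rule G1(6))
      show tG: "t \<in> G1" using t W(5) unfolding G_def by blast
      show "s \<in> U1" using s G1(5) by blast
      fix i assume i: "i < M"
      have "t \<in> T" using tG openin_subset[OF G1(2)] by blast
      then show "e t * (F s i t + H s i t) = F s i t + H s i t \<and>
          norm (F s i t + H s i t - (F s i t + H s i t)) < \<eta>1"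
        using field[OF family_field[OF family_add[OF F fH] i]] G1(1) by simp
    qed
    show "x \<in> C n" if "t \<in> C'" "n < N" "t \<in> C n" for t n using that W(5) unfolding G_def by blast
  qed
qed

end

subsection \<open>Adding the levels one by one\<close>

text \<open>At most one vertex on each level is used, as in a chain of simplices of a barycentric
  subdivision.\<close>

definition chain_supported :: "nat \<Rightarrow> (nat \<Rightarrow> nat) \<Rightarrow> (nat \<Rightarrow> real) \<Rightarrow> bool"
  where "chain_supported N lev s \<longleftrightarrow>
    (\<forall>n<N. \<forall>n'<N. s n \<noteq> 0 \<longrightarrow> s n' \<noteq> 0 \<longrightarrow> lev n = lev n' \<longrightarrow> n = n')"

text \<open>The perturbations for the various new vertices \<open>N + l\<close> are all constructed on a cone with
  vertex \<open>N\<close>; this map carries the cone with vertex \<open>N + l\<close> onto it.\<close>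

definition move_vertex :: "nat \<Rightarrow> nat \<Rightarrow> (nat \<Rightarrow> real) \<Rightarrow> nat \<Rightarrow> real"
  where "move_vertex N l s = (\<lambda>n. if n < N then s n else if n = N then s (N + l) else 0)"

lemma continuous_move_vertex: "continuous_on UNIV (move_vertex N l)"
proof -
  have "continuous_on UNIV (\<lambda>s. move_vertex N l s n)" for n
    unfolding move_vertex_def by (cases "n < N"; cases "n = N") auto
  then show ?thesis by (rule continuous_on_coordinatewise_then_product)
qed

context dense_tuples
begin

text \<open>The situation after \<open>j\<close> rounds: \<open>N\<close> vertices on the levels below \<open>j\<close>, and a family \<open>F\<close>
  within \<open>j * \<delta>\<close> of the given tuple \<open>a\<close>. Left invertibility at \<open>t\<close> is demanded for all \<open>t\<close> in the
  closed sets \<open>C n\<close>, since the neighbourhoods chosen in the next round must avoid those \<open>C n\<close> that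
  do not contain the point in question.\<close>

definition stage where
  "stage K a \<delta> j N lev W C F \<longleftrightarrow>
    (\<forall>n<N. lev n < j \<and> openin X (W n) \<and> closedin X (C n) \<and> W n \<subseteq> C n) \<and>
    (\<forall>i<j. \<forall>t\<in>K. \<exists>n<N. lev n = i \<and> t \<in> W n) \<and>
    family F \<and> (\<forall>s s'. (\<forall>n<N. s n = s' n) \<longrightarrow> F s = F s') \<and>
    (\<forall>s. chain_supported N lev s \<longrightarrow> (\<forall>i<M. \<forall>t\<in>T. norm (F s i t - a i t) \<le> real j * \<delta>)) \<and>
    (\<forall>s t. chain_supported N lev s \<longrightarrow> s \<in> std_simplex {..<N} \<longrightarrow> t \<in> T \<longrightarrow>
      (\<forall>n<N. s n \<noteq> 0 \<longrightarrow> t \<in> C n) \<longrightarrow> LI t (\<lambda>i. F s i t))"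

lemma stage_zero:
  assumes "\<And>i. i < M \<Longrightarrow> a i \<in> S"
  shows "stage K a \<delta> 0 0 lev W C (\<lambda>s. a)"
  unfolding stage_def using family_const[of a] assms by (auto simp: std_simplex_def)

lemma stage_step:
  assumes st: "stage K a \<delta> j N lev W C F" and K: "compactin X K" and j: "j \<le> k" and \<delta>: "\<delta> > 0"
  shows "\<exists>N lev W C F. stage K a \<delta> (Suc j) N lev W C F"
proof -
  have lev: "\<And>n. n < N \<Longrightarrow> lev n < j" and Wo: "\<And>n. n < N \<Longrightarrow> openin X (W n)"
    and Cc: "\<And>n. n < N \<Longrightarrow> closedin X (C n)" and WC: "\<And>n. n < N \<Longrightarrow> W n \<subseteq> C n"
    and cov: "\<And>i t. i < j \<Longrightarrow> t \<in> K \<Longrightarrow> \<exists>n<N. lev n = i \<and> t \<in> W n"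
    and F: "family F" and Fdep: "\<And>s s'. (\<And>n. n < N \<Longrightarrow> s n = s' n) \<Longrightarrow> F s = F s'"
    and Fn: "\<And>s i t. chain_supported N lev s \<Longrightarrow> i < M \<Longrightarrow> t \<in> T \<Longrightarrow> norm (F s i t - a i t) \<le> real j * \<delta>"
    and FL: "\<And>s t. chain_supported N lev s \<Longrightarrow> s \<in> std_simplex {..<N} \<Longrightarrow> t \<in> T \<Longrightarrow>
      (\<And>n. n < N \<Longrightarrow> s n \<noteq> 0 \<Longrightarrow> t \<in> C n) \<Longrightarrow> LI t (\<lambda>i. F s i t)"
    using st unfolding stage_def by simp_all
  have KT: "K \<subseteq> T" using K by (rule compactin_subset_topspace)
  define good where "good x H V D \<longleftrightarrow> family H \<and> (\<forall>s i t. s N = 0 \<longrightarrow> H s i t = 0) \<and>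
    (\<forall>s i t. i < M \<longrightarrow> t \<in> T \<longrightarrow> norm (H s i t) \<le> \<delta>) \<and>
    openin X V \<and> closedin X D \<and> x \<in> V \<and> V \<subseteq> D \<and>
    (\<forall>t\<in>D. \<forall>s\<in>vertex_star N lev C x. LI t (\<lambda>i. F s i t + H s i t)) \<and>
    (\<forall>t\<in>D. \<forall>n<N. t \<in> C n \<longrightarrow> x \<in> C n)" for x H V D
  have "\<exists>q. good x (fst q) (fst (snd q)) (snd (snd q))" if x: "x \<in> K" for x
  proof -
    have xT: "x \<in> T" using x KT by blast
    have base: "LI x (\<lambda>i. F s i x)" if s: "s \<in> vertex_star N lev C x" and s0: "s N = 0" for s
    proof -
      obtain c where c: "c \<subseteq> {..N}" "\<And>n. n \<in> c \<Longrightarrow> n < N \<Longrightarrow> x \<in> C n" "inj_on lev (c - {N})"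
        "s \<in> std_simplex c" using s unfolding vertex_star_def by blast
      have nn: "\<And>n. 0 \<le> s n" and out: "\<And>n. n \<notin> c \<Longrightarrow> s n = 0" and sum: "(\<Sum>n\<in>c. s n) = 1"
        using c(4) unfolding std_simplex_def by auto
      have fc: "finite c" using c(1) by (rule finite_subset) simp
      have "(\<Sum>n<N. s n) = (\<Sum>n\<in>c. s n)"
      proof -
        have "(\<Sum>n<N. s n) = (\<Sum>n\<in>{..<N} \<union> c. s n)"
          using c(1) s0 fc by (intro sum.mono_neutral_left) (auto simp: le_less)
        also have "\<dots> = (\<Sum>n\<in>c. s n)" using out fc by (intro sum.mono_neutral_right) auto
        finally show ?thesis .
      qed
      moreover have "s n = 0" if "n \<notin> {..<N}" for n
        using that out[of n] s0 c(1) by (cases "n \<in> c") (auto simp: le_less)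
      ultimately have "s \<in> std_simplex {..<N}" using nn sum unfolding std_simplex_def by simp
      moreover have "chain_supported N lev s"
        unfolding chain_supported_def
      proof (intro allI impI)
        fix n n' assume "n < N" "n' < N" "s n \<noteq> 0" "s n' \<noteq> 0" and l: "lev n = lev n'"
        then have "n \<in> c - {N}" "n' \<in> c - {N}" using out by auto
        then show "n = n'" using c(3) l by (simp add: inj_on_def)
      qed
      moreover have "x \<in> C n" if "n < N" "s n \<noteq> 0" for n using that out c(2) by blast
      ultimately show ?thesis using FL xT by blast
    qed
    have "\<exists>H V D. good x H V D"
      unfolding good_def by (rule extend_family[OF F xT lev j Cc \<delta> base])
    then obtain H V D where "good x H V D" by blast
    then show ?thesis by (intro exI[of _ "(H, V, D)"]) simp
  qed
  then have "\<forall>x\<in>K. \<exists>q. good x (fst q) (fst (snd q)) (snd (snd q))" by simp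
  from bchoice[OF this] obtain f where f: "\<forall>x\<in>K. good x (fst (f x)) (fst (snd (f x))) (snd (snd (f x)))" ..
  define H where "H x = fst (f x)" for x
  define V where "V x = fst (snd (f x))" for x
  define D where "D x = snd (snd (f x))" for x
  have g: "good x (H x) (V x) (D x)" if "x \<in> K" for x using f that unfolding H_def V_def D_def by blast
  \<comment> \<open>Finitely many of the neighbourhoods cover \<open>K\<close>, and each contributes one new vertex on level
    \<open>j\<close>.\<close>
  have "\<exists>\<F>. finite \<F> \<and> \<F> \<subseteq> V ` K \<and> K \<subseteq> \<Union>\<F>"
    by (rule compactinD[OF K]) (use g in \<open>auto simp: good_def\<close>)
  then obtain \<F> where \<F>: "finite \<F>" "\<F> \<subseteq> V ` K" "K \<subseteq> \<Union>\<F>" by blast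
  obtain A where A: "A \<subseteq> K" "finite A" "\<F> = V ` A" using finite_subset_image[OF \<F>(1,2)] by blast
  obtain xs where xs: "set xs = A" using finite_list[OF A(2)] by blast
  define m where "m = length xs"
  have xK: "xs ! l \<in> K" if "l < m" for l using that A(1) xs nth_mem unfolding m_def by blast
  have gl: "good (xs ! l) (H (xs ! l)) (V (xs ! l)) (D (xs ! l))" if "l < m" for l using g xK that by blast
  define N' where "N' = N + m"
  define lev' where "lev' n = (if n < N then lev n else j)" for n
  define W' where "W' n = (if n < N then W n else V (xs ! (n - N)))" for n
  define C' where "C' n = (if n < N then C n else D (xs ! (n - N)))" for n
  \<comment> \<open>On the complex at most one summand is nonzero, because at most one of the new vertices is
    used.\<close>
  define F' where "F' s i t = F s i t + (\<Sum>l<m. H (xs ! l) (move_vertex N l s) i t)" for s i t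
  have Hz: "H (xs ! l) (move_vertex N l s) i t = 0" if "l < m" "s (N + l) = 0" for l s i t
  proof -
    have "move_vertex N l s N = 0" using that(2) by (simp add: move_vertex_def)
    then show ?thesis using gl[OF that(1)] unfolding good_def by blast
  qed
  have chain_old: "chain_supported N lev s" if "chain_supported N' lev' s" for s
    unfolding chain_supported_def
  proof (intro allI impI)
    fix n n' assume n: "n < N" "n' < N" "s n \<noteq> 0" "s n' \<noteq> 0" "lev n = lev n'"
    then have "n < N'" "n' < N'" "lev' n = lev' n'" unfolding N'_def lev'_def by auto
    then show "n = n'" using that n unfolding chain_supported_def by blast
  qed
  have uniq: "l = l'" if ch: "chain_supported N' lev' s" and l: "l < m" "l' < m" "s (N + l) \<noteq> 0" "s (N + l') \<noteq> 0" for s l l'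
  proof -
    have "N + l < N'" "N + l' < N'" "lev' (N + l) = lev' (N + l')" using l unfolding N'_def lev'_def by auto
    then have "N + l = N + l'" using ch l unfolding chain_supported_def by blast
    then show ?thesis by simp
  qed
  have single: "F' s i t = F s i t + H (xs ! l) (move_vertex N l s) i t"
    if ch: "chain_supported N' lev' s" and l: "l < m" "s (N + l) \<noteq> 0" for s l i t
  proof -
    have "(\<Sum>l<m. H (xs ! l) (move_vertex N l s) i t) = (\<Sum>l\<in>{l}. H (xs ! l) (move_vertex N l s) i t)"
    proof (rule sum.mono_neutral_right)
      show "\<forall>i'\<in>{..<m} - {l}. H (xs ! i') (move_vertex N i' s) i t = 0"
        using uniq[OF ch _ l(1) _ l(2)] Hz by blast
    qed (use l in auto)
    then show ?thesis unfolding F'_def by simp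
  qed
  have none: "F' s i t = F s i t" if "\<And>l. l < m \<Longrightarrow> s (N + l) = 0" for s i t
    unfolding F'_def using Hz that by simp
  have "stage K a \<delta> (Suc j) N' lev' W' C' F'"
    unfolding stage_def
  proof (intro conjI allI impI ballI)
    fix n assume n: "n < N'"
    show "lev' n < Suc j" unfolding lev'_def using lev by (simp add: less_SucI)
    have l: "n - N < m" if "\<not> n < N" using n that unfolding N'_def by simp
    show "openin X (W' n)" unfolding W'_def using Wo gl[OF l] unfolding good_def by simp
    show "closedin X (C' n)" unfolding C'_def using Cc gl[OF l] unfolding good_def by simp
    show "W' n \<subseteq> C' n" unfolding W'_def C'_def using WC gl[OF l] unfolding good_def by simp
  next
    fix i t assume i: "i < Suc j" and t: "t \<in> K"
    show "\<exists>n<N'. lev' n = i \<and> t \<in> W' n"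
    proof (cases "i < j")
      case True
      then obtain n where "n < N" "lev n = i" "t \<in> W n" using cov t by blast
      then show ?thesis unfolding N'_def lev'_def W'_def by (intro exI[of _ n]) simp
    next
      case False
      obtain x where "x \<in> A" "t \<in> V x" using \<F>(3) A(3) t by blast
      then obtain l where "l < m" "t \<in> V (xs ! l)" using xs unfolding m_def by (metis in_set_conv_nth)
      then show ?thesis using False i unfolding N'_def lev'_def W'_def by (intro exI[of _ "N + l"]) simp
    qed
  next
    have "family (\<lambda>s i t. \<Sum>l<m. H (xs ! l) (move_vertex N l s) i t)"
    proof (rule family_sum)
      fix l assume "l \<in> {..<m}"
      then have "family (H (xs ! l))" using gl unfolding good_def by blast
      then show "family (\<lambda>s. H (xs ! l) (move_vertex N l s))"
        by (rule family_compose) (rule continuous_move_vertex)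
    qed simp
    from family_add[OF F this] show "family F'" unfolding F'_def[abs_def] .
  next
    fix s s' :: "nat \<Rightarrow> real" assume eq: "\<forall>n<N'. s n = s' n"
    have "F s = F s'" by (rule Fdep) (use eq in \<open>simp add: N'_def\<close>)
    moreover have "move_vertex N l s = move_vertex N l s'" if "l < m" for l
      unfolding move_vertex_def using eq that by (simp add: N'_def fun_eq_iff)
    ultimately show "F' s = F' s'" unfolding F'_def[abs_def] by simp
  next
    fix s i t assume ch: "chain_supported N' lev' s" and i: "i < M" and t: "t \<in> T"
    have b: "norm (F s i t - a i t) \<le> real j * \<delta>" by (rule Fn[OF chain_old[OF ch] i t])
    show "norm (F' s i t - a i t) \<le> real (Suc j) * \<delta>"
    proof (cases "\<exists>l<m. s (N + l) \<noteq> 0")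
      case True
      then obtain l where l: "l < m" "s (N + l) \<noteq> 0" by blast
      have h: "norm (H (xs ! l) (move_vertex N l s) i t) \<le> \<delta>" using gl[OF l(1)] i t unfolding good_def by blast
      have eq: "F' s i t - a i t = (F s i t - a i t) + H (xs ! l) (move_vertex N l s) i t"
        using single[OF ch l] by simp
      have "norm (F' s i t - a i t) \<le> real j * \<delta> + \<delta>" unfolding eq by (rule norm_triangle_mono[OF b h])
      then show ?thesis by (simp add: algebra_simps)
    next
      case False
      then have "F' s i t = F s i t" by (intro none) blast
      then show ?thesis using b \<delta> by (simp add: algebra_simps)
    qed
  next
    fix s t assume ch: "chain_supported N' lev' s" and s: "s \<in> std_simplex {..<N'}" and t: "t \<in> T"
      and C: "\<forall>n<N'. s n \<noteq> 0 \<longrightarrow> t \<in> C' n"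
    have nn: "\<And>n. 0 \<le> s n" and out: "\<And>n. n \<ge> N' \<Longrightarrow> s n = 0" and sum: "(\<Sum>n<N'. s n) = 1"
      using s unfolding std_simplex_def by auto
    have Cold: "t \<in> C n" if "n < N" "s n \<noteq> 0" for n using C that unfolding N'_def C'_def by (metis trans_less_add1)
    show "LI t (\<lambda>i. F' s i t)"
    proof (cases "\<exists>l<m. s (N + l) \<noteq> 0")
      case True
      then obtain l where l: "l < m" "s (N + l) \<noteq> 0" by blast
      let ?s = "move_vertex N l s"
      have others: "s n = 0" if "n \<ge> N" "n \<noteq> N + l" for n
      proof (cases "n < N'")
        case True
        then have "n - N < m" "N + (n - N) = n" using that unfolding N'_def by auto
        then show ?thesis using uniq[OF ch, of "n - N" l] l that by fastforce
      qed (use out in simp)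
      have sum1: "(\<Sum>n<N. s n) + s (N + l) = 1"
      proof -
        have "(\<Sum>n<N'. s n) = (\<Sum>n\<in>insert (N + l) {..<N}. s n)"
          using others l(1) by (intro sum.mono_neutral_right) (auto simp: N'_def)
        then show ?thesis using sum by simp
      qed
      define c where "c = {n. n \<le> N \<and> ?s n \<noteq> 0}"
      have "?s \<in> std_simplex c"
      proof -
        have "(\<Sum>n\<in>c. ?s n) = (\<Sum>n\<le>N. ?s n)"
          unfolding c_def by (intro sum.mono_neutral_left) auto
        also have "\<dots> = (\<Sum>n<N. ?s n) + ?s N" by (simp flip: lessThan_Suc_atMost)
        also have "(\<Sum>n<N. ?s n) = (\<Sum>n<N. s n)" by (simp add: move_vertex_def)
        finally have "(\<Sum>n\<in>c. ?s n) = 1" using sum1 by (simp add: move_vertex_def)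
        moreover have "0 \<le> ?s n" for n using nn by (simp add: move_vertex_def)
        moreover have "?s n = 0" if "n \<notin> c" for n
          using that unfolding c_def by (cases "n \<le> N") (auto simp: move_vertex_def)
        ultimately show ?thesis unfolding std_simplex_def by simp
      qed
      moreover have tD: "t \<in> D (xs ! l)"
      proof -
        have "t \<in> C' (N + l)" using C l by (simp add: N'_def)
        then show ?thesis by (simp add: C'_def)
      qed
      moreover have "xs ! l \<in> C n" if "n \<in> c" "n < N" for n
      proof -
        have "t \<in> C n" using Cold[of n] that unfolding c_def move_vertex_def by simp
        then show ?thesis using gl[OF l(1)] tD that(2) unfolding good_def by blast
      qed
      moreover have "inj_on lev (c - {N})"
      proof (rule inj_onI)
        fix n n' assume "n \<in> c - {N}" "n' \<in> c - {N}" and e: "lev n = lev n'"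
        then have "n < N" "n' < N" "s n \<noteq> 0" "s n' \<noteq> 0"
          unfolding c_def move_vertex_def by (auto split: if_splits)
        then show "n = n'" using chain_old[OF ch] e unfolding chain_supported_def by blast
      qed
      ultimately have star: "?s \<in> vertex_star N lev C (xs ! l)"
        unfolding vertex_star_def by (intro UnionI[of "std_simplex c"]) (auto simp: c_def)
      have "LI t (\<lambda>i. F ?s i t + H (xs ! l) ?s i t)" using gl[OF l(1)] star tD unfolding good_def by blast
      moreover have "F ?s = F s" by (rule Fdep) (simp add: move_vertex_def)
      ultimately show ?thesis using single[OF ch l] by simp
    next
      case False
      then have z: "\<And>l. l < m \<Longrightarrow> s (N + l) = 0" by blast
      have z': "s n = 0" if "n \<ge> N" for n
      proof (cases "n < N'")
        case True
        then show ?thesis using z[of "n - N"] that unfolding N'_def by auto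
      qed (use out in simp)
      have "(\<Sum>n<N'. s n) = (\<Sum>n<N. s n)"
        using z' by (intro sum.mono_neutral_right) (auto simp: N'_def)
      then have "s \<in> std_simplex {..<N}" using nn z' sum unfolding std_simplex_def by simp
      then have "LI t (\<lambda>i. F s i t)" using FL[OF chain_old[OF ch] _ t] Cold by blast
      moreover have "F' s i t = F s i t" for i by (rule none) (rule z)
      ultimately show ?thesis by simp
    qed
  qed
  then show ?thesis by blast
qed

lemma stage_exists:
  assumes "\<And>i. i < M \<Longrightarrow> a i \<in> S" "compactin X K" "\<delta> > 0"
  shows "j \<le> Suc k \<Longrightarrow> \<exists>N lev W C F. stage K a \<delta> j N lev W C F"
proof (induction j)
  case 0
  show ?case using stage_zero[of a] assms(1) by blast
next
  case (Suc j)
  then obtain N lev W C F where "stage K a \<delta> j N lev W C F" by auto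
  then show ?case using stage_step[OF _ assms(2) _ assms(3)] Suc.prems by auto
qed

end

section \<open>Maps of a finite dimensional space into a complex\<close>

text \<open>The distance to the complement of \<open>V\<close>, truncated at 1.\<close>

lemma metric_cozero:
  fixes m :: "'x metric"
  assumes V: "openin (mtopology_of m) V"
  obtains f where "continuous_map (mtopology_of m) euclideanreal f"
    "\<And>t. 0 \<le> f t \<and> f t \<le> 1" "\<And>t. t \<in> mspace m \<Longrightarrow> f t > 0 \<longleftrightarrow> t \<in> V"
proof (cases "mspace m - V = {}")
  case True
  then show ?thesis using that[of "\<lambda>_. 1"] by auto
next
  case False
  interpret Metric_space "mspace m" "mdist m" by (rule Metric_space_mspace_mdist)
  let ?Z = "mspace m - V"
  define g where "g t = (INF y\<in>?Z. mdist m t y)" for t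
  have bdd: "bdd_below ((\<lambda>y. mdist m t y) ` ?Z)" for t by (auto intro: bdd_belowI[of _ 0])
  have g0: "g t \<ge> 0" for t unfolding g_def using False by (intro cINF_greatest) auto
  have lip: "g s \<le> mdist m s t + g t" if st: "s \<in> mspace m" "t \<in> mspace m" for s t
  proof -
    have "g s - mdist m s t \<le> g t"
      unfolding g_def[of t]
    proof (rule cINF_greatest[OF False])
      fix y assume y: "y \<in> ?Z"
      have "g s \<le> mdist m s y" unfolding g_def by (rule cINF_lower[OF bdd y])
      also have "\<dots> \<le> mdist m s t + mdist m t y" using st y by (intro triangle) auto
      finally show "g s - mdist m s t \<le> mdist m t y" by simp
    qed
    then show ?thesis by simp
  qed
  have gpos: "g t > 0 \<longleftrightarrow> t \<in> V" if t: "t \<in> mspace m" for t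
  proof
    assume "g t > 0"
    then show "t \<in> V" using cINF_lower[OF bdd, of t t] t unfolding g_def by fastforce
  next
    assume "t \<in> V"
    then obtain r where r: "r > 0" "mball t r \<subseteq> V"
      using V unfolding mtopology_of_def openin_mtopology by blast
    have "r \<le> g t" unfolding g_def
    proof (rule cINF_greatest[OF False])
      fix y assume "y \<in> ?Z"
      then have "y \<notin> mball t r" "y \<in> mspace m" using r(2) by auto
      then show "r \<le> mdist m t y" using t by simp
    qed
    then show "g t > 0" using r(1) by simp
  qed
  have "Lipschitz_continuous_map m euclidean_metric g"
    unfolding Lipschitz_continuous_map_def
  proof (intro conjI exI[of _ 1] ballI)
    fix s t assume st: "s \<in> mspace m" "t \<in> mspace m"
    show "mdist euclidean_metric (g s) (g t) \<le> 1 * mdist m s t"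
      using lip[OF st] lip[OF st(2,1)] commute[of s t] by (simp add: dist_real_def abs_le_iff)
  qed simp
  then have gc: "continuous_map (mtopology_of m) euclideanreal g"
    using Lipschitz_continuous_imp_continuous_map by fastforce
  show ?thesis
  proof (rule that[of "\<lambda>t. min 1 (g t)"])
    show "continuous_map (mtopology_of m) euclideanreal (\<lambda>t. min 1 (g t))"
      by (intro continuous_map_real_min gc) simp
  qed (use g0 gpos in auto)
qed

text \<open>Choose one vertex on each level; the intersections of the corresponding sets \<open>W n\<close> cover
  \<open>K\<close>, and together with the complement of \<open>K\<close> they form a finite open cover. Let \<open>\<V>\<close> be a
  refinement of order at most \<open>k + 1\<close>, with functions \<open>l V\<close> that are positive exactly on \<open>V\<close>. A
  point \<open>t\<close> orders the members of \<open>\<V>\<close> by the values \<open>l V t\<close>, and the sets \<open>A\<close> of members with the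
  largest values form a chain. This is the point's simplex in the barycentric subdivision of the
  nerve. The weight \<open>\<omega> A\<close> belongs to \<open>A\<close>, and it is assigned to a vertex on the level
  \<open>card A - 1\<close>, so no level is used twice.\<close>

lemma covering_map:
  fixes m :: "'x metric" and W :: "nat \<Rightarrow> 'x set"
  assumes X: "X = mtopology_of m" and dim: "covering_dim_le X (int k)" and K: "compactin X K"
    and Wo: "\<And>n. n < N \<Longrightarrow> openin X (W n)"
    and cov: "\<And>i t. i \<le> k \<Longrightarrow> t \<in> K \<Longrightarrow> \<exists>n<N. lev n = i \<and> t \<in> W n"
  obtains w :: "'x \<Rightarrow> nat \<Rightarrow> real"
  where "\<And>n. continuous_map X euclideanreal (\<lambda>t. w t n)"
    "\<And>t n. 0 \<le> w t n \<and> w t n \<le> 1" "\<And>t n. n \<ge> N \<Longrightarrow> w t n = 0"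
    "\<And>t. t \<in> topspace X \<Longrightarrow> chain_supported N lev (w t)"
    "\<And>t n. t \<in> topspace X \<Longrightarrow> w t n \<noteq> 0 \<Longrightarrow> t \<in> W n"
    "\<And>t. t \<in> K \<Longrightarrow> (\<Sum>n<N. w t n) = 1"
proof -
  \<comment> \<open>The ways to choose one vertex on each level.\<close>
  define \<Phi> where "\<Phi> = (\<Pi>\<^sub>E i\<in>{..k}. {n. n < N \<and> lev n = i})"
  have fin\<Phi>: "finite \<Phi>" unfolding \<Phi>_def by (rule finite_PiE) auto
  have \<Phi>D: "\<phi> i < N" "lev (\<phi> i) = i" if "\<phi> \<in> \<Phi>" "i \<le> k" for \<phi> i using that unfolding \<Phi>_def by auto
  define B where "B \<phi> = (\<Inter>i\<in>{..k}. W (\<phi> i))" for \<phi>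
  have KT: "K \<subseteq> topspace X" using K by (rule compactin_subset_topspace)
  have "Hausdorff_space X" unfolding X by (simp add: Metric_space.Hausdorff_space_mtopology mtopology_of_def)
  then have "closedin X K" using K by (rule compactin_imp_closedin)
  have Bo: "openin X (B \<phi>)" if "\<phi> \<in> \<Phi>" for \<phi>
    unfolding B_def using Wo \<Phi>D[OF that] by (intro openin_Inter) auto
  have cover: "finite_open_cover X (insert (topspace X - K) (B ` \<Phi>))"
    unfolding finite_open_cover_def
  proof (intro conjI ballI)
    show "finite (insert (topspace X - K) (B ` \<Phi>))" using fin\<Phi> by simp
    show "openin X U" if "U \<in> insert (topspace X - K) (B ` \<Phi>)" for U
      using that Bo \<open>closedin X K\<close> by (auto intro: openin_diff)
    have "K \<subseteq> \<Union>(B ` \<Phi>)"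
    proof
      fix t assume "t \<in> K"
      then have "\<forall>i\<in>{..k}. \<exists>n. n < N \<and> lev n = i \<and> t \<in> W n" using cov by auto
      from bchoice[OF this] obtain \<phi> where \<phi>: "\<forall>i\<in>{..k}. \<phi> i < N \<and> lev (\<phi> i) = i \<and> t \<in> W (\<phi> i)" ..
      have "restrict \<phi> {..k} \<in> \<Phi>" using \<phi> unfolding \<Phi>_def by auto
      moreover have "t \<in> B (restrict \<phi> {..k})" using \<phi> unfolding B_def by simp
      ultimately show "t \<in> \<Union>(B ` \<Phi>)" by blast
    qed
    moreover have "\<Union>(B ` \<Phi>) \<subseteq> topspace X" using Bo openin_subset by blast
    ultimately show "\<Union>(insert (topspace X - K) (B ` \<Phi>)) = topspace X" by auto
  qed
  obtain \<V> where \<V>: "finite_open_cover X \<V>" "\<And>V. V \<in> \<V> \<Longrightarrow> \<exists>U\<in>insert (topspace X - K) (B ` \<Phi>). V \<subseteq> U"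
    "\<And>x. x \<in> topspace X \<Longrightarrow> int (card {V \<in> \<V>. x \<in> V}) \<le> int k + 1"
    using dim[unfolded covering_dim_le_def, rule_format, OF cover] by blast
  have fV: "finite \<V>" and oV: "\<And>V. V \<in> \<V> \<Longrightarrow> openin X V" and UV: "\<Union>\<V> = topspace X"
    using \<V>(1) unfolding finite_open_cover_def by auto
  have "\<exists>\<phi>\<in>\<Phi>. V \<subseteq> B \<phi>" if "V \<in> \<V>" "V \<inter> K \<noteq> {}" for V using \<V>(2)[OF that(1)] that(2) by blast
  then obtain \<phi> where \<phi>: "\<And>V. V \<in> \<V> \<Longrightarrow> V \<inter> K \<noteq> {} \<Longrightarrow> \<phi> V \<in> \<Phi> \<and> V \<subseteq> B (\<phi> V)" by metis
  have "\<forall>V\<in>\<V>. \<exists>f. continuous_map X euclideanreal f \<and> (\<forall>t. 0 \<le> f t \<and> f t \<le> 1) \<and>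
      (\<forall>t\<in>topspace X. f t > 0 \<longleftrightarrow> t \<in> V)"
  proof
    fix V assume "V \<in> \<V>"
    then have "openin (mtopology_of m) V" using oV X by simp
    then obtain f where "continuous_map (mtopology_of m) euclideanreal f"
      "\<And>t. 0 \<le> f t \<and> f t \<le> 1" "\<And>t. t \<in> mspace m \<Longrightarrow> f t > 0 \<longleftrightarrow> t \<in> V"
      by (rule metric_cozero) (rule that)
    then show "\<exists>f. continuous_map X euclideanreal f \<and> (\<forall>t. 0 \<le> f t \<and> f t \<le> 1) \<and>
      (\<forall>t\<in>topspace X. f t > 0 \<longleftrightarrow> t \<in> V)" unfolding X by (intro exI[of _ f]) simp
  qed
  from bchoice[OF this] obtain l where l: "\<And>V. V \<in> \<V> \<Longrightarrow> continuous_map X euclideanreal (l V)"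
    "\<And>V t. V \<in> \<V> \<Longrightarrow> 0 \<le> l V t \<and> l V t \<le> 1"
    "\<And>V t. V \<in> \<V> \<Longrightarrow> t \<in> topspace X \<Longrightarrow> l V t > 0 \<longleftrightarrow> t \<in> V" by auto
  \<comment> \<open>Nonzero exactly if all functions in \<open>A\<close> are positive at \<open>t\<close> and exceed the ones outside \<open>A\<close>.\<close>
  define \<omega> where "\<omega> A t = (\<Prod>V\<in>A. l V t) * (\<Prod>V\<in>A. \<Prod>V'\<in>\<V> - A. max 0 (l V t - l V' t))" for A t
  have \<omega>01: "0 \<le> \<omega> A t \<and> \<omega> A t \<le> 1" if A: "A \<subseteq> \<V>" for A t
  proof -
    have "0 \<le> (\<Prod>V\<in>A. l V t)" "(\<Prod>V\<in>A. l V t) \<le> 1"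
      using l(2) A by (auto intro!: prod_nonneg prod_le_1)
    moreover have "0 \<le> (\<Prod>V\<in>A. \<Prod>V'\<in>\<V> - A. max 0 (l V t - l V' t))" by (intro prod_nonneg) auto
    moreover have "(\<Prod>V\<in>A. \<Prod>V'\<in>\<V> - A. max 0 (l V t - l V' t)) \<le> 1"
    proof (intro prod_le_1 conjI prod_nonneg)
      fix V V' assume "V \<in> A" "V' \<in> \<V> - A"
      then show "max 0 (l V t - l V' t) \<le> 1" using l(2)[of V t] l(2)[of V' t] A by fastforce
    qed auto
    ultimately show ?thesis unfolding \<omega>_def by (simp add: mult_le_one)
  qed
  have \<omega>c: "continuous_map X euclideanreal (\<omega> A)" if A: "A \<subseteq> \<V>" for A
  proof -
    have fA: "finite A" using A fV by (rule finite_subset)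
    show ?thesis unfolding \<omega>_def[abs_def]
      using fA fV l(1) A
      by (intro continuous_map_real_mult continuous_map_prod continuous_map_real_max continuous_map_diff) auto
  qed
  have fin: "finite A" if "A \<subseteq> \<V>" for A using that fV by (rule finite_subset)
  have \<omega>D1: "t \<in> V" if A: "A \<subseteq> \<V>" "\<omega> A t \<noteq> 0" "t \<in> topspace X" "V \<in> A" for A t V
  proof -
    have "l V t \<noteq> 0"
    proof
      assume "l V t = 0"
      then have "(\<Prod>V\<in>A. l V t) = 0" using prod_zero[OF fin[OF A(1)], of "\<lambda>V. l V t"] A(4) by blast
      then show False using A(2) unfolding \<omega>_def by simp
    qed
    then show ?thesis using l(2)[of V t] l(3)[of V t] A by force
  qed
  have \<omega>D2: "l V' t < l V t" if A: "A \<subseteq> \<V>" "\<omega> A t \<noteq> 0" "V \<in> A" "V' \<in> \<V> - A" for A t V V'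
  proof (rule ccontr)
    assume "\<not> l V' t < l V t"
    then have "max 0 (l V t - l V' t) = 0" by simp
    then have "(\<Prod>V'\<in>\<V> - A. max 0 (l V t - l V' t)) = 0"
      using prod_zero[of "\<V> - A" "\<lambda>V'. max 0 (l V t - l V' t)"] A(4) fV by blast
    then have "(\<Prod>V\<in>A. \<Prod>V'\<in>\<V> - A. max 0 (l V t - l V' t)) = 0"
      using prod_zero[OF fin[OF A(1)], of "\<lambda>V. \<Prod>V'\<in>\<V> - A. max 0 (l V t - l V' t)"] A(3) by blast
    then show False using A(2) unfolding \<omega>_def by simp
  qed
  have disj: "A = A'" if A: "A \<subseteq> \<V>" "\<omega> A t \<noteq> 0" "A' \<subseteq> \<V>" "\<omega> A' t \<noteq> 0" "card A = card A'" "t \<in> topspace X" for A A' t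
  proof (rule ccontr)
    assume "A \<noteq> A'"
    then have "\<not> A \<subseteq> A'" "\<not> A' \<subseteq> A"
      using card_subset_eq[OF fin[OF A(3)]] card_subset_eq[OF fin[OF A(1)]] A(5) by auto
    then obtain V V' where V: "V \<in> A" "V \<notin> A'" "V' \<in> A'" "V' \<notin> A" by blast
    have "l V' t < l V t" by (rule \<omega>D2[OF A(1,2)]) (use V A in auto)
    moreover have "l V t < l V' t" by (rule \<omega>D2[OF A(3,4)]) (use V A in auto)
    ultimately show False by simp
  qed
  define rep where "rep A = (SOME V. V \<in> A)" for A :: "'x set set"
  have rep: "rep A \<in> A" if "A \<noteq> {}" for A using that unfolding rep_def by (simp add: some_in_eq)
  \<comment> \<open>A choice of vertices is attached only to those members of the refinement that meet \<open>K\<close>, which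
    is why \<open>rep A\<close> has to meet \<open>K\<close>. At points of \<open>K\<close> nothing is lost, since \<open>\<Omega>\<close> is positive
    there.\<close>
  define \<S> where "\<S> = {A. A \<subseteq> \<V> \<and> A \<noteq> {} \<and> card A \<le> k + 1 \<and> rep A \<inter> K \<noteq> {}}"
  have fS: "finite \<S>" by (rule finite_subset[of _ "Pow \<V>"]) (auto simp: \<S>_def fV)
  define ix where "ix A = \<phi> (rep A) (card A - 1)" for A
  have ix: "ix A < N" "lev (ix A) = card A - 1" "rep A \<subseteq> W (ix A)" if "A \<in> \<S>" for A
  proof -
    have A: "A \<subseteq> \<V>" "A \<noteq> {}" "card A - 1 \<le> k" "rep A \<inter> K \<noteq> {}" using that unfolding \<S>_def by auto
    have r: "rep A \<in> \<V>" using rep[OF A(2)] A(1) by blast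
    have p: "\<phi> (rep A) \<in> \<Phi>" "rep A \<subseteq> B (\<phi> (rep A))" using \<phi>[OF r A(4)] by auto
    show "ix A < N" "lev (ix A) = card A - 1" unfolding ix_def by (rule \<Phi>D[OF p(1) A(3)])+
    show "rep A \<subseteq> W (ix A)" using p(2) A(3) unfolding B_def ix_def by auto
  qed
  define u where "u t n = (\<Sum>A\<in>{A \<in> \<S>. ix A = n}. \<omega> A t)" for t n
  define \<Omega> where "\<Omega> t = (\<Sum>A\<in>\<S>. \<omega> A t)" for t
  have SV: "A \<subseteq> \<V>" if "A \<in> \<S>" for A using that unfolding \<S>_def by blast
  have u0: "0 \<le> u t n" for t n unfolding u_def using \<omega>01[OF SV] by (intro sum_nonneg) auto
  have u\<Omega>: "u t n \<le> \<Omega> t" for t n unfolding u_def \<Omega>_def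
    using \<omega>01[OF SV] fS by (intro sum_mono2) auto
  have \<Omega>sum: "\<Omega> t = (\<Sum>n<N. u t n)" for t
    unfolding \<Omega>_def u_def using fS ix(1) by (intro sum.group[symmetric]) auto
  have uD: "\<exists>A\<in>\<S>. ix A = n \<and> \<omega> A t \<noteq> 0" if "u t n \<noteq> 0" for t n
    using that unfolding u_def by (metis (mono_tags, lifting) mem_Collect_eq sum.neutral)
  have uc: "continuous_map X euclideanreal (\<lambda>t. u t n)" for n
    unfolding u_def using fS \<omega>c[OF SV] by (intro continuous_map_sum) auto
  have \<Omega>c: "continuous_map X euclideanreal \<Omega>"
    unfolding \<Omega>_def[abs_def] using fS \<omega>c[OF SV] by (intro continuous_map_sum) auto
  have \<Omega>pos: "\<Omega> t > 0" if t: "t \<in> K" for t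
  proof -
    have tT: "t \<in> topspace X" using t KT by blast
    define A where "A = {V \<in> \<V>. t \<in> V}"
    have A: "A \<subseteq> \<V>" "A \<noteq> {}" "card A \<le> k + 1" using UV tT \<V>(3)[OF tT] unfolding A_def by auto
    have "rep A \<inter> K \<noteq> {}" using rep[OF A(2)] t unfolding A_def by auto
    then have AS: "A \<in> \<S>" using A unfolding \<S>_def by blast
    have "(\<Prod>V\<in>A. l V t) > 0" using l(3)[OF _ tT] unfolding A_def by (intro prod_pos) auto
    moreover have "(\<Prod>V\<in>A. \<Prod>V'\<in>\<V> - A. max 0 (l V t - l V' t)) > 0"
    proof (intro prod_pos ballI)
      fix V V' assume V: "V \<in> A" "V' \<in> \<V> - A"
      then have "l V t > 0" "\<not> l V' t > 0" using l(3)[OF _ tT] unfolding A_def by auto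
      then show "0 < max 0 (l V t - l V' t)" by simp
    qed
    ultimately have "\<omega> A t > 0" unfolding \<omega>_def by simp
    also have "\<omega> A t \<le> \<Omega> t" unfolding \<Omega>_def using AS fS \<omega>01[OF SV] by (intro member_le_sum) auto
    finally show ?thesis .
  qed
  \<comment> \<open>A positive lower bound on \<open>K\<close> lets one normalize the weights without dividing by zero
    elsewhere; outside \<open>K\<close> their sum may be less than 1.\<close>
  obtain \<mu> where \<mu>: "\<mu> > 0" "\<And>t. t \<in> K \<Longrightarrow> \<mu> \<le> \<Omega> t"
  proof (cases "K = {}")
    case True
    then show ?thesis using that[of 1] by simp
  next
    case False
    have "compact (\<Omega> ` K)" using image_compactin[OF K \<Omega>c] by simp
    then obtain y where "y \<in> \<Omega> ` K" "\<forall>z\<in>\<Omega> ` K. y \<le> z"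
      using compact_attains_inf[of "\<Omega> ` K"] False by blast
    then show ?thesis using that[of y] \<Omega>pos by blast
  qed
  have mp: "max \<mu> (\<Omega> t) > 0" for t using \<mu>(1) by simp
  define w where "w t n = u t n / max \<mu> (\<Omega> t)" for t n
  have wu: "w t n \<noteq> 0 \<Longrightarrow> u t n \<noteq> 0" for t n unfolding w_def by auto
  show ?thesis
  proof (rule that[of w])
    show "continuous_map X euclideanreal (\<lambda>t. w t n)" for n
      unfolding w_def using mp
      by (intro continuous_map_real_divide continuous_map_real_max uc \<Omega>c) (auto simp: less_le)
    show "0 \<le> w t n \<and> w t n \<le> 1" for t n
      unfolding w_def using u0[of t n] u\<Omega>[of t n] mp[of t] by (simp add: divide_le_eq)
    show "w t n = 0" if "n \<ge> N" for t n using wu[of t n] uD[of t n] ix(1) that by fastforce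
    show "(\<Sum>n<N. w t n) = 1" if "t \<in> K" for t
      unfolding w_def sum_divide_distrib[symmetric] \<Omega>sum[symmetric]
      using \<mu>(2)[OF that] \<Omega>pos[OF that] by (simp add: max_absorb2)
    show "t \<in> W n" if t: "t \<in> topspace X" and n: "w t n \<noteq> 0" for t n
    proof -
      obtain A where A: "A \<in> \<S>" "ix A = n" "\<omega> A t \<noteq> 0" using uD[OF wu[OF n]] by blast
      have "t \<in> rep A" using \<omega>D1[OF SV[OF A(1)] A(3) t] rep A(1) unfolding \<S>_def by blast
      then show ?thesis using ix(3)[OF A(1)] A(2) by blast
    qed
    show "chain_supported N lev (w t)" if t: "t \<in> topspace X" for t
      unfolding chain_supported_def
    proof (intro allI impI)
      fix n n' assume n: "w t n \<noteq> 0" "w t n' \<noteq> 0" "lev n = lev n'"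
      obtain A where A: "A \<in> \<S>" "ix A = n" "\<omega> A t \<noteq> 0" using uD[OF wu[OF n(1)]] by blast
      obtain A' where A': "A' \<in> \<S>" "ix A' = n'" "\<omega> A' t \<noteq> 0" using uD[OF wu[OF n(2)]] by blast
      have "card A - 1 = card A' - 1" using ix(2)[OF A(1)] ix(2)[OF A'(1)] A(2) A'(2) n(3) by simp
      moreover have "card A > 0" "card A' > 0"
        using A(1) A'(1) fin unfolding \<S>_def by (auto simp: card_gt_0_iff)
      ultimately have "A = A'" using disj[OF SV[OF A(1)] A(3) SV[OF A'(1)] A'(3) _ t] by simp
      then show "n = n'" using A(2) A'(2) by simp
    qed
  qed
qed

section \<open>Left invertible tuples and inverses\<close>

context dense_tuples
begin

text \<open>The parameter of the family is chosen in dependence on the point: \<open>b t = F (w t) t\<close>. Locally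
  \<open>w\<close> is almost constant, so \<open>b\<close> is close to the fields \<open>F s\<close> with \<open>s\<close> fixed. Outside \<open>K\<close> the
  tuple is too small not to be left invertible.\<close>

theorem perturb_everywhere:
  fixes m :: "'x metric"
  assumes X: "X = mtopology_of m" and dim: "covering_dim_le X (int k)"
    and a: "\<And>i. i < M \<Longrightarrow> a i \<in> S" and \<epsilon>: "\<epsilon> > 0"
  obtains b where "\<And>i. i < M \<Longrightarrow> b i \<in> S"
    "\<And>i t. i < M \<Longrightarrow> t \<in> T \<Longrightarrow> norm (b i t - a i t) \<le> \<epsilon>"
    "\<And>t. t \<in> T \<Longrightarrow> LI t (\<lambda>i. b i t)"
proof -
  obtain r where r: "r > 0"
    "\<And>t b. t \<in> T \<Longrightarrow> (\<And>j. j < M \<Longrightarrow> e t * b j = b j \<and> norm (b j) < r) \<Longrightarrow> LI t b"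
    using LI_small by blast
  have "\<exists>K. compactin X K \<and> (\<forall>t\<in>T - K. norm (a i t) < r / 2)" if "i < M" for i
  proof -
    have "r / 2 > 0" using r(1) by simp
    with norm_field_vanishes[OF a[OF that]] show ?thesis
      unfolding vanishes_at_infinity_def by (metis abs_norm_cancel)
  qed
  then obtain Ki where Ki: "\<And>i. i < M \<Longrightarrow> compactin X (Ki i)"
    "\<And>i t. i < M \<Longrightarrow> t \<in> T - Ki i \<Longrightarrow> norm (a i t) < r / 2" by metis
  define K where "K = (\<Union>i<M. Ki i)"
  have K: "compactin X K" unfolding K_def using Ki(1) by (intro compactin_Union) auto
  \<comment> \<open>The bound \<open>r / 2\<close> keeps the perturbed tuple below \<open>r\<close> outside \<open>K\<close>; each of the \<open>k + 1\<close> rounds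
    may use an equal share of the bound.\<close>
  define \<delta>0 where "\<delta>0 = min \<epsilon> (r / 2)"
  have \<delta>0: "\<delta>0 > 0" "\<delta>0 \<le> \<epsilon>" "\<delta>0 \<le> r / 2" using \<epsilon> r(1) unfolding \<delta>0_def by auto
  define \<delta> where "\<delta> = \<delta>0 / real (Suc k)"
  have \<delta>: "\<delta> > 0" "real (Suc k) * \<delta> = \<delta>0" using \<delta>0(1) unfolding \<delta>_def by auto
  obtain N lev W C F where st: "stage K a \<delta> (Suc k) N lev W C F"
    using stage_exists[of a K \<delta> "Suc k"] a K \<delta>(1) by blast
  have Wo: "\<And>n. n < N \<Longrightarrow> openin X (W n)" and WC: "\<And>n. n < N \<Longrightarrow> W n \<subseteq> C n"
    and cov: "\<And>i t. i < Suc k \<Longrightarrow> t \<in> K \<Longrightarrow> \<exists>n<N. lev n = i \<and> t \<in> W n"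
    and F: "family F"
    and Fn: "\<And>s i t. chain_supported N lev s \<Longrightarrow> i < M \<Longrightarrow> t \<in> T \<Longrightarrow> norm (F s i t - a i t) \<le> real (Suc k) * \<delta>"
    and FL: "\<And>s t. chain_supported N lev s \<Longrightarrow> s \<in> std_simplex {..<N} \<Longrightarrow> t \<in> T \<Longrightarrow>
      (\<And>n. n < N \<Longrightarrow> s n \<noteq> 0 \<Longrightarrow> t \<in> C n) \<Longrightarrow> LI t (\<lambda>i. F s i t)"
    using st unfolding stage_def by simp_all
  have cov': "\<exists>n<N. lev n = i \<and> t \<in> W n" if "i \<le> k" "t \<in> K" for i t using cov[of i t] that by simp
  obtain w where w: "\<And>n. continuous_map X euclideanreal (\<lambda>t. w t n)"
    "\<And>t n. 0 \<le> w t n \<and> w t n \<le> 1" "\<And>t n. n \<ge> N \<Longrightarrow> w t n = 0"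
    "\<And>t. t \<in> T \<Longrightarrow> chain_supported N lev (w t)"
    "\<And>t n. t \<in> T \<Longrightarrow> w t n \<noteq> 0 \<Longrightarrow> t \<in> W n"
    "\<And>t. t \<in> K \<Longrightarrow> (\<Sum>n<N. w t n) = 1"
    by (rule covering_map[OF X dim K Wo cov']) (assumption+, rule that)
  define b where "b i t = F (w t) i t" for i t
  have ba: "norm (b i t - a i t) \<le> \<delta>0" if "i < M" "t \<in> T" for i t
    unfolding b_def using Fn[OF w(4)[OF that(2)] that] \<delta>(2) by simp
  have be: "e t * b i t = b i t" if "i < M" "t \<in> T" for i t
    unfolding b_def by (rule field[OF family_field[OF F that(1)] that(2)])
  have wc: "continuous_map X euclidean w"
    unfolding euclidean_product_topology[symmetric] continuous_map_componentwise_UNIV using w(1) by simp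
  \<comment> \<open>All parameters \<open>w t\<close> lie in this compact set, so finitely many members of the family
    approximate all \<open>F (w t)\<close>; this gives the vanishing at infinity.\<close>
  define Z where "Z = {s :: nat \<Rightarrow> real. \<forall>n. s n \<in> (if n < N then {0..1} else {0})}"
  have Z: "compact Z" unfolding Z_def by (rule compact_box) simp
  have wZ: "w t \<in> Z" for t unfolding Z_def using w(2,3) by simp
  have near: "\<exists>U. open U \<and> s0 \<in> U \<and> (\<forall>s\<in>U. \<forall>t\<in>T. norm (F s i t - F s0 i t) < \<eta>)"
    if i: "i < M" and \<eta>: "\<eta> > 0" for i s0 and \<eta> :: real
    using family_eventually[OF F \<eta>, of s0] i unfolding eventually_nhds by blast
  have bS: "b i \<in> S" if i: "i < M" for i
  proof (rule local_field)
    show "e t * b i t = b i t" if "t \<in> T" for t by (rule be[OF i that])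
    fix t0 and \<eta> :: real assume t0: "t0 \<in> T" and \<eta>: "\<eta> > 0"
    obtain U where U: "open U" "w t0 \<in> U" "\<forall>s\<in>U. \<forall>t\<in>T. norm (F s i t - F (w t0) i t) < \<eta>"
      using near[OF i \<eta>] by blast
    have "openin X {t \<in> T. w t \<in> U}" using openin_continuous_map_preimage[OF wc] U(1) by simp
    then show "\<exists>a\<in>S. \<exists>G. openin X G \<and> t0 \<in> G \<and> (\<forall>t\<in>G. norm (b i t - a t) < \<eta>)"
      using U t0 by (intro bexI[OF _ family_field[OF F i, of "w t0"]] exI[of _ "{t \<in> T. w t \<in> U}"])
        (auto simp: b_def)
  next
    show "vanishes_at_infinity X (\<lambda>t. norm (b i t))"
      unfolding vanishes_at_infinity_def
    proof (intro allI impI)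
      fix \<eta> :: real assume \<eta>: "\<eta> > 0"
      then have \<eta>2: "\<eta> / 2 > 0" by simp
      have "\<forall>s0. \<exists>U. open U \<and> s0 \<in> U \<and> (\<forall>s\<in>U. \<forall>t\<in>T. norm (F s i t - F s0 i t) < \<eta> / 2)"
        using near[OF i \<eta>2] by blast
      from choice[OF this] obtain U where U: "\<forall>s0. open (U s0) \<and> s0 \<in> U s0 \<and>
        (\<forall>s\<in>U s0. \<forall>t\<in>T. norm (F s i t - F s0 i t) < \<eta> / 2)" ..
      obtain D where D: "D \<subseteq> Z" "finite D" "Z \<subseteq> (\<Union>s\<in>D. U s)"
        by (rule compactE_image[OF Z, of Z U]) (use U in auto)
      have "\<forall>s. \<exists>K. compactin X K \<and> (\<forall>t\<in>T - K. norm (F s i t) < \<eta> / 2)"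
        using norm_field_vanishes[OF family_field[OF F i]] \<eta>2
        unfolding vanishes_at_infinity_def by (metis abs_norm_cancel)
      from choice[OF this] obtain Q where Q: "\<forall>s. compactin X (Q s) \<and> (\<forall>t\<in>T - Q s. norm (F s i t) < \<eta> / 2)" ..
      have "\<bar>norm (b i t)\<bar> < \<eta>" if t: "t \<in> T - (\<Union>s\<in>D. Q s)" for t
      proof -
        obtain s where s: "s \<in> D" "w t \<in> U s" using wZ[of t] D(3) by blast
        have "norm (F (w t) i t - F s i t) < \<eta> / 2" using U s(2) t by blast
        moreover have "norm (F s i t) < \<eta> / 2" using Q s(1) t by blast
        ultimately show ?thesis
          using norm_triangle_ineq[of "F (w t) i t - F s i t" "F s i t"] unfolding b_def by simp
      qed
      moreover have "compactin X (\<Union>s\<in>D. Q s)" using Q D(2) by (intro compactin_Union) auto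
      ultimately show "\<exists>K. compactin X K \<and> (\<forall>t\<in>T - K. \<bar>norm (b i t)\<bar> < \<eta>)" by blast
    qed
  qed
  have bL: "LI t (\<lambda>i. b i t)" if t: "t \<in> T" for t
  proof (cases "t \<in> K")
    case True
    have "w t \<in> std_simplex {..<N}" unfolding std_simplex_def using w(2,3) w(6)[OF True] by simp
    moreover have "t \<in> C n" if "n < N" "w t n \<noteq> 0" for n using w(5)[OF t that(2)] WC[OF that(1)] by blast
    ultimately show ?thesis unfolding b_def using FL[OF w(4)[OF t] _ t] by blast
  next
    case False
    show ?thesis
    proof (rule r(2)[OF t])
      fix i assume i: "i < M"
      have "norm (a i t) < r / 2" using Ki(2)[OF i] False t i unfolding K_def by blast
      moreover have "norm (b i t) \<le> norm (a i t) + norm (b i t - a i t)" by (rule norm_triangle_sub)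
      ultimately show "e t * b i t = b i t \<and> norm (b i t) < r" using be[OF i t] ba[OF i t] \<delta>0(3) by simp
    qed
  qed
  show ?thesis
  proof (rule that[of b])
    show "norm (b i t - a i t) \<le> \<epsilon>" if "i < M" "t \<in> T" for i t
      using ba[OF that] \<delta>0(2) by (rule order_trans)
  qed (fact bS bL)+
qed

end

context shifted_tuples
begin

definition gram :: "(nat \<Rightarrow> 'x \<Rightarrow> 'u) \<Rightarrow> 'x \<Rightarrow> 'u"
  where "gram b t = (\<Sum>j<M. star (b j t + cx (p j) * e t) * (b j t + cx (p j) * e t))"

text \<open>A unit of the whole algebra instead of \<open>e t\<close> is obtained by adding the entry \<open>1 - e t\<close> to
  the tuple; then \<open>sum_star_mult_invertible\<close> applies.\<close>

lemma gram_invertible_at: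
  assumes t: "t \<in> T" and b: "\<And>j. j < M \<Longrightarrow> e t * b j t = b j t" and LI: "LI t (\<lambda>j. b j t)"
  shows "e t * gram b t = gram b t" "\<exists>y. e t * y = y \<and> gram b t * y = e t \<and> y * gram b t = e t"
proof -
  let ?B = "\<lambda>j. b j t + cx (p j) * e t"
  have ee: "e t * e t = e t" by (rule e_idem[OF t])
  have eB: "e t * ?B j = ?B j" if "j < M" for j
  proof -
    have "e t * (cx (p j) * e t) = cx (p j) * (e t * e t)" by (simp only: cx_central[of "p j" "e t", symmetric] flip: mult.assoc)
    then show ?thesis using b[OF that] ee by (simp add: distrib_left)
  qed
  have es: "e t * star (?B j) = star (?B j)" if "j < M" for j
    using arg_cong[OF eB[OF that], of star] e_star[OF t] e_central[OF t, of "star (?B j)"]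
    by (simp add: star_mult)
  show eg: "e t * gram b t = gram b t"
    unfolding gram_def sum_distrib_left by (rule sum.cong) (simp_all add: es flip: mult.assoc)
  obtain d where d: "(\<Sum>j<M. d j * ?B j) = e t" using LI unfolding LI_def by blast
  define B where "B j = (if j < M then ?B j else 1 - e t)" for j
  define c where "c j = (if j < M then d j else 1 - e t)" for j
  have q: "(1 - e t) * (1 - e t) = 1 - e t" using ee by (simp add: algebra_simps)
  have "(\<Sum>j<Suc M. c j * B j) = (\<Sum>j<M. d j * ?B j) + (1 - e t) * (1 - e t)"
    unfolding B_def c_def by simp
  also have "\<dots> = 1" unfolding d q by simp
  finally have "invertible_elt (\<Sum>j<Suc M. star (B j) * B j)" by (rule sum_star_mult_invertible)
  moreover have "(\<Sum>j<Suc M. star (B j) * B j) = gram b t + (1 - e t)"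
    unfolding B_def gram_def using q e_star[OF t] by (simp add: star_diff)
  ultimately obtain y where y: "(gram b t + (1 - e t)) * y = 1" "y * (gram b t + (1 - e t)) = 1"
    unfolding invertible_elt_def by auto
  have eX: "e t * (gram b t + (1 - e t)) = gram b t" using eg ee by (simp add: algebra_simps)
  have ce: "e t * u = u * e t" for u by (rule e_central[OF t])
  have "gram b t * (e t * y) = (gram b t * e t) * y" by (simp only: mult.assoc)
  also have "gram b t * e t = gram b t" using eg ce[of "gram b t"] by simp
  also have "gram b t * y = e t * ((gram b t + (1 - e t)) * y)" by (simp only: eX flip: mult.assoc)
  finally have 1: "gram b t * (e t * y) = e t" using y(1) by simp
  have "e t * y * gram b t = y * (e t * gram b t)" by (simp only: ce[of y] mult.assoc)
  also have "\<dots> = y * (e t * (gram b t + (1 - e t)))" by (simp only: eg eX)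
  also have "\<dots> = y * ((gram b t + (1 - e t)) * e t)" by (simp only: ce[of "gram b t + (1 - e t)"])
  also have "\<dots> = (y * (gram b t + (1 - e t))) * e t" by (simp only: mult.assoc)
  finally have 2: "e t * y * gram b t = e t" using y(2) by simp
  have "e t * (e t * y) = e t * y" using ee by (simp flip: mult.assoc)
  with 1 2 show "\<exists>y. e t * y = y \<and> gram b t * y = e t \<and> y * gram b t = e t" by blast
qed

lemma gram_expand:
  assumes t: "t \<in> T" and b: "\<And>j. j < M \<Longrightarrow> e t * b j t = b j t"
  shows "gram b t = (\<Sum>j<M. star (b j t) * b j t + cx (p j) * star (b j t) + cx (cnj (p j)) * b j t) + P *\<^sub>R e t"
proof -
  have "gram b t = (\<Sum>j<M. (star (b j t) * b j t + cx (p j) * star (b j t) + cx (cnj (p j)) * b j t) + ((cmod (p j))\<^sup>2) *\<^sub>R e t)"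
    unfolding gram_def
  proof (rule sum.cong[OF refl])
    fix j assume "j \<in> {..<M}"
    then have bj: "e t * b j t = b j t" using b by simp
    have bs: "star (b j t) * e t = star (b j t)"
      using arg_cong[OF bj, of star] e_star[OF t] by (simp add: star_mult)
    have st: "star (b j t + cx (p j) * e t) = star (b j t) + e t * cx (cnj (p j))"
      by (simp add: star_add star_mult star_cx e_star[OF t])
    have 1: "star (b j t) * (cx (p j) * e t) = cx (p j) * star (b j t)"
    proof -
      have "star (b j t) * (cx (p j) * e t) = (star (b j t) * cx (p j)) * e t" by (simp only: mult.assoc)
      also have "\<dots> = cx (p j) * (star (b j t) * e t)"
        by (simp only: cx_central[of "p j" "star (b j t)", symmetric] mult.assoc)
      finally show ?thesis by (simp only: bs)
    qed
    have 2: "e t * cx (cnj (p j)) * b j t = cx (cnj (p j)) * b j t"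
      by (simp only: cx_central[of "cnj (p j)" "e t", symmetric] mult.assoc bj)
    have "e t * cx (cnj (p j)) * (cx (p j) * e t) = e t * (cx (cnj (p j)) * cx (p j)) * e t" by (simp only: mult.assoc)
    also have "cx (cnj (p j)) * cx (p j) = of_real ((cmod (p j))\<^sup>2)"
      by (simp only: mult.commute[of "cnj (p j)"] complex_norm_square[symmetric] cx_of_real flip: cx_mult of_real_power)
    also have "e t * of_real ((cmod (p j))\<^sup>2) * e t = ((cmod (p j))\<^sup>2) *\<^sub>R e t" by (simp add: of_real_def e_idem[OF t])
    finally have 3: "e t * cx (cnj (p j)) * (cx (p j) * e t) = ((cmod (p j))\<^sup>2) *\<^sub>R e t" .
    show "star (b j t + cx (p j) * e t) * (b j t + cx (p j) * e t) =
      (star (b j t) * b j t + cx (p j) * star (b j t) + cx (cnj (p j)) * b j t) + ((cmod (p j))\<^sup>2) *\<^sub>R e t"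
      unfolding st by (simp only: distrib_left distrib_right 1 2 3) simp
  qed
  also have "\<dots> = (\<Sum>j<M. star (b j t) * b j t + cx (p j) * star (b j t) + cx (cnj (p j)) * b j t) + P *\<^sub>R e t"
    unfolding P_def by (simp only: sum.distrib scaleR_sum_left)
  finally show ?thesis .
qed

text \<open>Let \<open>y t\<close> be the inverse of \<open>g t = s t + P\<close>, where \<open>s\<close> is a field, and \<open>z = y - 1/P\<close>. Near
  \<open>t0\<close>, if \<open>a\<close> is a field with \<open>a t0\<close> close to \<open>z t0\<close>, then \<open>w = g (a + 1/P) - 1\<close> is a field,
  hence small near \<open>t0\<close>, and \<open>a - z = y w\<close>. At infinity, \<open>P z = - y s\<close> is small with \<open>s\<close>.\<close>

theorem inverse_field:
  assumes b: "\<And>j. j < M \<Longrightarrow> b j \<in> S" and LI: "\<And>t. t \<in> T \<Longrightarrow> LI t (\<lambda>j. b j t)"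
  obtains z where "z \<in> S"
    "\<And>t. t \<in> T \<Longrightarrow> gram b t * (z t + (1 / P) *\<^sub>R e t) = e t"
    "\<And>t. t \<in> T \<Longrightarrow> (z t + (1 / P) *\<^sub>R e t) * gram b t = e t"
proof -
  define s where "s t = (\<Sum>j<M. star (b j t) * b j t + cx (p j) * star (b j t) + cx (cnj (p j)) * b j t)" for t
  have sS: "s \<in> S" unfolding s_def[abs_def]
    using b by (intro sum_field add_field mult_field star_field scale_field) auto
  have eb: "e t * b j t = b j t" if "j < M" "t \<in> T" for j t using field[OF b[OF that(1)] that(2)] .
  have gs: "gram b t = s t + P *\<^sub>R e t" if "t \<in> T" for t unfolding s_def using that eb by (intro gram_expand) auto
  have "\<forall>t\<in>T. \<exists>y. e t * y = y \<and> gram b t * y = e t \<and> y * gram b t = e t"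
    using gram_invertible_at(2) eb LI by blast
  from bchoice[OF this] obtain y where y: "\<And>t. t \<in> T \<Longrightarrow> e t * y t = y t"
    "\<And>t. t \<in> T \<Longrightarrow> gram b t * y t = e t" "\<And>t. t \<in> T \<Longrightarrow> y t * gram b t = e t" by blast
  define z where "z t = y t - (1 / P) *\<^sub>R e t" for t
  have yz: "y t = z t + (1 / P) *\<^sub>R e t" for t unfolding z_def by simp
  have ez: "e t * z t = z t" if "t \<in> T" for t
    unfolding z_def using y(1)[OF that] e_idem[OF that] by (simp add: right_diff_distrib)
  have ye: "y t * e t = y t" if "t \<in> T" for t using y(1)[OF that] e_central[OF that, of "y t"] by simp
  have Pn: "1 / P > 0" "P \<noteq> 0" using P_pos by auto
  have ne: "norm ((1 / P) *\<^sub>R e t) \<le> 1 / P" if "t \<in> T" for t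
    using mult_left_mono[OF norm_e[OF that], of "1 / P"] Pn(1) by simp
  have "z \<in> S"
  proof (rule local_field)
    show "e t * z t = z t" if "t \<in> T" for t by (rule ez[OF that])
    fix t0 and \<eta> :: real assume t0: "t0 \<in> T" and \<eta>: "\<eta> > 0"
    define R where "R = norm (z t0) + 1 + 1 / P"
    have R: "R > 0" unfolding R_def using Pn(1) by (simp add: add_nonneg_pos)
    define \<kappa> where "\<kappa> = min (1/2) (\<eta> / (2 * R))"
    have \<kappa>: "\<kappa> > 0" "\<kappa> \<le> 1/2" "2 * R * \<kappa> \<le> \<eta>"
    proof -
      show "\<kappa> > 0" "\<kappa> \<le> 1/2" using \<eta> R unfolding \<kappa>_def by auto
      have "2 * R * \<kappa> \<le> 2 * R * (\<eta> / (2 * R))" using R unfolding \<kappa>_def by (intro mult_left_mono) auto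
      then show "2 * R * \<kappa> \<le> \<eta>" using R by simp
    qed
    define \<zeta> where "\<zeta> = min 1 (\<kappa> / (norm (gram b t0) + 1))"
    have gp: "norm (gram b t0) + 1 > 0" by (simp add: add_nonneg_pos)
    have \<zeta>: "\<zeta> > 0" "\<zeta> \<le> 1" using \<kappa>(1) gp unfolding \<zeta>_def by auto
    obtain a where a: "a \<in> S" "norm (a t0 - z t0) < \<zeta>" "\<And>t. t \<in> T \<Longrightarrow> norm (a t) \<le> norm (z t0) + \<zeta>"
      using lift_field[OF t0 ez[OF t0] \<zeta>(1)] by blast
    define w where "w t = s t * a t + P *\<^sub>R a t + (1 / P) *\<^sub>R s t" for t
    have wS: "w \<in> S" unfolding w_def[abs_def]
      by (intro add_field mult_field scaleR_field sS a(1))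
    have w_eq: "w t = gram b t * (a t + (1 / P) *\<^sub>R e t) - e t" if t: "t \<in> T" for t
    proof -
      have "s t * e t = s t" using field[OF sS t] e_central[OF t, of "s t"] by simp
      then show ?thesis unfolding w_def gs[OF t]
        using field[OF a(1) t] e_idem[OF t] Pn(2) by (simp add: distrib_left distrib_right scaleR_add_right)
    qed
    have w0: "w t0 = gram b t0 * (a t0 - z t0)"
      unfolding w_eq[OF t0] using y(2)[OF t0] unfolding yz by (simp add: algebra_simps)
    have "norm (w t0) \<le> norm (gram b t0) * \<zeta>"
      unfolding w0 using a(2) by (intro order_trans[OF norm_mult_ineq] mult_left_mono) auto
    also have "\<dots> < (norm (gram b t0) + 1) * \<zeta>" using \<zeta>(1) by simp
    also have "\<dots> \<le> (norm (gram b t0) + 1) * (\<kappa> / (norm (gram b t0) + 1))"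
      unfolding \<zeta>_def by (intro mult_left_mono) auto
    also have "\<dots> = \<kappa>" using gp by simp
    finally have w0\<kappa>: "norm (w t0) < \<kappa>" .
    define G where "G = {t \<in> T. norm (w t) < \<kappa>}"
    have "openin X G" unfolding G_def by (intro openin_less norm_field_continuous wS)
    moreover have "t0 \<in> G" unfolding G_def using t0 w0\<kappa> by simp
    moreover have "norm (z t - a t) < \<eta>" if "t \<in> G" for t
    proof -
      have t: "t \<in> T" and wt: "norm (w t) < \<kappa>" using that unfolding G_def by auto
      have "y t * w t = (y t * gram b t) * (a t + (1 / P) *\<^sub>R e t) - y t * e t"
        unfolding w_eq[OF t] by (simp only: right_diff_distrib mult.assoc)
      also have "\<dots> = (a t + (1 / P) *\<^sub>R e t) - y t"
        using y(3)[OF t] ye[OF t] field[OF a(1) t] e_idem[OF t] by (simp add: distrib_left)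
      finally have yw: "y t * w t = a t - z t" unfolding yz[of t] by simp
      have yn: "norm (a t - z t) \<le> norm (y t) * norm (w t)" unfolding yw[symmetric] by (rule norm_mult_ineq)
      have "y t = (a t + (1 / P) *\<^sub>R e t) - (a t - z t)" unfolding yz[of t] by simp
      then have "norm (y t) \<le> norm (a t + (1 / P) *\<^sub>R e t) + norm (a t - z t)" by (metis norm_triangle_ineq4)
      also have "norm (a t + (1 / P) *\<^sub>R e t) \<le> R"
        using norm_triangle_ineq[of "a t" "(1 / P) *\<^sub>R e t"] a(3)[OF t] \<zeta>(2) ne[OF t] unfolding R_def by linarith
      also have "norm (a t - z t) \<le> norm (y t) * (1/2)"
        using yn wt \<kappa>(2) mult_left_mono[of "norm (w t)" "1/2" "norm (y t)"] by simp
      finally have y2: "norm (y t) \<le> 2 * R" by simp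
      have "norm (y t) * norm (w t) \<le> 2 * R * norm (w t)" by (rule mult_right_mono[OF y2 norm_ge_zero])
      also have "\<dots> < 2 * R * \<kappa>" using wt R by simp
      finally show ?thesis using yn \<kappa>(3) by (simp add: norm_minus_commute)
    qed
    ultimately show "\<exists>a\<in>S. \<exists>G. openin X G \<and> t0 \<in> G \<and> (\<forall>t\<in>G. norm (z t - a t) < \<eta>)" using a(1) by blast
  next
    show "vanishes_at_infinity X (\<lambda>t. norm (z t))"
      unfolding vanishes_at_infinity_def
    proof (intro allI impI)
      fix \<eta> :: real assume \<eta>: "\<eta> > 0"
      define \<kappa> where "\<kappa> = min (P / 2) (\<eta> * P\<^sup>2 / 2)"
      have \<kappa>: "\<kappa> > 0" "\<kappa> \<le> P / 2" "\<kappa> \<le> \<eta> * P\<^sup>2 / 2" using \<eta> P_pos unfolding \<kappa>_def by auto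
      obtain K where K: "compactin X K" "\<forall>t\<in>T - K. \<bar>norm (s t)\<bar> < \<kappa>"
        using norm_field_vanishes[OF sS] \<kappa>(1) unfolding vanishes_at_infinity_def by blast
      have "\<bar>norm (z t)\<bar> < \<eta>" if t: "t \<in> T - K" for t
      proof -
        have tT: "t \<in> T" using t by blast
        have sn: "norm (s t) < \<kappa>" using K(2) t by simp
        have "y t * s t + P *\<^sub>R y t = e t"
          using y(3)[OF tT] ye[OF tT] unfolding gs[OF tT] by (simp add: distrib_left)
        moreover have "P *\<^sub>R y t = P *\<^sub>R z t + e t"
          unfolding yz[of t] using Pn(2) by (simp add: scaleR_add_right)
        ultimately have "P *\<^sub>R z t + y t * s t = 0" by (simp add: algebra_simps)
        then have "P *\<^sub>R z t = - (y t * s t)" by (rule eq_neg_iff_add_eq_0[THEN iffD2])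
        then have "P * norm (z t) = norm (y t * s t)" using P_pos by (metis abs_of_pos norm_minus_cancel norm_scaleR)
        also have "\<dots> \<le> norm (y t) * norm (s t)" by (rule norm_mult_ineq)
        also have "norm (y t) \<le> norm (z t) + 1 / P"
          using norm_triangle_ineq[of "z t" "(1 / P) *\<^sub>R e t"] ne[OF tT] unfolding yz[of t] by simp
        finally have le: "P * norm (z t) \<le> norm (z t) * norm (s t) + norm (s t) / P"
          by (simp add: mult_right_mono algebra_simps)
        also have "norm (z t) * norm (s t) \<le> norm (z t) * (P / 2)"
          using sn \<kappa>(2) by (intro mult_left_mono) auto
        finally have "P * norm (z t) \<le> norm (z t) * (P / 2) + norm (s t) / P" by simp
        moreover have "norm (z t) * (P / 2) = P * norm (z t) / 2" by simp
        ultimately have "P * norm (z t) \<le> 2 * (norm (s t) / P)" by linarith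
        then have "norm (z t) \<le> 2 * norm (s t) / P\<^sup>2"
          using P_pos by (simp add: field_simps power2_eq_square)
        also have "\<dots> < 2 * (\<eta> * P\<^sup>2 / 2) / P\<^sup>2"
          using sn \<kappa>(3) P_pos by (intro divide_strict_right_mono) auto
        finally show ?thesis using P_pos by simp
      qed
      then show "\<exists>K. compactin X K \<and> (\<forall>t\<in>T - K. \<bar>norm (z t)\<bar> < \<eta>)" using K(1) by blast
    qed
  qed
  then show ?thesis using y(2,3) unfolding yz by (rule that)
qed

end

section \<open>Tensor products with C(Y)\<close>

definition unemb :: "'b cstar \<Rightarrow> 'b universal_cstar \<Rightarrow> 'b"
  where "unemb A u = (SOME x. x \<in> carrier A \<and> emb A x = u)"

context
  fixes A :: "'b cstar"
  assumes A: "unital_cstar A"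
begin

interpretation A: cstar_algebra A using A unfolding unital_cstar_def by simp

lemma unemb:
  assumes "fibre_one A * u = u"
  shows "unemb A u \<in> carrier A" "emb A (unemb A u) = u"
proof -
  have "\<exists>x. x \<in> carrier A \<and> emb A x = u" using fibre_one_range[OF A, of u] assms by auto
  from someI_ex[OF this] show "unemb A u \<in> carrier A" "emb A (unemb A u) = u"
    unfolding unemb_def by auto
qed

lemma emb_fin_sum:
  "(\<And>i. i < n \<Longrightarrow> f i \<in> carrier A) \<Longrightarrow> emb A (fin_sum A f n) = (\<Sum>i<n. emb A (f i))"
  by (induction n) (simp_all add: emb_zero[OF A] emb_add[OF A] A.fin_sum_closed)

end

lemma fin_sum_field_algebra:
  "t \<in> T \<Longrightarrow> fin_sum (field_algebra T G S) f n t = fin_sum (G t) (\<lambda>i. f i t) n"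
  by (induction n) simp_all

context
  fixes A :: "'b cstar" and Y :: "'y topology"
  assumes A: "unital_cstar A"
begin

interpretation A: cstar_algebra A using A unfolding unital_cstar_def by simp

lemma alg_tensor_iff:
  assumes "h \<in> alg_tensor Y A"
  shows "continuous_map Y euclidean (\<lambda>s. emb A (h s))" "\<And>s. s \<in> topspace Y \<Longrightarrow> h s \<in> carrier A"
proof -
  obtain f a n where h: "h = fin_sum (field_algebra (topspace Y) (\<lambda>_. A) (topspace Y \<rightarrow>\<^sub>E carrier A))
        (\<lambda>i. elem_tensor Y A (f i) (a i)) n"
    and f: "\<And>i. i < n \<Longrightarrow> f i \<in> carrier (C_algebra Y)" and a: "\<And>i. i < n \<Longrightarrow> a i \<in> carrier A"
    using assms unfolding alg_tensor_def by blast
  have hs: "h s = fin_sum A (\<lambda>i. smult A (f i s) (a i)) n" if "s \<in> topspace Y" for s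
    unfolding h fin_sum_field_algebra[OF that] using that by (simp add: elem_tensor_def)
  have cl: "smult A (f i s) (a i) \<in> carrier A" if "i < n" for i s by (rule A.smult_closed[OF a[OF that]])
  show "h s \<in> carrier A" if "s \<in> topspace Y" for s
    unfolding hs[OF that] by (rule A.fin_sum_closed[OF cl])
  have eq: "emb A (h s) = (\<Sum>i<n. of_real (Re (f i s)) * emb A (a i) + of_real (Im (f i s)) * (im * emb A (a i)))"
    if "s \<in> topspace Y" for s
  proof -
    have "emb A (h s) = (\<Sum>i<n. emb A (smult A (f i s) (a i)))"
      unfolding hs[OF that] by (rule emb_fin_sum[OF A]) (rule cl)
    also have "\<dots> = (\<Sum>i<n. of_real (Re (f i s)) * emb A (a i) + of_real (Im (f i s)) * (im * emb A (a i)))"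
      by (intro sum.cong refl) (simp add: emb_smult[OF A a] cx_def distrib_right mult.assoc)
    finally show ?thesis .
  qed
  have fc: "continuous_map Y euclidean (f i)" if "i < n" for i
    using f[OF that] by (simp add: C_algebra_def)
  have "continuous_map Y euclidean (\<lambda>s. \<Sum>i<n. Re (f i s) *\<^sub>R emb A (a i) + Im (f i s) *\<^sub>R (im * emb A (a i)))"
  proof (intro continuous_map_sum finite_lessThan continuous_map_add)
    fix i assume "i \<in> {..<n}"
    then have "continuous_map Y euclidean (f i)" using fc by simp
    then have *: "continuous_map Y euclidean (g \<circ> f i)" if "continuous_on UNIV g" for g :: "complex \<Rightarrow> 'b universal_cstar"
      using that by (intro continuous_map_compose[of Y euclidean]) (auto simp: continuous_map_iff_continuous2)
    show "continuous_map Y euclidean (\<lambda>s. Re (f i s) *\<^sub>R emb A (a i))"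
      using *[of "\<lambda>c. Re c *\<^sub>R emb A (a i)"] by (simp add: o_def continuous_intros)
    show "continuous_map Y euclidean (\<lambda>s. Im (f i s) *\<^sub>R (im * emb A (a i)))"
      using *[of "\<lambda>c. Im c *\<^sub>R (im * emb A (a i))"] by (simp add: o_def continuous_intros)
  qed
  then show "continuous_map Y euclidean (\<lambda>s. emb A (h s))"
    by (rule continuous_map_eq) (simp add: eq scaleR_conv_of_real)
qed

lemma C_tensor_carrier:
  "g \<in> carrier (C_tensor Y A) \<longleftrightarrow> g \<in> topspace Y \<rightarrow>\<^sub>E carrier A \<and>
      (\<forall>\<epsilon>>0. \<exists>h\<in>alg_tensor Y A. \<forall>s\<in>topspace Y. cnorm A (g s \<ominus>\<^bsub>A\<^esub> h s) < \<epsilon>)"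
  by (simp add: C_tensor_def)

text \<open>A uniform limit of continuous maps is continuous.\<close>

lemma C_tensor_continuous:
  assumes g: "g \<in> carrier (C_tensor Y A)"
  shows "continuous_map Y euclidean (\<lambda>s. emb A (g s))"
  unfolding Met_TC.continuous_map_to_metric[unfolded mtopology_is_euclidean]
proof (intro ballI allI impI)
  fix s and \<epsilon> :: real assume s: "s \<in> topspace Y" and \<epsilon>: "\<epsilon> > 0"
  have "\<epsilon> / 3 > 0" using \<epsilon> by simp
  then obtain h where h: "h \<in> alg_tensor Y A" "\<And>s. s \<in> topspace Y \<Longrightarrow> cnorm A (g s \<ominus>\<^bsub>A\<^esub> h s) < \<epsilon> / 3"
    using g unfolding C_tensor_carrier by blast
  have gc: "g s \<in> carrier A" if "s \<in> topspace Y" for s using g that unfolding C_tensor_carrier by blast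
  have n: "norm (emb A (g s) - emb A (h s)) < \<epsilon> / 3" if "s \<in> topspace Y" for s
    using h(2)[OF that] norm_emb[OF A A.diff_closed[OF gc[OF that] alg_tensor_iff(2)[OF h(1) that]]]
      emb_diff[OF A gc[OF that] alg_tensor_iff(2)[OF h(1) that]] by simp
  have "\<epsilon> / 3 > 0" using \<epsilon> by simp
  with alg_tensor_iff(1)[OF h(1), unfolded Met_TC.continuous_map_to_metric[unfolded mtopology_is_euclidean]] s
  have "\<exists>U. openin Y U \<and> s \<in> U \<and> (\<forall>y\<in>U. emb A (h y) \<in> Met_TC.mball (emb A (h s)) (\<epsilon> / 3))" by blast
  then obtain U where U: "openin Y U" "s \<in> U" "\<And>y. y \<in> U \<Longrightarrow> dist (emb A (h s)) (emb A (h y)) < \<epsilon> / 3"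
    by (auto simp: Met_TC.in_mball)
  have "dist (emb A (g s)) (emb A (g y)) < \<epsilon>" if y: "y \<in> U" for y
  proof -
    have yY: "y \<in> topspace Y" using y openin_subset[OF U(1)] by blast
    have "dist (emb A (g s)) (emb A (h s)) < \<epsilon> / 3" "dist (emb A (h y)) (emb A (g y)) < \<epsilon> / 3"
      using n[OF s] n[OF yY] by (simp_all add: dist_norm norm_minus_commute)
    then show ?thesis using U(3)[OF y] by (metis dist_triangle_third)
  qed
  then show "\<exists>U. openin Y U \<and> s \<in> U \<and> (\<forall>y\<in>U. emb A (g y) \<in> Met_TC.mball (emb A (g s)) \<epsilon>)"
    using U(1,2) by (intro exI[of _ U]) (simp add: Met_TC.in_mball)
qed

text \<open>A continuous map on a compact set is approximated by finite sums of scalar functions times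
  constants, by \<open>finite_rank_approximation\<close>; such sums are elementary tensors after composition
  with \<open>q\<close>.\<close>

lemma C_tensor_pullback:
  fixes f :: "(nat \<Rightarrow> real) \<Rightarrow> 'b universal_cstar"
  assumes L: "compact L" and f: "continuous_on L f" "\<And>s. s \<in> L \<Longrightarrow> fibre_one A * f s = f s"
    and q: "continuous_map Y euclidean q" "\<And>y. y \<in> topspace Y \<Longrightarrow> q y \<in> L"
  shows "(\<lambda>y\<in>topspace Y. unemb A (f (q y))) \<in> carrier (C_tensor Y A)"
  unfolding C_tensor_carrier
proof (intro conjI allI impI)
  have un: "unemb A (f s) \<in> carrier A" "emb A (unemb A (f s)) = f s" if "s \<in> L" for s
    using unemb[OF A f(2)[OF that]] by auto
  show "(\<lambda>y\<in>topspace Y. unemb A (f (q y))) \<in> topspace Y \<rightarrow>\<^sub>E carrier A" using un(1) q(2) by auto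
  fix \<epsilon> :: real assume "\<epsilon> > 0"
  then have \<epsilon>2: "\<epsilon> / 2 > 0" by simp
  obtain l D where D: "finite D" "D \<subseteq> L" "\<And>i. continuous_on UNIV (l i)"
    "\<And>i s. 0 \<le> l i s" "\<And>s. (\<Sum>i\<in>D. l i s) \<le> 1"
    "\<And>s j. s \<in> L \<Longrightarrow> j < (1::nat) \<Longrightarrow> norm ((\<Sum>i\<in>D. l i s *\<^sub>R f i) - f s) \<le> \<epsilon> / 2"
    by (rule finite_rank_approximation[where M = 1 and D = "\<lambda>s j. f s", OF L f(1) \<epsilon>2]) (rule that)
  obtain \<beta> where \<beta>: "bij_betw \<beta> {0..<card D} D" using ex_bij_betw_nat_finite[OF D(1)] by blast
  have \<beta>D: "\<beta> i \<in> D" "\<beta> i \<in> L" if "i < card D" for i using bij_betwE[OF \<beta>] that D(2) by auto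
  define \<phi> where "\<phi> i = (\<lambda>y\<in>topspace Y. complex_of_real (l (\<beta> i) (q y)))" for i
  define a where "a i = unemb A (f (\<beta> i))" for i
  have ac: "a i \<in> carrier A" "emb A (a i) = f (\<beta> i)" if "i < card D" for i
    unfolding a_def using un[OF \<beta>D(2)[OF that]] by auto
  define h where "h = fin_sum (field_algebra (topspace Y) (\<lambda>_. A) (topspace Y \<rightarrow>\<^sub>E carrier A))
        (\<lambda>i. elem_tensor Y A (\<phi> i) (a i)) (card D)"
  have \<phi>c: "\<phi> i \<in> carrier (C_algebra Y)" for i
  proof -
    have "continuous_map euclidean euclidean (\<lambda>s. complex_of_real (l (\<beta> i) s))"
      using D(3)[of "\<beta> i"] by (simp add: continuous_map_iff_continuous2 continuous_intros)
    from continuous_map_compose[OF q(1) this]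
    have "continuous_map Y euclidean (\<phi> i)" unfolding \<phi>_def by (rule continuous_map_eq) simp
    then show ?thesis by (simp add: C_algebra_def \<phi>_def)
  qed
  have "h \<in> alg_tensor Y A" unfolding alg_tensor_def h_def using \<phi>c ac(1) by blast
  moreover have "cnorm A ((\<lambda>y\<in>topspace Y. unemb A (f (q y))) y \<ominus>\<^bsub>A\<^esub> h y) < \<epsilon>" if y: "y \<in> topspace Y" for y
  proof -
    have qL: "q y \<in> L" using q(2)[OF y] .
    have hy: "h y = fin_sum A (\<lambda>i. smult A (\<phi> i y) (a i)) (card D)"
      unfolding h_def fin_sum_field_algebra[OF y] using y by (simp add: elem_tensor_def)
    have cl: "smult A (\<phi> i y) (a i) \<in> carrier A" if "i < card D" for i by (rule A.smult_closed[OF ac(1)[OF that]])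
    have hc: "h y \<in> carrier A" unfolding hy by (rule A.fin_sum_closed[OF cl])
    have "emb A (h y) = (\<Sum>i<card D. emb A (smult A (\<phi> i y) (a i)))"
      unfolding hy by (rule emb_fin_sum[OF A]) (rule cl)
    also have "\<dots> = (\<Sum>i<card D. l (\<beta> i) (q y) *\<^sub>R f (\<beta> i))"
      using y by (intro sum.cong refl) (simp add: emb_smult[OF A ac(1)] ac(2) \<phi>_def cx_of_real scaleR_conv_of_real)
    also have "\<dots> = (\<Sum>i\<in>D. l i (q y) *\<^sub>R f i)"
      using sum.reindex_bij_betw[OF \<beta>, of "\<lambda>i. l i (q y) *\<^sub>R f i"] by (simp add: lessThan_atLeast0)
    finally have "norm (f (q y) - emb A (h y)) \<le> \<epsilon> / 2"
      using D(6)[OF qL, of 0] by (simp add: norm_minus_commute)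
    moreover have "cnorm A (unemb A (f (q y)) \<ominus>\<^bsub>A\<^esub> h y) = norm (f (q y) - emb A (h y))"
      using norm_emb[OF A A.diff_closed[OF un(1)[OF qL] hc]] emb_diff[OF A un(1)[OF qL] hc] un(2)[OF qL] by simp
    ultimately show ?thesis using y \<open>\<epsilon> > 0\<close> by simp
  qed
  ultimately show "\<exists>h\<in>alg_tensor Y A. \<forall>y\<in>topspace Y. cnorm A ((\<lambda>y\<in>topspace Y. unemb A (f (q y))) y \<ominus>\<^bsub>A\<^esub> h y) < \<epsilon>" by blast
qed

lemma C_tensor_unit: "is_unit_of (C_tensor Y A) (\<lambda>y\<in>topspace Y. one_of A)"
proof -
  have one: "is_unit_of A (one_of A)" by (rule one_of_unit[OF A])
  have "unemb A (fibre_one A) = one_of A"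
    using unemb[OF A fibre_one_idem[OF A]] emb_inject[OF A _ one_of_closed[OF A]]
    by (simp add: fibre_one_def)
  moreover have "(\<lambda>y\<in>topspace Y. unemb A (fibre_one A)) \<in> carrier (C_tensor Y A)"
    using C_tensor_pullback[of "{\<lambda>_. 0}" "\<lambda>_. fibre_one A" "\<lambda>_ _. 0"] fibre_one_idem[OF A] by simp
  ultimately have car: "(\<lambda>y\<in>topspace Y. one_of A) \<in> carrier (C_tensor Y A)" by simp
  have "(\<lambda>y\<in>topspace Y. one_of A) \<otimes>\<^bsub>C_tensor Y A\<^esub> g = g \<and> g \<otimes>\<^bsub>C_tensor Y A\<^esub> (\<lambda>y\<in>topspace Y. one_of A) = g"
    if "g \<in> carrier (C_tensor Y A)" for g
  proof -
    have "g \<in> topspace Y \<rightarrow>\<^sub>E carrier A" using that unfolding C_tensor_carrier by blast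
    then show ?thesis using one unfolding is_unit_of_def C_tensor_def field_algebra_simps
      by (auto simp: fun_eq_iff PiE_def extensional_def)
  qed
  then show ?thesis unfolding is_unit_of_def using car by blast
qed

text \<open>Evaluation at \<open>y\<close> is a unital homomorphism.\<close>

lemma Lg_left_inverse:
  assumes b: "b \<in> Lg (C_tensor Y A) n" and y: "y \<in> topspace Y"
  shows "\<exists>d. (\<Sum>j<n. d j * emb A (b j y)) = fibre_one A"
proof -
  let ?C = "C_tensor Y A"
  have bc: "b j \<in> carrier ?C" if "j < n" for j
    using b that unfolding Lg_def tuples_def by blast
  have mem: "g y \<in> carrier A" if "g \<in> carrier ?C" for g using that y unfolding C_tensor_carrier by blast
  let ?x = "fin_sum ?C (\<lambda>j. adj ?C (b j) \<otimes>\<^bsub>?C\<^esub> b j) n"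
  obtain v where v: "v \<in> carrier ?C" "is_unit_of ?C (v \<otimes>\<^bsub>?C\<^esub> ?x)"
    using b unfolding Lg_def invertible_in_def by blast
  have "v \<otimes>\<^bsub>?C\<^esub> ?x = (\<lambda>y\<in>topspace Y. one_of A)" using unit_unique[OF v(2) C_tensor_unit] .
  then have "(v \<otimes>\<^bsub>?C\<^esub> ?x) y = one_of A" using y by simp
  moreover have xy: "?x y = fin_sum A (\<lambda>j. adj A (b j y) \<otimes>\<^bsub>A\<^esub> b j y) n"
    unfolding C_tensor_def fin_sum_field_algebra[OF y] using y by simp
  ultimately have eq: "v y \<otimes>\<^bsub>A\<^esub> fin_sum A (\<lambda>j. adj A (b j y) \<otimes>\<^bsub>A\<^esub> b j y) n = one_of A"
    using y by (simp add: C_tensor_def)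
  have cl: "adj A (b j y) \<otimes>\<^bsub>A\<^esub> b j y \<in> carrier A" if "j < n" for j
    by (intro A.mult_closed A.adj_closed mem bc that)
  have "fibre_one A = emb A (v y) * (\<Sum>j<n. emb A (adj A (b j y) \<otimes>\<^bsub>A\<^esub> b j y))"
  proof -
    have "emb A (fin_sum A (\<lambda>j. adj A (b j y) \<otimes>\<^bsub>A\<^esub> b j y) n) = (\<Sum>j<n. emb A (adj A (b j y) \<otimes>\<^bsub>A\<^esub> b j y))"
      by (rule emb_fin_sum[OF A]) (rule cl)
    moreover have "fin_sum A (\<lambda>j. adj A (b j y) \<otimes>\<^bsub>A\<^esub> b j y) n \<in> carrier A"
      by (rule A.fin_sum_closed) (rule cl)
    ultimately show ?thesis unfolding fibre_one_def eq[symmetric] by (simp add: emb_mult[OF A mem[OF v(1)]])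
  qed
  also have "\<dots> = (\<Sum>j<n. (emb A (v y) * emb A (adj A (b j y))) * emb A (b j y))"
    unfolding sum_distrib_left
    by (intro sum.cong refl) (simp add: emb_mult[OF A A.adj_closed[OF mem[OF bc]] mem[OF bc]] mult.assoc)
  finally show ?thesis by (intro exI[of _ "\<lambda>j. emb A (v y) * emb A (adj A (b j y))"]) simp
qed

end

subsection \<open>Simplices as retracts of the cube\<close>

lemma topspace_cube: "topspace (cube k) = {..<k} \<rightarrow>\<^sub>E {0..1}"
  by (simp add: cube_def)

text \<open>A simplex with vertices \<open>v 0, \<dots>, v r\<close> is embedded into the cube by the coordinates
  \<open>v 1, \<dots>, v r\<close>. The retraction divides a point by the sum of its coordinates if this sum exceeds
  1, and the remaining weight goes to \<open>v 0\<close>.\<close>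

lemma simplex_retract:
  assumes c: "finite c" "card c \<le> k + 1" "c \<noteq> {}"
  obtains q i where "continuous_map (cube k) euclidean q"
    "\<And>y. y \<in> topspace (cube k) \<Longrightarrow> q y \<in> std_simplex c"
    "continuous_map (top_of_set (std_simplex c)) (cube k) i"
    "\<And>s. s \<in> std_simplex c \<Longrightarrow> q (i s) = s"
proof -
  obtain idx where idx: "bij_betw idx c {0..<card c}" using ex_bij_betw_finite_nat[OF c(1)] by blast
  define v where "v = inv_into c idx"
  have v: "v l \<in> c" "idx (v l) = l" if "l < card c" for l
    using bij_betw_inv_into_right[OF idx] bij_betwE[OF bij_betw_inv_into[OF idx]] that unfolding v_def by auto
  have vi: "v (idx n) = n" if "n \<in> c" for n using bij_betw_inv_into_left[OF idx that] unfolding v_def .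
  have il: "idx n < card c" if "n \<in> c" for n using bij_betwE[OF idx] that by auto
  define r where "r = card c - 1"
  have cr: "card c = Suc r" using c unfolding r_def by (simp add: card_gt_0_iff)
  have rk: "r \<le> k" using c(2) cr by simp
  define \<Sigma> where "\<Sigma> y = (\<Sum>l<r. y l)" for y :: "nat \<Rightarrow> real"
  define q where "q y n = (if n \<in> c then (if idx n = 0 then 1 - \<Sigma> y / max 1 (\<Sigma> y) else y (idx n - 1) / max 1 (\<Sigma> y)) else 0)"
    for y :: "nat \<Rightarrow> real" and n
  define i where "i s = (\<lambda>l\<in>{..<k}. if l < r then s (v (Suc l)) else 0)" for s :: "nat \<Rightarrow> real"
  have sum_c: "(\<Sum>n\<in>c. g n) = g (v 0) + (\<Sum>l<r. g (v (Suc l)))" for g :: "nat \<Rightarrow> real"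
  proof -
    have "(\<Sum>n\<in>c. g n) = (\<Sum>l<card c. g (v l))"
      using sum.reindex_bij_betw[OF bij_betw_inv_into[OF idx], of g] unfolding v_def by (simp add: lessThan_atLeast0)
    then show ?thesis unfolding cr by (simp only: sum.lessThan_Suc_shift)
  qed
  have proj: "continuous_map (cube k) euclideanreal (\<lambda>y. y l)" if "l < k" for l
    using continuous_map_product_projection[of l "{..<k}" "\<lambda>_. top_of_set {0..1::real}"] that
    unfolding cube_def by (simp add: continuous_map_in_subtopology)
  have \<Sigma>c: "continuous_map (cube k) euclideanreal \<Sigma>"
    unfolding \<Sigma>_def[abs_def] using rk by (intro continuous_map_sum proj) auto
  show ?thesis
  proof (rule that[of q i])
    show "continuous_map (cube k) euclidean q"
      unfolding euclidean_product_topology[symmetric] continuous_map_componentwise_UNIV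
    proof
      fix n
      have m: "max 1 (\<Sigma> y) \<noteq> 0" for y by simp
      show "continuous_map (cube k) euclideanreal (\<lambda>y. q y n)"
      proof (cases "n \<in> c")
        case True
        show ?thesis
        proof (cases "idx n = 0")
          case True
          then have eq: "(\<lambda>y. q y n) = (\<lambda>y. 1 - \<Sigma> y / max 1 (\<Sigma> y))" using \<open>n \<in> c\<close> by (simp add: q_def)
          show ?thesis unfolding eq
            by (intro continuous_map_diff continuous_map_real_divide continuous_map_real_max \<Sigma>c m) simp_all
        next
          case False
          then have "idx n - 1 < k" using il[OF \<open>n \<in> c\<close>] cr rk by simp
          have eq: "(\<lambda>y. q y n) = (\<lambda>y. y (idx n - 1) / max 1 (\<Sigma> y))" using \<open>n \<in> c\<close> False by (simp add: q_def)
          show ?thesis unfolding eq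
            by (intro proj[OF \<open>idx n - 1 < k\<close>] continuous_map_real_divide continuous_map_real_max \<Sigma>c m) simp_all
        qed
      qed (simp add: q_def)
    qed
    show "q y \<in> std_simplex c" if y: "y \<in> topspace (cube k)" for y
    proof -
      have y01: "0 \<le> y l" if "l < k" for l using y that unfolding topspace_cube by (auto simp: PiE_def Pi_def)
      have S0: "0 \<le> \<Sigma> y" unfolding \<Sigma>_def using y01 rk by (intro sum_nonneg) auto
      have mp: "max 1 (\<Sigma> y) > 0" by simp
      have "0 \<le> q y n" for n
      proof (cases "n \<in> c")
        case True
        show ?thesis
        proof (cases "idx n = 0")
          case True
          have "\<Sigma> y / max 1 (\<Sigma> y) \<le> 1" using mp by (simp add: divide_le_eq)
          then show ?thesis using True \<open>n \<in> c\<close> unfolding q_def by simp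
        next
          case False
          then have "idx n - 1 < k" using il[OF \<open>n \<in> c\<close>] cr rk by simp
          then show ?thesis using y01 mp False \<open>n \<in> c\<close> unfolding q_def by simp
        qed
      qed (simp add: q_def)
      moreover have "(\<Sum>n\<in>c. q y n) = 1"
      proof -
        have "q y (v 0) = 1 - \<Sigma> y / max 1 (\<Sigma> y)" using v[of 0] cr unfolding q_def by simp
        moreover have "(\<Sum>l<r. q y (v (Suc l))) = (\<Sum>l<r. y l / max 1 (\<Sigma> y))"
          using v cr unfolding q_def by (intro sum.cong refl) simp
        ultimately show ?thesis unfolding sum_c by (simp add: \<Sigma>_def sum_divide_distrib)
      qed
      ultimately show ?thesis unfolding std_simplex_def by (simp add: q_def)
    qed
    show "continuous_map (top_of_set (std_simplex c)) (cube k) i"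
      unfolding cube_def continuous_map_componentwise
    proof (intro conjI ballI)
      show "i ` topspace (top_of_set (std_simplex c)) \<subseteq> extensional {..<k}" unfolding i_def by auto
      fix l assume l: "l \<in> {..<k}"
      have "continuous_map (top_of_set (std_simplex c)) euclideanreal (\<lambda>s. i s l)"
        using l unfolding i_def by (cases "l < r") (auto intro!: continuous_on_subset[OF continuous_on_product_coordinates])
      moreover have "i s l \<in> {0..1}" if "s \<in> std_simplex c" for s
        using l that std_simplex_le_1[OF c(1) that] unfolding i_def std_simplex_def by auto
      ultimately show "continuous_map (top_of_set (std_simplex c)) (top_of_set {0..1}) (\<lambda>s. i s l)"
        by (auto simp: continuous_map_in_subtopology)
    qed
    show "q (i s) = s" if s: "s \<in> std_simplex c" for s
    proof
      fix n
      have nn: "\<And>n. 0 \<le> s n" and out: "\<And>n. n \<notin> c \<Longrightarrow> s n = 0" and sum: "(\<Sum>n\<in>c. s n) = 1"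
        using s unfolding std_simplex_def by auto
      have "\<Sigma> (i s) = (\<Sum>l<r. s (v (Suc l)))" unfolding \<Sigma>_def i_def using rk by (intro sum.cong refl) simp
      then have S: "\<Sigma> (i s) = 1 - s (v 0)" using sum unfolding sum_c by simp
      then have m: "max 1 (\<Sigma> (i s)) = 1" using nn[of "v 0"] by simp
      show "q (i s) n = s n"
      proof (cases "n \<in> c")
        case True
        show ?thesis
        proof (cases "idx n = 0")
          case True
          then have "v 0 = n" using vi[OF \<open>n \<in> c\<close>] by simp
          then show ?thesis using True \<open>n \<in> c\<close> m S unfolding q_def by simp
        next
          case False
          then have "idx n - 1 < r" "Suc (idx n - 1) = idx n" using il[OF \<open>n \<in> c\<close>] cr by auto
          then show ?thesis using False \<open>n \<in> c\<close> m rk vi[OF \<open>n \<in> c\<close>] unfolding q_def i_def by simp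
        qed
      qed (simp add: q_def out)
    qed
  qed
qed

lemma compact_cube: "compact_space (cube k)"
  unfolding cube_def compact_space_product_topology by (simp add: compact_space_subtopology)

text \<open>Pull the map back to the cube along the retraction, apply the density there, and restrict
  the result to the embedded simplex. Only the first \<open>n\<close> entries are changed; a left inverse of
  these is a left inverse of the whole tuple, so density for \<open>n\<close> implies density for \<open>M \<ge> n\<close>.\<close>

lemma C_tensor_simplex_dense:
  fixes A :: "'b cstar" and f :: "(nat \<Rightarrow> real) \<Rightarrow> nat \<Rightarrow> 'b universal_cstar"
  assumes A: "unital_cstar A" and dense: "Lg_dense (C_tensor (cube k) A) n" and n: "n \<le> M"
    and c: "finite c" "card c \<le> k + 1"
    and f: "\<And>j. j < M \<Longrightarrow> continuous_on (std_simplex c) (\<lambda>s. f s j)"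
      "\<And>s j. s \<in> std_simplex c \<Longrightarrow> j < M \<Longrightarrow> fibre_one A * f s j = f s j"
    and \<delta>: "\<delta> > 0"
  shows "\<exists>g. (\<forall>j<M. continuous_on (std_simplex c) (\<lambda>s. g s j)) \<and>
        (\<forall>s\<in>std_simplex c. (\<exists>d. (\<Sum>j<M. d j * (g s j + cx (p j) * fibre_one A)) = fibre_one A) \<and>
          (\<forall>j<M. fibre_one A * g s j = g s j \<and> norm (g s j - f s j) < \<delta>))"
proof (cases "c = {}")
  case True
  then have "std_simplex c = {}" unfolding std_simplex_def by simp
  then show ?thesis by simp
next
  case False
  interpret A: cstar_algebra A using A unfolding unital_cstar_def by simp
  let ?L = "std_simplex c" and ?Y = "cube k" and ?e = "fibre_one A"
  let ?C = "C_tensor ?Y A"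
  obtain q i where q: "continuous_map ?Y euclidean q" "\<And>y. y \<in> topspace ?Y \<Longrightarrow> q y \<in> ?L"
    and i: "continuous_map (top_of_set ?L) ?Y i" "\<And>s. s \<in> ?L \<Longrightarrow> q (i s) = s"
    by (rule simplex_retract[OF c False]) (rule that)
  have iY: "i s \<in> topspace ?Y" if "s \<in> ?L" for s using continuous_map_funspace[OF i(1)] that by auto
  have cxe: "?e * (cx z * ?e) = cx z * ?e" for z
    using fibre_one_idem[OF A] cx_central[of z ?e] by (metis mult.assoc)
  define F where "F s j = f s j + cx (p j) * ?e" for s j
  have F: "continuous_on ?L (\<lambda>s. F s j)" "\<And>s. s \<in> ?L \<Longrightarrow> ?e * F s j = F s j" if "j < M" for j
    using f that cxe unfolding F_def by (auto intro!: continuous_intros simp: distrib_left)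
  define a where "a = (\<lambda>j\<in>{..<n}. \<lambda>y\<in>topspace ?Y. unemb A (F (q y) j))"
  have aC: "a j \<in> carrier ?C" if "j < n" for j
    using C_tensor_pullback[OF A compact_std_simplex[OF c(1)] F q, of j] that n unfolding a_def by simp
  have "a \<in> tuples ?C n" unfolding tuples_def using aC by (auto simp: a_def)
  then obtain b where b: "b \<in> Lg ?C n" "\<And>j. j < n \<Longrightarrow> cnorm ?C (a j \<ominus>\<^bsub>?C\<^esub> b j) < \<delta>"
    using dense \<delta> unfolding Lg_dense_def by blast
  have bC: "b j \<in> carrier ?C" if "j < n" for j using b(1) that unfolding Lg_def tuples_def by blast
  have mem: "g y \<in> carrier A" if "g \<in> carrier ?C" "y \<in> topspace ?Y" for g y
    using that unfolding C_tensor_carrier[OF A] by blast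
  define g where "g s j = (if j < n then emb A (b j (i s)) - cx (p j) * ?e else f s j)" for s j
  have "continuous_on ?L (\<lambda>s. g s j)" if j: "j < M" for j
  proof (cases "j < n")
    case True
    have "continuous_map (top_of_set ?L) euclidean ((\<lambda>y. emb A (b j y)) \<circ> i)"
      by (rule continuous_map_compose[OF i(1) C_tensor_continuous[OF A bC[OF True]]])
    then have "continuous_on ?L (\<lambda>s. emb A (b j (i s)))" by (simp add: o_def)
    then show ?thesis using True unfolding g_def by (simp add: continuous_intros)
  qed (use f(1) j in \<open>simp add: g_def\<close>)
  moreover have "\<exists>d. (\<Sum>j<M. d j * (g s j + cx (p j) * ?e)) = ?e" if s: "s \<in> ?L" for s
  proof -
    obtain d where d: "(\<Sum>j<n. d j * emb A (b j (i s))) = ?e" using Lg_left_inverse[OF A b(1) iY[OF s]] by blast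
    have "(\<Sum>j<M. (if j < n then d j else 0) * (g s j + cx (p j) * ?e)) =
        (\<Sum>j<n. (if j < n then d j else 0) * (g s j + cx (p j) * ?e))"
      using n by (intro sum.mono_neutral_right) auto
    also have "\<dots> = (\<Sum>j<n. d j * emb A (b j (i s)))" unfolding g_def by (intro sum.cong refl) simp
    finally show ?thesis using d by (intro exI[of _ "\<lambda>j. if j < n then d j else 0"]) simp
  qed
  moreover have "?e * g s j = g s j \<and> norm (g s j - f s j) < \<delta>" if s: "s \<in> ?L" and j: "j < M" for s j
  proof (cases "j < n")
    case True
    let ?d = "a j \<ominus>\<^bsub>?C\<^esub> b j"
    have bm: "b j (i s) \<in> carrier A" by (rule mem[OF bC[OF True] iY[OF s]])
    have ay: "a j y = unemb A (F (q y) j)" if "y \<in> topspace ?Y" for y using that True unfolding a_def by simp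
    have am: "a j y \<in> carrier A" "emb A (a j y) = F (q y) j" if "y \<in> topspace ?Y" for y
      using unemb[OF A F(2)[OF j q(2)[OF that]]] ay[OF that] by auto
    have dy: "?d y = a j y \<ominus>\<^bsub>A\<^esub> b j y" if "y \<in> topspace ?Y" for y
      using that by (simp add: C_tensor_def)
    have nd: "cnorm A (?d y) = norm (emb A (a j y) - emb A (b j y))" if "y \<in> topspace ?Y" for y
      unfolding dy[OF that]
      using norm_emb[OF A A.diff_closed[OF am(1)[OF that] mem[OF bC[OF True] that]]]
        emb_diff[OF A am(1)[OF that] mem[OF bC[OF True] that]] by simp
    have "continuous_map ?Y euclideanreal (\<lambda>y. norm (emb A (a j y) - emb A (b j y)))"
      by (intro continuous_map_norm continuous_map_diff C_tensor_continuous[OF A] aC bC True)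
    then have "compact ((\<lambda>y. norm (emb A (a j y) - emb A (b j y))) ` topspace ?Y)"
      using image_compactin compact_cube unfolding compact_space_def by (metis compactin_euclidean_iff)
    then have "bdd_above ((\<lambda>y. norm (emb A (a j y) - emb A (b j y))) ` topspace ?Y)"
      by (intro bounded_imp_bdd_above compact_imp_bounded)
    also have "(\<lambda>y. norm (emb A (a j y) - emb A (b j y))) ` topspace ?Y = (\<lambda>y. cnorm A (?d y)) ` topspace ?Y"
      using nd by (intro image_cong refl) simp
    finally have "cnorm A (?d (i s)) \<le> (SUP y\<in>topspace ?Y. cnorm A (?d y))"
      using iY[OF s] by (intro cSUP_upper)
    also have "\<dots> = cnorm ?C ?d" by (simp add: C_tensor_def)
    also have "\<dots> < \<delta>" by (rule b(2)[OF True])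
    finally have "norm (F s j - emb A (b j (i s))) < \<delta>"
      unfolding nd[OF iY[OF s]] am(2)[OF iY[OF s]] i(2)[OF s] .
    moreover have "g s j - f s j = - (F s j - emb A (b j (i s)))" unfolding g_def F_def using True by simp
    ultimately have "norm (g s j - f s j) < \<delta>" by (simp only: norm_minus_cancel)
    moreover have "?e * g s j = g s j"
      unfolding g_def using True fibre_one_emb[OF A bm] cxe by (simp add: right_diff_distrib)
    ultimately show ?thesis by simp
  next
    case False
    then show ?thesis using f(2)[OF s j] \<delta> unfolding g_def by simp
  qed
  ultimately show ?thesis by (intro exI[of _ g]) blast
qed

lemma continuous_map_realI:
  fixes f :: "'x \<Rightarrow> real"
  assumes "\<And>t \<epsilon>. t \<in> topspace X \<Longrightarrow> \<epsilon> > 0 \<Longrightarrow> \<exists>G. openin X G \<and> t \<in> G \<and> (\<forall>s\<in>G. \<bar>f s - f t\<bar> < \<epsilon>)"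
  shows "continuous_map X euclideanreal f"
  unfolding Met_TC.continuous_map_to_metric[unfolded mtopology_is_euclidean]
proof (intro ballI allI impI)
  fix t and \<epsilon> :: real assume "t \<in> topspace X" "\<epsilon> > 0"
  from assms[OF this] obtain G where "openin X G" "t \<in> G" "\<forall>s\<in>G. \<bar>f s - f t\<bar> < \<epsilon>" by blast
  then show "\<exists>U. openin X U \<and> t \<in> U \<and> (\<forall>y\<in>U. f y \<in> Met_TC.mball (f t) \<epsilon>)"
    by (intro exI[of _ G]) (auto simp: Met_TC.in_mball dist_real_def abs_minus_commute)
qed

section \<open>Maximal full algebras of operator fields\<close>

text \<open>The base space is assumed to be nonempty because the supremum norm on the fields over an
  empty space is unspecified.\<close>

locale unital_fields =
  fixes X :: "'x topology" and F :: "'x \<Rightarrow> 'b cstar" and \<A> :: "('x \<Rightarrow> 'b) set"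
  assumes full: "full_algebra X F \<A>"
    and unital_fibre: "t \<in> topspace X \<Longrightarrow> unital (F t)"
    and nonempty: "topspace X \<noteq> {}"
begin

abbreviation base where "base \<equiv> topspace X"
abbreviation Q where "Q \<equiv> field_algebra base F \<A>"

definition iota :: "('x \<Rightarrow> 'b) \<Rightarrow> 'x \<Rightarrow> 'b universal_cstar"
  where "iota a t = emb (F t) (a t)"

abbreviation E :: "'x \<Rightarrow> 'b universal_cstar"
  where "E t \<equiv> fibre_one (F t)"

abbreviation opf where "opf \<equiv> operator_fields X F"

lemma fib: "t \<in> base \<Longrightarrow> cstar_algebra (F t)"
  using full by (rule full_algebra.fibre_cstar)

lemma sfib: "t \<in> base \<Longrightarrow> star_algebra (F t)"
  using fib cstar_algebra.axioms(1) by blast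

lemma uc: "t \<in> base \<Longrightarrow> unital_cstar (F t)"
  using fib unital_fibre unfolding unital_cstar_def by blast

lemma starQ: "star_algebra Q"
  using full by (rule full_algebra.star_alg)

lemma A_opf: "a \<in> \<A> \<Longrightarrow> a \<in> opf"
  using full_algebra.fields[OF full] by blast

lemma opf_mem: "a \<in> opf \<Longrightarrow> t \<in> base \<Longrightarrow> a t \<in> carrier (F t)"
  unfolding operator_fields_def by blast

lemma opf_eqI:
  assumes "a \<in> opf" "b \<in> opf" "\<And>t. t \<in> base \<Longrightarrow> iota a t = iota b t"
  shows "a = b"
  using assms emb_inject[OF uc opf_mem[OF assms(1)] opf_mem[OF assms(2)]]
  unfolding operator_fields_def iota_def by (intro PiE_ext) auto

lemma iota_ops:
  assumes t: "t \<in> base"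
  shows "iota (\<lambda>t\<in>base. zero (F t)) t = 0"
    "a \<in> opf \<Longrightarrow> b \<in> opf \<Longrightarrow> iota (\<lambda>t\<in>base. add (F t) (a t) (b t)) t = iota a t + iota b t"
    "a \<in> opf \<Longrightarrow> b \<in> opf \<Longrightarrow> iota (\<lambda>t\<in>base. mult (F t) (a t) (b t)) t = iota a t * iota b t"
    "a \<in> opf \<Longrightarrow> iota (\<lambda>t\<in>base. smult (F t) c (a t)) t = cx c * iota a t"
    "a \<in> opf \<Longrightarrow> iota (\<lambda>t\<in>base. adj (F t) (a t)) t = star (iota a t)"
    "a \<in> opf \<Longrightarrow> b \<in> opf \<Longrightarrow> iota (\<lambda>t\<in>base. diff (F t) (a t) (b t)) t = iota a t - iota b t"
  using t by (simp_all add: iota_def emb_zero[OF uc] emb_add[OF uc] emb_mult[OF uc] emb_smult[OF uc]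
      emb_adj[OF uc] emb_diff[OF uc] opf_mem)

lemma opf_closed:
  "(\<lambda>t\<in>base. zero (F t)) \<in> opf"
  "a \<in> opf \<Longrightarrow> b \<in> opf \<Longrightarrow> (\<lambda>t\<in>base. add (F t) (a t) (b t)) \<in> opf"
  "a \<in> opf \<Longrightarrow> b \<in> opf \<Longrightarrow> (\<lambda>t\<in>base. mult (F t) (a t) (b t)) \<in> opf"
  "a \<in> opf \<Longrightarrow> (\<lambda>t\<in>base. smult (F t) c (a t)) \<in> opf"
  "a \<in> opf \<Longrightarrow> (\<lambda>t\<in>base. adj (F t) (a t)) \<in> opf"
  unfolding operator_fields_def
  by (auto intro: star_algebra.zero_closed[OF sfib] star_algebra.add_closed[OF sfib]
      star_algebra.mult_closed[OF sfib] star_algebra.smult_closed[OF sfib] star_algebra.adj_closed[OF sfib])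

lemma A_closed:
  "(\<lambda>t\<in>base. zero (F t)) \<in> \<A>"
  "a \<in> \<A> \<Longrightarrow> b \<in> \<A> \<Longrightarrow> (\<lambda>t\<in>base. add (F t) (a t) (b t)) \<in> \<A>"
  "a \<in> \<A> \<Longrightarrow> b \<in> \<A> \<Longrightarrow> (\<lambda>t\<in>base. mult (F t) (a t) (b t)) \<in> \<A>"
  "a \<in> \<A> \<Longrightarrow> (\<lambda>t\<in>base. smult (F t) c (a t)) \<in> \<A>"
  "a \<in> \<A> \<Longrightarrow> (\<lambda>t\<in>base. adj (F t) (a t)) \<in> \<A>"
  using star_algebra.zero_closed[OF starQ] star_algebra.add_closed[OF starQ, of a b]
    star_algebra.mult_closed[OF starQ, of a b] star_algebra.smult_closed[OF starQ, of a c]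
    star_algebra.adj_closed[OF starQ, of a] by simp_all

lemma norm_iota: "a \<in> opf \<Longrightarrow> t \<in> base \<Longrightarrow> norm (iota a t) = cnorm (F t) (a t)"
  unfolding iota_def by (rule norm_emb[OF uc opf_mem])

lemma norm_diff_iota:
  assumes "a \<in> opf" "b \<in> opf" "t \<in> base"
  shows "cnorm (F t) (a t \<ominus>\<^bsub>F t\<^esub> b t) = norm (iota a t - iota b t)"
  unfolding iota_def emb_diff[OF uc[OF assms(3)] opf_mem[OF assms(1,3)] opf_mem[OF assms(2,3)], symmetric]
  by (rule norm_emb[OF uc[OF assms(3)], symmetric])
     (rule star_algebra.diff_closed[OF sfib[OF assms(3)] opf_mem[OF assms(1,3)] opf_mem[OF assms(2,3)]])

lemma A_norm_continuous: "a \<in> \<A> \<Longrightarrow> continuous_map X euclideanreal (\<lambda>t. norm (iota a t))"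
  using full_algebra.norm_continuous[OF full] norm_iota[OF A_opf]
  by (metis (no_types, lifting) continuous_map_eq)

lemma vanishes_cong:
  "(\<And>t. t \<in> base \<Longrightarrow> f t = g t) \<Longrightarrow> vanishes_at_infinity X f \<Longrightarrow> vanishes_at_infinity X g"
  unfolding vanishes_at_infinity_def by (metis DiffD1)

lemma A_norm_vanishes: "a \<in> \<A> \<Longrightarrow> vanishes_at_infinity X (\<lambda>t. norm (iota a t))"
  by (rule vanishes_cong[OF _ full_algebra.norm_vanishes[OF full]]) (simp_all add: norm_iota A_opf)

definition local_approx :: "('x \<Rightarrow> 'b) \<Rightarrow> bool"
  where "local_approx d \<longleftrightarrow> (\<forall>t\<in>base. \<forall>\<eta>>0. \<exists>a\<in>\<A>. \<exists>G. openin X G \<and> t \<in> G \<and>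
    (\<forall>s\<in>G. norm (iota d s - iota a s) < \<eta>))"

lemma local_approxE:
  assumes "local_approx d" "t \<in> base" "\<eta> > 0"
  obtains a G where "a \<in> \<A>" "openin X G" "t \<in> G" "G \<subseteq> base" "\<And>s. s \<in> G \<Longrightarrow> norm (iota d s - iota a s) < \<eta>"
proof -
  have "\<exists>a\<in>\<A>. \<exists>G. openin X G \<and> t \<in> G \<and> (\<forall>s\<in>G. norm (iota d s - iota a s) < \<eta>)"
    using assms unfolding local_approx_def by simp
  then obtain a G where "a \<in> \<A>" "openin X G" "t \<in> G" "\<forall>s\<in>G. norm (iota d s - iota a s) < \<eta>" by blast
  then show ?thesis using that[of a G] openin_subset[of X G] by simp
qed

lemma local_approxI:
  assumes "\<And>t \<eta>. t \<in> base \<Longrightarrow> \<eta> > 0 \<Longrightarrow>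
    \<exists>a G. a \<in> \<A> \<and> openin X G \<and> t \<in> G \<and> (\<forall>s\<in>G. norm (iota d s - iota a s) < \<eta>)"
  shows "local_approx d"
  unfolding local_approx_def using assms by meson

lemma local_approx_field: "a \<in> \<A> \<Longrightarrow> local_approx a"
  by (rule local_approxI) (intro exI[of _ a] exI[of _ base], simp)

lemma local_norm_continuous:
  assumes "local_approx d"
  shows "continuous_map X euclideanreal (\<lambda>t. norm (iota d t))"
proof (rule continuous_map_realI)
  fix t and \<epsilon> :: real assume t: "t \<in> base" and \<epsilon>: "\<epsilon> > 0"
  then have e3: "\<epsilon> / 3 > 0" by simp
  obtain a G where a: "a \<in> \<A>" "openin X G" "t \<in> G" "G \<subseteq> base" "\<And>s. s \<in> G \<Longrightarrow> norm (iota d s - iota a s) < \<epsilon> / 3"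
    by (rule local_approxE[OF assms t e3]) (rule that)
  define G' where "G' = G \<inter> {s \<in> base. \<bar>norm (iota a s) - norm (iota a t)\<bar> < \<epsilon> / 3}"
  have "openin X G'" unfolding G'_def
    by (intro openin_Int a(2) openin_less continuous_map_real_abs continuous_map_diff A_norm_continuous a(1)) simp
  moreover have "t \<in> G'" unfolding G'_def using a(3) t e3 by simp
  moreover have "\<bar>norm (iota d s) - norm (iota d t)\<bar> < \<epsilon>" if "s \<in> G'" for s
  proof -
    have "norm (iota d s - iota a s) < \<epsilon> / 3" "norm (iota d t - iota a t) < \<epsilon> / 3"
      "\<bar>norm (iota a s) - norm (iota a t)\<bar> < \<epsilon> / 3" using that a(3,5) unfolding G'_def by auto
    then show ?thesis
      using norm_triangle_ineq3[of "iota d s" "iota a s"] norm_triangle_ineq3[of "iota d t" "iota a t"] by linarith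
  qed
  ultimately show "\<exists>G. openin X G \<and> t \<in> G \<and> (\<forall>s\<in>G. \<bar>norm (iota d s) - norm (iota d t)\<bar> < \<epsilon>)" by blast
qed

text \<open>The largest full algebra of operator fields that contains \<open>\<A>\<close>.\<close>

definition completion :: "('x \<Rightarrow> 'b) set"
  where "completion = {d \<in> opf. local_approx d \<and> vanishes_at_infinity X (\<lambda>t. norm (iota d t))}"

lemma completion_bounded:
  assumes d: "d \<in> completion"
  obtains r where "r \<ge> 0" "\<And>t. t \<in> base \<Longrightarrow> norm (iota d t) \<le> r"
proof -
  have "vanishes_at_infinity X (\<lambda>t. norm (iota d t))" using d unfolding completion_def by blast
  then obtain K where K: "compactin X K" "\<forall>t\<in>base - K. \<bar>norm (iota d t)\<bar> < 1"
    unfolding vanishes_at_infinity_def using zero_less_one by blast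
  have "continuous_map X euclideanreal (\<lambda>t. norm (iota d t))"
    using d local_norm_continuous unfolding completion_def by blast
  then have "compact ((\<lambda>t. norm (iota d t)) ` K)" using image_compactin[OF K(1)] by fastforce
  then have "bounded ((\<lambda>t. norm (iota d t)) ` K)" by (rule compact_imp_bounded)
  then obtain B where "\<forall>x\<in>(\<lambda>t. norm (iota d t)) ` K. norm x \<le> B" unfolding bounded_iff by blast
  then have B: "\<And>t. t \<in> K \<Longrightarrow> norm (iota d t) \<le> B" by simp
  have "norm (iota d t) \<le> max 1 B" if "t \<in> base" for t
    using B[of t] K(2) that by (cases "t \<in> K") (auto simp: le_max_iff_disj less_imp_le)
  then show ?thesis using that[of "max 1 B"] by auto
qed

lemma completionI:
  assumes "d \<in> opf"
    "\<And>t \<eta>. t \<in> base \<Longrightarrow> \<eta> > 0 \<Longrightarrow>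
      \<exists>a G. a \<in> \<A> \<and> openin X G \<and> t \<in> G \<and> (\<forall>s\<in>G. norm (iota d s - iota a s) < \<eta>)"
    "\<And>\<eta>. \<eta> > 0 \<Longrightarrow> \<exists>K. compactin X K \<and> (\<forall>t\<in>base - K. norm (iota d t) < \<eta>)"
  shows "d \<in> completion"
  unfolding completion_def vanishes_at_infinity_def using assms local_approxI[of d] by simp

lemma completionD:
  assumes "d \<in> completion"
  shows "d \<in> opf" "local_approx d" "\<eta> > 0 \<Longrightarrow> \<exists>K. compactin X K \<and> (\<forall>t\<in>base - K. norm (iota d t) < \<eta>)"
  using assms unfolding completion_def vanishes_at_infinity_def by auto

lemma completion_add:
  assumes d: "d \<in> completion" and d': "d' \<in> completion"
  shows "(\<lambda>t\<in>base. add (F t) (d t) (d' t)) \<in> completion" (is "?d \<in> _")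
proof (rule completionI)
  note o = completionD(1)[OF d] completionD(1)[OF d']
  show "?d \<in> opf" by (rule opf_closed(2)[OF o])
  fix \<eta> :: real assume \<eta>: "\<eta> > 0"
  then have \<eta>2: "\<eta> / 2 > 0" by simp
  show "\<exists>a G. a \<in> \<A> \<and> openin X G \<and> t \<in> G \<and> (\<forall>s\<in>G. norm (iota ?d s - iota a s) < \<eta>)" if t: "t \<in> base" for t
  proof -
    obtain a G where a: "a \<in> \<A>" "openin X G" "t \<in> G" "G \<subseteq> base" "\<And>s. s \<in> G \<Longrightarrow> norm (iota d s - iota a s) < \<eta> / 2"
      by (rule local_approxE[OF completionD(2)[OF d] t \<eta>2]) (rule that)
    obtain a' G' where a': "a' \<in> \<A>" "openin X G'" "t \<in> G'" "G' \<subseteq> base" "\<And>s. s \<in> G' \<Longrightarrow> norm (iota d' s - iota a' s) < \<eta> / 2"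
      by (rule local_approxE[OF completionD(2)[OF d'] t \<eta>2]) (rule that)
    have "norm (iota ?d s - iota (\<lambda>t\<in>base. add (F t) (a t) (a' t)) s) < \<eta>" if s: "s \<in> G \<inter> G'" for s
    proof -
      have sT: "s \<in> base" using s a(4) by blast
      have "norm (iota d s - iota a s) < \<eta> / 2" "norm (iota d' s - iota a' s) < \<eta> / 2" using s a(5) a'(5) by auto
      then show ?thesis
        unfolding iota_ops(2)[OF sT o] iota_ops(2)[OF sT A_opf[OF a(1)] A_opf[OF a'(1)]]
        using norm_triangle_ineq[of "iota d s - iota a s" "iota d' s - iota a' s"] by (simp add: algebra_simps)
    qed
    then show ?thesis
      by (intro exI[of _ "\<lambda>t\<in>base. add (F t) (a t) (a' t)"] exI[of _ "G \<inter> G'"] conjI A_closed(2) a(1) a'(1)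
        openin_Int a(2) a'(2)) (use a(3) a'(3) in auto)
  qed
  obtain K K' where K: "compactin X K" "\<forall>t\<in>base - K. norm (iota d t) < \<eta> / 2"
    "compactin X K'" "\<forall>t\<in>base - K'. norm (iota d' t) < \<eta> / 2"
    using completionD(3)[OF d \<eta>2] completionD(3)[OF d' \<eta>2] by blast
  have "norm (iota ?d t) < \<eta>" if t: "t \<in> base - (K \<union> K')" for t
  proof -
    have tT: "t \<in> base" using t by blast
    have "norm (iota d t) < \<eta> / 2" "norm (iota d' t) < \<eta> / 2" using t K(2,4) by auto
    then show ?thesis unfolding iota_ops(2)[OF tT o] using norm_triangle_ineq[of "iota d t" "iota d' t"] by linarith
  qed
  then show "\<exists>K. compactin X K \<and> (\<forall>t\<in>base - K. norm (iota ?d t) < \<eta>)"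
    using compactin_Un[OF K(1,3)] by blast
qed

text \<open>If \<open>a\<close> and \<open>a'\<close> approximate bounded fields \<open>d\<close> and \<open>d'\<close>, then \<open>a a'\<close> approximates \<open>d d'\<close>.\<close>

lemma completion_mult:
  assumes d: "d \<in> completion" and d': "d' \<in> completion"
  shows "(\<lambda>t\<in>base. mult (F t) (d t) (d' t)) \<in> completion" (is "?d \<in> _")
proof (rule completionI)
  note o = completionD(1)[OF d] completionD(1)[OF d']
  obtain r r' where r: "r \<ge> 0" "\<And>t. t \<in> base \<Longrightarrow> norm (iota d t) \<le> r"
    and r': "r' \<ge> 0" "\<And>t. t \<in> base \<Longrightarrow> norm (iota d' t) \<le> r'"
    using completion_bounded[OF d] completion_bounded[OF d'] by metis
  show "?d \<in> opf" by (rule opf_closed(3)[OF o])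
  fix \<eta> :: real assume \<eta>: "\<eta> > 0"
  define \<delta> where "\<delta> = min 1 (\<eta> / (r + r' + 2))"
  have rr: "r + r' + 2 > 0" using r(1) r'(1) by simp
  have \<delta>: "\<delta> > 0" "\<delta> \<le> 1" using \<eta> rr unfolding \<delta>_def by auto
  have "\<delta> * (r + r' + 2) \<le> \<eta> / (r + r' + 2) * (r + r' + 2)"
    unfolding \<delta>_def using rr by (intro mult_right_mono) auto
  then have \<delta>\<eta>: "\<delta> * (r + r' + 2) \<le> \<eta>" using rr by simp
  show "\<exists>a G. a \<in> \<A> \<and> openin X G \<and> t \<in> G \<and> (\<forall>s\<in>G. norm (iota ?d s - iota a s) < \<eta>)" if t: "t \<in> base" for t
  proof -
    obtain a G where a: "a \<in> \<A>" "openin X G" "t \<in> G" "G \<subseteq> base" "\<And>s. s \<in> G \<Longrightarrow> norm (iota d s - iota a s) < \<delta>"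
      by (rule local_approxE[OF completionD(2)[OF d] t \<delta>(1)]) (rule that)
    obtain a' G' where a': "a' \<in> \<A>" "openin X G'" "t \<in> G'" "G' \<subseteq> base" "\<And>s. s \<in> G' \<Longrightarrow> norm (iota d' s - iota a' s) < \<delta>"
      by (rule local_approxE[OF completionD(2)[OF d'] t \<delta>(1)]) (rule that)
    have "norm (iota ?d s - iota (\<lambda>t\<in>base. mult (F t) (a t) (a' t)) s) < \<eta>" if s: "s \<in> G \<inter> G'" for s
    proof -
      have sT: "s \<in> base" using s a(4) by blast
      have n: "norm (iota d s - iota a s) < \<delta>" "norm (iota d' s - iota a' s) < \<delta>" using s a(5) a'(5) by auto
      have an: "norm (iota a s) \<le> r + 1"
        using norm_triangle_sub[of "iota a s" "iota d s"] r(2)[OF sT] n(1) \<delta>(2) by (simp add: norm_minus_commute)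
      have "iota d s * iota d' s - iota a s * iota a' s =
          (iota d s - iota a s) * iota d' s + iota a s * (iota d' s - iota a' s)" by (simp add: algebra_simps)
      also have "norm \<dots> \<le> norm (iota d s - iota a s) * norm (iota d' s) + norm (iota a s) * norm (iota d' s - iota a' s)"
        by (intro norm_triangle_mono norm_mult_ineq)
      also have "\<dots> \<le> \<delta> * r' + (r + 1) * \<delta>"
        using n an r'(2)[OF sT] r(1) \<delta>(1) by (intro add_mono mult_mono) auto
      also have "\<dots> < \<delta> * (r + r' + 2)" using \<delta>(1) by (simp add: algebra_simps)
      finally show ?thesis
        unfolding iota_ops(3)[OF sT o] iota_ops(3)[OF sT A_opf[OF a(1)] A_opf[OF a'(1)]] using \<delta>\<eta> by linarith
    qed
    then show ?thesis
      by (intro exI[of _ "\<lambda>t\<in>base. mult (F t) (a t) (a' t)"] exI[of _ "G \<inter> G'"] conjI A_closed(3) a(1) a'(1)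
        openin_Int a(2) a'(2)) (use a(3) a'(3) in auto)
  qed
  obtain K where K: "compactin X K" "\<forall>t\<in>base - K. norm (iota d t) < \<delta>" using completionD(3)[OF d \<delta>(1)] by blast
  have "norm (iota ?d t) < \<eta>" if t: "t \<in> base - K" for t
  proof -
    have tT: "t \<in> base" using t by blast
    have "norm (iota d t * iota d' t) \<le> norm (iota d t) * norm (iota d' t)" by (rule norm_mult_ineq)
    also have "\<dots> \<le> \<delta> * r'" using K(2) t r'(2)[OF tT] \<delta>(1) by (intro mult_mono) (auto intro: less_imp_le)
    also have "\<dots> < \<delta> * (r + r' + 2)" using \<delta>(1) r(1) by simp
    finally show ?thesis unfolding iota_ops(3)[OF tT o] using \<delta>\<eta> by linarith
  qed
  then show "\<exists>K. compactin X K \<and> (\<forall>t\<in>base - K. norm (iota ?d t) < \<eta>)" using K(1) by blast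
qed

lemma completion_smult:
  assumes d: "d \<in> completion"
  shows "(\<lambda>t\<in>base. smult (F t) c (d t)) \<in> completion" (is "?d \<in> _")
proof (rule completionI)
  note o = completionD(1)[OF d]
  show "?d \<in> opf" by (rule opf_closed(4)[OF o])
  fix \<eta> :: real assume \<eta>: "\<eta> > 0"
  define \<delta> where "\<delta> = \<eta> / (cmod c + 1)"
  have cp: "cmod c + 1 > 0" by (simp add: add_nonneg_pos)
  have \<delta>: "\<delta> > 0" "(cmod c + 1) * \<delta> = \<eta>" using \<eta> cp unfolding \<delta>_def by auto
  have small: "cmod c * x < \<eta>" if "x < \<delta>" "x \<ge> 0" for x
  proof -
    have "cmod c * x \<le> (cmod c + 1) * x" using that(2) by (intro mult_right_mono) auto
    also have "\<dots> < (cmod c + 1) * \<delta>" using that(1) cp by simp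
    finally show ?thesis using \<delta>(2) by simp
  qed
  show "\<exists>a G. a \<in> \<A> \<and> openin X G \<and> t \<in> G \<and> (\<forall>s\<in>G. norm (iota ?d s - iota a s) < \<eta>)" if t: "t \<in> base" for t
  proof -
    obtain a G where a: "a \<in> \<A>" "openin X G" "t \<in> G" "G \<subseteq> base" "\<And>s. s \<in> G \<Longrightarrow> norm (iota d s - iota a s) < \<delta>"
      by (rule local_approxE[OF completionD(2)[OF d] t \<delta>(1)]) (rule that)
    have "norm (iota ?d s - iota (\<lambda>t\<in>base. smult (F t) c (a t)) s) < \<eta>" if s: "s \<in> G" for s
    proof -
      have sT: "s \<in> base" using s a(4) by blast
      show ?thesis unfolding iota_ops(4)[OF sT o] iota_ops(4)[OF sT A_opf[OF a(1)]]
          right_diff_distrib[symmetric] norm_cx_mult by (rule small[OF a(5)[OF s]]) simp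
    qed
    then show ?thesis
      by (intro exI[of _ "\<lambda>t\<in>base. smult (F t) c (a t)"] exI[of _ G] conjI A_closed(4) a(1,2,3)) auto
  qed
  obtain K where K: "compactin X K" "\<forall>t\<in>base - K. norm (iota d t) < \<delta>" using completionD(3)[OF d \<delta>(1)] by blast
  have "norm (iota ?d t) < \<eta>" if t: "t \<in> base - K" for t
  proof -
    have tT: "t \<in> base" using t by blast
    show ?thesis unfolding iota_ops(4)[OF tT o] norm_cx_mult using K(2) t by (intro small) auto
  qed
  then show "\<exists>K. compactin X K \<and> (\<forall>t\<in>base - K. norm (iota ?d t) < \<eta>)" using K(1) by blast
qed

lemma completion_adj:
  assumes d: "d \<in> completion"
  shows "(\<lambda>t\<in>base. adj (F t) (d t)) \<in> completion" (is "?d \<in> _")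
proof (rule completionI)
  note o = completionD(1)[OF d]
  show "?d \<in> opf" by (rule opf_closed(5)[OF o])
  fix \<eta> :: real assume \<eta>: "\<eta> > 0"
  show "\<exists>a G. a \<in> \<A> \<and> openin X G \<and> t \<in> G \<and> (\<forall>s\<in>G. norm (iota ?d s - iota a s) < \<eta>)" if t: "t \<in> base" for t
  proof -
    obtain a G where a: "a \<in> \<A>" "openin X G" "t \<in> G" "G \<subseteq> base" "\<And>s. s \<in> G \<Longrightarrow> norm (iota d s - iota a s) < \<eta>"
      by (rule local_approxE[OF completionD(2)[OF d] t \<eta>]) (rule that)
    have "norm (iota ?d s - iota (\<lambda>t\<in>base. adj (F t) (a t)) s) < \<eta>" if s: "s \<in> G" for s
    proof -
      have sT: "s \<in> base" using s a(4) by blast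
      show ?thesis unfolding iota_ops(5)[OF sT o] iota_ops(5)[OF sT A_opf[OF a(1)]]
          star_diff[symmetric] norm_star by (rule a(5)[OF s])
    qed
    then show ?thesis
      by (intro exI[of _ "\<lambda>t\<in>base. adj (F t) (a t)"] exI[of _ G] conjI A_closed(5) a(1,2,3)) auto
  qed
  show "\<exists>K. compactin X K \<and> (\<forall>t\<in>base - K. norm (iota ?d t) < \<eta>)"
    using completionD(3)[OF d \<eta>] iota_ops(5)[OF _ o] by simp
qed

lemma A_subset_completion: "\<A> \<subseteq> completion"
  unfolding completion_def using A_opf local_approx_field A_norm_vanishes by blast

lemma completion_star: "star_algebra (field_algebra base F completion)"
proof (rule star_algebra_fields)
  show "star_algebra (F t)" if "t \<in> base" for t by (rule sfib[OF that])
  show "completion \<subseteq> (\<Pi>\<^sub>E t\<in>base. carrier (F t))"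
    using completionD(1) unfolding operator_fields_def by blast
  show "(\<lambda>t\<in>base. zero (F t)) \<in> completion" using A_closed(1) A_subset_completion by blast
qed (erule (1) completion_add completion_mult | erule completion_smult completion_adj)+

lemma completion_full: "full_algebra X F completion"
proof (rule full_algebra.intro)
  have sub: "completion \<subseteq> bounded_fields base F"
  proof
    fix d assume d: "d \<in> completion"
    obtain r where "\<And>t. t \<in> base \<Longrightarrow> norm (iota d t) \<le> r" using completion_bounded[OF d] by metis
    then have "\<forall>t\<in>base. cnorm (F t) (d t) \<le> r" using norm_iota[OF completionD(1)[OF d]] by simp
    then show "d \<in> bounded_fields base F"
      using completionD(1)[OF d] unfolding bounded_fields_def operator_fields_def by blast
  qed
  have star: "star_algebra (field_algebra base F completion)" by (rule completion_star)
  then show "star_algebra (field_algebra base F completion)" .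
  show "norm_complete (field_algebra base F completion)"
  proof (rule norm_complete_fields[OF nonempty fib sub star])
    fix c assume c: "c \<in> (\<Pi>\<^sub>E t\<in>base. carrier (F t))"
      and ap: "\<And>\<epsilon>. \<epsilon> > 0 \<Longrightarrow> \<exists>a\<in>completion. \<forall>t\<in>base. cnorm (F t) (a t \<ominus>\<^bsub>F t\<^esub> c t) \<le> \<epsilon>"
    have co: "c \<in> opf" using c unfolding operator_fields_def .
    have ap': "\<exists>a\<in>completion. \<forall>t\<in>base. norm (iota c t - iota a t) \<le> \<epsilon>" if "\<epsilon> > 0" for \<epsilon>
      using ap[OF that] norm_diff_iota[OF completionD(1) co] by (metis norm_minus_commute)
    show "c \<in> completion"
    proof (rule completionI[OF co])
      fix \<eta> :: real assume \<eta>: "\<eta> > 0"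
      then have \<eta>2: "\<eta> / 2 > 0" by simp
      obtain d where d: "d \<in> completion" "\<And>t. t \<in> base \<Longrightarrow> norm (iota c t - iota d t) \<le> \<eta> / 2"
        using ap'[OF \<eta>2] by blast
      show "\<exists>a G. a \<in> \<A> \<and> openin X G \<and> t \<in> G \<and> (\<forall>s\<in>G. norm (iota c s - iota a s) < \<eta>)" if t: "t \<in> base" for t
      proof -
        obtain a G where a: "a \<in> \<A>" "openin X G" "t \<in> G" "G \<subseteq> base" "\<And>s. s \<in> G \<Longrightarrow> norm (iota d s - iota a s) < \<eta> / 2"
          by (rule local_approxE[OF completionD(2)[OF d(1)] t \<eta>2]) (rule that)
        have "norm (iota c s - iota a s) < \<eta>" if "s \<in> G" for s
          using norm_triangle_ineq[of "iota c s - iota d s" "iota d s - iota a s"] d(2)[of s] a(4) a(5)[OF that] that by force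
        then show ?thesis using a(1-3) by blast
      qed
      obtain K where K: "compactin X K" "\<forall>t\<in>base - K. norm (iota d t) < \<eta> / 2" using completionD(3)[OF d(1) \<eta>2] by blast
      have "norm (iota c t) < \<eta>" if t: "t \<in> base - K" for t
        using norm_triangle_ineq[of "iota c t - iota d t" "iota d t"] d(2)[of t] K(2) t by force
      then show "\<exists>K. compactin X K \<and> (\<forall>t\<in>base - K. norm (iota c t) < \<eta>)" using K(1) by blast
    qed
  qed
  show "locally_compact_space X" using full by (rule full_algebra.base_locally_compact)
  show "Hausdorff_space X" using full by (rule full_algebra.base_Hausdorff)
  show "cstar_algebra (F t)" if "t \<in> base" for t using fib[OF that] .
  show "completion \<subseteq> opf" using completionD(1) by blast
  fix d assume d: "d \<in> completion"
  show "continuous_map X euclideanreal (\<lambda>t. cnorm (F t) (d t))"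
    by (rule continuous_map_eq[OF local_norm_continuous[OF completionD(2)[OF d]]])
       (rule norm_iota[OF completionD(1)[OF d]])
  show "vanishes_at_infinity X (\<lambda>t. cnorm (F t) (d t))"
    by (rule vanishes_cong[of "\<lambda>t. norm (iota d t)"])
       (use d norm_iota[OF completionD(1)[OF d]] in \<open>auto simp: completion_def\<close>)
next
  fix t x and \<epsilon> :: real assume "t \<in> base" "x \<in> carrier (F t)" "0 < \<epsilon>"
  then show "\<exists>a\<in>completion. cnorm (F t) (x \<ominus>\<^bsub>F t\<^esub> a t) < \<epsilon>"
    using full_algebra.fibre_dense[OF full] A_subset_completion by blast
qed

end

locale maximal_unital_fields = unital_fields X F \<A>
  for X :: "'x topology" and F :: "'x \<Rightarrow> 'b cstar" and \<A> :: "('x \<Rightarrow> 'b) set" +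
  assumes maximal: "maximal_full_algebra X F \<A>"
begin

lemma completion_eq: "completion = \<A>"
  using maximal completion_full A_subset_completion unfolding maximal_full_algebra_def by blast

definition fields where "fields = {c. \<exists>a\<in>\<A>. \<forall>t\<in>base. c t = iota a t}"

text \<open>The axiom \<open>local_field\<close> is \<open>completion_eq\<close>, read through the embedding of the fibres.\<close>

lemma field_system: "operator_field_system X E fields"
proof
  fix t assume t: "t \<in> base"
  show "E t * E t = E t" "star (E t) = E t" by (rule fibre_one_idem[OF uc[OF t]] star_fibre_one[OF uc[OF t]])+
  show "E t * u = u * E t" for u by (rule fibre_one_central[OF uc[OF t]])
  fix u and \<eta> :: real assume u: "E t * u = u" and \<eta>: "\<eta> > 0"
  obtain x where x: "x \<in> carrier (F t)" "u = emb (F t) x" using fibre_one_range[OF uc[OF t], of u] u by auto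
  obtain a where a: "a \<in> \<A>" "cnorm (F t) (x \<ominus>\<^bsub>F t\<^esub> a t) < \<eta>"
    using full_algebra.fibre_dense[OF full t x(1) \<eta>] by blast
  have at: "a t \<in> carrier (F t)" by (rule opf_mem[OF A_opf[OF a(1)] t])
  have "norm (iota a t - u) = cnorm (F t) (x \<ominus>\<^bsub>F t\<^esub> a t)"
    unfolding x(2) iota_def norm_minus_commute[of "emb (F t) (a t)"]
    using emb_diff[OF uc[OF t] x(1) at] norm_emb[OF uc[OF t] star_algebra.diff_closed[OF sfib[OF t] x(1) at]] by simp
  then have "norm (iota a t - u) < \<eta>" using a(2) by simp
  then show "\<exists>a\<in>fields. norm (a t - u) < \<eta>" unfolding fields_def using a(1) by (intro bexI[of _ "iota a"]) auto
next
  fix c t assume "c \<in> fields" "t \<in> base"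
  then obtain a where "a \<in> \<A>" "c t = iota a t" unfolding fields_def by blast
  then show "E t * c t = c t"
    unfolding iota_def using fibre_one_emb[OF uc opf_mem[OF A_opf]] \<open>t \<in> base\<close> by simp
next
  show "(\<lambda>t. 0) \<in> fields" unfolding fields_def using A_closed(1) iota_ops(1) by force
next
  fix c d assume "c \<in> fields" "d \<in> fields"
  then obtain a b where ab: "a \<in> \<A>" "\<forall>t\<in>base. c t = iota a t" "b \<in> \<A>" "\<forall>t\<in>base. d t = iota b t" unfolding fields_def by blast
  show "(\<lambda>t. c t + d t) \<in> fields" unfolding fields_def
    using ab iota_ops(2)[OF _ A_opf[OF ab(1)] A_opf[OF ab(3)]]
    by (intro CollectI bexI[OF _ A_closed(2)[OF ab(1,3)]]) simp
  show "(\<lambda>t. c t * d t) \<in> fields" unfolding fields_def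
    using ab iota_ops(3)[OF _ A_opf[OF ab(1)] A_opf[OF ab(3)]]
    by (intro CollectI bexI[OF _ A_closed(3)[OF ab(1,3)]]) simp
next
  fix c assume "c \<in> fields"
  then obtain a where a: "a \<in> \<A>" "\<forall>t\<in>base. c t = iota a t" unfolding fields_def by blast
  show "(\<lambda>t. star (c t)) \<in> fields" unfolding fields_def
    using a iota_ops(5)[OF _ A_opf[OF a(1)]] by (intro CollectI bexI[OF _ A_closed(5)[OF a(1)]]) simp
  show "(\<lambda>t. cx z * c t) \<in> fields" for z unfolding fields_def
    using a iota_ops(4)[OF _ A_opf[OF a(1)]] by (intro CollectI bexI[OF _ A_closed(4)[OF a(1), of z]]) simp
  show "continuous_map X euclideanreal (\<lambda>t. norm (c t))"
    by (rule continuous_map_eq[OF A_norm_continuous[OF a(1)]]) (simp add: a(2))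
  show "vanishes_at_infinity X (\<lambda>t. norm (c t))"
    by (rule vanishes_cong[OF _ A_norm_vanishes[OF a(1)]]) (simp add: a(2))
next
  fix d assume ed: "\<And>t. t \<in> base \<Longrightarrow> E t * d t = d t"
    and loc: "\<And>t \<eta>. t \<in> base \<Longrightarrow> 0 < \<eta> \<Longrightarrow> \<exists>a\<in>fields. \<exists>G. openin X G \<and> t \<in> G \<and> (\<forall>s\<in>G. norm (d s - a s) < \<eta>)"
    and van: "vanishes_at_infinity X (\<lambda>t. norm (d t))"
  define x where "x = (\<lambda>t\<in>base. unemb (F t) (d t))"
  have x: "x \<in> opf" unfolding x_def operator_fields_def using unemb(1)[OF uc ed] by auto
  have ix: "iota x t = d t" if "t \<in> base" for t unfolding iota_def x_def using unemb(2)[OF uc[OF that] ed[OF that]] that by simp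
  have "x \<in> completion"
  proof (rule completionI[OF x])
    fix \<eta> :: real assume \<eta>: "\<eta> > 0"
    show "\<exists>a G. a \<in> \<A> \<and> openin X G \<and> t \<in> G \<and> (\<forall>s\<in>G. norm (iota x s - iota a s) < \<eta>)" if t: "t \<in> base" for t
    proof -
      obtain c G where c: "c \<in> fields" "openin X G" "t \<in> G" "\<forall>s\<in>G. norm (d s - c s) < \<eta>" using loc[OF t \<eta>] by blast
      obtain a where a: "a \<in> \<A>" "\<forall>t\<in>base. c t = iota a t" using c(1) unfolding fields_def by blast
      have "norm (iota x s - iota a s) < \<eta>" if s: "s \<in> G" for s
      proof -
        have sT: "s \<in> base" using s openin_subset[OF c(2)] by blast
        have "norm (d s - c s) < \<eta>" "c s = iota a s" using c(4) s a(2) sT by blast+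
        then show ?thesis using ix[OF sT] by simp
      qed
      then show ?thesis using a(1) c(2,3) by blast
    qed
    show "\<exists>K. compactin X K \<and> (\<forall>t\<in>base - K. norm (iota x t) < \<eta>)"
      using van \<eta> ix unfolding vanishes_at_infinity_def by fastforce
  qed
  then show "d \<in> fields" unfolding fields_def using ix completion_eq by force
qed

end

section \<open>Stable rank\<close>

context maximal_unital_fields
begin

lemma iota_fin_sum:
  assumes "\<And>j. j < n \<Longrightarrow> f j \<in> \<A>" and t: "t \<in> base"
  shows "iota (fin_sum Q f n) t = (\<Sum>j<n. iota (f j) t)"
proof -
  have "f j t \<in> carrier (F t)" if "j < n" for j by (rule opf_mem[OF A_opf[OF assms(1)[OF that]] t])
  then show ?thesis
    unfolding iota_def fin_sum_field_algebra[OF t] by (intro emb_fin_sum[OF uc[OF t]])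
qed

lemma fin_sum_in_A: "(\<And>j. j < n \<Longrightarrow> f j \<in> \<A>) \<Longrightarrow> fin_sum Q f n \<in> \<A>"
  using star_algebra.fin_sum_closed[OF starQ, of n f] by simp

lemma Q_norm_le:
  assumes "a \<in> \<A>" "\<And>t. t \<in> base \<Longrightarrow> norm (iota a t) \<le> r"
  shows "cnorm Q a \<le> r"
  using nonempty assms norm_iota[OF A_opf[OF assms(1)]] by (simp add: cSUP_least)

lemma norm_le_Q:
  assumes a: "a \<in> \<A>" and t: "t \<in> base"
  shows "norm (iota a t) \<le> cnorm Q a"
proof -
  have "a \<in> completion" using a A_subset_completion by blast
  then obtain r where r: "\<And>t. t \<in> base \<Longrightarrow> norm (iota a t) \<le> r" using completion_bounded by metis
  have "cnorm (F t) (a t) \<le> (SUP t\<in>base. cnorm (F t) (a t))"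
    using r norm_iota[OF A_opf[OF a]] t by (intro cSUP_upper bdd_aboveI[of _ r]) auto
  then show ?thesis using norm_iota[OF A_opf[OF a] t] by simp
qed

text \<open>All that is needed for the stable rank, in terms of members of \<open>\<A>\<close>: a tuple near \<open>\<alpha>\<close> whose
  shift by \<open>p\<close> has an invertible \<open>\<Sum> b\<^sub>j\<^sup>* b\<^sub>j\<close>, with inverse \<open>\<zeta> + 1/P\<close>. The equations hold at each
  point; the second form of the sum is the one that can be computed in the unitization.\<close>

lemma perturbed_tuple:
  fixes m :: "'x metric" and p :: "nat \<Rightarrow> complex"
  assumes X: "X = mtopology_of m" and dim: "covering_dim_le X (int k)"
    and dense: "\<And>t. t \<in> base \<Longrightarrow> \<exists>n\<le>M. Lg_dense (C_tensor (cube k) (F t)) n"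
    and \<alpha>: "\<And>j. j < M \<Longrightarrow> \<alpha> j \<in> \<A>" and \<epsilon>: "\<epsilon> > 0"
    and P: "P = (\<Sum>j<M. (cmod (p j))\<^sup>2)" "P > 0"
  obtains \<beta> \<zeta> where "\<And>j. j < M \<Longrightarrow> \<beta> j \<in> \<A>" "\<zeta> \<in> \<A>"
    "\<And>j t. j < M \<Longrightarrow> t \<in> base \<Longrightarrow> norm (iota (\<beta> j) t - iota (\<alpha> j) t) \<le> \<epsilon>"
    "\<And>t. t \<in> base \<Longrightarrow> (\<Sum>j<M. star (iota (\<beta> j) t + cx (p j) * E t) * (iota (\<beta> j) t + cx (p j) * E t)) =
      (\<Sum>j<M. star (iota (\<beta> j) t) * iota (\<beta> j) t + cx (p j) * star (iota (\<beta> j) t) + cx (cnj (p j)) * iota (\<beta> j) t)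
        + P *\<^sub>R E t"
    "\<And>t. t \<in> base \<Longrightarrow> (\<Sum>j<M. star (iota (\<beta> j) t + cx (p j) * E t) * (iota (\<beta> j) t + cx (p j) * E t)) *
      (iota \<zeta> t + (1 / P) *\<^sub>R E t) = E t"
    "\<And>t. t \<in> base \<Longrightarrow> (iota \<zeta> t + (1 / P) *\<^sub>R E t) *
      (\<Sum>j<M. star (iota (\<beta> j) t + cx (p j) * E t) * (iota (\<beta> j) t + cx (p j) * E t)) = E t"
proof -
  interpret operator_field_system X E fields by (rule field_system)
  interpret shifted_tuples X E fields M p P by unfold_locales (rule P)+
  interpret dense_tuples X E fields M p P k
  proof
    show "regular_space X" unfolding X
      by (simp add: Metric_space.regular_space_mtopology mtopology_of_def)
    fix x c f and \<delta> :: real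
    assume x: "x \<in> base" and c: "finite c" "card c \<le> k + 1"
      and f: "\<And>j. j < M \<Longrightarrow> continuous_on (std_simplex c) (\<lambda>s. f s j)"
        "\<And>s j. s \<in> std_simplex c \<Longrightarrow> j < M \<Longrightarrow> E x * f s j = f s j" and \<delta>: "\<delta> > 0"
    obtain n where n: "n \<le> M" "Lg_dense (C_tensor (cube k) (F x)) n" using dense[OF x] by blast
    show "\<exists>g. (\<forall>j<M. continuous_on (std_simplex c) (\<lambda>s. g s j)) \<and>
        (\<forall>s\<in>std_simplex c. (\<exists>d. (\<Sum>j<M. d j * (g s j + cx (p j) * E x)) = E x) \<and>
          (\<forall>j<M. E x * g s j = g s j \<and> norm (g s j - f s j) < \<delta>))"
      by (rule C_tensor_simplex_dense[OF uc[OF x] n(2,1) c f \<delta>])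
  qed
  have a: "iota (\<alpha> i) \<in> fields" if "i < M" for i using \<alpha>[OF that] unfolding fields_def by blast
  obtain b where b: "\<And>i. i < M \<Longrightarrow> b i \<in> fields"
    "\<And>i t. i < M \<Longrightarrow> t \<in> base \<Longrightarrow> norm (b i t - iota (\<alpha> i) t) \<le> \<epsilon>"
    "\<And>t. t \<in> base \<Longrightarrow> LI t (\<lambda>i. b i t)"
    by (rule perturb_everywhere[OF X dim a \<epsilon>]) (assumption, rule that)
  obtain z where z: "z \<in> fields"
    "\<And>t. t \<in> base \<Longrightarrow> gram b t * (z t + (1 / P) *\<^sub>R E t) = E t"
    "\<And>t. t \<in> base \<Longrightarrow> (z t + (1 / P) *\<^sub>R E t) * gram b t = E t"
    by (rule inverse_field[OF b(1,3)]) (assumption+, rule that)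
  obtain \<zeta> where \<zeta>: "\<zeta> \<in> \<A>" "\<forall>t\<in>base. z t = iota \<zeta> t" using z(1) unfolding fields_def by blast
  have "\<forall>i\<in>{..<M}. \<exists>a. a \<in> \<A> \<and> (\<forall>t\<in>base. b i t = iota a t)" using b(1) unfolding fields_def by blast
  from bchoice[OF this] obtain \<beta> where \<beta>: "\<And>i. i < M \<Longrightarrow> \<beta> i \<in> \<A>"
    "\<And>i t. i < M \<Longrightarrow> t \<in> base \<Longrightarrow> b i t = iota (\<beta> i) t" by auto
  have g: "gram b t = (\<Sum>j<M. star (iota (\<beta> j) t + cx (p j) * E t) * (iota (\<beta> j) t + cx (p j) * E t))"
    if "t \<in> base" for t unfolding gram_def using \<beta>(2)[OF _ that] by simp
  have eb: "E t * b j t = b j t" if "j < M" "t \<in> base" for j t using field[OF b(1)[OF that(1)] that(2)] .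
  show ?thesis
  proof (rule that[of \<beta> \<zeta>])
    show "norm (iota (\<beta> j) t - iota (\<alpha> j) t) \<le> \<epsilon>" if "j < M" "t \<in> base" for j t
      using b(2)[OF that] \<beta>(2)[OF that] by simp
    fix t assume t: "t \<in> base"
    show "(\<Sum>j<M. star (iota (\<beta> j) t + cx (p j) * E t) * (iota (\<beta> j) t + cx (p j) * E t)) =
      (\<Sum>j<M. star (iota (\<beta> j) t) * iota (\<beta> j) t + cx (p j) * star (iota (\<beta> j) t) + cx (cnj (p j)) * iota (\<beta> j) t)
        + P *\<^sub>R E t"
      unfolding g[OF t, symmetric] using gram_expand[OF t, of b] eb[OF _ t] \<beta>(2)[OF _ t] by simp
    show "(\<Sum>j<M. star (iota (\<beta> j) t + cx (p j) * E t) * (iota (\<beta> j) t + cx (p j) * E t)) *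
      (iota \<zeta> t + (1 / P) *\<^sub>R E t) = E t"
      unfolding g[OF t, symmetric] using z(2)[OF t] \<zeta>(2) t by simp
    show "(iota \<zeta> t + (1 / P) *\<^sub>R E t) *
      (\<Sum>j<M. star (iota (\<beta> j) t + cx (p j) * E t) * (iota (\<beta> j) t + cx (p j) * E t)) = E t"
      unfolding g[OF t, symmetric] using z(3)[OF t] \<zeta>(2) t by simp
  qed (fact \<beta>(1) \<zeta>(1))+
qed

text \<open>The difference \<open>u t - e t\<close> annihilates all values \<open>a t\<close> of fields, and these are dense in
  the fibre.\<close>

lemma unit_field:
  assumes u: "is_unit_of Q u" and t: "t \<in> base"
  shows "iota u t = E t"
proof -
  have uA: "u \<in> \<A>" and ua: "\<And>a. a \<in> \<A> \<Longrightarrow> (\<lambda>t\<in>base. mult (F t) (u t) (a t)) = a"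
    using u unfolding is_unit_of_def by auto
  interpret operator_field_system X E fields by (rule field_system)
  have uf: "iota u \<in> fields" using uA unfolding fields_def by blast
  have "norm (iota u t - E t) \<le> 0 + \<eta>" if \<eta>: "\<eta> > 0" for \<eta>
  proof -
    define D where "D = norm (iota u t - E t)"
    have D: "D + 1 > 0" unfolding D_def by (simp add: add_nonneg_pos)
    have "\<eta> / (D + 1) > 0" using \<eta> D by simp
    then obtain c where "c \<in> fields" "norm (c t - E t) < \<eta> / (D + 1)"
      using dense_field[OF t e_idem[OF t]] by blast
    then obtain a where a: "a \<in> \<A>" "norm (iota a t - E t) < \<eta> / (D + 1)"
      unfolding fields_def using t by auto
    have "iota u t * iota a t = iota a t"
      using iota_ops(3)[OF t A_opf[OF uA] A_opf[OF a(1)]] ua[OF a(1)] by simp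
    moreover have "E t * iota a t = iota a t"
      unfolding iota_def by (rule fibre_one_emb[OF uc[OF t] opf_mem[OF A_opf[OF a(1)] t]])
    moreover have "iota u t * E t = iota u t" using field[OF uf t] e_central[OF t, of "iota u t"] by simp
    ultimately have "iota u t - E t = (iota u t - E t) * (E t - iota a t)"
      using e_idem[OF t] by (simp add: left_diff_distrib right_diff_distrib)
    then have "D \<le> D * norm (E t - iota a t)" unfolding D_def by (metis norm_mult_ineq)
    also have "\<dots> \<le> D * (\<eta> / (D + 1))"
      using a(2) by (intro mult_left_mono) (auto simp: D_def norm_minus_commute intro: less_imp_le)
    also have "\<dots> \<le> \<eta>" using D \<eta> by (simp add: field_simps D_def)
    finally show ?thesis unfolding D_def by simp
  qed
  then have "norm (iota u t - E t) \<le> 0" by (rule field_le_epsilon)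
  then show ?thesis by simp
qed

lemma A_eqI: "a \<in> \<A> \<Longrightarrow> b \<in> \<A> \<Longrightarrow> (\<And>t. t \<in> base \<Longrightarrow> iota a t = iota b t) \<Longrightarrow> a = b"
  using opf_eqI A_opf by blast

lemma iota_Q:
  assumes t: "t \<in> base"
  shows "a \<in> \<A> \<Longrightarrow> b \<in> \<A> \<Longrightarrow> iota (a \<oplus>\<^bsub>Q\<^esub> b) t = iota a t + iota b t"
    "a \<in> \<A> \<Longrightarrow> b \<in> \<A> \<Longrightarrow> iota (a \<otimes>\<^bsub>Q\<^esub> b) t = iota a t * iota b t"
    "a \<in> \<A> \<Longrightarrow> iota (c \<odot>\<^bsub>Q\<^esub> a) t = cx c * iota a t"
    "a \<in> \<A> \<Longrightarrow> iota (adj Q a) t = star (iota a t)"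
    "a \<in> \<A> \<Longrightarrow> b \<in> \<A> \<Longrightarrow> iota (a \<ominus>\<^bsub>Q\<^esub> b) t = iota a t - iota b t"
    "iota (zero Q) t = 0"
  using iota_ops[OF t] A_opf by simp_all

lemma Q_closed:
  "a \<in> \<A> \<Longrightarrow> b \<in> \<A> \<Longrightarrow> a \<oplus>\<^bsub>Q\<^esub> b \<in> \<A>" "a \<in> \<A> \<Longrightarrow> b \<in> \<A> \<Longrightarrow> a \<otimes>\<^bsub>Q\<^esub> b \<in> \<A>"
  "a \<in> \<A> \<Longrightarrow> c \<odot>\<^bsub>Q\<^esub> a \<in> \<A>" "a \<in> \<A> \<Longrightarrow> adj Q a \<in> \<A>" "a \<in> \<A> \<Longrightarrow> b \<in> \<A> \<Longrightarrow> a \<ominus>\<^bsub>Q\<^esub> b \<in> \<A>"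
  "zero Q \<in> \<A>"
  using A_closed star_algebra.diff_closed[OF starQ, of a b] by simp_all

text \<open>With a unit \<open>u\<close> in \<open>\<A>\<close> a tuple \<open>a\<close> is written as \<open>(a - u) + u\<close>, so all scalar parts \<open>p\<^sub>j\<close> are
  1.\<close>

lemma Lg_dense_unital:
  fixes m :: "'x metric"
  assumes X: "X = mtopology_of m" and dim: "covering_dim_le X (int k)"
    and dense: "\<And>t. t \<in> base \<Longrightarrow> \<exists>n\<le>M. Lg_dense (C_tensor (cube k) (F t)) n" and M: "M \<ge> 1"
    and u: "is_unit_of Q u"
  shows "Lg_dense Q M"
  unfolding Lg_dense_def
proof (intro ballI allI impI)
  fix a and \<epsilon> :: real assume a: "a \<in> tuples Q M" and \<epsilon>: "\<epsilon> > 0"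
  have uA: "u \<in> \<A>" using u unfolding is_unit_of_def by simp
  have aA: "a j \<in> \<A>" if "j < M" for j using a that unfolding tuples_def by auto
  have iu: "iota u t = E t" if "t \<in> base" for t by (rule unit_field[OF u that])
  define P where "P = real M"
  have P: "P = (\<Sum>j<M. (cmod ((\<lambda>_. 1) j))\<^sup>2)" "P > 0" using M unfolding P_def by auto
  have \<epsilon>2: "\<epsilon> / 2 > 0" using \<epsilon> by simp
  have \<alpha>: "a j \<ominus>\<^bsub>Q\<^esub> u \<in> \<A>" if "j < M" for j by (rule Q_closed(5)[OF aA[OF that] uA])
  obtain \<beta> \<zeta> where \<beta>: "\<And>j. j < M \<Longrightarrow> \<beta> j \<in> \<A>" "\<zeta> \<in> \<A>"
    "\<And>j t. j < M \<Longrightarrow> t \<in> base \<Longrightarrow> norm (iota (\<beta> j) t - iota (a j \<ominus>\<^bsub>Q\<^esub> u) t) \<le> \<epsilon> / 2"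
    "\<And>t. t \<in> base \<Longrightarrow> (\<Sum>j<M. star (iota (\<beta> j) t + cx 1 * E t) * (iota (\<beta> j) t + cx 1 * E t)) *
      (iota \<zeta> t + (1 / P) *\<^sub>R E t) = E t"
    "\<And>t. t \<in> base \<Longrightarrow> (iota \<zeta> t + (1 / P) *\<^sub>R E t) *
      (\<Sum>j<M. star (iota (\<beta> j) t + cx 1 * E t) * (iota (\<beta> j) t + cx 1 * E t)) = E t"
    by (rule perturbed_tuple[OF X dim dense \<alpha> \<epsilon>2 P]) (assumption+, rule that)
  define b where "b = (\<lambda>j\<in>{..<M}. \<beta> j \<oplus>\<^bsub>Q\<^esub> u)"
  have b: "b j \<in> \<A>" "\<And>t. t \<in> base \<Longrightarrow> iota (b j) t = iota (\<beta> j) t + cx 1 * E t" if "j < M" for j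
    using that Q_closed(1)[OF \<beta>(1)[OF that] uA] iota_Q(1)[OF _ \<beta>(1)[OF that] uA] iu unfolding b_def by auto
  let ?x = "fin_sum Q (\<lambda>j. adj Q (b j) \<otimes>\<^bsub>Q\<^esub> b j) M"
  have xj: "adj Q (b j) \<otimes>\<^bsub>Q\<^esub> b j \<in> \<A>" if "j < M" for j by (intro Q_closed b(1)[OF that])
  have xA: "?x \<in> \<A>" by (rule fin_sum_in_A) (rule xj)
  have ix: "iota ?x t = (\<Sum>j<M. star (iota (\<beta> j) t + cx 1 * E t) * (iota (\<beta> j) t + cx 1 * E t))" if t: "t \<in> base" for t
  proof -
    have "iota ?x t = (\<Sum>j<M. iota (adj Q (b j) \<otimes>\<^bsub>Q\<^esub> b j) t)" by (rule iota_fin_sum[OF _ t]) (rule xj)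
    also have "\<dots> = (\<Sum>j<M. star (iota (b j) t) * iota (b j) t)"
      by (intro sum.cong refl) (simp only: lessThan_iff iota_Q(2,4)[OF t] b(1) Q_closed(4))
    also have "\<dots> = (\<Sum>j<M. star (iota (\<beta> j) t + cx 1 * E t) * (iota (\<beta> j) t + cx 1 * E t))"
      by (intro sum.cong refl) (simp only: lessThan_iff b(2)[OF _ t])
    finally show ?thesis .
  qed
  define y where "y = \<zeta> \<oplus>\<^bsub>Q\<^esub> (complex_of_real (1 / P) \<odot>\<^bsub>Q\<^esub> u)"
  have yA: "y \<in> \<A>" unfolding y_def by (intro Q_closed \<beta>(2) uA)
  have iy: "iota y t = iota \<zeta> t + (1 / P) *\<^sub>R E t" if t: "t \<in> base" for t
    unfolding y_def iota_Q(1)[OF t \<beta>(2) Q_closed(3)[OF uA]] iota_Q(3)[OF t uA] iu[OF t] cx_of_real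
    by (simp only: scaleR_conv_of_real)
  have "?x \<otimes>\<^bsub>Q\<^esub> y = u"
    by (rule A_eqI[OF Q_closed(2)[OF xA yA] uA]) (simp only: iota_Q(2)[OF _ xA yA] ix iy \<beta>(4) iu)
  moreover have "y \<otimes>\<^bsub>Q\<^esub> ?x = u"
    by (rule A_eqI[OF Q_closed(2)[OF yA xA] uA]) (simp only: iota_Q(2)[OF _ yA xA] ix iy \<beta>(5) iu)
  ultimately have "invertible_in Q ?x"
    unfolding invertible_in_def using xA yA u by auto
  moreover have "b \<in> tuples Q M" unfolding tuples_def using b(1) by (auto simp: b_def)
  ultimately have "b \<in> Lg Q M" unfolding Lg_def by blast
  moreover have "cnorm Q (a j \<ominus>\<^bsub>Q\<^esub> b j) < \<epsilon>" if j: "j < M" for j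
  proof -
    have "cnorm Q (a j \<ominus>\<^bsub>Q\<^esub> b j) \<le> \<epsilon> / 2"
    proof (rule Q_norm_le[OF Q_closed(5)[OF aA[OF j] b(1)[OF j]]])
      fix t assume t: "t \<in> base"
      have "norm (iota (a j) t - iota (b j) t) = norm (iota (\<beta> j) t - iota (a j \<ominus>\<^bsub>Q\<^esub> u) t)"
        unfolding b(2)[OF j t] iota_Q(5)[OF t aA[OF j] uA] iu[OF t]
        by (subst norm_minus_commute) (simp add: algebra_simps)
      then show "norm (iota (a j \<ominus>\<^bsub>Q\<^esub> b j) t) \<le> \<epsilon> / 2"
        unfolding iota_Q(5)[OF t aA[OF j] b(1)[OF j]] using \<beta>(3)[OF j t] by simp
    qed
    then show ?thesis using \<epsilon> by simp
  qed
  ultimately show "\<exists>b\<in>Lg Q M. \<forall>j<M. cnorm Q (a j \<ominus>\<^bsub>Q\<^esub> b j) < \<epsilon>" by blast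
qed

lemma unitization_simps:
  "carrier (unitization Q) = \<A> \<times> UNIV"
  "zero (unitization Q) = (zero Q, 0)"
  "add (unitization Q) (a, c) (b, d) = (a \<oplus>\<^bsub>Q\<^esub> b, c + d)"
  "mult (unitization Q) (a, c) (b, d) = (a \<otimes>\<^bsub>Q\<^esub> b \<oplus>\<^bsub>Q\<^esub> c \<odot>\<^bsub>Q\<^esub> b \<oplus>\<^bsub>Q\<^esub> d \<odot>\<^bsub>Q\<^esub> a, c * d)"
  "adj (unitization Q) (a, c) = (adj Q a, cnj c)"
  "diff (unitization Q) (a, c) (b, d) = (a \<ominus>\<^bsub>Q\<^esub> b, c - d)"
  "cnorm (unitization Q) (a, c) = (SUP b\<in>{b \<in> \<A>. cnorm Q b \<le> 1}. cnorm Q (a \<otimes>\<^bsub>Q\<^esub> b \<oplus>\<^bsub>Q\<^esub> c \<odot>\<^bsub>Q\<^esub> b))"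
  by (simp_all add: unitization_def diff_def del: field_algebra_simps(2-7))

text \<open>The norm of the unitization is the norm of left multiplication on \<open>\<A>\<close>, which is estimated at
  each point.\<close>

lemma unitization_norm_le:
  assumes a: "a \<in> \<A>" and r: "\<And>t. t \<in> base \<Longrightarrow> norm (iota a t) + cmod c \<le> r" "r \<ge> 0"
  shows "cnorm (unitization Q) (a, c) \<le> r"
  unfolding unitization_simps
proof (rule cSUP_least)
  have "cnorm Q (zero Q) \<le> 1" by (rule Q_norm_le[OF Q_closed(6)]) (simp only: iota_Q(6) norm_zero zero_le_one)
  then show "{b \<in> \<A>. cnorm Q b \<le> 1} \<noteq> {}" using Q_closed(6) by blast
  fix b assume "b \<in> {b \<in> \<A>. cnorm Q b \<le> 1}"
  then have b: "b \<in> \<A>" "cnorm Q b \<le> 1" by auto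
  show "cnorm Q (a \<otimes>\<^bsub>Q\<^esub> b \<oplus>\<^bsub>Q\<^esub> c \<odot>\<^bsub>Q\<^esub> b) \<le> r"
  proof (rule Q_norm_le)
    show "a \<otimes>\<^bsub>Q\<^esub> b \<oplus>\<^bsub>Q\<^esub> c \<odot>\<^bsub>Q\<^esub> b \<in> \<A>" by (intro Q_closed a b)
    fix t assume t: "t \<in> base"
    have b1: "norm (iota b t) \<le> 1" using norm_le_Q[OF b(1) t] b(2) by simp
    have "iota (a \<otimes>\<^bsub>Q\<^esub> b \<oplus>\<^bsub>Q\<^esub> c \<odot>\<^bsub>Q\<^esub> b) t = iota a t * iota b t + cx c * iota b t"
      by (simp only: iota_Q(1-3)[OF t] Q_closed a b)
    also have "norm \<dots> \<le> norm (iota a t) * norm (iota b t) + cmod c * norm (iota b t)"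
      by (intro norm_triangle_mono norm_mult_ineq) (simp only: norm_cx_mult order_refl)
    also have "\<dots> = (norm (iota a t) + cmod c) * norm (iota b t)" by (simp add: distrib_right)
    also have "\<dots> \<le> r * 1" using r t b1 by (intro mult_mono) auto
    finally show "norm (iota (a \<otimes>\<^bsub>Q\<^esub> b \<oplus>\<^bsub>Q\<^esub> c \<odot>\<^bsub>Q\<^esub> b) t) \<le> r" by simp
  qed
qed

lemma unitization_unit: "is_unit_of (unitization Q) (zero Q, 1)"
  unfolding is_unit_of_def unitization_simps(1)
proof (intro conjI ballI)
  show "(zero Q, 1) \<in> \<A> \<times> UNIV" using Q_closed(6) by blast
  fix x assume "x \<in> \<A> \<times> (UNIV :: complex set)"
  then obtain a c where x: "x = (a, c)" "a \<in> \<A>" by blast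
  have "zero Q \<otimes>\<^bsub>Q\<^esub> a \<oplus>\<^bsub>Q\<^esub> 1 \<odot>\<^bsub>Q\<^esub> a \<oplus>\<^bsub>Q\<^esub> c \<odot>\<^bsub>Q\<^esub> zero Q = a"
    by (rule A_eqI[OF _ x(2)]) (simp_all only: iota_Q(1-3,6) Q_closed x(2) cx_simps mult_zero_left mult_zero_right mult_1_left add_0_left add_0_right)
  moreover have "a \<otimes>\<^bsub>Q\<^esub> zero Q \<oplus>\<^bsub>Q\<^esub> c \<odot>\<^bsub>Q\<^esub> zero Q \<oplus>\<^bsub>Q\<^esub> 1 \<odot>\<^bsub>Q\<^esub> a = a"
    by (rule A_eqI[OF _ x(2)]) (simp_all only: iota_Q(1-3,6) Q_closed x(2) cx_simps mult_zero_left mult_zero_right mult_1_left add_0_left add_0_right)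
  ultimately show "(zero Q, 1) \<otimes>\<^bsub>unitization Q\<^esub> x = x" "x \<otimes>\<^bsub>unitization Q\<^esub> (zero Q, 1) = x"
    unfolding x(1) unitization_simps by simp_all
qed

text \<open>The scalar parts of the given tuple serve as \<open>p\<^sub>j\<close>; if all of them vanish, the first one is
  replaced by a small number so that \<open>P > 0\<close>.\<close>

lemma Lg_dense_unitization:
  fixes m :: "'x metric"
  assumes X: "X = mtopology_of m" and dim: "covering_dim_le X (int k)"
    and dense: "\<And>t. t \<in> base \<Longrightarrow> \<exists>n\<le>M. Lg_dense (C_tensor (cube k) (F t)) n" and M: "M \<ge> 1"
  shows "Lg_dense (unitization Q) M"
  unfolding Lg_dense_def
proof (intro ballI allI impI)
  let ?U = "unitization Q"
  fix a and \<epsilon> :: real assume a: "a \<in> tuples ?U M" and \<epsilon>: "\<epsilon> > 0"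
  define \<alpha> where "\<alpha> j = fst (a j)" for j
  define \<pi> where "\<pi> j = snd (a j)" for j
  have a_eq: "a j = (\<alpha> j, \<pi> j)" for j unfolding \<alpha>_def \<pi>_def by simp
  have \<alpha>: "\<alpha> j \<in> \<A>" if "j < M" for j
  proof -
    have "a j \<in> carrier ?U" using a that unfolding tuples_def by blast
    then show ?thesis unfolding a_eq unitization_simps by blast
  qed
  define p where "p j = (if (\<forall>i<M. \<pi> i = 0) \<and> j = 0 then complex_of_real (\<epsilon> / 2) else \<pi> j)" for j
  have p\<pi>: "cmod (\<pi> j - p j) \<le> \<epsilon> / 2" if "j < M" for j unfolding p_def using \<epsilon> that by auto
  define P where "P = (\<Sum>j<M. (cmod (p j))\<^sup>2)"
  obtain i where i: "i < M" "p i \<noteq> 0"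
  proof (cases "\<forall>i<M. \<pi> i = 0")
    case True
    then show ?thesis using that[of 0] M \<epsilon> unfolding p_def by auto
  next
    case False
    then obtain i where "i < M" "\<pi> i \<noteq> 0" by blast
    then show ?thesis using that[of i] False unfolding p_def by auto
  qed
  have "(cmod (p i))\<^sup>2 \<le> P" unfolding P_def using i(1) by (intro member_le_sum) auto
  moreover have "(cmod (p i))\<^sup>2 > 0" using i(2) by simp
  ultimately have Ppos: "P > 0" by linarith
  have \<epsilon>4: "\<epsilon> / 4 > 0" using \<epsilon> by simp
  obtain \<beta> \<zeta> where \<beta>: "\<And>j. j < M \<Longrightarrow> \<beta> j \<in> \<A>" "\<zeta> \<in> \<A>"
    "\<And>j t. j < M \<Longrightarrow> t \<in> base \<Longrightarrow> norm (iota (\<beta> j) t - iota (\<alpha> j) t) \<le> \<epsilon> / 4"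
    "\<And>t. t \<in> base \<Longrightarrow> (\<Sum>j<M. star (iota (\<beta> j) t + cx (p j) * E t) * (iota (\<beta> j) t + cx (p j) * E t)) =
      (\<Sum>j<M. star (iota (\<beta> j) t) * iota (\<beta> j) t + cx (p j) * star (iota (\<beta> j) t) + cx (cnj (p j)) * iota (\<beta> j) t)
        + P *\<^sub>R E t"
    "\<And>t. t \<in> base \<Longrightarrow> (\<Sum>j<M. star (iota (\<beta> j) t + cx (p j) * E t) * (iota (\<beta> j) t + cx (p j) * E t)) *
      (iota \<zeta> t + (1 / P) *\<^sub>R E t) = E t"
    "\<And>t. t \<in> base \<Longrightarrow> (iota \<zeta> t + (1 / P) *\<^sub>R E t) *
      (\<Sum>j<M. star (iota (\<beta> j) t + cx (p j) * E t) * (iota (\<beta> j) t + cx (p j) * E t)) = E t"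
    by (rule perturbed_tuple[OF X dim dense \<alpha> \<epsilon>4 P_def Ppos]) (assumption+, rule that)
  define b where "b = (\<lambda>j\<in>{..<M}. (\<beta> j, p j))"
  define g where "g j = adj Q (\<beta> j) \<otimes>\<^bsub>Q\<^esub> \<beta> j \<oplus>\<^bsub>Q\<^esub> cnj (p j) \<odot>\<^bsub>Q\<^esub> \<beta> j \<oplus>\<^bsub>Q\<^esub> p j \<odot>\<^bsub>Q\<^esub> adj Q (\<beta> j)" for j
  have gA: "g j \<in> \<A>" if "j < M" for j unfolding g_def by (intro Q_closed \<beta>(1)[OF that])
  define s where "s = fin_sum Q g M"
  have sA: "s \<in> \<A>" unfolding s_def by (rule fin_sum_in_A[OF gA])
  have iota_s: "iota s t = (\<Sum>j<M. star (iota (\<beta> j) t) * iota (\<beta> j) t + cx (p j) * star (iota (\<beta> j) t) + cx (cnj (p j)) * iota (\<beta> j) t)"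
    if t: "t \<in> base" for t
  proof -
    have "iota s t = (\<Sum>j<M. iota (g j) t)" unfolding s_def by (rule iota_fin_sum[OF gA t])
    also have "\<dots> = (\<Sum>j<M. star (iota (\<beta> j) t) * iota (\<beta> j) t + cx (cnj (p j)) * iota (\<beta> j) t + cx (p j) * star (iota (\<beta> j) t))"
      unfolding g_def by (intro sum.cong refl) (simp only: lessThan_iff iota_Q(1-4)[OF t] \<beta>(1) Q_closed)
    finally show ?thesis by (simp add: add_ac)
  qed
  have fs: "fin_sum ?U (\<lambda>j. adj ?U (b j) \<otimes>\<^bsub>?U\<^esub> b j) n = (fin_sum Q g n, \<Sum>j<n. cnj (p j) * p j)" if "n \<le> M" for n
    using that
  proof (induction n)
    case (Suc n)
    have bn: "b n = (\<beta> n, p n)" using Suc.prems unfolding b_def by simp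
    have IH: "fin_sum ?U (\<lambda>j. adj ?U (b j) \<otimes>\<^bsub>?U\<^esub> b j) n = (fin_sum Q g n, \<Sum>j<n. cnj (p j) * p j)"
      using Suc by simp
    have "adj ?U (b n) \<otimes>\<^bsub>?U\<^esub> b n = (g n, cnj (p n) * p n)" unfolding bn unitization_simps g_def ..
    then show ?case unfolding fin_sum.simps(2) IH by (simp only: unitization_simps sum.lessThan_Suc)
  qed (simp only: fin_sum.simps(1) unitization_simps lessThan_0 sum.empty)
  have sumP: "(\<Sum>j<M. cnj (p j) * p j) = complex_of_real P"
    unfolding P_def of_real_sum by (intro sum.cong refl) (simp only: complex_norm_square mult.commute)
  have x: "fin_sum ?U (\<lambda>j. adj ?U (b j) \<otimes>\<^bsub>?U\<^esub> b j) M = (s, complex_of_real P)"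
    using fs[of M] sumP unfolding s_def by simp
  \<comment> \<open>The candidate for the inverse, \<open>\<zeta> + 1/P\<close>.\<close>
  define y where "y = (\<zeta>, complex_of_real (1 / P))"
  have PP: "complex_of_real P * complex_of_real (1 / P) = 1" "complex_of_real (1 / P) * complex_of_real P = 1"
    using Ppos by simp_all
  interpret operator_field_system X E fields by (rule field_system)
  have fld: "E t * iota c t = iota c t" "iota c t * E t = iota c t" if "c \<in> \<A>" "t \<in> base" for c t
    using fibre_one_emb[OF uc[OF that(2)] opf_mem[OF A_opf[OF that(1)] that(2)]] e_central[OF that(2), of "iota c t"]
    unfolding iota_def by simp_all
  have e1: "iota s t * iota \<zeta> t + P *\<^sub>R iota \<zeta> t + (1 / P) *\<^sub>R iota s t = 0"
    and e2: "iota \<zeta> t * iota s t + (1 / P) *\<^sub>R iota s t + P *\<^sub>R iota \<zeta> t = 0" if t: "t \<in> base" for t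
  proof -
    have G: "(\<Sum>j<M. star (iota (\<beta> j) t + cx (p j) * E t) * (iota (\<beta> j) t + cx (p j) * E t)) = iota s t + P *\<^sub>R E t"
      using \<beta>(4)[OF t] iota_s[OF t] by simp
    have "(iota s t + P *\<^sub>R E t) * (iota \<zeta> t + (1 / P) *\<^sub>R E t) =
        iota s t * iota \<zeta> t + P *\<^sub>R iota \<zeta> t + (1 / P) *\<^sub>R iota s t + E t"
      using fld[OF sA t] fld[OF \<beta>(2) t] e_idem[OF t] Ppos
      by (simp add: distrib_left distrib_right scaleR_right_distrib)
    then show "iota s t * iota \<zeta> t + P *\<^sub>R iota \<zeta> t + (1 / P) *\<^sub>R iota s t = 0" using \<beta>(5)[OF t] unfolding G by simp
    have "(iota \<zeta> t + (1 / P) *\<^sub>R E t) * (iota s t + P *\<^sub>R E t) =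
        iota \<zeta> t * iota s t + (1 / P) *\<^sub>R iota s t + P *\<^sub>R iota \<zeta> t + E t"
      using fld[OF sA t] fld[OF \<beta>(2) t] e_idem[OF t] Ppos
      by (simp add: distrib_left distrib_right scaleR_right_distrib)
    then show "iota \<zeta> t * iota s t + (1 / P) *\<^sub>R iota s t + P *\<^sub>R iota \<zeta> t = 0" using \<beta>(6)[OF t] unfolding G by simp
  qed
  have "(s, complex_of_real P) \<otimes>\<^bsub>?U\<^esub> y = (zero Q, 1)"
    unfolding y_def unitization_simps PP
    by (intro arg_cong2[of _ _ _ _ Pair] refl A_eqI Q_closed sA \<beta>(2))
       (simp only: iota_Q(1-3,6) Q_closed sA \<beta>(2) cx_of_real e1 flip: scaleR_conv_of_real)
  moreover have "y \<otimes>\<^bsub>?U\<^esub> (s, complex_of_real P) = (zero Q, 1)"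
    unfolding y_def unitization_simps PP
    by (intro arg_cong2[of _ _ _ _ Pair] refl A_eqI Q_closed sA \<beta>(2))
       (simp only: iota_Q(1-3,6) Q_closed sA \<beta>(2) cx_of_real e2 flip: scaleR_conv_of_real)
  ultimately have "is_unit_of ?U ((s, complex_of_real P) \<otimes>\<^bsub>?U\<^esub> y)"
      "is_unit_of ?U (y \<otimes>\<^bsub>?U\<^esub> (s, complex_of_real P))" using unitization_unit by (simp_all only:)
  moreover have "y \<in> carrier ?U" "(s, complex_of_real P) \<in> carrier ?U"
    unfolding y_def unitization_simps(1) using sA \<beta>(2) by blast+
  ultimately have "invertible_in ?U (s, complex_of_real P)"
    unfolding invertible_in_def by blast
  moreover have "b \<in> tuples ?U M" unfolding tuples_def using \<beta>(1) by (auto simp: b_def unitization_simps(1))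
  ultimately have "b \<in> Lg ?U M" unfolding Lg_def using x by simp
  moreover have "cnorm ?U (a j \<ominus>\<^bsub>?U\<^esub> b j) < \<epsilon>" if j: "j < M" for j
  proof -
    have "a j \<ominus>\<^bsub>?U\<^esub> b j = (\<alpha> j \<ominus>\<^bsub>Q\<^esub> \<beta> j, \<pi> j - p j)" using j unfolding a_eq b_def by (simp only: restrict_apply' lessThan_iff unitization_simps)
    moreover have "cnorm ?U (\<alpha> j \<ominus>\<^bsub>Q\<^esub> \<beta> j, \<pi> j - p j) \<le> 3 * \<epsilon> / 4"
    proof (rule unitization_norm_le[OF Q_closed(5)[OF \<alpha>[OF j] \<beta>(1)[OF j]]])
      fix t assume t: "t \<in> base"
      show "norm (iota (\<alpha> j \<ominus>\<^bsub>Q\<^esub> \<beta> j) t) + cmod (\<pi> j - p j) \<le> 3 * \<epsilon> / 4"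
        unfolding iota_Q(5)[OF t \<alpha>[OF j] \<beta>(1)[OF j]]
        using \<beta>(3)[OF j t] p\<pi>[OF j] by (simp add: norm_minus_commute)
    qed (use \<epsilon> in simp)
    ultimately show ?thesis using \<epsilon> by simp
  qed
  ultimately show "\<exists>b\<in>Lg ?U M. \<forall>j<M. cnorm ?U (a j \<ominus>\<^bsub>?U\<^esub> b j) < \<epsilon>" by blast
qed

end

lemma unital_stable_rank_le_iff:
  "unital_stable_rank A \<le> enat M \<longleftrightarrow> (\<exists>n. 1 \<le> n \<and> n \<le> M \<and> Lg_dense A n)"
proof
  assume le: "unital_stable_rank A \<le> enat M"
  then have ex: "\<exists>n\<ge>1. Lg_dense A n" unfolding unital_stable_rank_def by (auto split: if_splits)
  let ?n = "LEAST n. 1 \<le> n \<and> Lg_dense A n"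
  have "1 \<le> ?n \<and> Lg_dense A ?n" by (rule LeastI_ex) (use ex in blast)
  moreover have "?n \<le> M" using le ex unfolding unital_stable_rank_def by simp
  ultimately show "\<exists>n. 1 \<le> n \<and> n \<le> M \<and> Lg_dense A n" by blast
next
  assume "\<exists>n. 1 \<le> n \<and> n \<le> M \<and> Lg_dense A n"
  then obtain n where n: "1 \<le> n" "n \<le> M" "Lg_dense A n" by blast
  have "(LEAST n. 1 \<le> n \<and> Lg_dense A n) \<le> n" by (rule Least_le) (use n in blast)
  moreover have "\<exists>n\<ge>1. Lg_dense A n" using n by blast
  ultimately show "unital_stable_rank A \<le> enat M" using n(2) unfolding unital_stable_rank_def by simp
qed

theorem theorem1p2:
  fixes m :: "'x metric" and X :: "'x topology" and k :: nat
    and F :: "'x \<Rightarrow> 'b cstar" and \<A> :: "('x \<Rightarrow> 'b) set"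
  assumes "X = mtopology_of m"
    and "sigma_compact_space X"
    and "locally_compact_space X"
    and "has_covering_dim X (int k)"
    and "maximal_full_algebra X F \<A>"
    and "\<forall>t\<in>topspace X. unital (F t)"
  shows "stable_rank (field_algebra (topspace X) F \<A>)
    \<le> (SUP t\<in>topspace X. stable_rank (C_tensor (cube k) (F t)))"
proof (cases "(SUP t\<in>topspace X. stable_rank (C_tensor (cube k) (F t))) = \<infinity>")
  case False
  then obtain M where M: "(SUP t\<in>topspace X. stable_rank (C_tensor (cube k) (F t))) = enat M" by auto
  have dim: "covering_dim_le X (int k)" using assms(4) unfolding has_covering_dim_def by blast
  have ne: "topspace X \<noteq> {}"
  proof
    assume "topspace X = {}"
    then have "covering_dim_le X (int k - 1)"
      unfolding covering_dim_le_def finite_open_cover_def by (auto intro!: exI[of _ "{}"])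
    then show False using assms(4) unfolding has_covering_dim_def by blast
  qed
  have full: "full_algebra X F \<A>" using assms(5) unfolding maximal_full_algebra_def by blast
  interpret maximal_unital_fields X F \<A>
    by (intro maximal_unital_fields.intro unital_fields.intro maximal_unital_fields_axioms.intro
        full assms(5) ne bspec[OF assms(6)])
  have sr: "\<exists>n. 1 \<le> n \<and> n \<le> M \<and> Lg_dense (C_tensor (cube k) (F t)) n" if t: "t \<in> topspace X" for t
  proof -
    have "stable_rank (C_tensor (cube k) (F t)) \<le> enat M"
      unfolding M[symmetric] using t by (rule SUP_upper)
    moreover have "unital (C_tensor (cube k) (F t))"
      unfolding unital_def using C_tensor_unit[OF uc[OF t]] by blast
    ultimately show ?thesis by (simp add: stable_rank_def unital_stable_rank_le_iff)
  qed
  then have dense: "\<exists>n\<le>M. Lg_dense (C_tensor (cube k) (F t)) n" if "t \<in> topspace X" for t using that by blast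
  have M1: "M \<ge> 1" using sr ne by fastforce
  have "stable_rank (field_algebra (topspace X) F \<A>) \<le> enat M"
  proof (cases "unital (field_algebra (topspace X) F \<A>)")
    case True
    then obtain u where "is_unit_of (field_algebra (topspace X) F \<A>) u" unfolding unital_def by blast
    from Lg_dense_unital[OF assms(1) dim dense M1 this] show ?thesis
      unfolding stable_rank_def using True M1 by (auto simp: unital_stable_rank_le_iff)
  next
    case False
    from Lg_dense_unitization[OF assms(1) dim dense M1] show ?thesis
      unfolding stable_rank_def using False M1 by (auto simp: unital_stable_rank_le_iff)
  qed
  then show ?thesis using M by simp
qed simp

end
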